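(* Let $\beta_c$ be the unique positive solution of $c_\beta/e^\beta=1$. For every $\beta>\beta_c$, the partition function $Z_{L,\beta}$ satisfies $$Z_{L,\beta}\;\sim\;\frac{K_\beta}{L^{3/4}}\,e^{\beta L+\tilde{\mathcal G}(a_\beta)\sqrt L}\qquad (L\to\infty),$$ where $$\tilde{\mathcal G}(x):=x\log\frac{c_\beta}{e^\beta}-x\,\tilde\psi(x^{-2}),\quad x>0,\qquad a_\beta:=\operatorname{arg\,max}\{\tilde{\mathcal G}(x):x\in(0,\infty)\},$$ and $$K_\beta:=\frac{2\sqrt{2\pi}\;C_{\beta,a_\beta^{-2}}\;e^{\tilde\psi'(a_\beta^{-2})}}{\big[(1+e^{-\beta})\,e^{\mathrm{arccosh}(e^{-\beta/2}\cosh(\beta))}-e^{\beta/2}(1-e^{-\beta})\big]^2\;a_\beta^2\;\big|\tilde{\mathcal G}''(a_\beta)\big|^{1/2}}.$$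
   Context: Here $\sim$ means that the ratio of the two sides tends to $1$. Model. For $L\in\mathbb N=\{1,2,\dots\}$ and $1\le N\le L$ let $\mathcal L_{N,L}=\{\ell=(\ell_i)_{i=1}^N\in\mathbb Z^N:\sum_{n=1}^N|\ell_n|+N=L\}$. For $x,y\in\mathbb Z$ let $x\,\tilde\wedge\, y=\min(|x|,|y|)$ if $xy<0$ and $0$ otherwise. For $\ell\in\mathcal L_{N,L}$ set $H_{L,\beta}(\ell)=\beta\sum_{n=1}^{N-1}(\ell_n\,\tilde\wedge\,\ell_{n+1})$. The partition function is $Z_{L,\beta}=\sum_{N=1}^L\sum_{\ell\in\mathcal L_{N,L}}e^{H_{L,\beta}(\ell)}$. Constants and functions. For $\beta>0$: $c_\beta=\sum_{k\in\mathbb Z}e^{-\frac\beta2|k|}=\frac{1+e^{-\beta/2}}{1-e^{-\beta/2}}$, and $\mathbf P_\beta$ is the law on $\mathbb Z$ with $\mathbf P_\beta(k)=e^{-\frac\beta2|k|}/c_\beta$. If $Z$ has law $\mathbf P_\beta$, let $\mathcal L(h)=\log\mathbf E_\beta[e^{hZ}]$ for $|h|<\beta/2$. Let $\tilde{\mathbf P}_h$ be the law on $\mathbb Z$ with $\tilde{\mathbf P}_h(k)=e^{hk-\mathcal L(h)}\mathbf P_\beta(k)$. For $h\in(0,\beta/2)$, $\kappa(h)=\tilde{\mathbf P}_h(X_i>0\ \forall i\in\mathbb N)$, where under $\tilde{\mathbf P}_h$ the walk $X$ starts at $X_0=0$ and has i.i.d. increments of law $\tilde{\mathbf P}_h$;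 one has $\kappa(h)=\frac{e^{2h}-1}{e^{h+\beta/2}-1}$. For $h\in(-\beta,\beta)$ let $\mathcal G(h)=\int_0^1\mathcal L(h(\tfrac12-x))\,dx$. The derivative $\mathcal G'$ is an increasing $C^1$ diffeomorphism from $(-\beta,\beta)$ onto $\mathbb R$ with $\mathcal G'(0)=0$; $q\mapsto\tilde h^q$ denotes its inverse. For $q>0$ let $\tilde\psi(q)=q\,\tilde h^q-\mathcal G(\tilde h^q)$, and $$C_{\beta,q}=\frac{1}{2\pi\,\vartheta(\tilde h^q)^{1/2}}\,\kappa\big(\tfrac{\tilde h^q}{2}\big)^2,$$ where for $h\in(-\beta,\beta)$ $$\vartheta(h)=\int_0^1x^2\mathcal L''[h(x-\tfrac12)]dx\int_0^1\mathcal L''[h(x-\tfrac12)]dx-\Big[\int_0^1x\,\mathcal L''[h(x-\tfrac12)]dx\Big]^2.$$ For $\beta>\beta_c$ the function $\tilde{\mathcal G}$ is $C^2$, has negative second derivative, and attains its maximum on $(0,\infty)$ at a unique point, so $a_\beta$ is well defined. *)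

theory Defs
  imports "HOL-Probability.Probability" "HOL-Library.Landau_Symbols"
begin

section \<open>The model\<close>

text \<open>A configuration is a list of stretches; list positions are counted from 0, so the \<open>n\<close>-th
  stretch (\<open>1 \<le> n \<le> N\<close>) is \<open>l ! (n - 1)\<close>.\<close>

definition configurations :: "nat \<Rightarrow> nat \<Rightarrow> int list set" where
  "configurations N L = {l. length l = N \<and> (\<Sum>n<N. \<bar>l ! n\<bar>) + int N = int L}"

definition wedge :: "int \<Rightarrow> int \<Rightarrow> int" where
  "wedge x y = (if x * y < 0 then min \<bar>x\<bar> \<bar>y\<bar> else 0)"

definition hamiltonian :: "real \<Rightarrow> int list \<Rightarrow> real" where
  "hamiltonian \<beta> l = \<beta> * (\<Sum>n<length l - 1. real_of_int (wedge (l ! n) (l ! Suc n)))"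

definition partition_fun :: "real \<Rightarrow> nat \<Rightarrow> real" where
  "partition_fun \<beta> L = (\<Sum>N=1..L. \<Sum>l\<in>configurations N L. exp (hamiltonian \<beta> l))"

section \<open>The associated random walk\<close>

definition c_const :: "real \<Rightarrow> real" where
  "c_const \<beta> = (\<Sum>\<^sub>\<infinity>k\<in>(UNIV :: int set). exp (- (\<beta> / 2) * \<bar>real_of_int k\<bar>))"

definition beta_c :: real where
  "beta_c = (THE \<beta>. 0 < \<beta> \<and> c_const \<beta> / exp \<beta> = 1)"

text \<open>The laws \<open>P\<^sub>\<beta>\<close> and its exponential tilts. \<open>embed_pmf\<close> is only
  meaningful for genuine probability weights; see \<open>pmf_step_law\<close> and \<open>pmf_tilted_law\<close> below.\<close>

definition step_law :: "real \<Rightarrow> int pmf" where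
  "step_law \<beta> = embed_pmf (\<lambda>k. exp (- (\<beta> / 2) * \<bar>real_of_int k\<bar>) / c_const \<beta>)"

definition log_mgf :: "real \<Rightarrow> real \<Rightarrow> real" where
  "log_mgf \<beta> h = ln (measure_pmf.expectation (step_law \<beta>) (\<lambda>k. exp (h * real_of_int k)))"

definition tilted_law :: "real \<Rightarrow> real \<Rightarrow> int pmf" where
  "tilted_law \<beta> h =
     embed_pmf (\<lambda>k. exp (h * real_of_int k - log_mgf \<beta> h) * pmf (step_law \<beta>) k)"

text \<open>The sample space is the space of increment sequences; \<open>\<omega> j\<close> is the increment
  \<open>X\<^bsub>j+1\<^esub> - X\<^bsub>j\<^esub>\<close>, so \<open>X\<^sub>i\<close> is the sum of the first \<open>i\<close> increments.\<close>

definition kappa :: "real \<Rightarrow> real \<Rightarrow> real" where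
  "kappa \<beta> h = measure (\<Pi>\<^sub>M j\<in>(UNIV :: nat set). measure_pmf (tilted_law \<beta> h))
     {\<omega>. \<forall>i\<ge>1. 0 < (\<Sum>j<i. \<omega> j)}"

section \<open>Rate functions and constants\<close>

definition G_fun :: "real \<Rightarrow> real \<Rightarrow> real" where
  "G_fun \<beta> h = integral {0..1} (\<lambda>x. log_mgf \<beta> (h * (1 / 2 - x)))"

definition h_tilde :: "real \<Rightarrow> real \<Rightarrow> real" where
  "h_tilde \<beta> = the_inv_into {-\<beta><..<\<beta>} (deriv (G_fun \<beta>))"

definition psi_tilde :: "real \<Rightarrow> real \<Rightarrow> real" where
  "psi_tilde \<beta> q = q * h_tilde \<beta> q - G_fun \<beta> (h_tilde \<beta> q)"

definition theta :: "real \<Rightarrow> real \<Rightarrow> real" where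
  "theta \<beta> h =
     integral {0..1} (\<lambda>x. x\<^sup>2 * (deriv ^^ 2) (log_mgf \<beta>) (h * (x - 1 / 2))) *
     integral {0..1} (\<lambda>x. (deriv ^^ 2) (log_mgf \<beta>) (h * (x - 1 / 2))) -
     (integral {0..1} (\<lambda>x. x * (deriv ^^ 2) (log_mgf \<beta>) (h * (x - 1 / 2))))\<^sup>2"

definition C_const :: "real \<Rightarrow> real \<Rightarrow> real" where
  "C_const \<beta> q =
     1 / (2 * pi * sqrt (theta \<beta> (h_tilde \<beta> q))) * (kappa \<beta> (h_tilde \<beta> q / 2))\<^sup>2"

definition G_tilde :: "real \<Rightarrow> real \<Rightarrow> real" where
  "G_tilde \<beta> x = x * ln (c_const \<beta> / exp \<beta>) - x * psi_tilde \<beta> (1 / x\<^sup>2)"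

definition a_opt :: "real \<Rightarrow> real" where
  "a_opt \<beta> = arg_max_on (G_tilde \<beta>) {0<..}"

definition K_const :: "real \<Rightarrow> real" where
  "K_const \<beta> =
     (2 * sqrt (2 * pi) * C_const \<beta> (1 / (a_opt \<beta>)\<^sup>2) *
        exp (deriv (psi_tilde \<beta>) (1 / (a_opt \<beta>)\<^sup>2))) /
     (((1 + exp (- \<beta>)) * exp (arcosh (exp (- \<beta> / 2) * cosh \<beta>))
         - exp (\<beta> / 2) * (1 - exp (- \<beta>)))\<^sup>2 *
      (a_opt \<beta>)\<^sup>2 * sqrt \<bar>(deriv ^^ 2) (G_tilde \<beta>) (a_opt \<beta>)\<bar>)"

section \<open>Well-definedness of the laws and of the critical point\<close>

lemma has_sum_two_sided_geometric:
  fixes b h :: real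
  assumes "\<bar>h\<bar> < b"
  shows "((\<lambda>k::int. exp (h * real_of_int k - b * \<bar>real_of_int k\<bar>)) has_sum
           (1 / (1 - exp (h - b)) + exp (- h - b) / (1 - exp (- h - b)))) UNIV"
proof -
  let ?f = "\<lambda>k::int. exp (h * real_of_int k - b * \<bar>real_of_int k\<bar>)"
  have geo: "((\<lambda>n. r ^ n) has_sum (1 / (1 - r))) (UNIV :: nat set)" if "0 < r" "r < 1" for r :: real
    using that by (intro norm_summable_imp_has_sum geometric_sums)
      (auto intro: summable_geometric simp: norm_power)
  have 1: "(?f has_sum (1 / (1 - exp (h - b)))) (range int)"
  proof (subst has_sum_reindex)
    have "?f \<circ> int = (\<lambda>n. exp (h - b) ^ n)"
      by (auto simp: fun_eq_iff algebra_simps simp flip: exp_of_nat_mult)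
    then show "((?f \<circ> int) has_sum (1 / (1 - exp (h - b)))) UNIV"
      using geo[of "exp (h - b)"] assms by auto
  qed auto
  have 2: "(?f has_sum (exp (- h - b) / (1 - exp (- h - b)))) (range (\<lambda>n. - int n - 1))"
  proof (subst has_sum_reindex)
    have "?f \<circ> (\<lambda>n. - int n - 1) = (\<lambda>n. exp (- h - b) * exp (- h - b) ^ n)"
      by (auto simp: fun_eq_iff algebra_simps simp flip: exp_of_nat_mult exp_add)
    then show "((?f \<circ> (\<lambda>n. - int n - 1)) has_sum (exp (- h - b) / (1 - exp (- h - b)))) UNIV"
      using has_sum_cmult_right[OF geo[of "exp (- h - b)"], of "exp (- h - b)"] assms by auto
  qed (auto simp: inj_on_def)
  have 3: "range int \<inter> range (\<lambda>n. - int n - 1) = {}"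
    by auto
  have 4: "range int \<union> range (\<lambda>n. - int n - 1) = UNIV"
  proof -
    have "k \<in> range int \<union> range (\<lambda>n. - int n - 1)" for k
    proof (cases "k \<ge> 0")
      case True
      then have "k = int (nat k)" by simp
      then show ?thesis by blast
    next
      case False
      then have "k = - int (nat (- k - 1)) - 1" by simp
      then show ?thesis by blast
    qed
    then show ?thesis by blast
  qed
  show ?thesis
    using has_sum_Un_disjoint[OF 1 2 3] unfolding 4 .
qed

lemma c_const_eq:
  assumes "\<beta> > 0"
  shows "c_const \<beta> = (1 + exp (- \<beta> / 2)) / (1 - exp (- \<beta> / 2))"
proof -
  have "c_const \<beta> = 1 / (1 - exp (- \<beta> / 2)) + exp (- \<beta> / 2) / (1 - exp (- \<beta> / 2))"
    using has_sum_two_sided_geometric[of 0 "\<beta> / 2"] assms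
    unfolding c_const_def by (intro infsumI) auto
  then show ?thesis by (simp add: add_divide_distrib)
qed

lemma c_const_pos: "\<beta> > 0 \<Longrightarrow> c_const \<beta> > 0"
  unfolding c_const_eq by (intro divide_pos_pos add_pos_pos) simp_all

lemma nn_integral_has_sum:
  fixes f :: "int \<Rightarrow> real"
  assumes "(f has_sum s) UNIV" "\<And>k. f k \<ge> 0"
  shows "(\<integral>\<^sup>+k. ennreal (f k) \<partial>count_space UNIV) = ennreal s"
proof -
  have "f summable_on UNIV"
    using assms(1) by (auto simp: summable_on_def)
  then have "(\<lambda>k. norm (f k)) summable_on UNIV"
    by (simp add: assms(2))
  then have "Infinite_Set_Sum.abs_summable_on f UNIV"
    by (rule abs_summable_equivalent[THEN iffD1])
  then show ?thesis
    using assms infsumI[OF assms(1)]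
    by (simp add: nn_integral_conv_infsetsum infsetsum_infsum)
qed

lemma pmf_step_law:
  assumes "\<beta> > 0"
  shows "pmf (step_law \<beta>) k = exp (- (\<beta> / 2) * \<bar>real_of_int k\<bar>) / c_const \<beta>"
  unfolding step_law_def
proof (rule pmf_embed_pmf)
  have "((\<lambda>k::int. exp (- (\<beta> / 2) * \<bar>real_of_int k\<bar>)) has_sum c_const \<beta>) UNIV"
    unfolding c_const_def
    using has_sum_two_sided_geometric[of 0 "\<beta> / 2"] assms
    by (intro has_sum_infsum) (auto simp: summable_on_def)
  from has_sum_divide_const[OF this, of "c_const \<beta>"]
  have "((\<lambda>k::int. exp (- (\<beta> / 2) * \<bar>real_of_int k\<bar>) / c_const \<beta>) has_sum 1) UNIV"
    using c_const_pos[OF assms] by simp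
  from nn_integral_has_sum[OF this] c_const_pos[OF assms]
  show "(\<integral>\<^sup>+k. ennreal (exp (- (\<beta> / 2) * \<bar>real_of_int k\<bar>) / c_const \<beta>) \<partial>count_space UNIV) = 1"
    by simp
qed (use c_const_pos[OF assms] in auto)

lemma has_sum_mgf_step_law:
  assumes "\<bar>h\<bar> < \<beta> / 2"
  shows "((\<lambda>k. exp (h * real_of_int k) * pmf (step_law \<beta>) k) has_sum exp (log_mgf \<beta> h)) UNIV"
proof -
  have \<beta>: "\<beta> > 0" using assms by auto
  let ?f = "\<lambda>k. exp (h * real_of_int k) * pmf (step_law \<beta>) k"
  let ?E = "measure_pmf.expectation (step_law \<beta>) (\<lambda>k. exp (h * real_of_int k))"
  let ?T = "1 / (1 - exp (h - \<beta> / 2)) + exp (- h - \<beta> / 2) / (1 - exp (- h - \<beta> / 2))"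
  define s where "s = ?T / c_const \<beta>"
  have "((\<lambda>k::int. exp (h * real_of_int k - \<beta> / 2 * \<bar>real_of_int k\<bar>) / c_const \<beta>) has_sum s) UNIV"
    unfolding s_def by (intro has_sum_divide_const has_sum_two_sided_geometric assms)
  moreover have "?f = (\<lambda>k::int. exp (h * real_of_int k - \<beta> / 2 * \<bar>real_of_int k\<bar>) / c_const \<beta>)"
    by (auto simp: fun_eq_iff pmf_step_law[OF \<beta>] simp flip: exp_add)
  ultimately have hs: "(?f has_sum s) UNIV"
    by simp
  have T: "?T > 0"
    using assms by (intro add_pos_pos divide_pos_pos) auto
  have s: "s > 0"
    unfolding s_def by (intro divide_pos_pos T c_const_pos \<beta>)
  have "?E = enn2real (\<integral>\<^sup>+k. ennreal (exp (h * real_of_int k)) \<partial>measure_pmf (step_law \<beta>))"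
    by (intro integral_eq_nn_integral) auto
  also have "(\<integral>\<^sup>+k. ennreal (exp (h * real_of_int k)) \<partial>measure_pmf (step_law \<beta>)) =
      (\<integral>\<^sup>+k. ennreal (?f k) \<partial>count_space UNIV)"
    by (simp add: nn_integral_measure_pmf ennreal_mult' mult.commute)
  also have "\<dots> = ennreal s"
    using hs by (intro nn_integral_has_sum) auto
  finally have "?E = s" using s by simp
  then show ?thesis using hs s by (simp add: log_mgf_def)
qed

lemma pmf_tilted_law:
  assumes "\<bar>h\<bar> < \<beta> / 2"
  shows "pmf (tilted_law \<beta> h) k =
    exp (h * real_of_int k - log_mgf \<beta> h) * pmf (step_law \<beta>) k"
  unfolding tilted_law_def
proof (rule pmf_embed_pmf)
  have "((\<lambda>k. exp (h * real_of_int k - log_mgf \<beta> h) * pmf (step_law \<beta>) k) has_sum 1) UNIV"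
    using has_sum_divide_const[OF has_sum_mgf_step_law[OF assms], of "exp (log_mgf \<beta> h)"]
    by (simp add: exp_diff)
  from nn_integral_has_sum[OF this]
  show "(\<integral>\<^sup>+k. ennreal (exp (h * real_of_int k - log_mgf \<beta> h) * pmf (step_law \<beta>) k)
      \<partial>count_space UNIV) = 1"
    by simp
qed auto

lemma beta_c_unique: "\<exists>!\<beta>. 0 < \<beta> \<and> c_const \<beta> / exp \<beta> = 1"
proof -
  define g :: "real \<Rightarrow> real" where "g x = x ^ 3 + x\<^sup>2 + x - 1" for x
  have g_mono: "g x < g y" if "0 < x" "x < y" for x y
    unfolding g_def using that power_strict_mono[of x y 3] power_strict_mono[of x y 2] by simp
  have iff: "c_const \<beta> / exp \<beta> = 1 \<longleftrightarrow> g (exp (- \<beta> / 2)) = 0" if "\<beta> > 0" for \<beta>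
  proof -
    define x where "x = exp (- \<beta> / 2)"
    have x: "0 < x" "x < 1" using that by (auto simp: x_def)
    have "exp \<beta> = 1 / x\<^sup>2"
      by (simp add: x_def power2_eq_square exp_minus field_simps flip: exp_add)
    then have "c_const \<beta> / exp \<beta> = (1 + x) * x\<^sup>2 / (1 - x)"
      unfolding c_const_eq[OF that] x_def[symmetric] by simp
    then have "c_const \<beta> / exp \<beta> = 1 \<longleftrightarrow> (1 + x) * x\<^sup>2 = 1 - x"
      using x by auto
    also have "\<dots> \<longleftrightarrow> g x = 0"
      by (auto simp: g_def algebra_simps power2_eq_square power3_eq_cube)
    finally show ?thesis by (simp only: x_def)
  qed
  have "\<exists>x. 0 \<le> x \<and> x \<le> 1 \<and> g x = 0"
    unfolding g_def by (rule IVT') (auto intro!: continuous_intros)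
  then obtain x where x: "0 \<le> x" "x \<le> 1" "g x = 0" by blast
  then have "x \<noteq> 0" "x \<noteq> 1" by (auto simp: g_def)
  with x have x': "0 < x" "x < 1" by auto
  show ?thesis
  proof (rule ex1I[of _ "- 2 * ln x"])
    show "0 < - 2 * ln x \<and> c_const (- 2 * ln x) / exp (- 2 * ln x) = 1"
      using iff[of "- 2 * ln x"] x x' by auto
  next
    fix \<beta> assume \<beta>: "0 < \<beta> \<and> c_const \<beta> / exp \<beta> = 1"
    then have "g (exp (- \<beta> / 2)) = g x" using iff x by auto
    then have "exp (- \<beta> / 2) = x"
      using g_mono[of x "exp (- \<beta> / 2)"] g_mono[of "exp (- \<beta> / 2)" x] x'
      by (metis exp_gt_zero less_irrefl linorder_neqE_linordered_idom)
    then show "\<beta> = - 2 * ln x" by auto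
  qed
qed

end

theory Submission
  imports Defs "HOL-Real_Asymp.Real_Asymp"
begin

text \<open>
  Reflecting every other stretch, \<open>V\<^sub>i = (-1)\<^sup>i l\<^sub>i\<close>, turns the interaction into a sum over increments, because
  \<open>2 wedge x y = |x| + |y| - |x + y|\<close>. A configuration with \<open>N\<close> stretches becomes a bridge of a random
  walk with \<open>n = N + 1\<close> steps of law \<open>step_law \<beta>\<close>, and its share of the partition function is
  \<open>e\<^bsup>\<beta>(L-N)\<^esup> c\<^bsup>n\<^esup>\<close> times the probability that the walk returns to 0 after \<open>n\<close> steps with
  \<open>\<Sum> |V\<^sub>i| = L - N\<close> (lemma \<open>partition_part_eq\<close>). In the collapsed phase the relevant \<open>n\<close> are of order
  \<open>\<surd>L\<close>, so the walk has to enclose an area of order \<open>n\<^sup>2\<close>, a large deviation event.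

  Such an event is made typical by an exponential tilt: step \<open>j\<close> is tilted by \<open>(h/n) ((n-1)/2 - j)\<close>, which
  weighs a bridge by \<open>exp (h/n * signed area)\<close>, and \<open>h\<close> is chosen so that the mean area \<open>n\<^sup>2 G'(h)\<close> is the
  required one. The tilted bridge is an arch of height of order \<open>n\<close>. It is positive apart from
  \<open>m \<approx> n\<^bsup>1/8\<^esup>\<close> steps at either end, where the difference between area and absolute area is far too
  small to matter against \<open>n/h\<close>. Therefore the absolute area can be replaced by the signed one at the sole
  price of a factor 2 for the two signs (\<open>bridge_lower\<close>, \<open>bridge_upper\<close>, \<open>positive_bridge_upper\<close>,
  \<open>positive_bridge_lower\<close>). End point and signed area are linear in the independent steps, and Fourier
  inversion gives a local limit theorem for the pair, with covariance determinant \<open>n\<^sup>4 \<theta>(h)\<close>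
  (\<open>local_limit\<close>). Together: the bridge probability is asymptotic to
  \<open>exp (n G(h) - h A / n) / (\<pi> n\<^sup>2 \<surd>\<theta>(h))\<close> for area \<open>A\<close> (\<open>bridge_limit\<close>), and by compactness it is
  bounded by a multiple of this, uniformly in \<open>h\<close> (\<open>bridge_ratio_bounded\<close>).

  Trajectories with a sign change in the bulk do not interact across that point, so their weight factorises.
  A Chernoff bound for absolute areas (\<open>chernoff_bridge\<close>) and the strict superadditivity of \<open>h G(h)\<close> make
  them exponentially rare in \<open>m\<close> (\<open>crossing_bound\<close>).

  It remains to sum over \<open>n\<close>. With \<open>x = n/\<surd>L\<close> the weight is \<open>e\<^bsup>\<surd>L G~(x)\<^esup>\<close> up to a prefactor of order
  \<open>n\<^bsup>-2\<^esup>\<close>, and Laplace's method at the maximum \<open>a\<close> of \<open>G~\<close> yields the power \<open>L\<^bsup>-3/4\<^esup>\<close>. The constant comes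
  out without any \<open>\<kappa>\<close>: at the optimal tilt \<open>\<kappa>\<close> is \<open>e\<^bsup>\<beta>/2\<^esup>\<close> times the bracket in the denominator of
  \<open>K_const\<close>, so both cancel (\<open>K_const_eq\<close>).
\<close>

section \<open>The cumulant generating function and the rate functions\<close>

locale ipdsaw =
  fixes \<beta> :: real
  assumes \<beta>_pos: "0 < \<beta>"
begin

text \<open>With \<open>C = cosh (\<beta>/2)\<close> the two geometric series of the moment generating
  function of a step add up to \<open>(C - 1) / (C - cosh h)\<close>. So \<open>lam\<close> is the logarithmic
  moment generating function, and \<open>lam1\<close>, \<open>lam2\<close> are its first two
  derivatives.\<close>

definition Cb :: real where "Cb = cosh (\<beta> / 2)"
definition lam :: "real \<Rightarrow> real" where "lam h = ln (Cb - 1) - ln (Cb - cosh h)"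
definition lam1 :: "real \<Rightarrow> real" where "lam1 h = sinh h / (Cb - cosh h)"
definition lam2 :: "real \<Rightarrow> real" where "lam2 h = (Cb * cosh h - 1) / (Cb - cosh h)\<^sup>2"

lemma Cb_gt_1: "Cb > 1"
  unfolding Cb_def using cosh_real_strict_mono[of 0 "\<beta>/2"] \<beta>_pos by auto

lemma Cb_minus_cosh_pos: "\<bar>h\<bar> < \<beta> / 2 \<Longrightarrow> cosh h < Cb"
  unfolding Cb_def using cosh_real_strict_mono[of "\<bar>h\<bar>" "\<beta>/2"] by auto

lemma lam_0 [simp]: "lam 0 = 0" by (simp add: lam_def)

lemma lam_minus [simp]: "lam (- h) = lam h" by (simp add: lam_def)

lemma lam1_0 [simp]: "lam1 0 = 0" by (simp add: lam1_def)

lemma lam1_minus [simp]: "lam1 (- h) = - lam1 h" by (simp add: lam1_def)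

lemma lam2_minus [simp]: "lam2 (- h) = lam2 h" by (simp add: lam2_def)

lemma lam_has_derivative:
  "\<bar>h\<bar> < \<beta> / 2 \<Longrightarrow> (lam has_real_derivative lam1 h) (at h)"
  unfolding lam_def lam1_def using Cb_minus_cosh_pos[of h]
  by (auto intro!: derivative_eq_intros)

lemma lam1_has_derivative:
  "\<bar>h\<bar> < \<beta> / 2 \<Longrightarrow> (lam1 has_real_derivative lam2 h) (at h)"
  unfolding lam1_def lam2_def using Cb_minus_cosh_pos[of h]
  by (auto intro!: derivative_eq_intros simp: power2_eq_square[symmetric] cosh_square_eq algebra_simps divide_simps)

lemma lam2_pos: "\<bar>h\<bar> < \<beta> / 2 \<Longrightarrow> 0 < lam2 h"
proof -
  assume "\<bar>h\<bar> < \<beta> / 2"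
  moreover have "1 * 1 < Cb * cosh h"
    using Cb_gt_1 cosh_real_ge_1[of h] by (intro mult_less_le_imp_less) auto
  ultimately show ?thesis unfolding lam2_def using Cb_minus_cosh_pos[of h]
    by (intro divide_pos_pos) auto
qed

lemma continuous_on_lam [continuous_intros]:
  "continuous_on S f \<Longrightarrow> (\<And>x. x \<in> S \<Longrightarrow> \<bar>f x\<bar> < \<beta> / 2) \<Longrightarrow> continuous_on S (\<lambda>x. lam (f x))"
  unfolding lam_def using Cb_minus_cosh_pos
  by (intro continuous_intros) (force)+

lemma continuous_on_lam1 [continuous_intros]:
  "continuous_on S f \<Longrightarrow> (\<And>x. x \<in> S \<Longrightarrow> \<bar>f x\<bar> < \<beta> / 2) \<Longrightarrow> continuous_on S (\<lambda>x. lam1 (f x))"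
  unfolding lam1_def using Cb_minus_cosh_pos
  by (intro continuous_intros) (force)+

lemma continuous_on_lam2 [continuous_intros]:
  "continuous_on S f \<Longrightarrow> (\<And>x. x \<in> S \<Longrightarrow> \<bar>f x\<bar> < \<beta> / 2) \<Longrightarrow> continuous_on S (\<lambda>x. lam2 (f x))"
  unfolding lam2_def using Cb_minus_cosh_pos
  by (intro continuous_intros) (force)+

lemma has_sum_lam:
  assumes "\<bar>h\<bar> < \<beta> / 2"
  shows "((\<lambda>k. exp (h * real_of_int k) * pmf (step_law \<beta>) k) has_sum exp (lam h)) UNIV"
    and log_mgf_eq: "log_mgf \<beta> h = lam h"
proof -
  define E where "E = exp (- (\<beta> / 2))"
  have E: "0 < E" "E < 1" using \<beta>_pos by (auto simp: E_def)
  define t where "t = exp h"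
  have t: "0 < t" by (simp add: t_def)
  have tE: "t * E < 1" "E < t"
    using assms by (auto simp: E_def t_def simp flip: exp_add)
  have C: "Cb = (1 / E + E) / 2" "cosh h = (t + 1 / t) / 2"
    by (simp_all add: Cb_def cosh_def E_def t_def exp_minus field_simps)
  have c: "c_const \<beta> = (1 + E) / (1 - E)"
    using c_const_eq[OF \<beta>_pos] by (simp add: E_def)
  have 1: "((\<lambda>k::int. exp (h * real_of_int k - \<beta> / 2 * \<bar>real_of_int k\<bar>) / c_const \<beta>) has_sum
           ((1 / (1 - exp (h - \<beta> / 2)) + exp (- h - \<beta> / 2) / (1 - exp (- h - \<beta> / 2))) / c_const \<beta>)) UNIV"
    by (intro has_sum_divide_const has_sum_two_sided_geometric assms)
  have 2: "exp (h * real_of_int k - \<beta> / 2 * \<bar>real_of_int k\<bar>) / c_const \<beta> =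
     exp (h * real_of_int k) * pmf (step_law \<beta>) k" for k
    by (simp add: pmf_step_law[OF \<beta>_pos] flip: exp_add)
  have e: "exp (h - \<beta> / 2) = t * E" "exp (- h - \<beta> / 2) = E / t"
    by (simp_all add: t_def E_def flip: exp_add exp_diff)
  have L: "exp (lam h) = (Cb - 1) / (Cb - cosh h)"
    unfolding lam_def using Cb_gt_1 Cb_minus_cosh_pos[OF assms] by (simp add: exp_diff)
  have ne: "1 - t * E \<noteq> 0" "t - E \<noteq> 0" "1 - E \<noteq> 0" "1 + E \<noteq> 0" "E \<noteq> 0" "t \<noteq> 0" using tE E t by auto
  have A: "1 / (1 - t * E) + (E / t) / (1 - E / t) = t * (1 - E) * (1 + E) / ((1 - t * E) * (t - E))"
  proof -
    have "(E / t) / (1 - E / t) = E / (t - E)" using ne by (simp add: field_simps)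
    then show ?thesis using ne by (simp add: divide_simps) (simp add: algebra_simps)
  qed
  have B: "Cb - cosh h = (1 - t * E) * (t - E) / (2 * E * t)"
    unfolding C using ne by (simp add: divide_simps) (simp add: algebra_simps)
  have D: "Cb - 1 = (1 - E)\<^sup>2 / (2 * E)"
    unfolding C using ne by (simp add: divide_simps power2_eq_square) (simp add: algebra_simps)
  have eq: "(1 / (1 - exp (h - \<beta> / 2)) + exp (- h - \<beta> / 2) / (1 - exp (- h - \<beta> / 2))) / c_const \<beta> = exp (lam h)"
    unfolding L e A B D c using ne by (simp add: divide_simps power2_eq_square)
  show *: "((\<lambda>k. exp (h * real_of_int k) * pmf (step_law \<beta>) k) has_sum exp (lam h)) UNIV"
    using 1 unfolding 2 eq .
  have "exp (lam h) = exp (log_mgf \<beta> h)"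
    using has_sum_unique[OF * has_sum_mgf_step_law[OF assms]] .
  then show "log_mgf \<beta> h = lam h" by simp
qed

lemma lam1_less: "\<bar>x\<bar> < \<beta> / 2 \<Longrightarrow> \<bar>y\<bar> < \<beta> / 2 \<Longrightarrow> x < y \<Longrightarrow> lam1 x < lam1 y"
  by (rule DERIV_pos_imp_increasing[of x y lam1])
    (auto intro!: exI[of _ "lam2 _"] lam1_has_derivative lam2_pos)

lemma lam_less: "0 \<le> x \<Longrightarrow> x < y \<Longrightarrow> y < \<beta> / 2 \<Longrightarrow> lam x < lam y"
  unfolding lam_def using Cb_minus_cosh_pos[of x] Cb_minus_cosh_pos[of y] cosh_real_strict_mono[of x y]
  by auto

lemma lam_mono: "\<bar>x\<bar> \<le> y \<Longrightarrow> y < \<beta> / 2 \<Longrightarrow> lam x \<le> lam y"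
proof -
  have *: "lam x = lam \<bar>x\<bar>" by (simp add: abs_if)
  show "\<bar>x\<bar> \<le> y \<Longrightarrow> y < \<beta> / 2 \<Longrightarrow> lam x \<le> lam y"
    unfolding * using lam_less[of "\<bar>x\<bar>" y] by (cases "\<bar>x\<bar> = y") auto
qed

lemma lam_nonneg: "\<bar>x\<bar> < \<beta> / 2 \<Longrightarrow> 0 \<le> lam x"
  using lam_mono[of 0 "\<bar>x\<bar>"] by (auto simp: abs_if split: if_splits)

lemma lam_convex: "convex_on {-(\<beta>/2)<..<\<beta>/2} lam"
proof (rule f''_ge0_imp_convex)
  show "convex {-(\<beta>/2)<..<\<beta>/2}" by (rule convex_real_interval)
qed (auto intro!: lam_has_derivative lam1_has_derivative less_imp_le[OF lam2_pos])

lemma lam_tangent: "\<bar>x\<bar> < \<beta> / 2 \<Longrightarrow> \<bar>y\<bar> < \<beta> / 2 \<Longrightarrow> lam x + lam1 x * (y - x) \<le> lam y"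
proof -
  assume x: "\<bar>x\<bar> < \<beta> / 2" and y: "\<bar>y\<bar> < \<beta> / 2"
  have "lam1 x * (y - x) \<le> lam y - lam x"
    by (rule convex_on_imp_above_tangent[OF lam_convex])
      (use x y in \<open>auto intro!: has_field_derivative_at_within lam_has_derivative\<close>)
  then show ?thesis by linarith
qed

text \<open>The function \<open>G_fun \<beta>\<close> in terms of \<open>lam\<close>, and its first two
  derivatives.\<close>

definition G0 :: "real \<Rightarrow> real" where "G0 h = integral {0..1} (\<lambda>x. lam (h * (1/2 - x)))"
definition G1 :: "real \<Rightarrow> real" where "G1 h = integral {0..1} (\<lambda>x. (1/2 - x) * lam1 (h * (1/2 - x)))"
definition G2 :: "real \<Rightarrow> real" where "G2 h = integral {0..1} (\<lambda>x. (1/2 - x)\<^sup>2 * lam2 (h * (1/2 - x)))"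

lemma arg_bound: "\<bar>h\<bar> < \<beta> \<Longrightarrow> x \<in> {0..1} \<Longrightarrow> \<bar>h * (1/2 - x)\<bar> < \<beta> / 2"
proof -
  assume h: "\<bar>h\<bar> < \<beta>" and x: "x \<in> {0..1}"
  have "\<bar>1/2 - x\<bar> \<le> 1/2" using x by (auto simp: abs_if)
  then have "\<bar>h * (1/2 - x)\<bar> \<le> \<bar>h\<bar> * (1/2)"
    unfolding abs_mult by (intro mult_left_mono) auto
  then show ?thesis using h by linarith
qed

lemma arg_bound': "\<bar>h\<bar> < \<beta> \<Longrightarrow> x \<in> {0..1} \<Longrightarrow> \<bar>h * (x - 1/2)\<bar> < \<beta> / 2"
  using arg_bound[of "-h" x] by (simp add: algebra_simps)

lemma G_fun_eq: "\<bar>h\<bar> < \<beta> \<Longrightarrow> G_fun \<beta> h = G0 h"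
  unfolding G_fun_def G0_def
  by (intro integral_cong log_mgf_eq arg_bound)

lemma G0_has_derivative:
  assumes "\<bar>h\<bar> < \<beta>"
  shows "(G0 has_real_derivative G1 h) (at h)"
proof -
  let ?U = "{-\<beta><..<\<beta>}"
  have "((\<lambda>h. integral (cbox 0 1) (\<lambda>x. lam (h * (1/2 - x)))) has_field_derivative
     integral (cbox 0 1) (\<lambda>x. (1/2 - x) * lam1 (h * (1/2 - x)))) (at h within ?U)"
  proof (rule leibniz_rule_field_derivative)
    fix x t :: real assume x: "x \<in> ?U" and t: "t \<in> cbox 0 1"
    have b: "\<bar>x * (1/2 - t)\<bar> < \<beta> / 2" using x t by (intro arg_bound) auto
    have "((\<lambda>x. x * (1/2 - t)) has_real_derivative (1/2 - t)) (at x within ?U)"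
      by (auto intro!: derivative_eq_intros)
    from DERIV_chain2[OF lam_has_derivative[OF b] this]
    show "((\<lambda>x. lam (x * (1/2 - t))) has_real_derivative (1/2 - t) * lam1 (x * (1/2 - t))) (at x within ?U)"
      by (simp add: mult.commute)
  next
    fix x :: real assume x: "x \<in> ?U"
    show "(\<lambda>t. lam (x * (1/2 - t))) integrable_on cbox 0 1"
      using x by (intro integrable_continuous continuous_intros arg_bound) auto
  next
    have *: "\<bar>fst p * (1/2 - snd p)\<bar> < \<beta> / 2" if "p \<in> ?U \<times> cbox 0 1" for p
      using that by (intro arg_bound) (auto simp: mem_Times_iff)
    show "continuous_on (?U \<times> cbox 0 1) (\<lambda>(x, t). (1/2 - t) * lam1 (x * (1/2 - t)))"
      unfolding case_prod_beta
      by (intro continuous_intros *) auto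
  qed (use assms in auto)
  then show ?thesis
    unfolding G0_def G1_def using assms by (simp add: at_within_open[of h ?U] abs_less_iff)
qed

lemma G1_has_derivative:
  assumes "\<bar>h\<bar> < \<beta>"
  shows "(G1 has_real_derivative G2 h) (at h)"
proof -
  let ?U = "{-\<beta><..<\<beta>}"
  have "((\<lambda>h. integral (cbox 0 1) (\<lambda>x. (1/2 - x) * lam1 (h * (1/2 - x)))) has_field_derivative
     integral (cbox 0 1) (\<lambda>x. (1/2 - x)\<^sup>2 * lam2 (h * (1/2 - x)))) (at h within ?U)"
  proof (rule leibniz_rule_field_derivative)
    fix x t :: real assume x: "x \<in> ?U" and t: "t \<in> cbox 0 1"
    have b: "\<bar>x * (1/2 - t)\<bar> < \<beta> / 2" using x t by (intro arg_bound) auto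
    have "((\<lambda>x. x * (1/2 - t)) has_real_derivative (1/2 - t)) (at x within ?U)"
      by (auto intro!: derivative_eq_intros)
    from DERIV_cmult[OF DERIV_chain2[OF lam1_has_derivative[OF b] this], of "1/2 - t"]
    show "((\<lambda>x. (1/2 - t) * lam1 (x * (1/2 - t))) has_real_derivative (1/2 - t)\<^sup>2 * lam2 (x * (1/2 - t))) (at x within ?U)"
      by (simp add: mult.commute power2_eq_square mult.left_commute)
  next
    fix x :: real assume x: "x \<in> ?U"
    show "(\<lambda>t. (1/2 - t) * lam1 (x * (1/2 - t))) integrable_on cbox 0 1"
      using x by (intro integrable_continuous continuous_intros arg_bound) auto
  next
    have *: "\<bar>fst p * (1/2 - snd p)\<bar> < \<beta> / 2" if "p \<in> ?U \<times> cbox 0 1" for p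
      using that by (intro arg_bound) (auto simp: mem_Times_iff)
    show "continuous_on (?U \<times> cbox 0 1) (\<lambda>(x, t). (1/2 - t)\<^sup>2 * lam2 (x * (1/2 - t)))"
      unfolding case_prod_beta
      by (intro continuous_intros *) auto
  qed (use assms in auto)
  then show ?thesis
    unfolding G1_def G2_def using assms by (simp add: at_within_open[of h ?U] abs_less_iff)
qed

text \<open>The integrand of \<open>h G'(h) + G(h)\<close> is the \<open>x\<close>-derivative of \<open>- (1/2
  - x) lam (h (1/2 - x))\<close>. Equivalently \<open>(h G(h))' = lam (h/2)\<close>; this is what makes
  \<open>G_tilde\<close> and the cost of splitting a bridge explicit.\<close>

lemma G0_G1_identity:
  assumes "\<bar>h\<bar> < \<beta>"
  shows "h * G1 h + G0 h = lam (h / 2)"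
proof -
  define F where "F x = - (1/2 - x) * lam (h * (1/2 - x))" for x
  have F: "(F has_vector_derivative (lam (h * (1/2 - x)) + h * ((1/2 - x) * lam1 (h * (1/2 - x))))) (at x within {0..1})"
    if "x \<in> {0..1}" for x
  proof -
    have b: "\<bar>h * (1/2 - x)\<bar> < \<beta> / 2" using assms that by (rule arg_bound)
    have d: "((\<lambda>x. h * (1/2 - x)) has_real_derivative - h) (at x)"
      by (auto intro!: derivative_eq_intros)
    have D: "((\<lambda>x. lam (h * (1/2 - x))) has_real_derivative lam1 (h * (1/2 - x)) * - h) (at x)"
      by (rule DERIV_chain2[OF lam_has_derivative[OF b] d])
    show ?thesis
      unfolding F_def has_real_derivative_iff_has_vector_derivative[symmetric]
      by (rule has_field_derivative_at_within, (rule derivative_eq_intros D refl)+) (simp add: algebra_simps)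
  qed
  have "((\<lambda>x. lam (h * (1/2 - x)) + h * ((1/2 - x) * lam1 (h * (1/2 - x)))) has_integral (F 1 - F 0)) {0..1}"
    by (rule fundamental_theorem_of_calculus) (use F in auto)
  moreover have "((\<lambda>x. lam (h * (1/2 - x)) + h * ((1/2 - x) * lam1 (h * (1/2 - x)))) has_integral (G0 h + h * G1 h)) {0..1}"
    unfolding G0_def G1_def
    by (intro has_integral_add has_integral_mult_right integrable_integral integrable_continuous_real
       continuous_intros arg_bound[OF assms])
  ultimately have "G0 h + h * G1 h = F 1 - F 0" by (rule has_integral_unique[THEN sym])
  also have "\<dots> = lam (h / 2)" by (simp add: F_def)
  finally show ?thesis by simp
qed

lemma G2_pos:
  assumes "\<bar>h\<bar> < \<beta>"
  shows "0 < G2 h"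
proof -
  let ?f = "\<lambda>x. (1/2 - x)\<^sup>2 * lam2 (h * (1/2 - x))"
  have c: "continuous_on {0..1} ?f" by (intro continuous_intros arg_bound[OF assms])
  have nn: "0 \<le> ?f x" if "x \<in> {0..1}" for x
    using lam2_pos[OF arg_bound[OF assms that]] by (simp add: less_imp_le)
  have "G2 h \<noteq> 0"
  proof
    assume "G2 h = 0"
    then have "(?f has_integral 0) (cbox 0 1)"
      unfolding G2_def using integrable_integral[OF integrable_continuous_real[OF c]] by simp
    then have "?f 0 = 0"
      using c nn by (intro has_integral_0_cbox_imp_0[of 0 1 ?f]) auto
    moreover have "?f 0 > 0" using lam2_pos[OF arg_bound[OF assms, of 0]] by simp
    ultimately show False by simp
  qed
  moreover have "0 \<le> G2 h" unfolding G2_def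
    by (intro integral_nonneg integrable_continuous_real c nn)
  ultimately show ?thesis by simp
qed

lemma G1_less: "\<bar>x\<bar> < \<beta> \<Longrightarrow> \<bar>y\<bar> < \<beta> \<Longrightarrow> x < y \<Longrightarrow> G1 x < G1 y"
  by (rule DERIV_pos_imp_increasing[of x y G1])
    (auto intro!: exI[of _ "G2 _"] G1_has_derivative G2_pos)

lemma G1_0 [simp]: "G1 0 = 0"
  unfolding G1_def by simp

text \<open>By convexity and \<open>lam 0 = 0\<close>, \<open>lam (h (1/2 - x))\<close> lies below the chord
  \<open>|1 - 2x| lam (h/2)\<close>, whose integral is one half of \<open>lam (h/2)\<close>.\<close>

lemma G0_le_half:
  assumes "0 \<le> h" "h < \<beta>"
  shows "G0 h \<le> lam (h / 2) / 2"
proof -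
  have hb: "\<bar>h\<bar> < \<beta>" using assms by simp
  have "((\<lambda>x. \<bar>1 - 2 * x\<bar> * lam (h / 2)) has_integral (1/2 * lam (h / 2))) {0..1}"
  proof (rule has_integral_mult_left)
    have a: "((\<lambda>x. \<bar>1 - 2 * x :: real\<bar>) has_integral ((1/2 - (1/2)^2) - (0 - 0^2))) {0..1/2}"
    proof (rule fundamental_theorem_of_calculus)
      fix x :: real assume "x \<in> {0..1/2}"
      then show "((\<lambda>x. x - x^2) has_vector_derivative \<bar>1 - 2 * x\<bar>) (at x within {0..1/2})"
        unfolding has_real_derivative_iff_has_vector_derivative[symmetric]
        by (auto intro!: derivative_eq_intros)
    qed simp
    have b: "((\<lambda>x. \<bar>1 - 2 * x :: real\<bar>) has_integral ((1^2 - 1) - ((1/2)^2 - 1/2))) {1/2..1}"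
    proof (rule fundamental_theorem_of_calculus)
      fix x :: real assume "x \<in> {1/2..1}"
      then show "((\<lambda>x. x^2 - x) has_vector_derivative \<bar>1 - 2 * x\<bar>) (at x within {1/2..1})"
        unfolding has_real_derivative_iff_has_vector_derivative[symmetric]
        by (auto intro!: derivative_eq_intros)
    qed simp
    show "((\<lambda>x. \<bar>1 - 2 * x :: real\<bar>) has_integral 1/2) {0..1}"
      using has_integral_combine[OF _ _ a b] by (simp add: power2_eq_square)
  qed
  note R = this
  have L: "((\<lambda>x. lam (h * (1/2 - x))) has_integral G0 h) {0..1}"
    unfolding G0_def by (intro integrable_integral integrable_continuous_real continuous_intros arg_bound[OF hb])
  have "G0 h \<le> 1/2 * lam (h / 2)"
  proof (rule has_integral_le[OF L R])
    fix x :: real assume x: "x \<in> {0..1}"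
    define u where "u = \<bar>1 - 2 * x\<bar>"
    have u: "0 \<le> u" "u \<le> 1" using x by (auto simp: u_def)
    have eq: "lam (h * (1/2 - x)) = lam (u * (h / 2))"
    proof (cases "1 - 2 * x \<ge> 0")
      case True
      then have "h * (1/2 - x) = u * (h / 2)" unfolding u_def abs_of_nonneg[OF True] by (simp add: algebra_simps)
      then show ?thesis by (simp only:)
    next
      case False
      then have "h * (1/2 - x) = - (u * (h / 2))" by (simp add: u_def field_simps)
      then show ?thesis by (simp only: lam_minus)
    qed
    have "lam ((1 - u) *\<^sub>R 0 + u *\<^sub>R (h / 2)) \<le> (1 - u) * lam 0 + u * lam (h / 2)"
      using assms \<beta>_pos u by (intro convex_onD[OF lam_convex]) auto
    then show "lam (h * (1/2 - x)) \<le> \<bar>1 - 2 * x\<bar> * lam (h / 2)"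
      unfolding eq u_def by simp
  qed
  then show ?thesis by simp
qed

lemma lam_at_top: "filterlim (\<lambda>h. lam (h / 2)) at_top (at_left \<beta>)"
proof -
  have "filterlim (\<lambda>h. Cb - cosh (h / 2)) (at_right 0) (at_left \<beta>)"
    unfolding filterlim_at
  proof
    have "((\<lambda>h. Cb - cosh (h / 2)) \<longlongrightarrow> Cb - cosh (\<beta> / 2)) (at_left \<beta>)"
      by (intro tendsto_intros) auto
    then show "filterlim (\<lambda>h. Cb - cosh (h / 2)) (nhds 0) (at_left \<beta>)" by (simp add: Cb_def)
  next
    have "eventually (\<lambda>h. h \<in> {0<..<\<beta>}) (at_left \<beta>)"
      using \<beta>_pos eventually_at_leftI[of 0 \<beta>] by auto
    then show "\<forall>\<^sub>F h in at_left \<beta>. Cb - cosh (h / 2) \<in> {0<..} \<and> Cb - cosh (h / 2) \<noteq> 0"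
      by eventually_elim (use Cb_minus_cosh_pos in force)
  qed
  then have "filterlim (\<lambda>h. ln (Cb - cosh (h / 2))) at_bot (at_left \<beta>)"
    using ln_at_0 filterlim_compose by blast
  then have "filterlim (\<lambda>h. - ln (Cb - cosh (h / 2))) at_top (at_left \<beta>)"
    by (simp add: filterlim_uminus_at_top)
  then have "filterlim (\<lambda>h. ln (Cb - 1) + - ln (Cb - cosh (h / 2))) at_top (at_left \<beta>)"
    by (rule filterlim_tendsto_add_at_top[OF tendsto_const])
  then show ?thesis by (simp add: lam_def)
qed

text \<open>The identity for \<open>h G'(h)\<close> and the chord bound give \<open>h G'(h) \<ge> lam (h/2) /
  2\<close>, and the right-hand side diverges at \<open>\<beta>\<close>; the intermediate value theorem does the
  rest.\<close>

lemma G1_surj: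
  assumes "0 < q"
  obtains h where "0 < h" "h < \<beta>" "G1 h = q"
proof -
  have "eventually (\<lambda>h. lam (h / 2) > 2 * \<beta> * q) (at_left \<beta>)"
    using lam_at_top by (simp add: filterlim_at_top_dense)
  moreover have "eventually (\<lambda>h. h \<in> {0<..<\<beta>}) (at_left \<beta>)"
    using \<beta>_pos eventually_at_leftI[of 0 \<beta>] by auto
  ultimately have "eventually (\<lambda>h. lam (h / 2) > 2 * \<beta> * q \<and> h \<in> {0<..<\<beta>}) (at_left \<beta>)"
    by eventually_elim auto
  then obtain y where y: "lam (y / 2) > 2 * \<beta> * q" "0 < y" "y < \<beta>"
    using eventually_happens'[OF trivial_limit_at_left_real] by fastforce
  have "y * G1 y \<ge> lam (y / 2) / 2" using G0_G1_identity[of y] G0_le_half[of y] y by simp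
  then have "y * G1 y > \<beta> * q" using y by simp
  moreover have "y * q \<le> \<beta> * q" using y assms by simp
  ultimately have "y * q < y * G1 y" by linarith
  then have "q < G1 y" using y by simp
  have "continuous_on {0..y} G1"
    by (rule DERIV_continuous_on[of _ _ G2], rule has_field_derivative_at_within, rule G1_has_derivative) (use y in auto)
  with \<open>q < G1 y\<close> assms y obtain h where "0 \<le> h" "h \<le> y" "G1 h = q"
    using IVT'[of G1 0 q y] by auto
  moreover have "h \<noteq> 0" using \<open>G1 h = q\<close> assms by auto
  ultimately show ?thesis using that[of h] y by auto
qed

lemma deriv_G_fun: "\<bar>h\<bar> < \<beta> \<Longrightarrow> deriv (G_fun \<beta>) h = G1 h"
proof -
  assume h: "\<bar>h\<bar> < \<beta>"
  have "eventually (\<lambda>x. x \<in> {-\<beta><..<\<beta>}) (nhds h)"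
    using h by (intro eventually_nhds_in_open) auto
  then have "eventually (\<lambda>x. G_fun \<beta> x = G0 x) (nhds h)"
    by eventually_elim (auto intro!: G_fun_eq)
  then have "(G_fun \<beta> has_real_derivative G1 h) (at h)"
    using G0_has_derivative[OF h] by (subst DERIV_cong_ev[OF refl _ refl])
  then show ?thesis by (rule DERIV_imp_deriv)
qed

lemma inj_deriv_G: "inj_on (deriv (G_fun \<beta>)) {-\<beta><..<\<beta>}"
proof (rule inj_onI)
  fix x y assume "x \<in> {-\<beta><..<\<beta>}" "y \<in> {-\<beta><..<\<beta>}" "deriv (G_fun \<beta>) x = deriv (G_fun \<beta>) y"
  then show "x = y" using G1_less[of x y] G1_less[of y x]
    by (cases x y rule: linorder_cases) (auto simp: deriv_G_fun abs_less_iff)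
qed

lemma h_tilde_G1: "\<bar>h\<bar> < \<beta> \<Longrightarrow> h_tilde \<beta> (G1 h) = h"
  unfolding h_tilde_def using the_inv_into_f_f[OF inj_deriv_G, of h] deriv_G_fun[of h]
  by (auto simp: abs_less_iff)

lemma h_tilde:
  assumes "0 < q"
  shows "0 < h_tilde \<beta> q" "h_tilde \<beta> q < \<beta>" "G1 (h_tilde \<beta> q) = q"
proof -
  obtain h where "0 < h" "h < \<beta>" "G1 h = q" using G1_surj[OF assms] .
  then have "h_tilde \<beta> q = h" using h_tilde_G1[of h] by simp
  then show "0 < h_tilde \<beta> q" "h_tilde \<beta> q < \<beta>" "G1 (h_tilde \<beta> q) = q"
    using \<open>0 < h\<close> \<open>h < \<beta>\<close> \<open>G1 h = q\<close> by simp_all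
qed

lemma h_tilde_less:
  assumes "0 < p" "p < q"
  shows "h_tilde \<beta> p < h_tilde \<beta> q"
proof (rule ccontr)
  assume "\<not> ?thesis"
  then have "G1 (h_tilde \<beta> q) \<le> G1 (h_tilde \<beta> p)"
    using h_tilde[of p] h_tilde[of q] assms G1_less[of "h_tilde \<beta> q" "h_tilde \<beta> p"]
    by (cases "h_tilde \<beta> q = h_tilde \<beta> p") auto
  then show False using h_tilde[of p] h_tilde[of q] assms by simp
qed

lemma h_tilde_has_derivative:
  assumes "0 < q"
  shows "(h_tilde \<beta> has_real_derivative 1 / G2 (h_tilde \<beta> q)) (at q)"
proof -
  let ?h = "h_tilde \<beta> q"
  have h: "\<bar>?h\<bar> < \<beta>" using h_tilde[OF assms] by simp
  have "(h_tilde \<beta> has_real_derivative inverse (G2 ?h)) (at q)"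
  proof (rule DERIV_inverse_function[where f = G1 and a = 0 and b = "q + 1"])
    show "(G1 has_real_derivative G2 ?h) (at ?h)" by (rule G1_has_derivative[OF h])
    show "G2 ?h \<noteq> 0" using G2_pos[OF h] by simp
    define d where "d = (\<beta> - \<bar>?h\<bar>) / 2"
    have d: "0 < d" using h by (simp add: d_def)
    have in_range: "\<bar>z\<bar> < \<beta>" if "\<bar>z - ?h\<bar> \<le> d" for z
    proof -
      have "\<bar>z\<bar> \<le> \<bar>?h\<bar> + \<bar>z - ?h\<bar>" by simp
      moreover have "2 * d = \<beta> - \<bar>?h\<bar>" by (simp add: d_def)
      ultimately show ?thesis using that d by linarith
    qed
    have "isCont (h_tilde \<beta>) (G1 ?h)"
      by (rule isCont_inverse_function[OF d, of _ _ G1])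
        (auto intro!: h_tilde_G1 in_range DERIV_isCont[OF G1_has_derivative])
    then show "isCont (h_tilde \<beta>) q" using h_tilde[OF assms] by simp
  qed (use assms h_tilde in auto)
  then show ?thesis by (simp add: field_simps)
qed

lemma psi_tilde_has_derivative:
  assumes "0 < q"
  shows "(psi_tilde \<beta> has_real_derivative h_tilde \<beta> q) (at q)"
proof -
  have h: "\<bar>h_tilde \<beta> q\<bar> < \<beta>" using h_tilde[OF assms] by simp
  have "eventually (\<lambda>x. x \<in> {0<..}) (nhds q)"
    using assms by (intro eventually_nhds_in_open) auto
  then have ev: "eventually (\<lambda>x. psi_tilde \<beta> x = x * h_tilde \<beta> x - G0 (h_tilde \<beta> x)) (nhds q)"
  proof eventually_elim
    case (elim x)
    then show ?case using h_tilde[of x] by (simp add: psi_tilde_def G_fun_eq)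
  qed
  have "((\<lambda>x. x * h_tilde \<beta> x - G0 (h_tilde \<beta> x)) has_real_derivative h_tilde \<beta> q) (at q)"
    by (rule derivative_eq_intros h_tilde_has_derivative assms DERIV_chain2[OF G0_has_derivative] h refl)+
      (simp add: h_tilde(3)[OF assms])
  then show ?thesis by (subst DERIV_cong_ev[OF refl ev refl])
qed

text \<open>The tilt that produces a bridge of \<open>n = x \<surd>L\<close> steps with area \<open>L\<close>,
  that is \<open>G'(h) = L / n\<^sup>2\<close>.\<close>

definition hx :: "real \<Rightarrow> real" where "hx x = h_tilde \<beta> (1 / x\<^sup>2)"

lemma hx: assumes "0 < x" shows "0 < hx x" "hx x < \<beta>" "G1 (hx x) = 1 / x\<^sup>2"
  unfolding hx_def using h_tilde[of "1 / x\<^sup>2"] assms by auto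

lemma hx_less: "0 < x \<Longrightarrow> x < y \<Longrightarrow> hx y < hx x"
  unfolding hx_def by (intro h_tilde_less) (auto simp: divide_simps power_strict_mono)

lemma hx_has_derivative:
  assumes "0 < x"
  shows "(hx has_real_derivative - 2 / (x ^ 3 * G2 (hx x))) (at x)"
proof -
  have d: "((\<lambda>x. 1 / x\<^sup>2) has_real_derivative - 2 / x ^ 3) (at x)"
    using assms by (auto intro!: derivative_eq_intros simp: power2_eq_square power3_eq_cube field_simps)
  have "0 < 1 / x\<^sup>2" using assms by simp
  from DERIV_chain2[OF h_tilde_has_derivative[OF this] d]
  show ?thesis by (simp add: hx_def[abs_def] mult.commute)
qed

abbreviation lnw :: real where "lnw \<equiv> ln (c_const \<beta> / exp \<beta>)"

text \<open>The first two derivatives of \<open>G_tilde \<beta>\<close>. The first one is this simple because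
  \<open>\<psi>~'(q)\<close> is \<open>h~(q)\<close> and \<open>(h G(h))' = lam (h/2)\<close>.\<close>

definition Gt1 :: "real \<Rightarrow> real" where "Gt1 x = lnw + lam (hx x / 2)"
definition Gt2 :: "real \<Rightarrow> real" where "Gt2 x = - lam1 (hx x / 2) / (x ^ 3 * G2 (hx x))"

lemma G_tilde_eq: "0 < x \<Longrightarrow> G_tilde \<beta> x = x * lnw - hx x / x + x * G0 (hx x)"
  using hx[of x] unfolding G_tilde_def psi_tilde_def
  unfolding hx_def[symmetric] by (simp add: G_fun_eq power2_eq_square algebra_simps)

lemma G_tilde_has_derivative:
  assumes "0 < x"
  shows "(G_tilde \<beta> has_real_derivative Gt1 x) (at x)"
proof -
  have d: "((\<lambda>x. 1 / x\<^sup>2) has_real_derivative - 2 / x ^ 3) (at x)"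
    using assms by (auto intro!: derivative_eq_intros simp: power2_eq_square power3_eq_cube field_simps)
  have q: "0 < 1 / x\<^sup>2" using assms by simp
  have D: "((\<lambda>x. psi_tilde \<beta> (1 / x\<^sup>2)) has_real_derivative hx x * (- 2 / x ^ 3)) (at x)"
    using DERIV_chain2[OF psi_tilde_has_derivative[OF q] d] by (simp add: hx_def)
  have psi: "psi_tilde \<beta> (1 / x\<^sup>2) = 1 / x\<^sup>2 * hx x - G0 (hx x)"
    unfolding psi_tilde_def using hx[OF assms] by (simp add: G_fun_eq hx_def[symmetric])
  have id: "G0 (hx x) = lam (hx x / 2) - hx x * (1 / x\<^sup>2)"
    using G0_G1_identity[of "hx x"] hx[OF assms] by simp
  have "(G_tilde \<beta> has_real_derivative (lnw - (psi_tilde \<beta> (1 / x\<^sup>2) + x * (hx x * (- 2 / x ^ 3))))) (at x)"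
    unfolding G_tilde_def[abs_def] by (rule derivative_eq_intros D refl)+ simp
  moreover have "lnw - (psi_tilde \<beta> (1 / x\<^sup>2) + x * (hx x * (- 2 / x ^ 3))) = Gt1 x"
    unfolding psi id Gt1_def using assms by (simp add: power2_eq_square power3_eq_cube)
  ultimately show ?thesis by simp
qed

lemma Gt1_has_derivative:
  assumes "0 < x"
  shows "(Gt1 has_real_derivative Gt2 x) (at x)"
proof -
  have b: "\<bar>hx x / 2\<bar> < \<beta> / 2" using hx[OF assms] by simp
  have "((\<lambda>x. hx x / 2) has_real_derivative - 2 / (x ^ 3 * G2 (hx x)) / 2) (at x)"
    by (intro DERIV_cdivide hx_has_derivative assms)
  from DERIV_chain2[OF lam_has_derivative[OF b] this]
  show ?thesis unfolding Gt1_def[abs_def] Gt2_def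
    by (auto intro!: derivative_eq_intros)
qed

lemma Gt2_neg: assumes "0 < x" shows "Gt2 x < 0"
proof -
  have "0 < lam1 (hx x / 2)" using lam1_less[of 0 "hx x / 2"] hx[OF assms] \<beta>_pos by simp
  moreover have "0 < G2 (hx x)" using G2_pos[of "hx x"] hx[OF assms] by simp
  ultimately show ?thesis unfolding Gt2_def using assms by (auto intro!: divide_neg_pos)
qed

lemma Gt1_less: "0 < x \<Longrightarrow> x < y \<Longrightarrow> Gt1 y < Gt1 x"
  unfolding Gt1_def using lam_less[of "hx y / 2" "hx x / 2"] hx[of x] hx[of y] hx_less[of x y] by auto

lemma deriv2_G_tilde:
  assumes "0 < x" shows "(deriv ^^ 2) (G_tilde \<beta>) x = Gt2 x"
proof -
  have "eventually (\<lambda>y. y \<in> {0<..}) (nhds x)" using assms by (intro eventually_nhds_in_open) auto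
  then have ev: "eventually (\<lambda>y. deriv (G_tilde \<beta>) y = Gt1 y) (nhds x)"
    by eventually_elim (auto intro!: DERIV_imp_deriv G_tilde_has_derivative)
  have "(deriv (G_tilde \<beta>) has_real_derivative Gt2 x) (at x)"
    using Gt1_has_derivative[OF assms] by (subst DERIV_cong_ev[OF refl ev refl])
  then show ?thesis by (simp add: numeral_2_eq_2 DERIV_imp_deriv)
qed

text \<open>The limit of \<open>1/n\<close> times the variance of the end point of the tilted walk;
  \<open>G2\<close> plays the same role for the area, with \<open>1/n\<^sup>3\<close>.\<close>

definition V0 :: "real \<Rightarrow> real" where "V0 h = integral {0..1} (\<lambda>x. lam2 (h * (1/2 - x)))"

lemma V0_pos:
  assumes "\<bar>h\<bar> < \<beta>"
  shows "0 < V0 h"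
proof -
  let ?f = "\<lambda>x. lam2 (h * (1/2 - x))"
  have c: "continuous_on {0..1} ?f" by (intro continuous_intros arg_bound[OF assms])
  have nn: "0 \<le> ?f x" if "x \<in> {0..1}" for x
    using lam2_pos[OF arg_bound[OF assms that]] by (simp add: less_imp_le)
  have "V0 h \<noteq> 0"
  proof
    assume "V0 h = 0"
    then have "(?f has_integral 0) (cbox 0 1)"
      unfolding V0_def using integrable_integral[OF integrable_continuous_real[OF c]] by simp
    then have "?f 0 = 0"
      using c nn by (intro has_integral_0_cbox_imp_0[of 0 1 ?f]) auto
    moreover have "?f 0 > 0" using lam2_pos[OF arg_bound[OF assms, of 0]] by simp
    ultimately show False by simp
  qed
  moreover have "0 \<le> V0 h" unfolding V0_def
    by (intro integral_nonneg integrable_continuous_real c nn)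
  ultimately show ?thesis by simp
qed

text \<open>End point and centred area are asymptotically uncorrelated, since \<open>lam2\<close> is even and
  \<open>1/2 - x\<close> is odd about the midpoint.\<close>

lemma odd_moment_zero:
  assumes "\<bar>h\<bar> < \<beta>"
  shows "integral {0..1} (\<lambda>x. (1/2 - x) * lam2 (h * (1/2 - x))) = 0" (is "?I = 0")
proof -
  let ?f = "\<lambda>x. (1/2 - x) * lam2 (h * (1/2 - x))"
  have "(?f has_integral ?I) {0..1}"
    by (intro integrable_integral integrable_continuous_real continuous_intros arg_bound[OF assms])
  then have "((\<lambda>x. ?f (- x + 1)) has_integral ?I) {0..1}"
    using has_integral_affinity[of ?f ?I 0 1 "-1" 1] by simp
  moreover have "?f (- x + 1) = - ?f x" for x
  proof -
    have *: "h * (1/2 - (- x + 1)) = - (h * (1/2 - x))" by (simp add: algebra_simps)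
    show ?thesis unfolding * lam2_minus by (simp add: algebra_simps)
  qed
  ultimately have "((\<lambda>x. - ?f x) has_integral ?I) {0..1}" by simp
  moreover have "((\<lambda>x. - ?f x) has_integral - ?I) {0..1}"
    using has_integral_neg[OF \<open>(?f has_integral ?I) {0..1}\<close>] .
  ultimately have "?I = - ?I" by (rule has_integral_unique)
  then show ?thesis by simp
qed

lemma deriv2_log_mgf:
  assumes "\<bar>h\<bar> < \<beta> / 2" shows "(deriv ^^ 2) (log_mgf \<beta>) h = lam2 h"
proof -
  have d1: "deriv (log_mgf \<beta>) x = lam1 x" if "\<bar>x\<bar> < \<beta> / 2" for x
  proof -
    have "eventually (\<lambda>y. y \<in> {-(\<beta>/2)<..<\<beta>/2}) (nhds x)" using that by (intro eventually_nhds_in_open) auto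
    then have ev: "eventually (\<lambda>y. log_mgf \<beta> y = lam y) (nhds x)"
      by eventually_elim (auto intro!: log_mgf_eq)
    have "(log_mgf \<beta> has_real_derivative lam1 x) (at x)"
      using lam_has_derivative[OF that] by (subst DERIV_cong_ev[OF refl ev refl])
    then show ?thesis by (rule DERIV_imp_deriv)
  qed
  have "eventually (\<lambda>y. y \<in> {-(\<beta>/2)<..<\<beta>/2}) (nhds h)" using assms by (intro eventually_nhds_in_open) auto
  then have ev: "eventually (\<lambda>y. deriv (log_mgf \<beta>) y = lam1 y) (nhds h)"
    by eventually_elim (auto intro!: d1)
  have "(deriv (log_mgf \<beta>) has_real_derivative lam2 h) (at h)"
    using lam1_has_derivative[OF assms] by (subst DERIV_cong_ev[OF refl ev refl])
  then show ?thesis by (simp add: numeral_2_eq_2 DERIV_imp_deriv)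
qed

text \<open>Shifting the weight \<open>x\<close> to \<open>x - 1/2\<close> does not change a covariance
  determinant, and the centred matrix is diagonal.\<close>

lemma theta_eq:
  assumes "\<bar>h\<bar> < \<beta>"
  shows "theta \<beta> h = V0 h * G2 h"
proof -
  let ?l = "\<lambda>x. lam2 (h * (1/2 - x))"
  have congr: "(deriv ^^ 2) (log_mgf \<beta>) (h * (x - 1/2)) = ?l x" if "x \<in> {0..1}" for x
  proof -
    have *: "h * (x - 1/2) = - (h * (1/2 - x))" by (simp add: algebra_simps)
    show ?thesis using deriv2_log_mgf[OF arg_bound'[OF assms that]] unfolding * by simp
  qed
  have i0: "integral {0..1} (\<lambda>x. (deriv ^^ 2) (log_mgf \<beta>) (h * (x - 1/2))) = V0 h"
    unfolding V0_def by (intro integral_cong congr)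
  note ii = integrable_continuous_real continuous_intros arg_bound[OF assms]
  have i0': "(?l has_integral V0 h) {0..1}" unfolding V0_def by (intro integrable_integral ii)
  have j1: "((\<lambda>x. (1/2 - x) * ?l x) has_integral 0) {0..1}"
  proof -
    have "(\<lambda>x. (1/2 - x) * ?l x) integrable_on {0..1}" by (intro ii)
    from integrable_integral[OF this] show ?thesis unfolding odd_moment_zero[OF assms] .
  qed
  have j2: "((\<lambda>x. (1/2 - x)\<^sup>2 * ?l x) has_integral G2 h) {0..1}"
    unfolding G2_def by (intro integrable_integral ii)
  have i1: "((\<lambda>x. 1/2 * ?l x - (1/2 - x) * ?l x) has_integral (1/2 * V0 h - 0)) {0..1}"
    by (intro has_integral_diff has_integral_mult_right i0' j1)
  have i2: "((\<lambda>x. (1/4 * ?l x - (1/2 - x) * ?l x) + (1/2 - x)\<^sup>2 * ?l x) has_integral (1/4 * V0 h - 0 + G2 h)) {0..1}"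
    by (intro has_integral_diff has_integral_add has_integral_mult_right i0' j1 j2)
  have k1: "integral {0..1} (\<lambda>x. x * (deriv ^^ 2) (log_mgf \<beta>) (h * (x - 1/2))) = V0 h / 2"
  proof -
    have "integral {0..1} (\<lambda>x. x * (deriv ^^ 2) (log_mgf \<beta>) (h * (x - 1/2))) =
       integral {0..1} (\<lambda>x. 1/2 * ?l x - (1/2 - x) * ?l x)"
      by (intro integral_cong) (simp only: congr, simp add: algebra_simps)
    then show ?thesis using integral_unique[OF i1] by simp
  qed
  have k2: "integral {0..1} (\<lambda>x. x\<^sup>2 * (deriv ^^ 2) (log_mgf \<beta>) (h * (x - 1/2))) = V0 h / 4 + G2 h"
  proof -
    have "integral {0..1} (\<lambda>x. x\<^sup>2 * (deriv ^^ 2) (log_mgf \<beta>) (h * (x - 1/2))) =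
       integral {0..1} (\<lambda>x. (1/4 * ?l x - (1/2 - x) * ?l x) + (1/2 - x)\<^sup>2 * ?l x)"
      by (intro integral_cong) (simp only: congr, simp add: algebra_simps power2_eq_square)
    then show ?thesis using integral_unique[OF i2] by simp
  qed
  show ?thesis unfolding theta_def i0 k1 k2 by (simp add: algebra_simps power2_eq_square)
qed

end

section \<open>The survival probability and the constant\<close>

lemma expectation_has_sum:
  fixes f :: "'a \<Rightarrow> real"
  assumes "((\<lambda>k. f k * pmf p k) has_sum s) UNIV"
  shows "integrable (measure_pmf p) f" "measure_pmf.expectation p f = s"
proof -
  have eq: "(\<lambda>k. pmf p k * f k) = (\<lambda>k. f k * pmf p k)" by (auto simp: mult.commute)
  have "(\<lambda>k. f k * pmf p k) summable_on UNIV" using assms by (auto simp: summable_on_def)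
  then have "Infinite_Sum.abs_summable_on (\<lambda>k. f k * pmf p k) UNIV"
    by (rule summable_on_iff_abs_summable_on_real[THEN iffD1])
  then have *: "Infinite_Set_Sum.abs_summable_on (\<lambda>k. pmf p k * f k) UNIV"
    unfolding eq by (simp only: abs_summable_equivalent)
  then show "integrable (measure_pmf p) f"
    by (simp add: measure_pmf_eq_density integrable_density Infinite_Set_Sum.abs_summable_on_def)
  show "measure_pmf.expectation p f = s"
    unfolding pmf_expectation_eq_infsetsum
    using infsetsum_infsum[OF *] infsumI[OF assms] by (simp add: mult.commute)
qed

context ipdsaw
begin

lemma pmf_tilted:
  "\<bar>h\<bar> < \<beta> / 2 \<Longrightarrow> pmf (tilted_law \<beta> h) k = exp (h * real_of_int k - lam h) * pmf (step_law \<beta>) k"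
  by (simp add: pmf_tilted_law log_mgf_eq)

lemma tilted_mgf:
  assumes "\<bar>h\<bar> < \<beta> / 2" "\<bar>h + t\<bar> < \<beta> / 2"
  shows "integrable (tilted_law \<beta> h) (\<lambda>k. exp (t * real_of_int k))"
    "measure_pmf.expectation (tilted_law \<beta> h) (\<lambda>k. exp (t * real_of_int k)) = exp (lam (h + t) - lam h)"
proof -
  have 1: "((\<lambda>k. exp ((h + t) * real_of_int k) * pmf (step_law \<beta>) k / exp (lam h)) has_sum exp (lam (h + t)) / exp (lam h)) UNIV"
    by (intro has_sum_divide_const has_sum_lam assms)
  have 2: "exp ((h + t) * real_of_int k) * pmf (step_law \<beta>) k / exp (lam h) =
     exp (t * real_of_int k) * pmf (tilted_law \<beta> h) k" for k
  proof -
    have "exp ((h + t) * real_of_int k) = exp (h * real_of_int k) * exp (t * real_of_int k)"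
      by (simp only: distrib_right exp_add)
    then show ?thesis unfolding pmf_tilted[OF assms(1)]
      by (simp only: exp_diff times_divide_eq_left times_divide_eq_right mult_ac)
  qed
  have "((\<lambda>k. exp (t * real_of_int k) * pmf (tilted_law \<beta> h) k) has_sum exp (lam (h + t) - lam h)) UNIV"
    using 1 unfolding 2 exp_diff .
  then show "integrable (tilted_law \<beta> h) (\<lambda>k. exp (t * real_of_int k))"
    "measure_pmf.expectation (tilted_law \<beta> h) (\<lambda>k. exp (t * real_of_int k)) = exp (lam (h + t) - lam h)"
    by (rule expectation_has_sum)+
qed

text \<open>The function \<open>g(x) = 1 - l e\<^bsup>-2hx\<^esup>\<close> is a martingale for the tilted walk
  because \<open>lam (h - 2h) = lam h\<close>. Downward jumps are geometric, and \<open>l\<close> is the value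
  for which the jumps out of the positive integers contribute zero to the expectation of \<open>g\<close>. So
  \<open>g\<close> is harmonic for the walk killed on leaving the positive integers, and the probability of
  surviving \<open>n\<close> steps from \<open>x\<close> is squeezed between \<open>g(x)\<close> and
  \<open>g(x)\<close> plus an error which decays like \<open>e\<^bsup>-n lam h\<^esup>\<close>. The claim is the
  value \<open>g(0)\<close>.\<close>

lemma kappa_eq:
  assumes h: "0 < h" "h < \<beta> / 2"
  shows "kappa \<beta> h = (exp (2 * h) - 1) / (exp (h + \<beta> / 2) - 1)"
proof -
  define b where "b = \<beta> / 2"
  have b: "0 < b" "h < b" using h by (auto simp: b_def)
  have hb: "\<bar>h\<bar> < \<beta> / 2" using h by auto
  define p where "p = tilted_law \<beta> h"
  \<comment> \<open>The ratio of the two geometric series over the jumps from \<open>x\<close> to the non-positive integers.\<close>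
  define l where "l = (1 - exp (h - b)) / (1 - exp (- h - b))"
  have l: "0 < l" unfolding l_def using b h by (intro divide_pos_pos) auto
  define g where "g x = 1 - l * exp (- 2 * h * real_of_int x)" for x
  define pos where "pos x u = (if 0 < x + u then 1 else 0 :: real)" for x u :: int
  interpret S: sequence_space "measure_pmf p" by standard
  let ?S = "\<Pi>\<^sub>M i\<in>(UNIV::nat set). measure_pmf p"
  have spS: "space ?S = UNIV" by (simp add: space_PiM PiE_def extensional_def)
  have meas_sum: "(\<lambda>\<omega>. real_of_int (\<Sum>j<i. \<omega> j)) \<in> borel_measurable ?S" for i :: nat
  proof -
    have "(\<lambda>\<omega>. \<Sum>j<i. real_of_int (\<omega> j)) \<in> borel_measurable ?S"
    proof (rule borel_measurable_sum)
      fix j :: nat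
      have "(\<lambda>\<omega>. \<omega> j) \<in> ?S \<rightarrow>\<^sub>M measure_pmf p" by (rule measurable_component_singleton) simp
      moreover have "real_of_int \<in> measure_pmf p \<rightarrow>\<^sub>M borel" by simp
      ultimately show "(\<lambda>\<omega>. real_of_int (\<omega> j)) \<in> borel_measurable ?S" by (rule measurable_compose)
    qed
    then show ?thesis by simp
  qed
  define E where "E n x = {\<omega>. \<forall>i\<in>{1..n}. 0 < x + (\<Sum>j<i. \<omega> j)}" for n :: nat and x :: int
  have measE [measurable]: "E n x \<in> sets ?S" for n x
  proof -
    have "{\<omega> \<in> space ?S. \<forall>i\<in>{1..n}. 0 < real_of_int x + real_of_int (\<Sum>j<i. \<omega> j)} \<in> sets ?S"
      using meas_sum by measurable
    also have "{\<omega> \<in> space ?S. \<forall>i\<in>{1..n}. 0 < real_of_int x + real_of_int (\<Sum>j<i. \<omega> j)} = E n x"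
      unfolding spS E_def by (auto simp flip: of_int_add of_int_sum)
    finally show ?thesis .
  qed
  define f where "f n x = measure ?S (E n x)" for n x
  have f01: "0 \<le> f n x" "f n x \<le> 1" for n x unfolding f_def by auto
  have int_pos: "integrable (measure_pmf p) (\<lambda>u. pos x u * f n (x + u))" for n x
    by (rule measure_pmf.integrable_const_bound[of _ 1]) (auto simp: pos_def f01)
  have rec: "f (Suc n) x = measure_pmf.expectation p (\<lambda>u. pos x u * f n (x + u))" for n x
  proof -
    let ?c = "\<lambda>(s, \<omega>). case_nat s \<omega> :: nat \<Rightarrow> int"
    have c: "?c \<in> measure_pmf p \<Otimes>\<^sub>M ?S \<rightarrow>\<^sub>M ?S" by measurable
    have "emeasure ?S (E (Suc n) x) = emeasure (distr (measure_pmf p \<Otimes>\<^sub>M ?S) ?S ?c) (E (Suc n) x)"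
      using S.PiM_iter by simp
    also have "\<dots> = emeasure (measure_pmf p \<Otimes>\<^sub>M ?S) (?c -` E (Suc n) x \<inter> space (measure_pmf p \<Otimes>\<^sub>M ?S))"
      by (rule emeasure_distr[OF c measE])
    also have "\<dots> = (\<integral>\<^sup>+u. emeasure ?S (Pair u -` (?c -` E (Suc n) x \<inter> space (measure_pmf p \<Otimes>\<^sub>M ?S))) \<partial>measure_pmf p)"
      by (rule S.emeasure_pair_measure_alt) (use measurable_sets[OF c measE] in auto)
    also have "\<dots> = (\<integral>\<^sup>+u. ennreal (pos x u * f n (x + u)) \<partial>measure_pmf p)"
    proof (rule nn_integral_cong)
      fix u :: int
      have "Pair u -` (?c -` E (Suc n) x \<inter> space (measure_pmf p \<Otimes>\<^sub>M ?S)) =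
        {\<omega>. \<forall>i\<in>{1..Suc n}. 0 < x + (\<Sum>j<i. case_nat u \<omega> j)}"
        by (auto simp: E_def space_pair_measure spS)
      also have "\<dots> = (if 0 < x + u then E n (x + u) else {})"
      proof -
        have "{1..Suc n} = insert 1 (Suc ` {1..n})"
          by (metis One_nat_def Suc_eq_plus1 atLeastAtMost_insertL image_Suc_atLeastAtMost le_add2)
        then have ball: "(\<forall>i\<in>{1..Suc n}. P i) \<longleftrightarrow> P 1 \<and> (\<forall>i\<in>{1..n}. P (Suc i))" for P
          by (simp del: image_Suc_atLeastAtMost)
        have "(\<forall>i\<in>{1..Suc n}. 0 < x + (\<Sum>j<i. case_nat u \<omega> j)) \<longleftrightarrow>
          0 < x + u \<and> (\<forall>i\<in>{1..n}. 0 < x + u + (\<Sum>j<i. \<omega> j))" for \<omega>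
          unfolding ball by (simp add: sum.lessThan_Suc_shift add.assoc del: sum.lessThan_Suc)
        then show ?thesis by (simp add: E_def)
      qed
      finally show "emeasure ?S (Pair u -` (?c -` E (Suc n) x \<inter> space (measure_pmf p \<Otimes>\<^sub>M ?S))) =
          ennreal (pos x u * f n (x + u))"
        by (simp add: pos_def f_def S.emeasure_eq_measure)
    qed
    also have "\<dots> = ennreal (measure_pmf.expectation p (\<lambda>u. pos x u * f n (x + u)))"
      by (rule nn_integral_eq_integral[OF int_pos]) (auto simp: pos_def f01)
    finally have "ennreal (f (Suc n) x) = ennreal (measure_pmf.expectation p (\<lambda>u. pos x u * f n (x + u)))"
      by (simp add: f_def S.emeasure_eq_measure)
    then show ?thesis
      by (subst (asm) ennreal_inj) (auto intro!: integral_nonneg_AE simp: pos_def f01)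
  qed
  have mgf: "integrable p (\<lambda>k. exp (- t * h * real_of_int k))"
      "measure_pmf.expectation p (\<lambda>k. exp (- t * h * real_of_int k)) = exp (lam (h - t * h) - lam h)"
    if "0 \<le> t" "t \<le> 2" for t
  proof -
    have "\<bar>1 - t\<bar> * h \<le> 1 * h" using that h by (intro mult_right_mono) auto
    then have "\<bar>h + - t * h\<bar> < \<beta> / 2"
    proof -
      assume *: "\<bar>1 - t\<bar> * h \<le> 1 * h"
      have "h + - t * h = (1 - t) * h" by (simp add: algebra_simps)
      then have "\<bar>h + - t * h\<bar> = \<bar>1 - t\<bar> * h" using h by (simp add: abs_mult)
      then show ?thesis using * h by linarith
    qed
    note m = tilted_mgf[OF hb this]
    show "integrable p (\<lambda>k. exp (- t * h * real_of_int k))"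
      unfolding p_def by (rule m(1))
    show "measure_pmf.expectation p (\<lambda>k. exp (- t * h * real_of_int k)) = exp (lam (h - t * h) - lam h)"
      unfolding p_def by (rule trans[OF m(2)]) simp
  qed
  have gx: "g (x + u) = 1 - l * exp (- 2 * h * real_of_int x) * exp (- 2 * h * real_of_int u)" for x u
    by (simp add: g_def algebra_simps flip: exp_add)
  have int_g: "integrable p (\<lambda>u. g (x + u))" for x
    unfolding gx using mgf(1)[of 2] by auto
  have mart: "measure_pmf.expectation p (\<lambda>u. g (x + u)) = g x" for x
    unfolding gx using mgf[of 2] by (simp add: g_def)
  have low: "((\<lambda>u. (1 - pos x u) * g (x + u) * pmf p u) has_sum 0) UNIV" if "0 \<le> x" for x
  proof -
    define D where "D = exp (- lam h) / c_const \<beta> * exp (- (h + b) * real_of_int x)"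
    let ?F = "\<lambda>u. (1 - pos x u) * g (x + u) * pmf p u"
    let ?r = "\<lambda>m::nat. - x - int m"
    have geo: "((\<lambda>n. r ^ n) has_sum (1 / (1 - r))) (UNIV :: nat set)" if "0 < r" "r < 1" for r :: real
      using that by (intro norm_summable_imp_has_sum geometric_sums)
        (auto intro: summable_geometric simp: norm_power)
    have eq: "(?F \<circ> ?r) m = D * (exp (- h - b) ^ m - l * exp (h - b) ^ m)" for m
    proof -
      have P1: "pmf p (?r m) = exp (- lam h) / c_const \<beta> * exp ((h + b) * (- real_of_int x - real m))"
      proof -
        have "\<bar>real_of_int (?r m)\<bar> = real_of_int x + real m" using that by simp
        then have "pmf p (?r m) = exp (h * real_of_int (?r m) - lam h) * (exp (- b * (real_of_int x + real m)) / c_const \<beta>)"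
          unfolding p_def pmf_tilted[OF hb] pmf_step_law[OF \<beta>_pos] b_def by simp
        also have "exp (h * real_of_int (?r m) - lam h) * (exp (- b * (real_of_int x + real m)) / c_const \<beta>)
            = exp (h * real_of_int (?r m) - lam h + - b * (real_of_int x + real m)) / c_const \<beta>"
          by (simp only: exp_add times_divide_eq_right)
        also have "h * real_of_int (?r m) - lam h + - b * (real_of_int x + real m) = - lam h + (h + b) * (- real_of_int x - real m)"
          by (simp add: algebra_simps)
        finally show ?thesis by (simp only: exp_add times_divide_eq_left)
      qed
      have P2: "exp ((h + b) * (- real_of_int x - real m)) = exp (- (h + b) * real_of_int x) * exp (- h - b) ^ m"
        by (simp add: algebra_simps flip: exp_add exp_of_nat_mult)
      have P3: "exp (- h - b) ^ m * exp (2 * h * real m) = exp (h - b) ^ m"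
        by (simp add: algebra_simps flip: exp_add exp_of_nat_mult)
      have "(?F \<circ> ?r) m = pmf p (?r m) - l * (pmf p (?r m) * exp (2 * h * real m))"
        by (simp add: pos_def g_def algebra_simps)
      also have "pmf p (?r m) = D * exp (- h - b) ^ m"
        unfolding P1 P2 D_def by (simp only: mult.assoc)
      also have "D * exp (- h - b) ^ m - l * (D * exp (- h - b) ^ m * exp (2 * h * real m)) =
        D * (exp (- h - b) ^ m - l * (exp (- h - b) ^ m * exp (2 * h * real m)))"
        by (simp add: algebra_simps)
      finally show ?thesis unfolding P3 .
    qed
    have "((\<lambda>m. D * (exp (- h - b) ^ m + (- l) * exp (h - b) ^ m)) has_sum
        (D * (1 / (1 - exp (- h - b)) + (- l) * (1 / (1 - exp (h - b)))))) UNIV"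
      using b h by (intro has_sum_cmult_right has_sum_add geo) auto
    then have "((\<lambda>m. D * (exp (- h - b) ^ m - l * exp (h - b) ^ m)) has_sum
        (D * (1 / (1 - exp (- h - b)) - l * (1 / (1 - exp (h - b)))))) UNIV"
      by simp
    moreover have "1 / (1 - exp (- h - b)) - l * (1 / (1 - exp (h - b))) = 0"
      using b h by (simp add: l_def)
    ultimately have "((?F \<circ> ?r) has_sum 0) UNIV" unfolding eq[abs_def] by simp
    then have "(?F has_sum 0) (range ?r)"
      by (subst has_sum_reindex) (auto simp: inj_on_def)
    then show ?thesis
    proof (rule has_sum_cong_neutral[THEN iffD1, rotated -1])
      fix u assume "u \<in> UNIV - range ?r"
      then have "0 < x + u"
      proof -
        have "u \<noteq> - x - int (nat (- x - u))" using \<open>u \<in> UNIV - range ?r\<close> by blast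
        then show ?thesis by (cases "- x - u \<ge> 0") auto
      qed
      then show "?F u = 0" by (simp add: pos_def)
    qed auto
  qed
  have int_pg: "integrable p (\<lambda>u. pos x u * g (x + u))"
    and harm: "measure_pmf.expectation p (\<lambda>u. pos x u * g (x + u)) = g x" if "0 \<le> x" for x
  proof -
    note L = expectation_has_sum[OF low[OF that]]
    have eq: "(\<lambda>u. pos x u * g (x + u)) = (\<lambda>u. g (x + u) - (1 - pos x u) * g (x + u))"
      by (auto simp: algebra_simps)
    show "integrable p (\<lambda>u. pos x u * g (x + u))" unfolding eq using L int_g by auto
    show "measure_pmf.expectation p (\<lambda>u. pos x u * g (x + u)) = g x"
      unfolding eq using L int_g by (subst Bochner_Integration.integral_diff) (auto simp: mart)
  qed
  define r where "r = exp (- lam h)"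
  have r: "0 < r" "r < 1" using lam_less[of 0 h] h by (auto simp: r_def)
  have lower: "0 \<le> x \<Longrightarrow> g x \<le> f n x" for n x
  proof (induction n arbitrary: x)
    case 0
    have "f 0 x = 1" unfolding f_def E_def using S.P.prob_space spS by simp
    then show ?case using l by (simp add: g_def)
  next
    case (Suc n)
    have "g x = measure_pmf.expectation p (\<lambda>u. pos x u * g (x + u))" using harm[OF Suc.prems] by simp
    also have "\<dots> \<le> measure_pmf.expectation p (\<lambda>u. pos x u * f n (x + u))"
      by (intro integral_mono int_pg int_pos Suc.prems) (use Suc.IH in \<open>auto simp: pos_def\<close>)
    finally show ?case unfolding rec .
  qed
  have upper: "0 \<le> x \<Longrightarrow> f n x \<le> g x + l * r ^ n * exp (- h * real_of_int x)" for n x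
  proof (induction n arbitrary: x)
    case 0
    have "exp (- 2 * h * real_of_int x) \<le> exp (- h * real_of_int x)"
      using h 0 by (auto simp: mult_le_cancel_right)
    then have "l * exp (- 2 * h * real_of_int x) \<le> l * exp (- h * real_of_int x)"
      using l by (intro mult_left_mono) auto
    then show ?case using f01(2)[of 0 x] by (simp add: g_def)
  next
    case (Suc n)
    have e: "exp (- h * real_of_int (x + u)) = exp (- h * real_of_int x) * exp (- 1 * h * real_of_int u)" for u
      by (simp add: algebra_simps flip: exp_add)
    have i: "integrable p (\<lambda>u. l * r ^ n * exp (- h * real_of_int (x + u)))"
      unfolding e using mgf(1)[of 1] by auto
    have "f (Suc n) x \<le> measure_pmf.expectation p (\<lambda>u. pos x u * g (x + u) + l * r ^ n * exp (- h * real_of_int (x + u)))"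
      unfolding rec
    proof (intro integral_mono int_pos Bochner_Integration.integrable_add int_pg i Suc.prems)
      fix u
      show "pos x u * f n (x + u) \<le> pos x u * g (x + u) + l * r ^ n * exp (- h * real_of_int (x + u))"
        using Suc.IH[of "x + u"] l r by (auto simp: pos_def)
    qed
    also have "\<dots> = g x + l * r ^ n * exp (- h * real_of_int x) * measure_pmf.expectation p (\<lambda>u. exp (- 1 * h * real_of_int u))"
      by (subst Bochner_Integration.integral_add[OF int_pg[OF Suc.prems] i])
        (simp only: harm[OF Suc.prems] e, simp)
    also have "measure_pmf.expectation p (\<lambda>u. exp (- 1 * h * real_of_int u)) = r"
      using mgf(2)[of 1] by (simp add: r_def)
    finally show ?case by (simp add: algebra_simps)
  qed
  have "(\<lambda>n. f n 0) \<longlonglongrightarrow> g 0"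
  proof (rule tendsto_sandwich[of "\<lambda>_. g 0" _ _ "\<lambda>n. g 0 + l * r ^ n"])
    have "(\<lambda>n. g 0 + l * r ^ n) \<longlonglongrightarrow> g 0 + l * 0"
      using r by (intro tendsto_intros LIMSEQ_power_zero) auto
    then show "(\<lambda>n. g 0 + l * r ^ n) \<longlonglongrightarrow> g 0" by simp
  qed (use lower[of 0] upper[of 0] in auto)
  moreover have "(\<lambda>n. f n 0) \<longlonglongrightarrow> measure ?S (\<Inter>n. E n 0)"
    unfolding f_def
  proof (intro S.finite_Lim_measure_decseq)
    show "range (\<lambda>n. E n 0) \<subseteq> sets ?S" using measE by blast
    show "decseq (\<lambda>n. E n 0)" by (auto simp: decseq_def E_def)
  qed
  ultimately have "measure ?S (\<Inter>n. E n 0) = g 0" using LIMSEQ_unique by blast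
  moreover have "(\<Inter>n. E n 0) = {\<omega>. \<forall>i\<ge>1. 0 < (\<Sum>j<i. \<omega> j)}"
  proof (intro set_eqI iffI)
    fix \<omega> assume "\<omega> \<in> (\<Inter>n. E n 0)"
    then have "\<omega> \<in> E i 0" for i by blast
    then show "\<omega> \<in> {\<omega>. \<forall>i\<ge>1. 0 < (\<Sum>j<i. \<omega> j)}" by (force simp: E_def)
  qed (auto simp: E_def)
  ultimately have "kappa \<beta> h = g 0" unfolding kappa_def p_def by simp
  also have "g 0 = (exp (2 * h) - 1) / (exp (h + b) - 1)"
  proof -
    define t q where "t = exp h" "q = exp b"
    have "1 < t" "1 < q" using h b by (auto simp: t_q_def)
    then have "1 < t * q" using mult_strict_mono[of 1 t 1 q] by simp
    have e: "exp (h - b) = t / q" "exp (- h - b) = 1 / (t * q)" "exp (2 * h) = t * t" "exp (h + b) = t * q"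
      by (auto simp: t_q_def exp_diff exp_add exp_minus field_simps simp flip: exp_add)
    show ?thesis unfolding g_def l_def e using \<open>1 < t * q\<close> \<open>1 < t\<close> \<open>1 < q\<close>
      by (simp add: divide_simps) (simp add: algebra_simps)
  qed
  finally show ?thesis by (simp add: b_def)
qed

end

locale collapsed = ipdsaw +
  assumes above_critical: "beta_c < \<beta>"
begin

lemma lnw_neg: "lnw < 0"
proof -
  have bc: "0 < beta_c" "c_const beta_c / exp beta_c = 1"
    using theI'[OF beta_c_unique] unfolding beta_c_def[symmetric] by auto
  define r where "r x = (1 + x) * x\<^sup>2 / (1 - x)" for x :: real
  have ratio: "c_const t / exp t = r (exp (- t / 2))" if "t > 0" for t
  proof -
    define x where "x = exp (- t / 2)"
    have x: "0 < x" "x < 1" using that by (auto simp: x_def)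
    have "exp t = 1 / x\<^sup>2"
      by (simp add: x_def power2_eq_square exp_minus field_simps flip: exp_add)
    then show ?thesis
      unfolding c_const_eq[OF that] x_def[symmetric] r_def by simp
  qed
  define x y where "x = exp (- \<beta> / 2)" and "y = exp (- beta_c / 2)"
  have xy: "0 < x" "x < y" "y < 1" using above_critical bc by (auto simp: x_def y_def)
  have "r x < r y" unfolding r_def
  proof (rule frac_less)
    show "(1 + x) * x\<^sup>2 < (1 + y) * y\<^sup>2"
      using xy by (intro mult_strict_mono power_strict_mono) auto
  qed (use xy in auto)
  then have "c_const \<beta> / exp \<beta> < 1"
    using ratio[OF \<beta>_pos] ratio[OF bc(1)] bc(2) by (simp add: x_def y_def)
  moreover have "0 < c_const \<beta> / exp \<beta>" using c_const_pos[OF \<beta>_pos] by simp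
  ultimately show ?thesis by simp
qed

lemma ex_critical_point: "\<exists>a>0. Gt1 a = 0"
proof -
  have "eventually (\<lambda>h. lam (h / 2) > - lnw) (at_left \<beta>)"
    using lam_at_top by (simp add: filterlim_at_top_dense)
  moreover have "eventually (\<lambda>h. h \<in> {0<..<\<beta>}) (at_left \<beta>)"
    using \<beta>_pos eventually_at_leftI[of 0 \<beta>] by auto
  ultimately have "eventually (\<lambda>h. lam (h / 2) > - lnw \<and> h \<in> {0<..<\<beta>}) (at_left \<beta>)"
    by eventually_elim auto
  then obtain y where y: "lam (y / 2) > - lnw" "0 < y" "y < \<beta>"
    using eventually_happens'[OF trivial_limit_at_left_real] by fastforce
  have "continuous_on {0..y} (\<lambda>h. lam (h / 2))"
    using y by (intro continuous_intros) auto
  then obtain h where h: "0 \<le> h" "h \<le> y" "lam (h / 2) = - lnw"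
    using IVT'[of "\<lambda>h. lam (h / 2)" 0 "- lnw" y] y lnw_neg by auto
  then have "h \<noteq> 0" using lnw_neg by auto
  then have h0: "0 < h" "h < \<beta>" using h y by auto
  then have q: "0 < G1 h" using G1_less[of 0 h] \<beta>_pos by auto
  show ?thesis
  proof (intro exI conjI)
    show "0 < 1 / sqrt (G1 h)" using q by simp
    have "hx (1 / sqrt (G1 h)) = h"
      unfolding hx_def using q h0 h_tilde_G1[of h] by (simp add: power_divide)
    then show "Gt1 (1 / sqrt (G1 h)) = 0" unfolding Gt1_def using h by simp
  qed
qed

text \<open>The derivative \<open>Gt1\<close> is strictly decreasing, so \<open>G_tilde\<close> increases up
  to its critical point and decreases after it.\<close>

lemma G_tilde_strict_max:
  assumes a: "0 < a" "Gt1 a = 0" and x: "0 < x" "x \<noteq> a"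
  shows "G_tilde \<beta> x < G_tilde \<beta> a"
proof (cases "x < a")
  case True
  show ?thesis
    by (rule DERIV_pos_imp_increasing_open[OF True])
      (use Gt1_less[of _ a] a x in \<open>auto intro!: exI[of _ "Gt1 _"] G_tilde_has_derivative
         DERIV_isCont[OF G_tilde_has_derivative] continuous_at_imp_continuous_on\<close>)
next
  case False
  then have "a < x" using x by simp
  then show ?thesis
    by (rule DERIV_neg_imp_decreasing_open)
      (use Gt1_less[of a] a x in \<open>auto intro!: exI[of _ "Gt1 _"] G_tilde_has_derivative
         DERIV_isCont[OF G_tilde_has_derivative] continuous_at_imp_continuous_on\<close>)
qed

lemma a_opt: "0 < a_opt \<beta>" "Gt1 (a_opt \<beta>) = 0"
proof -
  obtain a where a: "0 < a" "Gt1 a = 0" using ex_critical_point by auto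
  have "is_arg_max (G_tilde \<beta>) (\<lambda>x. x \<in> {0<..}) a"
    unfolding is_arg_max_def
  proof (intro conjI notI)
    show "a \<in> {0<..}" using a by simp
    assume "\<exists>y. y \<in> {0<..} \<and> G_tilde \<beta> a < G_tilde \<beta> y"
    then obtain y where "0 < y" "G_tilde \<beta> a < G_tilde \<beta> y" by auto
    then show False using G_tilde_strict_max[OF a, of y] by (cases "y = a") auto
  qed
  then have "is_arg_max (G_tilde \<beta>) (\<lambda>x. x \<in> {0<..}) (a_opt \<beta>)"
    unfolding a_opt_def arg_max_on_def arg_max_def by (rule someI)
  then have "a_opt \<beta> = a"
    unfolding is_arg_max_def using G_tilde_strict_max[OF a, of "a_opt \<beta>"] a by auto
  then show "0 < a_opt \<beta>" "Gt1 (a_opt \<beta>) = 0" using a by auto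
qed

text \<open>At the critical point \<open>lam (h/2) = - ln (c / e\<^bsup>\<beta>\<^esup>)\<close>, which says
  \<open>cosh (h/2) = e\<^bsup>-\<beta>/2\<^esup> cosh \<beta>\<close>. The \<open>arcosh\<close> in the
  constant is therefore \<open>h/2\<close>, and \<open>\<kappa>(h/2)\<close> turns out to be
  \<open>e\<^bsup>\<beta>/2\<^esup>\<close> times the bracket.\<close>

lemma K_const_eq:
  defines "a \<equiv> a_opt \<beta>"
  shows "K_const \<beta> = exp \<beta> * exp (hx a) * sqrt (2 * pi) /
    (pi * sqrt (V0 (hx a) * G2 (hx a)) * a\<^sup>2 * sqrt \<bar>Gt2 a\<bar>)"
proof -
  have a: "0 < a" "Gt1 a = 0" using a_opt by (auto simp: a_def)
  define h where "h = hx a"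
  have h: "0 < h" "h < \<beta>" using hx[OF a(1)] by (auto simp: h_def)
  define u where "u = h / 2"
  have u: "0 < u" "u < \<beta> / 2" using h by (auto simp: u_def)
  have ub: "\<bar>u\<bar> < \<beta> / 2" using u by simp
  define q where "q = exp (\<beta> / 2)"
  have q: "1 < q" using \<beta>_pos by (simp add: q_def)
  define t where "t = exp u"
  have t: "1 < t" using u by (simp add: t_def)
  have eb: "exp \<beta> = q\<^sup>2" "exp (- \<beta>) = 1 / q\<^sup>2" "exp (- \<beta> / 2) = 1 / q" "exp (\<beta> / 2) = q"
    by (simp_all add: q_def power2_eq_square exp_minus field_simps flip: exp_add)
  have cq: "c_const \<beta> = (q + 1) / (q - 1)"
    unfolding c_const_eq[OF \<beta>_pos] eb using q by (simp add: field_simps)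
  have Cq: "Cb = (q + 1 / q) / 2"
    by (simp add: Cb_def cosh_def q_def exp_minus field_simps)
  have "lam u = - lnw" using a unfolding Gt1_def u_def h_def by simp
  then have "exp (lam u) = exp \<beta> / c_const \<beta>"
    using c_const_pos[OF \<beta>_pos] by (simp add: exp_minus)
  moreover have "exp (lam u) = (Cb - 1) / (Cb - cosh u)"
    unfolding lam_def using Cb_gt_1 Cb_minus_cosh_pos[OF ub] by (simp add: exp_diff)
  ultimately have "(Cb - 1) * c_const \<beta> = exp \<beta> * (Cb - cosh u)"
    using Cb_minus_cosh_pos[OF ub] c_const_pos[OF \<beta>_pos] by (simp add: field_simps)
  moreover have "(Cb - 1) * c_const \<beta> = (q - 1 / q) / 2"
    unfolding Cq cq using q by (simp add: divide_simps) (simp add: algebra_simps)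
  ultimately have cu: "cosh u = (q + 1 / q ^ 3) / 2"
    unfolding Cq eb using q by (simp add: divide_simps power2_eq_square power3_eq_cube) (simp add: algebra_simps)
  have "exp (- \<beta> / 2) * cosh \<beta> = cosh u"
    unfolding cu cosh_def[of \<beta>] eb using q by (simp add: divide_simps power2_eq_square power3_eq_cube)
  then have arc: "arcosh (exp (- \<beta> / 2) * cosh \<beta>) = u"
    using u by (simp add: arcosh_cosh_real)
  define B where "B = (1 + exp (- \<beta>)) * exp (arcosh (exp (- \<beta> / 2) * cosh \<beta>)) - exp (\<beta> / 2) * (1 - exp (- \<beta>))"
  have B: "B = (1 + 1 / q\<^sup>2) * t - q * (1 - 1 / q\<^sup>2)"
    unfolding B_def arc unfolding eb t_def ..
  have "cosh u = (t + 1 / t) / 2" by (simp add: cosh_def t_def exp_minus field_simps)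
  with cu have "t + 1 / t = q + 1 / q ^ 3" by simp
  then have tq: "t * (q ^ 4 + 1) = q ^ 3 * (t\<^sup>2 + 1)"
    using q t by (simp add: divide_simps power2_eq_square power3_eq_cube) (simp add: algebra_simps power_numeral_reduce)
  have tq1: "1 < t * q" using t q mult_strict_mono[of 1 t 1 q] by simp
  have "q * B * (t * q - 1) = t\<^sup>2 - 1"
  proof -
    have "q * B * (t * q - 1) * q = (q * q + 1) * t * (t * q - 1) - q * (q\<^sup>2 - 1) * (t * q - 1)"
      unfolding B using q by (simp add: divide_simps power2_eq_square) (simp add: algebra_simps)
    also have "\<dots> = q * (t\<^sup>2 - 1) + (q ^ 3 * (t\<^sup>2 + 1) - t * (q ^ 4 + 1))"
      by (simp add: algebra_simps power2_eq_square power_numeral_reduce)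
    finally have E: "q * B * (t * q - 1) * q = (t\<^sup>2 - 1) * q" unfolding tq by (simp only: mult.commute)
    have "q \<noteq> 0" using q by simp
    from mult_right_cancel[OF this, THEN iffD1, OF E] show ?thesis .
  qed
  then have kB: "kappa \<beta> u = q * B"
    unfolding kappa_eq[OF u] exp_add exp_double eb t_def[symmetric] using tq1
    by (simp add: field_simps)
  have kpos: "0 < kappa \<beta> u"
  proof -
    have "1 < exp (2 * u)" using u by simp
    moreover have "1 < exp (u + \<beta> / 2)" using u \<beta>_pos by (subst one_less_exp_iff) auto
    ultimately show ?thesis unfolding kappa_eq[OF u] by simp
  qed
  have ht: "h_tilde \<beta> (1 / a\<^sup>2) = h" by (simp add: h_def hx_def)
  have th: "theta \<beta> h = V0 h * G2 h" using theta_eq[of h] h by simp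
  have psi: "deriv (psi_tilde \<beta>) (1 / a\<^sup>2) = h"
    using psi_tilde_has_derivative[of "1 / a\<^sup>2"] a ht by (auto intro: DERIV_imp_deriv)
  have C: "C_const \<beta> (1 / a\<^sup>2) = 1 / (2 * pi * sqrt (V0 h * G2 h)) * (q * B)\<^sup>2"
    unfolding C_const_def ht th u_def[symmetric] kB ..
  have "B \<noteq> 0" using kpos kB by auto
  have "K_const \<beta> = (2 * sqrt (2 * pi) * (1 / (2 * pi * sqrt (V0 h * G2 h)) * (q * B)\<^sup>2) * exp h) /
     (B\<^sup>2 * a\<^sup>2 * sqrt \<bar>Gt2 a\<bar>)"
    unfolding K_const_def a_def[symmetric] C psi B_def[symmetric] deriv2_G_tilde[OF a(1)] ..
  also have "\<dots> = exp \<beta> * exp h * sqrt (2 * pi) / (pi * sqrt (V0 h * G2 h) * a\<^sup>2 * sqrt \<bar>Gt2 a\<bar>)"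
    unfolding eb using \<open>B \<noteq> 0\<close> by (simp add: power_mult_distrib mult_ac)
  finally show ?thesis by (simp add: h_def)
qed

end

section \<open>Configurations as random walk bridges\<close>

text \<open>A walk is given by its increments; \<open>V u i\<close> is its position after \<open>i\<close>
  steps.\<close>

definition V :: "(nat \<Rightarrow> int) \<Rightarrow> nat \<Rightarrow> int" where "V u i = (\<Sum>j<i. u j)"
definition area :: "(nat \<Rightarrow> int) \<Rightarrow> nat \<Rightarrow> int" where "area u n = (\<Sum>i\<le>n. \<bar>V u i\<bar>)"
definition bridge :: "nat \<Rightarrow> int \<Rightarrow> (nat \<Rightarrow> int) set" where
  "bridge n A = {u. V u n = 0 \<and> area u n = A}"
definition partition_part :: "real \<Rightarrow> nat \<Rightarrow> nat \<Rightarrow> real" where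
  "partition_part \<beta> N L = (\<Sum>l\<in>configurations N L. exp (hamiltonian \<beta> l))"

text \<open>The reflected stretches, extended by 0 on both sides so that they form a bridge.\<close>

definition heights :: "int list \<Rightarrow> nat \<Rightarrow> int" where
  "heights l i = (if 1 \<le> i \<and> i \<le> length l then (-1) ^ i * l ! (i - 1) else 0)"
definition incr :: "int list \<Rightarrow> nat \<Rightarrow> int" where "incr l j = heights l (Suc j) - heights l j"

lemma V_0 [simp]: "V u 0 = 0" by (simp add: V_def)

lemma V_Suc: "V u (Suc i) = V u i + u i" by (simp add: V_def)

lemma V_cong: "(\<And>j. j < i \<Longrightarrow> u j = w j) \<Longrightarrow> V u i = V w i"
  unfolding V_def by (intro sum.cong) auto

lemma area_cong: "(\<And>j. j < n \<Longrightarrow> u j = w j) \<Longrightarrow> area u n = area w n"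
  unfolding area_def by (intro sum.cong refl arg_cong[of _ _ abs] V_cong) auto

lemma V_incr: "V (incr l) i = heights l i"
proof -
  have "V (incr l) i = heights l i - heights l 0"
    unfolding V_def incr_def by (rule sum_lessThan_telescope)
  then show ?thesis by (simp add: heights_def)
qed

lemma abs_heights: "\<bar>heights l (Suc i)\<bar> = (if i < length l then \<bar>l ! i\<bar> else 0)"
  by (auto simp: heights_def abs_mult power_abs)

lemma finite_configurations: "finite (configurations N L)"
proof (rule finite_subset)
  show "configurations N L \<subseteq> {l. set l \<subseteq> {- int L..int L} \<and> length l = N}"
  proof
    fix l assume l: "l \<in> configurations N L"
    then have N: "length l = N" and S: "(\<Sum>n<N. \<bar>l ! n\<bar>) + int N = int L" by (auto simp: configurations_def)
    have "\<bar>l ! i\<bar> \<le> int L" if "i < N" for i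
    proof -
      have "\<bar>l ! i\<bar> \<le> (\<Sum>n<N. \<bar>l ! n\<bar>)" using that by (intro member_le_sum) auto
      then show ?thesis using S by simp
    qed
    then show "l \<in> {l. set l \<subseteq> {- int L..int L} \<and> length l = N}"
      using N by (force simp: in_set_conv_nth abs_le_iff)
  qed
  show "finite {l. set l \<subseteq> {- int L..int L} \<and> length l = N}"
    by (rule finite_lists_length_eq) simp
qed

lemma wedge_eq: "2 * wedge x y = \<bar>x\<bar> + \<bar>y\<bar> - \<bar>x + y\<bar>"
proof -
  consider "x = 0" | "y = 0" | "0 < x" "0 < y" | "x < 0" "y < 0" | "0 < x" "y < 0" | "x < 0" "0 < y"
    by linarith
  then show ?thesis
    by cases (auto simp: wedge_def mult_less_0_iff zero_less_mult_iff not_less min_def)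
qed

lemma abs_incr:
  "\<bar>incr l j\<bar> = (if j = 0 then (if l = [] then 0 else \<bar>l ! 0\<bar>)
     else if j < length l then \<bar>l ! (j - 1) + l ! j\<bar>
     else if j = length l then \<bar>l ! (j - 1)\<bar> else 0)"
proof (cases j)
  case 0
  then show ?thesis by (cases l) (auto simp: incr_def heights_def)
next
  case (Suc k)
  have e: "\<bar>- ((-1) ^ k * x) - (-1) ^ k * (y :: int)\<bar> = \<bar>x + y\<bar>" for x y
  proof -
    have "- ((-1) ^ k * x) - (-1) ^ k * y = - ((-1) ^ k * (x + y))" by (simp add: algebra_simps)
    then show ?thesis by (simp add: abs_mult power_abs)
  qed
  show ?thesis
  proof (cases "j < length l")
    case True
    then have "incr l j = (-1) ^ k * l ! j + (-1) ^ k * l ! k"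
      using Suc by (simp add: incr_def heights_def)
    also have "\<dots> = (-1) ^ k * (l ! k + l ! j)" by (simp add: algebra_simps)
    finally show ?thesis using Suc True by (simp add: abs_mult power_abs)
  next
    case False
    then show ?thesis using Suc by (auto simp: incr_def heights_def abs_mult power_abs)
  qed
qed

text \<open>Summing the identity for \<open>wedge\<close>: the interaction compensates the stretches up to the
  total variation of the reflected path.\<close>

lemma hamiltonian_eq:
  assumes "length l = Suc M"
  shows "2 * (\<Sum>k<length l - 1. wedge (l ! k) (l ! Suc k)) =
    2 * (\<Sum>k<length l. \<bar>l ! k\<bar>) - (\<Sum>j<Suc (length l). \<bar>incr l j\<bar>)"
proof -
  have "(\<Sum>j<Suc (length l). \<bar>incr l j\<bar>) = \<bar>l ! 0\<bar> + (\<Sum>j<M. \<bar>l ! j + l ! Suc j\<bar>) + \<bar>l ! M\<bar>"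
  proof -
    have "(\<Sum>j<Suc (Suc M). \<bar>incr l j\<bar>) = \<bar>incr l 0\<bar> + (\<Sum>j<M. \<bar>incr l (Suc j)\<bar>) + \<bar>incr l (Suc M)\<bar>"
      by (subst sum.lessThan_Suc, subst sum.lessThan_Suc_shift) simp
    moreover have "\<bar>incr l 0\<bar> = \<bar>l ! 0\<bar>" using assms by (auto simp: abs_incr)
    moreover have "\<bar>incr l (Suc M)\<bar> = \<bar>l ! M\<bar>" using assms by (auto simp: abs_incr)
    moreover have "(\<Sum>j<M. \<bar>incr l (Suc j)\<bar>) = (\<Sum>j<M. \<bar>l ! j + l ! Suc j\<bar>)"
      using assms by (intro sum.cong) (auto simp: abs_incr)
    ultimately show ?thesis using assms by simp
  qed
  moreover have "2 * (\<Sum>k<M. wedge (l ! k) (l ! Suc k)) =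
     (\<Sum>k<M. \<bar>l ! k\<bar>) + (\<Sum>k<M. \<bar>l ! Suc k\<bar>) - (\<Sum>k<M. \<bar>l ! k + l ! Suc k\<bar>)"
    by (simp add: sum_distrib_left wedge_eq sum.distrib sum_subtractf)
  moreover have "(\<Sum>k<Suc M. \<bar>l ! k\<bar>) = (\<Sum>k<M. \<bar>l ! k\<bar>) + \<bar>l ! M\<bar>" by simp
  moreover have "(\<Sum>k<Suc M. \<bar>l ! k\<bar>) = \<bar>l ! 0\<bar> + (\<Sum>k<M. \<bar>l ! Suc k\<bar>)" by (rule sum.lessThan_Suc_shift)
  ultimately show ?thesis using assms by simp
qed

lemma hamiltonian_Cons: "hamiltonian \<beta> (x # y # zs) = \<beta> * real_of_int (wedge x y) + hamiltonian \<beta> (y # zs)"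
  unfolding hamiltonian_def by (simp add: sum.lessThan_Suc_shift distrib_left del: sum.lessThan_Suc)

lemma hamiltonian_append:
  "xs \<noteq> [] \<Longrightarrow> ys \<noteq> [] \<Longrightarrow> hamiltonian \<beta> (xs @ ys) =
    hamiltonian \<beta> xs + \<beta> * real_of_int (wedge (last xs) (hd ys)) + hamiltonian \<beta> ys"
proof (induction xs rule: induct_list012)
  case (2 x)
  then obtain y zs where "ys = y # zs" by (cases ys) auto
  then show ?case by (simp add: hamiltonian_Cons hamiltonian_def[of _ "[x]"])
next
  case (3 x y zs)
  then show ?case by (simp add: hamiltonian_Cons)
qed simp

lemma inj_incr: "inj_on incr (configurations N L)"
proof (rule inj_onI)
  fix l l' assume l: "l \<in> configurations N L" "l' \<in> configurations N L" and e: "incr l = incr l'"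
  have h: "heights l i = heights l' i" for i using V_incr[of l i] V_incr[of l' i] e by simp
  show "l = l'"
  proof (rule nth_equalityI)
    show "length l = length l'" using l by (simp add: configurations_def)
    fix i assume "i < length l"
    then show "l ! i = l' ! i" using h[of "Suc i"] l by (simp add: heights_def configurations_def)
  qed
qed

text \<open>The increments determine the configuration, and every bridge with the right absolute area arises.
  Increments beyond position \<open>N\<close> vanish, which is the support condition of \<open>Pi_pmf\<close>
  with default value 0.\<close>

lemma image_incr:
  "incr ` {l \<in> configurations N L. incr l \<in> X} =
    {u \<in> bridge (Suc N) (int L - int N) \<inter> X. \<forall>j\<ge>Suc N. u j = 0}"
proof (intro equalityI subsetI)
  have ar: "area (incr l) (Suc N) = (\<Sum>n<N. \<bar>l ! n\<bar>)" if "length l = N" for l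
  proof -
    have "area (incr l) (Suc N) = (\<Sum>i<Suc (Suc N). \<bar>heights l i\<bar>)"
      by (simp add: area_def V_incr lessThan_Suc_atMost)
    also have "\<dots> = (\<Sum>i<Suc N. \<bar>heights l (Suc i)\<bar>)"
      by (subst sum.lessThan_Suc_shift) (simp add: heights_def)
    also have "\<dots> = (\<Sum>i<N. \<bar>l ! i\<bar>)" by (simp add: abs_heights that)
    finally show ?thesis .
  qed
  fix u assume "u \<in> incr ` {l \<in> configurations N L. incr l \<in> X}"
  then obtain l where l: "l \<in> configurations N L" "incr l \<in> X" "u = incr l" by auto
  then have "length l = N" "(\<Sum>n<N. \<bar>l ! n\<bar>) + int N = int L" by (auto simp: configurations_def)
  then show "u \<in> {u \<in> bridge (Suc N) (int L - int N) \<inter> X. \<forall>j\<ge>Suc N. u j = 0}"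
    unfolding l(3) using l(2) ar[of l] by (auto simp: bridge_def V_incr) (auto simp: heights_def incr_def)
next
  fix u assume u: "u \<in> {u \<in> bridge (Suc N) (int L - int N) \<inter> X. \<forall>j\<ge>Suc N. u j = 0}"
  define l where "l = map (\<lambda>i. (-1) ^ Suc i * V u (Suc i)) [0..<N]"
  have len: "length l = N" by (simp add: l_def)
  have VN: "V u i = 0" if "Suc N \<le> i" for i
    using that
  proof (induction i rule: dec_induct)
    case base then show ?case using u by (simp add: bridge_def)
  next
    case (step i) then show ?case using u by (simp add: V_Suc)
  qed
  have hV: "heights l i = V u i" for i
  proof (cases i)
    case (Suc k)
    show ?thesis
    proof (cases "k < N")
      case True
      have "heights l i = ((-1) ^ Suc k * (-1) ^ Suc k) * V u (Suc k)"
        using True Suc by (simp add: heights_def len l_def del: power_Suc)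
      also have "(-1) ^ Suc k * (-1) ^ Suc k = (1 :: int)"
        by (simp only: power_mult_distrib[symmetric]) simp
      finally show ?thesis using Suc by simp
    next
      case False
      then show ?thesis using Suc VN[of i] by (simp add: heights_def len)
    qed
  qed (simp add: heights_def)
  have "incr l j = u j" for j unfolding incr_def hV by (simp add: V_Suc)
  then have ul: "incr l = u" by auto
  have "(\<Sum>n<N. \<bar>l ! n\<bar>) = (\<Sum>i<N. \<bar>V u (Suc i)\<bar>)"
    by (intro sum.cong) (auto simp: l_def abs_mult power_abs)
  also have "\<dots> = area u (Suc N)"
    using u unfolding area_def lessThan_Suc_atMost[symmetric]
    using sum.lessThan_Suc_shift[of "\<lambda>i. \<bar>V u i\<bar>" "Suc N"] by (simp add: bridge_def)
  also have "\<dots> = int L - int N" using u by (simp add: bridge_def)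
  finally have "l \<in> configurations N L" by (simp add: configurations_def len)
  then show "u \<in> incr ` {l \<in> configurations N L. incr l \<in> X}" using ul u by force
qed

context ipdsaw
begin

abbreviation cc :: real where "cc \<equiv> c_const \<beta>"

definition walk :: "nat \<Rightarrow> (nat \<Rightarrow> int) pmf" where "walk n = Pi_pmf {..<n} 0 (\<lambda>_. step_law \<beta>)"

text \<open>A configuration has Boltzmann weight \<open>exp (\<beta> (L - N))\<close> times \<open>exp (-
  \<beta>/2 |u\<^sub>j|)\<close> over its \<open>N + 1\<close> increments, and up to \<open>c\<close> each of
  the latter factors is a step probability. The set \<open>X\<close> allows for restricting to a class of
  paths.\<close>

lemma config_sum:
  assumes "1 \<le> N"
  shows "(\<Sum>l\<in>{l \<in> configurations N L. incr l \<in> X}. exp (hamiltonian \<beta> l)) =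
    exp (\<beta> * (real L - real N)) * cc ^ Suc N * measure (walk (Suc N)) (bridge (Suc N) (int L - int N) \<inter> X)"
proof -
  let ?C = "{l \<in> configurations N L. incr l \<in> X}"
  have cc: "0 < cc" by (rule c_const_pos[OF \<beta>_pos])
  have H: "exp (hamiltonian \<beta> l) = exp (\<beta> * (real L - real N)) * cc ^ Suc N * pmf (walk (Suc N)) (incr l)"
    if "l \<in> configurations N L" for l
  proof -
    have l: "length l = N" "(\<Sum>n<N. \<bar>l ! n\<bar>) + int N = int L" using that by (auto simp: configurations_def)
    have out: "incr l j = 0" if "j \<notin> {..<Suc N}" for j
      using that l by (auto simp: incr_def heights_def)
    obtain M where "length l = Suc M" using assms l by (cases N) auto
    from hamiltonian_eq[OF this] have e: "2 * (\<Sum>k<N - 1. wedge (l ! k) (l ! Suc k)) =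
      2 * (\<Sum>k<N. \<bar>l ! k\<bar>) - (\<Sum>j<Suc N. \<bar>incr l j\<bar>)" using l by simp
    have s: "(\<Sum>k<N. \<bar>l ! k\<bar>) = int L - int N" using l by simp
    have half: "2 * w = 2 * a - s' \<Longrightarrow> w = a - s' / 2" for w a s' :: real by simp
    have "2 * real_of_int (\<Sum>k<N - 1. wedge (l ! k) (l ! Suc k)) = 2 * (real L - real N) - (\<Sum>j<Suc N. \<bar>real_of_int (incr l j)\<bar>)"
      using arg_cong[OF e[unfolded s], of real_of_int] by (simp del: sum.lessThan_Suc)
    then have "real_of_int (\<Sum>k<N - 1. wedge (l ! k) (l ! Suc k)) = (real L - real N) - (\<Sum>j<Suc N. \<bar>real_of_int (incr l j)\<bar>) / 2"
      by (rule half)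
    then have HH: "hamiltonian \<beta> l = \<beta> * (real L - real N) - \<beta> / 2 * (\<Sum>j<Suc N. \<bar>real_of_int (incr l j)\<bar>)"
      unfolding hamiltonian_def l(1) of_int_sum[symmetric] by (simp add: right_diff_distrib del: sum.lessThan_Suc of_int_sum)
    have "pmf (walk (Suc N)) (incr l) = (\<Prod>j<Suc N. exp (- (\<beta> / 2) * \<bar>real_of_int (incr l j)\<bar>) / cc)"
      unfolding walk_def by (subst pmf_Pi') (auto simp: out pmf_step_law[OF \<beta>_pos] intro!: prod.cong)
    also have "\<dots> = exp (- (\<beta> / 2) * (\<Sum>j<Suc N. \<bar>real_of_int (incr l j)\<bar>)) / cc ^ Suc N"
      unfolding prod_dividef prod_constant sum_distrib_left exp_sum[OF finite_lessThan] by simp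
    finally have PP: "pmf (walk (Suc N)) (incr l) = \<dots>" .
    have "exp (hamiltonian \<beta> l) = exp (\<beta> * (real L - real N)) * exp (- (\<beta> / 2) * (\<Sum>j<Suc N. \<bar>real_of_int (incr l j)\<bar>))"
      unfolding HH by (simp add: exp_add[symmetric] del: sum.lessThan_Suc)
    then show ?thesis unfolding PP using cc by (simp del: sum.lessThan_Suc power_Suc)
  qed
  have inj: "inj_on incr ?C" using inj_incr by (rule inj_on_subset) auto
  have "measure (walk (Suc N)) (bridge (Suc N) (int L - int N) \<inter> X) = measure (walk (Suc N)) (incr ` ?C)"
  proof (rule measure_pmf.finite_measure_eq_AE)
    have "AE u in walk (Suc N). \<forall>j\<ge>Suc N. u j = 0"
      unfolding walk_def AE_measure_pmf_iff using set_Pi_pmf_subset[of "{..<Suc N}" 0 "\<lambda>_. step_law \<beta>"] by auto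
    then show "AE u in walk (Suc N). (u \<in> bridge (Suc N) (int L - int N) \<inter> X) = (u \<in> incr ` ?C)"
      by eventually_elim (auto simp: image_incr)
  qed auto
  also have "\<dots> = (\<Sum>l\<in>?C. pmf (walk (Suc N)) (incr l))"
    using finite_configurations by (subst measure_measure_pmf_finite) (auto simp: sum.reindex[OF inj])
  finally show ?thesis
    by (simp add: H sum_distrib_left)
qed

lemma partition_part_eq:
  assumes "1 \<le> N"
  shows "partition_part \<beta> N L = exp (\<beta> * (real L - real N)) * cc ^ Suc N * measure (walk (Suc N)) (bridge (Suc N) (int L - int N))"
  using config_sum[OF assms, of L UNIV] by (simp add: partition_part_def)

text \<open>If the reflected path changes sign or vanishes between \<open>i\<close> and \<open>i + 1\<close>,
  then the stretches \<open>i\<close> and \<open>i + 1\<close> do not point in opposite directions and do not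
  interact. The configuration can be cut there, at the cost of one more step and a sum over the length
  \<open>L'\<close> of the first part.\<close>

lemma crossing_split:
  assumes i: "1 \<le> i" "i < N"
  shows "measure (walk (Suc N)) (bridge (Suc N) (int L - int N) \<inter> {u. V u i * V u (Suc i) \<le> 0})
    \<le> cc * (\<Sum>L'\<le>L. measure (walk (Suc i)) (bridge (Suc i) (int L' - int i)) *
        measure (walk (Suc (N - i))) (bridge (Suc (N - i)) (int (L - L') - int (N - i))))"
proof -
  let ?X = "{u. V u i * V u (Suc i) \<le> 0}"
  let ?C = "{l \<in> configurations N L. incr l \<in> ?X}"
  let ?D = "SIGMA L':{..L}. configurations i L' \<times> configurations (N - i) (L - L')"
  have cc: "0 < cc" by (rule c_const_pos[OF \<beta>_pos])
  define f where "f l = (nat ((\<Sum>n<i. \<bar>take i l ! n\<bar>) + int i), take i l, drop i l)" for l :: "int list"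
  have C: "length l = N" "(\<Sum>n<N. \<bar>l ! n\<bar>) + int N = int L" "0 \<le> l ! (i - 1) * l ! i" if "l \<in> ?C" for l
  proof -
    show len: "length l = N" "(\<Sum>n<N. \<bar>l ! n\<bar>) + int N = int L" using that by (auto simp: configurations_def)
    have "heights l i * heights l (Suc i) \<le> 0" using that by (auto simp: V_incr)
    moreover have "heights l i * heights l (Suc i) = - ((-1) ^ i * (-1) ^ i) * (l ! (i - 1) * l ! i)"
      using i len by (simp add: heights_def)
    moreover have "(-1) ^ i * (-1) ^ i = (1 :: int)" by (simp only: power_mult_distrib[symmetric]) simp
    ultimately show "0 \<le> l ! (i - 1) * l ! i" by simp
  qed
  have fD: "f l \<in> ?D" if "l \<in> ?C" for l
  proof -
    note l = C[OF that]
    have s1: "(\<Sum>n<i. \<bar>take i l ! n\<bar>) = (\<Sum>n<i. \<bar>l ! n\<bar>)" by (intro sum.cong) auto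
    have s2: "(\<Sum>n<N - i. \<bar>drop i l ! n\<bar>) = (\<Sum>n\<in>{i..<N}. \<bar>l ! n\<bar>)"
    proof -
      have "(\<Sum>n\<in>{i..<N}. \<bar>l ! n\<bar>) = (\<Sum>n\<in>{0 + i..<(N - i) + i}. \<bar>l ! n\<bar>)" using i by simp
      also have "\<dots> = (\<Sum>n\<in>{0..<N - i}. \<bar>l ! (n + i)\<bar>)" by (rule sum.shift_bounds_nat_ivl)
      finally show ?thesis using l i by (simp add: atLeast0LessThan add.commute)
    qed
    have s3: "(\<Sum>n<N. \<bar>l ! n\<bar>) = (\<Sum>n<i. \<bar>l ! n\<bar>) + (\<Sum>n\<in>{i..<N}. \<bar>l ! n\<bar>)"
      using i by (subst sum.union_disjoint[symmetric]) (auto intro!: sum.cong)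
    have nn: "0 \<le> (\<Sum>n<i. \<bar>l ! n\<bar>)" "0 \<le> (\<Sum>n\<in>{i..<N}. \<bar>l ! n\<bar>)" by (auto intro!: sum_nonneg)
    define a b where "a = (\<Sum>n<i. \<bar>l ! n\<bar>)" and "b = (\<Sum>n\<in>{i..<N}. \<bar>l ! n\<bar>)"
    have ab: "0 \<le> a" "0 \<le> b" "a + b + int N = int L" using nn l s3 by (auto simp: a_def b_def)
    have "nat (a + int i) \<le> L" using ab i by linarith
    moreover have "take i l \<in> configurations i (nat (a + int i))"
      using l i s1 ab by (simp add: configurations_def a_def[symmetric])
    moreover have "drop i l \<in> configurations (N - i) (L - nat (a + int i))"
      using l i s2 ab \<open>nat (a + int i) \<le> L\<close> by (simp add: configurations_def b_def[symmetric] of_nat_diff)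
    ultimately show ?thesis
      unfolding f_def s1 a_def[symmetric] by simp
  qed
  have inj: "inj_on f ?C"
  proof (rule inj_onI)
    fix l l' assume "f l = f l'"
    then have "take i l = take i l'" "drop i l = drop i l'" by (auto simp: f_def)
    then show "l = l'" using append_take_drop_id by metis
  qed
  have ham: "exp (hamiltonian \<beta> l) = (\<lambda>(L', l1, l2). exp (hamiltonian \<beta> l1) * exp (hamiltonian \<beta> l2)) (f l)"
    if "l \<in> ?C" for l
  proof -
    note l = C[OF that]
    have ne: "take i l \<noteq> []" "drop i l \<noteq> []" using l i by auto
    have "last (take i l) = l ! (i - 1)" using ne l i by (simp add: last_conv_nth)
    moreover have "hd (drop i l) = l ! i" using l i by (simp add: hd_drop_conv_nth)
    ultimately have "wedge (last (take i l)) (hd (drop i l)) = 0" using l by (simp add: wedge_def)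
    then show ?thesis using hamiltonian_append[OF ne, of \<beta>] by (simp add: f_def exp_add)
  qed
  have fin: "finite ?D" using finite_configurations by auto
  have "(\<Sum>l\<in>?C. exp (hamiltonian \<beta> l)) = (\<Sum>(L', l1, l2)\<in>f ` ?C. exp (hamiltonian \<beta> l1) * exp (hamiltonian \<beta> l2))"
    by (subst sum.reindex[OF inj]) (auto intro!: sum.cong simp: ham)
  also have "\<dots> \<le> (\<Sum>(L', l1, l2)\<in>?D. exp (hamiltonian \<beta> l1) * exp (hamiltonian \<beta> l2))"
  proof (rule sum_mono2[OF fin])
    show "f ` ?C \<subseteq> ?D" using fD by (rule image_subsetI)
  qed auto
  also have "\<dots> = (\<Sum>L'\<le>L. partition_part \<beta> i L' * partition_part \<beta> (N - i) (L - L'))"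
    using finite_configurations
    by (subst sum.Sigma[symmetric]) (auto simp: partition_part_def sum_product sum.cartesian_product)
  also have "\<dots> = (\<Sum>L'\<le>L. exp (\<beta> * (real L - real N)) * cc ^ Suc N * (cc * (measure (walk (Suc i)) (bridge (Suc i) (int L' - int i)) *
        measure (walk (Suc (N - i))) (bridge (Suc (N - i)) (int (L - L') - int (N - i))))))"
  proof (rule sum.cong[OF refl])
    fix L' assume L': "L' \<in> {..L}"
    have e1: "cc ^ Suc i * cc ^ Suc (N - i) = cc ^ Suc N * cc"
      using i by (simp flip: power_add power_Suc2)
    have e2: "exp (\<beta> * (real L' - real i)) * exp (\<beta> * (real (L - L') - real (N - i))) = exp (\<beta> * (real L - real N))"
      using i L' by (simp add: of_nat_diff algebra_simps flip: exp_add)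
    have R: "(a * b * m) * (a' * b' * m') = (a * a') * (b * b') * (m * m')" for a b m a' b' m' :: real
      by (simp add: mult_ac)
    have iN: "1 \<le> N - i" using i by simp
    show "partition_part \<beta> i L' * partition_part \<beta> (N - i) (L - L') = exp (\<beta> * (real L - real N)) * cc ^ Suc N * (cc * (measure (walk (Suc i)) (bridge (Suc i) (int L' - int i)) *
        measure (walk (Suc (N - i))) (bridge (Suc (N - i)) (int (L - L') - int (N - i)))))"
      unfolding partition_part_eq[OF i(1)] partition_part_eq[OF iN] R e1 e2 by (simp only: mult.assoc)
  qed
  finally have "exp (\<beta> * (real L - real N)) * cc ^ Suc N * measure (walk (Suc N)) (bridge (Suc N) (int L - int N) \<inter> ?X)
     \<le> exp (\<beta> * (real L - real N)) * cc ^ Suc N * (cc * (\<Sum>L'\<le>L. measure (walk (Suc i)) (bridge (Suc i) (int L' - int i)) *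
        measure (walk (Suc (N - i))) (bridge (Suc (N - i)) (int (L - L') - int (N - i)))))"
    using i by (subst (asm) config_sum) (simp_all add: sum_distrib_left del: power_Suc)
  then show ?thesis using cc by (simp add: mult_le_cancel_left_pos del: power_Suc)
qed

end

section \<open>A Chernoff bound for the absolute area\<close>

text \<open>The midpoint rule underestimates a function with a supporting line at the midpoint of each cell,
  as the linear part integrates to zero over the cell.\<close>

lemma midpoint_sum_le_integral:
  fixes f :: "real \<Rightarrow> real"
  assumes n: "1 \<le> n" and f: "f integrable_on {0..1}"
    and cell: "\<And>j x. j < n \<Longrightarrow> real j / real n \<le> x \<Longrightarrow> x \<le> (real j + 1) / real n \<Longrightarrow>
       a j + b j * (x - (real j + 1/2) / real n) \<le> f x"
  shows "(\<Sum>j<n. a j) \<le> real n * integral {0..1} f"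
proof -
  have sub: "f integrable_on {c..d}" if "0 \<le> c" "d \<le> 1" for c d
    by (rule integrable_subinterval_real[OF f]) (use that in auto)
  have "(\<Sum>j<m. a j) / real n \<le> integral {0..real m / real n} f" if "m \<le> n" for m
    using that
  proof (induction m)
    case 0
    then show ?case by simp
  next
    case (Suc j)
    let ?c = "real j / real n" and ?d = "(real j + 1) / real n"
    have d1: "?d \<le> 1" using Suc.prems n by simp
    have cd: "?c \<le> ?d" using n by (simp add: divide_right_mono)
    have lin: "((\<lambda>x. a j + b j * (x - (real j + 1/2) / real n)) has_integral
        ((a j * ?d + b j * (?d - (real j + 1/2) / real n)\<^sup>2 / 2) - (a j * ?c + b j * (?c - (real j + 1/2) / real n)\<^sup>2 / 2))) {?c..?d}"
    proof (rule fundamental_theorem_of_calculus[OF cd])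
      fix x
      have "((\<lambda>x. a j * x + b j * (x - (real j + 1/2) / real n)\<^sup>2 / 2) has_real_derivative
          (a j + b j * (x - (real j + 1/2) / real n))) (at x)"
        by (auto intro!: derivative_eq_intros)
      from has_field_derivative_at_within[OF this]
      show "((\<lambda>x. a j * x + b j * (x - (real j + 1/2) / real n)\<^sup>2 / 2) has_vector_derivative
          (a j + b j * (x - (real j + 1/2) / real n))) (at x within {?c..?d})"
        by (simp only: has_real_derivative_iff_has_vector_derivative)
    qed
    have e: "(a j * ?d + b j * (?d - (real j + 1/2) / real n)\<^sup>2 / 2) - (a j * ?c + b j * (?c - (real j + 1/2) / real n)\<^sup>2 / 2) = a j / real n"
    proof -
      have c: "?d - (real j + 1/2) / real n = 1 / (2 * real n)" "?c - (real j + 1/2) / real n = - (1 / (2 * real n))"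
        using n by (simp_all add: field_simps)
      have "a j * ?d - a j * ?c = a j / real n"
        by (simp add: add_divide_distrib distrib_left)
      then show ?thesis unfolding c power2_minus by linarith
    qed
    have "a j / real n \<le> integral {?c..?d} f"
      using cell[of j] Suc.prems
      by (intro has_integral_le[OF lin[unfolded e] integrable_integral[OF sub]] d1) auto
    moreover have "integral {0..?c} f + integral {?c..?d} f = integral {0..?d} f"
      using cd d1 by (intro Henstock_Kurzweil_Integration.integral_combine sub) auto
    ultimately show ?case using Suc by (simp add: add_divide_distrib algebra_simps)
  qed
  from this[of n] n show ?thesis by (simp add: field_simps)
qed

context ipdsaw
begin

lemma lam2_mono: "\<bar>x\<bar> \<le> y \<Longrightarrow> y < \<beta> / 2 \<Longrightarrow> lam2 x \<le> lam2 y"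
proof -
  assume xy: "\<bar>x\<bar> \<le> y" "y < \<beta> / 2"
  have 1: "cosh x \<le> cosh y" using xy cosh_real_nonneg_le_iff[of "\<bar>x\<bar>" y] by simp
  have 2: "cosh y < Cb" using Cb_minus_cosh_pos[of y] xy by auto
  have 3: "1 * 1 \<le> Cb * cosh y" using Cb_gt_1 cosh_real_ge_1[of y] by (intro mult_mono) auto
  show ?thesis unfolding lam2_def
    by (rule frac_le) (use 1 2 3 Cb_gt_1 in \<open>auto intro: power_mono\<close>)
qed

lemma lam1_mono: "x \<le> y \<Longrightarrow> \<bar>x\<bar> < \<beta> / 2 \<Longrightarrow> \<bar>y\<bar> < \<beta> / 2 \<Longrightarrow> lam1 x \<le> lam1 y"
  using lam1_less[of x y] by (cases "x = y") auto

lemma abs_lam1_le: "\<bar>x\<bar> \<le> y \<Longrightarrow> y < \<beta> / 2 \<Longrightarrow> \<bar>lam1 x\<bar> \<le> lam1 y"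
proof -
  assume a: "\<bar>x\<bar> \<le> y" "y < \<beta> / 2"
  have b: "x \<le> y" "- y \<le> x" "\<bar>x\<bar> < \<beta> / 2" "\<bar>y\<bar> < \<beta> / 2" "\<bar>- y\<bar> < \<beta> / 2" using a by auto
  show ?thesis using lam1_mono[OF b(1,3,4)] lam1_mono[OF b(2,5,3)] by simp
qed

lemma lam1_lipschitz:
  assumes "\<bar>x\<bar> \<le> r" "\<bar>y\<bar> \<le> r" "r < \<beta> / 2"
  shows "\<bar>lam1 x - lam1 y\<bar> \<le> lam2 r * \<bar>x - y\<bar>"
proof -
  have "norm (lam1 x - lam1 y) \<le> lam2 r * norm (x - y)"
  proof (rule field_differentiable_bound[where S = "{-r..r}" and f' = lam2])
    fix z assume z: "z \<in> {-r..r}"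
    then have zb: "\<bar>z\<bar> < \<beta> / 2" using assms by auto
    then show "(lam1 has_field_derivative lam2 z) (at z within {-r..r})"
      by (rule has_field_derivative_at_within[OF lam1_has_derivative])
    show "norm (lam2 z) \<le> lam2 r"
      using lam2_mono[of z r] lam2_pos[OF zb] z assms by (auto simp: abs_le_iff)
  qed (use assms in auto)
  then show ?thesis by simp
qed

lemma lam_quadratic_upper:
  assumes "\<bar>x\<bar> \<le> r" "\<bar>y\<bar> \<le> r" "r < \<beta> / 2"
  shows "lam y \<le> lam x + lam1 x * (y - x) + lam2 r * (y - x)\<^sup>2"
proof -
  have "lam y + lam1 y * (x - y) \<le> lam x" using assms by (intro lam_tangent) auto
  moreover have "(lam1 y - lam1 x) * (y - x) \<le> lam2 r * (y - x)\<^sup>2"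
  proof -
    have "(lam1 y - lam1 x) * (y - x) \<le> \<bar>lam1 y - lam1 x\<bar> * \<bar>y - x\<bar>" by (metis abs_ge_self abs_mult)
    also have "\<dots> \<le> (lam2 r * \<bar>y - x\<bar>) * \<bar>y - x\<bar>" by (intro mult_right_mono lam1_lipschitz assms) auto
    finally show ?thesis by (simp add: power2_eq_square mult.assoc)
  qed
  ultimately show ?thesis by (simp add: algebra_simps)
qed

text \<open>The weight of step \<open>j\<close> in the centred area of a bridge of \<open>n\<close> steps. The
  tilt of step \<open>j\<close> is \<open>h/n\<close> times this weight.\<close>

definition cweight :: "nat \<Rightarrow> nat \<Rightarrow> real" where "cweight n j = (real n - 1) / 2 - real j"

lemma cweight_bound: "j < n \<Longrightarrow> \<bar>cweight n j\<bar> \<le> (real n - 1) / 2"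
  by (auto simp: cweight_def abs_le_iff field_simps)

lemma cweight_tilt_bound: "j < n \<Longrightarrow> 0 \<le> h \<Longrightarrow> \<bar>h / real n * cweight n j\<bar> \<le> h / 2"
proof -
  assume j: "j < n" and h: "0 \<le> h"
  have "\<bar>h / real n * cweight n j\<bar> \<le> h / real n * (real n / 2)"
    unfolding abs_mult using cweight_bound[OF j] h by (intro mult_mono) auto
  also have "\<dots> = h / 2" using j by simp
  finally show ?thesis .
qed

lemma cweight_cell:
  assumes "j < n"
  shows "h * (1/2 - x) - h / real n * cweight n j = - h * (x - (real j + 1/2) / real n)"
  using assms by (simp add: cweight_def field_simps)

lemma cell_subset: "j < n \<Longrightarrow> real j / real n \<le> x \<Longrightarrow> x \<le> (real j + 1) / real n \<Longrightarrow> x \<in> {0..1}"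
proof -
  assume j: "j < n" and x: "real j / real n \<le> x" "x \<le> (real j + 1) / real n"
  have b: "0 \<le> real j / real n" "(real j + 1) / real n \<le> 1" using j by auto
  show ?thesis using order_trans[OF b(1) x(1)] order_trans[OF x(2) b(2)] by simp
qed

lemma cell_dist: "j < n \<Longrightarrow> real j / real n \<le> x \<Longrightarrow> x \<le> (real j + 1) / real n \<Longrightarrow>
   \<bar>x - (real j + 1/2) / real n\<bar> \<le> 1 / (2 * real n)"
  by (auto simp: abs_le_iff field_simps)

lemma sum_lam_le:
  assumes n: "1 \<le> n" and h: "0 \<le> h" "h < \<beta>"
  shows "(\<Sum>j<n. lam (h / real n * cweight n j)) \<le> real n * G0 h"
  unfolding G0_def
proof (rule midpoint_sum_le_integral[OF n])
  have hb: "\<bar>h\<bar> < \<beta>" using h by simp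
  show "(\<lambda>x. lam (h * (1/2 - x))) integrable_on {0..1}"
    by (intro integrable_continuous_real continuous_intros arg_bound[OF hb])
  fix j x assume j: "j < n" and x: "real j / real n \<le> x" "x \<le> (real j + 1) / real n"
  have "\<bar>h / real n * cweight n j\<bar> < \<beta> / 2" using cweight_tilt_bound[OF j h(1)] h by linarith
  note T = lam_tangent[OF this arg_bound[OF hb cell_subset[OF j x]], unfolded cweight_cell[OF j]]
  have eq: "l * (- h * w) = (- h * l) * w" for l w :: real by simp
  show "lam (h / real n * cweight n j) + (- h * lam1 (h / real n * cweight n j)) * (x - (real j + 1/2) / real n) \<le> lam (h * (1/2 - x))"
    using T unfolding eq .
qed

lemma sum_lam_ge:
  assumes n: "1 \<le> n" and h: "0 \<le> h" "h < \<beta>"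
  shows "real n * G0 h - lam2 (h / 2) * h\<^sup>2 / real n \<le> (\<Sum>j<n. lam (h / real n * cweight n j))"
proof -
  have hb: "\<bar>h\<bar> < \<beta>" using h by simp
  define e where "e = lam2 (h / 2) * (h / (2 * real n))\<^sup>2"
  have l2: "0 \<le> lam2 (h / 2)" using lam2_pos[of "h/2"] h by simp
  have int: "(\<lambda>x. lam (h * (1/2 - x))) integrable_on {0..1}"
    by (intro integrable_continuous_real continuous_intros arg_bound[OF hb])
  have "(\<Sum>j<n. - lam (h / real n * cweight n j) - e) \<le> real n * integral {0..1} (\<lambda>x. - lam (h * (1/2 - x)))"
  proof (rule midpoint_sum_le_integral[OF n])
    show "(\<lambda>x. - lam (h * (1/2 - x))) integrable_on {0..1}" using int by (rule integrable_neg)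
    fix j x assume j: "j < n" and x: "real j / real n \<le> x" "x \<le> (real j + 1) / real n"
    let ?t = "h / real n * cweight n j" and ?y = "h * (1/2 - x)"
    have ty: "\<bar>?t\<bar> \<le> h / 2" by (rule cweight_tilt_bound[OF j h(1)])
    have "\<bar>1/2 - x\<bar> \<le> 1/2" using cell_subset[OF j x] by (auto simp: abs_if)
    then have "\<bar>?y\<bar> \<le> h * (1/2)" unfolding abs_mult using h by (intro mult_mono) auto
    then have yy: "\<bar>?y\<bar> \<le> h / 2" by simp
    have "\<bar>?y - ?t\<bar> = h * \<bar>x - (real j + 1/2) / real n\<bar>"
      unfolding cweight_cell[OF j] using h by (simp add: abs_mult)
    also have "\<dots> \<le> h * (1 / (2 * real n))" using cell_dist[OF j x] h by (intro mult_left_mono) auto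
    finally have "\<bar>?y - ?t\<bar>\<^sup>2 \<le> (h / (2 * real n))\<^sup>2" by (intro power_mono) auto
    then have "lam2 (h / 2) * (?y - ?t)\<^sup>2 \<le> e" unfolding e_def using l2 by (intro mult_left_mono) auto
    moreover have "lam ?y \<le> lam ?t + lam1 ?t * (?y - ?t) + lam2 (h / 2) * (?y - ?t)\<^sup>2"
      using h by (intro lam_quadratic_upper ty yy) auto
    ultimately have "lam ?y \<le> lam ?t + lam1 ?t * (?y - ?t) + e" by linarith
    moreover have eq: "l * (- h * w) = - ((h * l) * w)" for l w :: real by simp
    ultimately show "- lam ?t - e + (h * lam1 ?t) * (x - (real j + 1/2) / real n) \<le> - lam ?y"
      unfolding cweight_cell[OF j] eq by linarith
  qed
  then have "real n * G0 h \<le> (\<Sum>j<n. lam (h / real n * cweight n j)) + real n * e"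
    unfolding G0_def by (simp add: sum_subtractf sum_negf)
  moreover have "real n * e \<le> lam2 (h / 2) * h\<^sup>2 / real n"
  proof -
    have "real n * e = lam2 (h / 2) * h\<^sup>2 / real n / 4"
      unfolding e_def using n by (simp add: power2_eq_square field_simps)
    moreover have "0 \<le> lam2 (h / 2) * h\<^sup>2 / real n" using l2 by simp
    moreover have "a = b / 4 \<Longrightarrow> 0 \<le> b \<Longrightarrow> a \<le> b" for a b :: real by simp
    ultimately show ?thesis by blast
  qed
  ultimately show ?thesis by linarith
qed

text \<open>The left-hand sum is the mean of the centred area under the tilt.\<close>

lemma mean_riemann:
  assumes n: "1 \<le> n" and h: "0 \<le> h" "h < \<beta>"
  shows "\<bar>(\<Sum>j<n. cweight n j * lam1 (h / real n * cweight n j)) - (real n)\<^sup>2 * G1 h\<bar> \<le> real n * (lam1 (h / 2) + h * lam2 (h / 2))"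
proof -
  have hb: "\<bar>h\<bar> < \<beta>" using h by simp
  let ?F = "\<lambda>x. (1/2 - x) * lam1 (h * (1/2 - x))"
  define K where "K = lam1 (h / 2) + h * lam2 (h / 2)"
  have l2: "0 \<le> lam2 (h / 2)" using lam2_pos[of "h/2"] h by simp
  have l1: "0 \<le> lam1 (h / 2)" using lam1_mono[of 0 "h/2"] h \<beta>_pos by simp
  have int: "?F integrable_on {0..1}"
    by (intro integrable_continuous_real continuous_intros arg_bound[OF hb])
  have close: "\<bar>?F x - cweight n j * lam1 (h / real n * cweight n j) / real n\<bar> \<le> K / real n"
    if j: "j < n" and x: "real j / real n \<le> x" "x \<le> (real j + 1) / real n" for j x
  proof -
    define t y where "t = cweight n j / real n" and "y = 1/2 - x"
    have yh: "\<bar>y\<bar> \<le> 1/2" using cell_subset[OF j x] by (auto simp: y_def abs_if)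
    have th: "\<bar>t\<bar> \<le> 1/2" using cweight_bound[OF j] j by (simp add: t_def field_simps)
    have "y - t = - (x - (real j + 1/2) / real n)" using j by (simp add: y_def t_def cweight_def field_simps)
    then have yt: "\<bar>y - t\<bar> \<le> 1 / (2 * real n)" using cell_dist[OF j x] by simp
    have hy: "\<bar>h * y\<bar> \<le> h / 2" "\<bar>h * t\<bar> \<le> h / 2"
      unfolding abs_mult using mult_left_mono[OF yh, of h] mult_left_mono[OF th, of h] h by auto
    have "\<bar>y * lam1 (h * y) - t * lam1 (h * t)\<bar> = \<bar>(y - t) * lam1 (h * y) + t * (lam1 (h * y) - lam1 (h * t))\<bar>"
      by (simp add: algebra_simps)
    also have "\<dots> \<le> \<bar>y - t\<bar> * \<bar>lam1 (h * y)\<bar> + \<bar>t\<bar> * \<bar>lam1 (h * y) - lam1 (h * t)\<bar>"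
      by (metis abs_mult abs_triangle_ineq)
    also have "\<dots> \<le> (1 / (2 * real n)) * lam1 (h / 2) + 1/2 * (lam2 (h / 2) * \<bar>h * y - h * t\<bar>)"
      using h l2 l1 by (intro add_mono mult_mono yt th abs_lam1_le hy lam1_lipschitz) auto
    also have "\<bar>h * y - h * t\<bar> = h * \<bar>y - t\<bar>" using h by (simp add: abs_mult flip: right_diff_distrib)
    also have "(1 / (2 * real n)) * lam1 (h / 2) + 1/2 * (lam2 (h / 2) * (h * \<bar>y - t\<bar>))
       \<le> (1 / (2 * real n)) * lam1 (h / 2) + 1/2 * (lam2 (h / 2) * (h * (1 / (2 * real n))))"
      using h l2 by (intro add_mono mult_left_mono yt order_refl) auto
    also have "\<dots> \<le> K / real n"
      using h l2 l1 j by (simp add: K_def field_simps)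
    finally show ?thesis unfolding y_def t_def by (simp add: mult.commute)
  qed
  have "(\<Sum>j<n. cweight n j * lam1 (h / real n * cweight n j) / real n - K / real n) \<le> real n * integral {0..1} ?F"
  proof (rule midpoint_sum_le_integral[OF n int, of _ "\<lambda>_. 0"])
    fix j x assume "j < n" "real j / real n \<le> x" "x \<le> (real j + 1) / real n"
    from close[OF this] show "cweight n j * lam1 (h / real n * cweight n j) / real n - K / real n + 0 * (x - (real j + 1/2) / real n) \<le> ?F x"
      by (simp add: abs_le_iff)
  qed
  then have 1: "(\<Sum>j<n. cweight n j * lam1 (h / real n * cweight n j)) / real n - K \<le> real n * G1 h"
    unfolding G1_def using n by (simp add: sum_subtractf sum_divide_distrib)
  have "(\<Sum>j<n. - (cweight n j * lam1 (h / real n * cweight n j) / real n) - K / real n) \<le> real n * integral {0..1} (\<lambda>x. - ?F x)"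
  proof (rule midpoint_sum_le_integral[OF n integrable_neg[OF int], of _ "\<lambda>_. 0"])
    fix j x assume "j < n" "real j / real n \<le> x" "x \<le> (real j + 1) / real n"
    from close[OF this] show "- (cweight n j * lam1 (h / real n * cweight n j) / real n) - K / real n + 0 * (x - (real j + 1/2) / real n) \<le> - ?F x"
      by (simp add: abs_le_iff)
  qed
  then have 2: "real n * G1 h \<le> (\<Sum>j<n. cweight n j * lam1 (h / real n * cweight n j)) / real n + K"
    unfolding G1_def using n by (simp add: sum_subtractf sum_negf sum_divide_distrib)
  define S where "S = (\<Sum>j<n. cweight n j * lam1 (h / real n * cweight n j))"
  have "\<bar>S / real n - real n * G1 h\<bar> \<le> K" using 1 2 by (simp add: S_def abs_le_iff)
  then have "real n * \<bar>S / real n - real n * G1 h\<bar> \<le> real n * K" by (intro mult_left_mono) auto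
  moreover have "real n * \<bar>S / real n - real n * G1 h\<bar> = \<bar>real n * (S / real n - real n * G1 h)\<bar>"
    by (simp add: abs_mult)
  moreover have "real n * (S / real n - real n * G1 h) = S - (real n)\<^sup>2 * G1 h"
    using n by (simp add: right_diff_distrib power2_eq_square)
  ultimately show ?thesis by (simp add: S_def K_def)
qed

lemma step_mgf:
  assumes "\<bar>t\<bar> < \<beta> / 2"
  shows "integrable (step_law \<beta>) (\<lambda>k. exp (t * real_of_int k))"
    "measure_pmf.expectation (step_law \<beta>) (\<lambda>k. exp (t * real_of_int k)) = exp (lam t)"
  using expectation_has_sum[OF has_sum_lam(1)[OF assms]] by auto

lemma walk_Suc_measure:
  "emeasure (walk (Suc k)) {u. V u (Suc k) = y \<and> area u (Suc k) = A} =
    (\<integral>\<^sup>+u. emeasure (walk k) {w. V w k = y - u \<and> area w k = A - \<bar>y\<bar>} \<partial>step_law \<beta>)"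
proof -
  have "walk (Suc k) = step_law \<beta> \<bind> (\<lambda>y. walk k \<bind> (\<lambda>f. return_pmf (f(k := y))))"
    unfolding walk_def lessThan_Suc by (rule Pi_pmf_insert') auto
  then have w: "walk (Suc k) = step_law \<beta> \<bind> (\<lambda>y. map_pmf (\<lambda>f. f(k := y)) (walk k))"
    by (simp add: map_pmf_def)
  show ?thesis unfolding w emeasure_bind_pmf
  proof (rule nn_integral_cong)
    fix u
    have "(\<lambda>f. f(k := u)) -` {u. V u (Suc k) = y \<and> area u (Suc k) = A} = {w. V w k = y - u \<and> area w k = A - \<bar>y\<bar>}"
    proof -
      have "V (f(k := u)) i = V f i" if "i \<le> k" for f i using that by (intro V_cong) auto
      moreover have "area (f(k := u)) k = area f k" for f by (intro area_cong) auto
      ultimately have "V (f(k := u)) (Suc k) = V f k + u" "area (f(k := u)) (Suc k) = area f k + \<bar>V f k + u\<bar>" for f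
        by (simp_all add: V_Suc area_def)
      then show ?thesis by auto
    qed
    then show "emeasure (map_pmf (\<lambda>f. f(k := u)) (walk k)) {u. V u (Suc k) = y \<and> area u (Suc k) = A} =
       emeasure (walk k) {w. V w k = y - u \<and> area w k = A - \<bar>y\<bar>}"
      by simp
  qed
qed

text \<open>A supersolution for the walk with weight \<open>exp (s |V|)\<close> per site, where
  \<open>\<tau>\<close> is the remaining tilt. As long as \<open>\<tau> \<ge> 0\<close> the weight of a path at
  height \<open>x\<close> is controlled by \<open>e\<^bsup>-\<tau>|x|\<^esup>\<close>; the triangle inequality
  suffices. In the second half of the walk the tilt is negative and the profile has to grow. The sum of both
  exponentials has an explicit expectation, and the factor \<open>2|\<tau>|/s\<close>, twice the number of steps
  past the middle, telescopes the quotient which each step loses by \<open>cosh_step\<close>.\<close>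

definition end_profile :: "real \<Rightarrow> real \<Rightarrow> int \<Rightarrow> real" where
  "end_profile s \<tau> x = (if 0 \<le> \<tau> then exp (- \<tau> * \<bar>real_of_int x\<bar>)
     else 2 * \<bar>\<tau>\<bar> / s * (exp (\<bar>\<tau>\<bar> * real_of_int x) + exp (- \<bar>\<tau>\<bar> * real_of_int x)))"

lemma cosh_step:
  fixes s \<sigma> z :: real
  assumes "0 < s" "0 < \<sigma>" "0 \<le> z"
  shows "exp (s * z) * (exp (\<sigma> * z) + exp (- \<sigma> * z)) \<le> (\<sigma> + s) / \<sigma> * (exp ((\<sigma> + s) * z) + exp (- (\<sigma> + s) * z))"
proof -
  have a: "2 * \<sigma> * z \<le> exp (2 * \<sigma> * z)" using exp_ge_add_one_self[of "2 * \<sigma> * z"] by linarith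
  have b: "1 - exp (- 2 * s * z) \<le> 2 * s * z" using exp_ge_add_one_self[of "- 2 * s * z"] by linarith
  have "exp ((s - \<sigma>) * z) * (1 - exp (- 2 * s * z)) \<le> exp ((s - \<sigma>) * z) * (2 * s * z)"
    using b by (intro mult_left_mono) auto
  also have "\<dots> = s / \<sigma> * (exp ((s - \<sigma>) * z) * (2 * \<sigma> * z))" using assms by (simp add: field_simps)
  also have "\<dots> \<le> s / \<sigma> * (exp ((s - \<sigma>) * z) * exp (2 * \<sigma> * z))"
    using a assms by (intro mult_left_mono) auto
  also have "exp ((s - \<sigma>) * z) * exp (2 * \<sigma> * z) = exp ((\<sigma> + s) * z)"
    by (simp add: algebra_simps flip: exp_add)
  finally have 1: "exp ((s - \<sigma>) * z) * (1 - exp (- 2 * s * z)) \<le> s / \<sigma> * exp ((\<sigma> + s) * z)" .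
  have 2: "exp ((s - \<sigma>) * z) * (1 - exp (- 2 * s * z)) = exp ((s - \<sigma>) * z) - exp (- (\<sigma> + s) * z)"
    by (simp add: algebra_simps flip: exp_add)
  have 3: "exp (s * z) * (exp (\<sigma> * z) + exp (- \<sigma> * z)) = exp ((\<sigma> + s) * z) + exp ((s - \<sigma>) * z)"
    by (simp add: algebra_simps flip: exp_add)
  have 4: "0 \<le> s / \<sigma> * exp (- (\<sigma> + s) * z)" using assms by simp
  have 5: "(\<sigma> + s) / \<sigma> = 1 + s / \<sigma>" using assms by (simp add: field_simps)
  show ?thesis unfolding 3 5 using 1 2 4 by (simp add: distrib_left distrib_right)
qed

text \<open>One step of the walk reproduces the profile with the tilt lowered by \<open>s\<close>. The
  assumption that \<open>\<tau>\<close> is an integer multiple of \<open>s/2\<close> fixes what happens when the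
  tilt changes sign: the value before is 0 or \<open>s/2\<close>.\<close>

lemma end_profile_step:
  assumes s: "0 < s" and \<tau>: "\<bar>\<tau>\<bar> < \<beta> / 2" and half: "\<tau> = s * real_of_int m / 2"
  shows "integrable (step_law \<beta>) (\<lambda>u. end_profile s \<tau> (y - u))"
    and "exp (s * \<bar>real_of_int y\<bar>) * measure_pmf.expectation (step_law \<beta>) (\<lambda>u. end_profile s \<tau> (y - u)) \<le> exp (lam \<tau>) * end_profile s (\<tau> - s) y"
proof -
  let ?z = "\<bar>real_of_int y\<bar>"
  have \<tau>': "\<bar>- \<tau>\<bar> < \<beta> / 2" "\<bar>\<bar>\<tau>\<bar>\<bar> < \<beta> / 2" "\<bar>- \<bar>\<tau>\<bar>\<bar> < \<beta> / 2" using \<tau> by auto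
  show int: "integrable (step_law \<beta>) (\<lambda>u. end_profile s \<tau> (y - u))"
  proof (cases "0 \<le> \<tau>")
    case True
    show ?thesis
      by (rule measure_pmf.integrable_const_bound[of _ 1]) (use True in \<open>auto simp: end_profile_def\<close>)
  next
    case False
    have "(\<lambda>u. end_profile s \<tau> (y - u)) = (\<lambda>u. 2 * \<bar>\<tau>\<bar> / s * (exp (\<bar>\<tau>\<bar> * real_of_int y) * exp (- \<bar>\<tau>\<bar> * real_of_int u) + exp (- \<bar>\<tau>\<bar> * real_of_int y) * exp (\<bar>\<tau>\<bar> * real_of_int u)))"
      using False by (auto simp: end_profile_def algebra_simps simp flip: exp_add)
    then show ?thesis using step_mgf(1)[OF \<tau>'(2)] step_mgf(1)[OF \<tau>'(3)] by simp
  qed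
  show "exp (s * ?z) * measure_pmf.expectation (step_law \<beta>) (\<lambda>u. end_profile s \<tau> (y - u)) \<le> exp (lam \<tau>) * end_profile s (\<tau> - s) y"
  proof (cases "0 \<le> \<tau>")
    case True
    define e :: real where "e = (if 0 \<le> y then 1 else - 1)"
    have e: "\<bar>e * \<tau>\<bar> < \<beta> / 2" "lam (e * \<tau>) = lam \<tau>" using \<tau> by (auto simp: e_def)
    have "measure_pmf.expectation (step_law \<beta>) (\<lambda>u. end_profile s \<tau> (y - u)) \<le>
       measure_pmf.expectation (step_law \<beta>) (\<lambda>u. exp (- \<tau> * ?z) * exp (e * \<tau> * real_of_int u))"
    proof (intro integral_mono int integrable_mult_right step_mgf(1) e)
      fix u :: int
      have "?z - e * real_of_int u \<le> \<bar>real_of_int (y - u)\<bar>" by (auto simp: e_def abs_if)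
      then have "\<tau> * (?z - e * real_of_int u) \<le> \<tau> * \<bar>real_of_int (y - u)\<bar>" using True by (intro mult_left_mono) auto
      then have "- \<tau> * \<bar>real_of_int (y - u)\<bar> \<le> - \<tau> * ?z + e * \<tau> * real_of_int u" by (simp add: algebra_simps)
      then have "exp (- \<tau> * \<bar>real_of_int (y - u)\<bar>) \<le> exp (- \<tau> * ?z + e * \<tau> * real_of_int u)"
        by (simp only: exp_le_cancel_iff)
      then show "end_profile s \<tau> (y - u) \<le> exp (- \<tau> * ?z) * exp (e * \<tau> * real_of_int u)"
        using True unfolding end_profile_def exp_add by simp
    qed
    also have "\<dots> = exp (- \<tau> * ?z) * exp (lam \<tau>)"
      using step_mgf(2)[OF e(1)] by (simp add: e)
    finally have "exp (s * ?z) * measure_pmf.expectation (step_law \<beta>) (\<lambda>u. end_profile s \<tau> (y - u)) \<le> exp (s * ?z) * (exp (- \<tau> * ?z) * exp (lam \<tau>))"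
      by (intro mult_left_mono) auto
    also have "\<dots> = exp (lam \<tau>) * exp ((s - \<tau>) * ?z)" by (simp add: algebra_simps flip: exp_add)
    also have "exp ((s - \<tau>) * ?z) \<le> end_profile s (\<tau> - s) y"
    proof (cases "0 \<le> \<tau> - s")
      case True
      then show ?thesis by (simp add: end_profile_def algebra_simps)
    next
      case False
      have "0 \<le> m" using True half s by (simp add: zero_le_mult_iff)
      moreover have "s * real_of_int m < s * 2" using False half by simp
      then have "m < 2" using s by simp
      ultimately have "real_of_int m \<le> 1" by simp
      then have "s * real_of_int m \<le> s * 1" using s by (intro mult_left_mono) auto
      then have "2 * \<tau> \<le> s" using half by simp
      moreover have "\<bar>\<tau> - s\<bar> = s - \<tau>" using False by simp
      ultimately have "1 \<le> 2 * \<bar>\<tau> - s\<bar> / s" using s by (simp add: field_simps)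
      moreover have "exp (t * ?z) \<le> exp (t * real_of_int y) + exp (- t * real_of_int y)" for t
        by (cases "0 \<le> y") auto
      note this[of "s - \<tau>"]
      then have "exp ((s - \<tau>) * ?z) \<le> exp (\<bar>\<tau> - s\<bar> * real_of_int y) + exp (- \<bar>\<tau> - s\<bar> * real_of_int y)"
        unfolding \<open>\<bar>\<tau> - s\<bar> = s - \<tau>\<close> .
      ultimately have "1 * exp ((s - \<tau>) * ?z) \<le> 2 * \<bar>\<tau> - s\<bar> / s * (exp (\<bar>\<tau> - s\<bar> * real_of_int y) + exp (- \<bar>\<tau> - s\<bar> * real_of_int y))"
        by (intro mult_mono) auto
      then show ?thesis using False by (simp add: end_profile_def)
    qed
    finally show ?thesis by simp
  next
    case False
    define \<sigma> where "\<sigma> = - \<tau>"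
    have \<sigma>: "0 < \<sigma>" "\<bar>\<tau>\<bar> = \<sigma>" "\<bar>\<tau> - s\<bar> = \<sigma> + s" "\<tau> - s < 0" "\<bar>\<sigma>\<bar> < \<beta> / 2" "\<bar>- \<sigma>\<bar> < \<beta> / 2" "lam \<tau> = lam \<sigma>"
      using False s \<tau> by (auto simp: \<sigma>_def)
    have "(\<lambda>u. end_profile s \<tau> (y - u)) = (\<lambda>u. 2 * \<sigma> / s * (exp (\<sigma> * real_of_int y) * exp (- \<sigma> * real_of_int u) + exp (- \<sigma> * real_of_int y) * exp (\<sigma> * real_of_int u)))"
      using False \<sigma> by (auto simp: end_profile_def algebra_simps simp flip: exp_add)
    then have E: "measure_pmf.expectation (step_law \<beta>) (\<lambda>u. end_profile s \<tau> (y - u)) =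
       2 * \<sigma> / s * (exp (\<sigma> * real_of_int y) + exp (- \<sigma> * real_of_int y)) * exp (lam \<sigma>)"
      using step_mgf[OF \<sigma>(5)] step_mgf[OF \<sigma>(6)] by (simp add: algebra_simps)
    have sym: "exp (t * real_of_int y) + exp (- t * real_of_int y) = exp (t * ?z) + exp (- t * ?z)" for t
      by (cases "0 \<le> y") auto
    have "exp (s * ?z) * measure_pmf.expectation (step_law \<beta>) (\<lambda>u. end_profile s \<tau> (y - u)) =
       2 * \<sigma> / s * exp (lam \<sigma>) * (exp (s * ?z) * (exp (\<sigma> * ?z) + exp (- \<sigma> * ?z)))"
      unfolding E sym by (simp add: algebra_simps)
    also have "\<dots> \<le> 2 * \<sigma> / s * exp (lam \<sigma>) * ((\<sigma> + s) / \<sigma> * (exp ((\<sigma> + s) * ?z) + exp (- (\<sigma> + s) * ?z)))"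
      using s \<sigma> by (intro mult_left_mono cosh_step) auto
    also have "\<dots> = exp (lam \<tau>) * end_profile s (\<tau> - s) y"
    proof -
      have "end_profile s (\<tau> - s) y = 2 * (\<sigma> + s) / s * (exp ((\<sigma> + s) * ?z) + exp (- (\<sigma> + s) * ?z))"
        using \<sigma>(4) unfolding end_profile_def sym[symmetric] \<sigma>(3) by (intro if_not_P) (simp only: not_le)
      then show ?thesis using \<sigma> by simp
    qed
    finally show ?thesis .
  qed
qed

lemma end_profile_nonneg: "0 < s \<Longrightarrow> 0 \<le> end_profile s \<tau> x"
proof (cases "0 \<le> \<tau>")
  case False
  assume "0 < s"
  then have "0 \<le> 2 * \<bar>\<tau>\<bar> / s * (exp (\<bar>\<tau>\<bar> * real_of_int x) + exp (- \<bar>\<tau>\<bar> * real_of_int x))"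
    by (intro mult_nonneg_nonneg divide_nonneg_pos add_nonneg_nonneg) auto
  then show ?thesis unfolding end_profile_def using False by (simp only: if_False)
qed (simp add: end_profile_def)

text \<open>Induction on the number of steps, with the profile as the dependence on the end point. The
  exponent \<open>\<Sum> lam (s d\<^sub>j)\<close> is the one for signed areas; having absolute areas on the
  left costs only the profile.\<close>

lemma chernoff_endpoint:
  assumes n: "1 \<le> n" and s: "0 < s" "s * real n < \<beta>" and k: "k \<le> n"
  shows "measure (walk k) {u. V u k = x \<and> area u k = A} \<le>
    exp (- s * real_of_int A) * exp (\<Sum>j<k. lam (s * cweight n j)) * end_profile s (s * cweight n k) x"
  using k
proof (induction k arbitrary: x A)
  case 0
  have "0 \<le> s * cweight n 0" using n s by (simp add: cweight_def)
  show ?case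
  proof (cases "x = 0 \<and> A = 0")
    case True
    then show ?thesis using \<open>0 \<le> s * cweight n 0\<close> by (simp add: end_profile_def)
  next
    case False
    then have "{u. V u 0 = x \<and> area u 0 = A} = {}" by (auto simp: area_def)
    then have "measure (walk 0) {u. V u 0 = x \<and> area u 0 = A} = 0" by (simp only: measure_empty)
    moreover have "0 \<le> exp (- s * real_of_int A) * exp (\<Sum>j<0. lam (s * cweight n j)) * end_profile s (s * cweight n 0) x"
      using end_profile_nonneg[OF s(1)] by simp
    ultimately show ?thesis by linarith
  qed
next
  case (Suc k)
  let ?t = "s * cweight n k"
  have t: "\<bar>?t\<bar> < \<beta> / 2"
  proof -
    have "\<bar>?t\<bar> \<le> s * (real n / 2)" unfolding abs_mult using cweight_bound[of k n] Suc.prems s by (intro mult_mono) auto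
    then show ?thesis using s by simp
  qed
  have half: "?t = s * real_of_int (int n - 1 - 2 * int k) / 2" by (simp add: cweight_def field_simps)
  have ts: "?t - s = s * cweight n (Suc k)" by (simp add: cweight_def algebra_simps)
  define P where "P = exp (\<Sum>j<k. lam (s * cweight n j))"
  define a where "a = exp (- s * real_of_int A) * exp (s * \<bar>real_of_int x\<bar>) * P"
  have "ennreal (measure (walk (Suc k)) {u. V u (Suc k) = x \<and> area u (Suc k) = A}) =
     (\<integral>\<^sup>+u. emeasure (walk k) {w. V w k = x - u \<and> area w k = A - \<bar>x\<bar>} \<partial>step_law \<beta>)"
    using walk_Suc_measure[of k x A] by (simp add: measure_pmf.emeasure_eq_measure)
  also have "\<dots> \<le> (\<integral>\<^sup>+u. ennreal (a * end_profile s ?t (x - u)) \<partial>step_law \<beta>)"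
  proof (rule nn_integral_mono)
    fix u
    have "measure (walk k) {w. V w k = x - u \<and> area w k = A - \<bar>x\<bar>} \<le> exp (- s * real_of_int (A - \<bar>x\<bar>)) * P * end_profile s ?t (x - u)"
      using Suc.IH[of "x - u" "A - \<bar>x\<bar>"] Suc.prems unfolding P_def by simp
    also have "exp (- s * real_of_int (A - \<bar>x\<bar>)) = exp (- s * real_of_int A) * exp (s * \<bar>real_of_int x\<bar>)"
      by (simp add: algebra_simps flip: exp_add)
    finally show "emeasure (walk k) {w. V w k = x - u \<and> area w k = A - \<bar>x\<bar>} \<le> ennreal (a * end_profile s ?t (x - u))"
      unfolding measure_pmf.emeasure_eq_measure a_def by (intro ennreal_leI)
  qed
  also have "\<dots> = ennreal (measure_pmf.expectation (step_law \<beta>) (\<lambda>u. a * end_profile s ?t (x - u)))"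
    by (intro nn_integral_eq_integral integrable_mult_right end_profile_step(1)[OF s(1) t half])
      (auto simp: a_def P_def end_profile_nonneg[OF s(1)])
  finally have "measure (walk (Suc k)) {u. V u (Suc k) = x \<and> area u (Suc k) = A} \<le> a * measure_pmf.expectation (step_law \<beta>) (\<lambda>u. end_profile s ?t (x - u))"
    by (subst (asm) ennreal_le_iff) (auto simp: a_def P_def end_profile_nonneg[OF s(1)] intro!: integral_nonneg_AE)
  also have "\<dots> = exp (- s * real_of_int A) * P * (exp (s * \<bar>real_of_int x\<bar>) * measure_pmf.expectation (step_law \<beta>) (\<lambda>u. end_profile s ?t (x - u)))"
    by (simp add: a_def)
  also have "\<dots> \<le> exp (- s * real_of_int A) * P * (exp (lam ?t) * end_profile s (?t - s) x)"
    by (intro mult_left_mono end_profile_step(2)[OF s(1) t half]) (auto simp: P_def)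
  also have "\<dots> = exp (- s * real_of_int A) * exp (\<Sum>j<Suc k. lam (s * cweight n j)) * end_profile s (s * cweight n (Suc k)) x"
    unfolding ts P_def by (simp add: exp_add)
  finally show ?case .
qed

lemma chernoff_bridge:
  assumes n: "1 \<le> n" and h: "0 < h" "h < \<beta>"
  shows "measure (walk n) (bridge n A) \<le> 2 * (real n + 1) * exp (- h / real n * real_of_int A + real n * G0 h)"
proof -
  define s where "s = h / real n"
  have s: "0 < s" "s * real n < \<beta>" using n h by (auto simp: s_def)
  have d: "cweight n n = - (real n + 1) / 2" by (simp add: cweight_def field_simps)
  have neg: "s * cweight n n < 0" unfolding d using s by (simp add: mult_pos_neg)
  have "\<bar>s * cweight n n\<bar> = s * ((real n + 1) / 2)" unfolding d abs_mult using s by simp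
  then have g: "end_profile s (s * cweight n n) 0 = 2 * (real n + 1)"
    using neg s unfolding end_profile_def by (simp add: field_simps)
  have "measure (walk n) (bridge n A) \<le> exp (- s * real_of_int A) * exp (\<Sum>j<n. lam (s * cweight n j)) * (2 * (real n + 1))"
    using chernoff_endpoint[OF n s order_refl, of 0 A] unfolding bridge_def g .
  also have "\<dots> \<le> exp (- s * real_of_int A) * exp (real n * G0 h) * (2 * (real n + 1))"
    using sum_lam_le[OF n, of h] h unfolding s_def by (intro mult_right_mono mult_left_mono) auto
  also have "- s = - h / real n" by (simp add: s_def)
  finally show ?thesis unfolding exp_add by (simp only: mult_ac)
qed

end

section \<open>Fourier inversion, trigonometric sums and Riemann sums\<close>

lemma product_integral_lborel:
  fixes f g :: "real \<Rightarrow> 'b::{real_normed_field, banach, second_countable_topology}"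
  assumes f: "integrable lborel f" and g: "integrable lborel g"
  shows "integrable (lborel \<Otimes>\<^sub>M lborel) (\<lambda>p. f (fst p) * g (snd p))"
    and "(\<integral>p. f (fst p) * g (snd p) \<partial>(lborel \<Otimes>\<^sub>M lborel)) = (\<integral>x. f x \<partial>lborel) * (\<integral>x. g x \<partial>lborel)"
proof -
  have [measurable]: "f \<in> borel_measurable borel" "g \<in> borel_measurable borel" using f g by auto
  show int: "integrable (lborel \<Otimes>\<^sub>M lborel) (\<lambda>p. f (fst p) * g (snd p))"
  proof (rule lborel_pair.Fubini_integrable)
    show "(\<lambda>p. f (fst p) * g (snd p)) \<in> borel_measurable (lborel \<Otimes>\<^sub>M lborel)" by measurable
    show "integrable lborel (\<lambda>x. \<integral>y. norm (f (fst (x, y)) * g (snd (x, y))) \<partial>lborel)"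
      using f by (simp add: norm_mult)
    show "AE x in lborel. integrable lborel (\<lambda>y. f (fst (x, y)) * g (snd (x, y)))"
      using g by simp
  qed
  have "(\<integral>x. (\<integral>y. f x * g y \<partial>lborel) \<partial>lborel) = (\<integral>p. f (fst p) * g (snd p) \<partial>(lborel \<Otimes>\<^sub>M lborel))"
    using lborel_pair.integral_fst'[OF int] by simp
  then show "(\<integral>p. f (fst p) * g (snd p) \<partial>(lborel \<Otimes>\<^sub>M lborel)) = (\<integral>x. f x \<partial>lborel) * (\<integral>x. g x \<partial>lborel)"
    by simp
qed

lemma integral_cis_period:
  fixes k :: int
  assumes a: "0 < \<alpha>"
  shows "integrable lborel (\<lambda>x. indicator {-(pi * \<alpha>)..pi * \<alpha>} x *\<^sub>R cis (x / \<alpha> * real_of_int k))"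
    and "(\<integral>x. indicator {-(pi * \<alpha>)..pi * \<alpha>} x *\<^sub>R cis (x / \<alpha> * real_of_int k) \<partial>lborel) =
      (if k = 0 then complex_of_real (2 * pi * \<alpha>) else 0)"
proof -
  define F where "F x = (if k = 0 then complex_of_real x else - \<i> * complex_of_real (\<alpha> / real_of_int k) * cis (x / \<alpha> * real_of_int k))" for x
  have le: "-(pi * \<alpha>) \<le> pi * \<alpha>" using a by simp
  have D: "(F has_vector_derivative cis (x / \<alpha> * real_of_int k)) (at x within S)" for x S
  proof (cases "k = 0")
    case True
    then show ?thesis unfolding F_def by (auto intro!: derivative_eq_intros)
  next
    case False
    have "((\<lambda>x. cis (x / \<alpha> * real_of_int k)) has_vector_derivative
        (real_of_int k / \<alpha>) *\<^sub>R (\<i> * cis (x / \<alpha> * real_of_int k))) (at x within S)"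
    proof -
      have 1: "((\<lambda>x. x / \<alpha> * real_of_int k) has_real_derivative real_of_int k / \<alpha>) (at x within S)"
        using a by (auto intro!: derivative_eq_intros)
      have 2: "(cis has_vector_derivative \<i> * cis (x / \<alpha> * real_of_int k)) (at (x / \<alpha> * real_of_int k) within (\<lambda>x. x / \<alpha> * real_of_int k) ` S)"
        unfolding cis_conv_exp[abs_def]
        by (auto intro!: derivative_eq_intros has_vector_derivative_real_field)
      from vector_diff_chain_within[OF 1[unfolded has_real_derivative_iff_has_vector_derivative] 2]
      show ?thesis by (simp add: o_def)
    qed
    from has_vector_derivative_mult_right[OF this, of "- \<i> * complex_of_real (\<alpha> / real_of_int k)"]
    have "((\<lambda>x. - \<i> * complex_of_real (\<alpha> / real_of_int k) * cis (x / \<alpha> * real_of_int k)) has_vector_derivative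
        - \<i> * complex_of_real (\<alpha> / real_of_int k) * ((real_of_int k / \<alpha>) *\<^sub>R (\<i> * cis (x / \<alpha> * real_of_int k)))) (at x within S)" .
    moreover have "- \<i> * complex_of_real (\<alpha> / real_of_int k) * ((real_of_int k / \<alpha>) *\<^sub>R (\<i> * z)) = z" for z
      using False a by (simp add: scaleR_conv_of_real)
    ultimately show ?thesis unfolding F_def using False by simp
  qed
  have c: "continuous_on S (\<lambda>x. cis (x / \<alpha> * real_of_int k))" for S
    using a by (intro continuous_intros) auto
  have B: "has_bochner_integral lborel (\<lambda>x. indicator {-(pi * \<alpha>)..pi * \<alpha>} x *\<^sub>R cis (x / \<alpha> * real_of_int k)) (F (pi * \<alpha>) - F (-(pi * \<alpha>)))"
    by (rule has_bochner_integral_FTC_Icc[OF le D c])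
  have "F (pi * \<alpha>) - F (-(pi * \<alpha>)) = (if k = 0 then complex_of_real (2 * pi * \<alpha>) else 0)"
  proof (cases "k = 0")
    case False
    have "cis (pi * real_of_int k) = cis (- (pi * real_of_int k))"
      by (simp add: complex_eq_iff sin_times_pi_eq_0 mult.commute)
    then show ?thesis using False a by (simp add: F_def)
  qed (simp add: F_def)
  then show "integrable lborel (\<lambda>x. indicator {-(pi * \<alpha>)..pi * \<alpha>} x *\<^sub>R cis (x / \<alpha> * real_of_int k))"
    "(\<integral>x. indicator {-(pi * \<alpha>)..pi * \<alpha>} x *\<^sub>R cis (x / \<alpha> * real_of_int k) \<partial>lborel) =
      (if k = 0 then complex_of_real (2 * pi * \<alpha>) else 0)"
    using B by (auto simp: has_bochner_integral_iff)
qed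

abbreviation fbox :: "real \<Rightarrow> real \<Rightarrow> (real \<times> real) set" where
  "fbox \<alpha> \<gamma> \<equiv> {-(pi * \<alpha>)..pi * \<alpha>} \<times> {-(pi * \<gamma>)..pi * \<gamma>}"

text \<open>The two frequencies are rescaled by \<open>\<alpha>\<close> and \<open>\<gamma>\<close> so that
  the characteristic function can converge pointwise; the box of integration grows accordingly.\<close>

lemma fourier_inversion_pair:
  fixes M :: "'a pmf" and X Y :: "'a \<Rightarrow> int"
  assumes a: "0 < \<alpha>" and g: "0 < \<gamma>"
  shows "(\<integral>p. indicator (fbox \<alpha> \<gamma>) p *\<^sub>R (\<integral>u. cis (fst p / \<alpha> * real_of_int (X u - v) + snd p / \<gamma> * real_of_int (Y u - w)) \<partial>measure_pmf M) \<partial>(lborel \<Otimes>\<^sub>M lborel))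
    = complex_of_real (4 * pi\<^sup>2 * \<alpha> * \<gamma> * measure M {u. X u = v \<and> Y u = w})"
proof -
  let ?N = "lborel \<Otimes>\<^sub>M lborel :: (real \<times> real) measure"
  let ?c = "\<lambda>u p. cis (fst p / \<alpha> * real_of_int (X u - v) + snd p / \<gamma> * real_of_int (Y u - w))"
  have sf: "sigma_finite_measure ?N" by (rule sigma_finite_pair_measure) (rule sigma_finite_lborel)+
  interpret P: pair_sigma_finite "measure_pmf M" ?N
    by (intro pair_sigma_finite.intro sf measure_pmf.sigma_finite_measure_axioms)
  have emb: "emeasure ?N (fbox \<alpha> \<gamma>) < \<infinity>"
    by (subst lborel.emeasure_pair_measure_Times)
      (use a g in \<open>auto simp: ennreal_mult_less_top emeasure_lborel_Icc_eq\<close>)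
  have meas: "(\<lambda>(u, p). ?c u p) \<in> borel_measurable (measure_pmf M \<Otimes>\<^sub>M ?N)"
  proof -
    have [measurable]: "(\<lambda>u. real_of_int (X u - v)) \<in> borel_measurable (measure_pmf M)"
      "(\<lambda>u. real_of_int (Y u - w)) \<in> borel_measurable (measure_pmf M)" by simp_all
    have [measurable]: "cis \<in> borel_measurable borel"
      by (intro borel_measurable_continuous_onI continuous_intros)
    show ?thesis by measurable
  qed
  have "integrable (measure_pmf M \<Otimes>\<^sub>M ?N) (\<lambda>z. indicator (UNIV \<times> fbox \<alpha> \<gamma>) z *\<^sub>R (\<lambda>(u, p). ?c u p) z)"
  proof (rule integrableI_bounded_set_indicator[where B = 1])
    show "emeasure (measure_pmf M \<Otimes>\<^sub>M ?N) (UNIV \<times> fbox \<alpha> \<gamma>) < \<infinity>"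
      using emb by (subst sigma_finite_measure.emeasure_pair_measure_Times[OF sf]) (auto simp: ennreal_mult_less_top)
  qed (use meas in auto)
  then have int: "integrable (measure_pmf M \<Otimes>\<^sub>M ?N) (case_prod (\<lambda>u p. indicator (fbox \<alpha> \<gamma>) p *\<^sub>R ?c u p))"
    by (rule Bochner_Integration.integrable_cong[THEN iffD1, rotated -1]) (auto simp: indicator_def)
  have inner: "(\<integral>p. indicator (fbox \<alpha> \<gamma>) p *\<^sub>R ?c u p \<partial>?N) =
     complex_of_real (4 * pi\<^sup>2 * \<alpha> * \<gamma> * indicator {u. X u = v \<and> Y u = w} u)" for u
  proof -
    let ?f = "\<lambda>x. indicator {-(pi * \<alpha>)..pi * \<alpha>} x *\<^sub>R cis (x / \<alpha> * real_of_int (X u - v))"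
    let ?g = "\<lambda>x. indicator {-(pi * \<gamma>)..pi * \<gamma>} x *\<^sub>R cis (x / \<gamma> * real_of_int (Y u - w))"
    have "(\<integral>p. indicator (fbox \<alpha> \<gamma>) p *\<^sub>R ?c u p \<partial>?N) = (\<integral>p. ?f (fst p) * ?g (snd p) \<partial>?N)"
      by (intro Bochner_Integration.integral_cong refl) (auto simp: indicator_def cis_mult)
    also have "\<dots> = integral\<^sup>L lborel ?f * integral\<^sup>L lborel ?g"
      by (rule product_integral_lborel(2)[OF integral_cis_period(1)[OF a] integral_cis_period(1)[OF g]])
    also have "\<dots> = complex_of_real (4 * pi\<^sup>2 * \<alpha> * \<gamma> * indicator {u. X u = v \<and> Y u = w} u)"
      unfolding integral_cis_period(2)[OF a] integral_cis_period(2)[OF g]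
      by (simp add: indicator_def power2_eq_square)
    finally show ?thesis .
  qed
  have "(\<integral>p. (\<integral>u. indicator (fbox \<alpha> \<gamma>) p *\<^sub>R ?c u p \<partial>measure_pmf M) \<partial>?N) =
     (\<integral>u. (\<integral>p. indicator (fbox \<alpha> \<gamma>) p *\<^sub>R ?c u p \<partial>?N) \<partial>measure_pmf M)"
    by (rule P.Fubini_integral[OF int])
  also have "\<dots> = complex_of_real (4 * pi\<^sup>2 * \<alpha> * \<gamma> * measure M {u. X u = v \<and> Y u = w})"
    unfolding inner by (simp add: measure_pmf.integrable_const_bound[of _ 1])
  finally show ?thesis by simp
qed

lemma one_minus_cos_ge:
  fixes \<psi> :: real
  assumes "\<bar>\<psi>\<bar> \<le> 4"
  shows "\<psi>\<^sup>2 / 18 \<le> 1 - cos \<psi>"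
proof -
  define x where "x = \<bar>\<psi>\<bar> / 2"
  have x: "0 \<le> x" "x \<le> 2" using assms by (auto simp: x_def)
  have "\<bar>sin x - (\<Sum>m<3. sin_coeff m * x ^ m)\<bar> \<le> inverse (fact 3) * \<bar>x\<bar> ^ 3" by (rule Maclaurin_sin_bound)
  then have "\<bar>sin x - x\<bar> \<le> x ^ 3 / 6"
    using x by (simp add: eval_nat_numeral sin_coeff_def)
  then have "x - x ^ 3 / 6 \<le> sin x" using abs_le_D2[of "sin x - x" "x ^ 3 / 6"] by simp
  moreover have "x ^ 3 \<le> 4 * x"
  proof -
    have "x * x * x \<le> 2 * 2 * x" using x by (intro mult_mono) auto
    then show ?thesis by (simp add: power3_eq_cube)
  qed
  ultimately have "x / 3 \<le> sin x" by linarith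
  then have "(x / 3)\<^sup>2 \<le> (sin x)\<^sup>2" using x by (intro power_mono) auto
  moreover have "cos \<psi> = 1 - 2 * (sin x)\<^sup>2"
  proof -
    have "cos \<psi> = cos \<bar>\<psi>\<bar>" by simp
    also have "\<bar>\<psi>\<bar> = 2 * x" by (simp add: x_def)
    finally show ?thesis by (simp add: cos_double_sin)
  qed
  moreover have "(x / 3)\<^sup>2 = \<psi>\<^sup>2 / 36" by (simp add: x_def power_divide)
  ultimately show ?thesis by simp
qed

lemma sum_square_block:
  fixes x y :: real
  shows "(\<Sum>k\<in>{- int r..int r}. (x + real_of_int k * y)\<^sup>2) = (2 * real r + 1) * x\<^sup>2 + real r * (real r + 1) * (2 * real r + 1) / 3 * y\<^sup>2"
proof (induction r)
  case (Suc r)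
  have "{- int (Suc r)..int (Suc r)} = insert (- int (Suc r)) (insert (int (Suc r)) {- int r..int r})" by auto
  then have "(\<Sum>k\<in>{- int (Suc r)..int (Suc r)}. (x + real_of_int k * y)\<^sup>2) =
     (x - (real r + 1) * y)\<^sup>2 + ((x + (real r + 1) * y)\<^sup>2 + (\<Sum>k\<in>{- int r..int r}. (x + real_of_int k * y)\<^sup>2))"
    by (simp add: algebra_simps)
  then show ?case unfolding Suc by (simp add: power2_eq_square field_simps)
qed simp

text \<open>The local limit theorem needs decay of the characteristic function of the pair (sum, moment) in
  all of \<open>[-\<pi>, \<pi>]\<^sup>2\<close>. For \<open>r |t\<^sub>2| \<le> 1/2\<close> no angle leaves the
  range in which \<open>1 - cos\<close> is quadratic. For larger \<open>t\<^sub>2\<close> the angles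
  \<open>t\<^sub>1 + k t\<^sub>2\<close> rotate, so that a fixed proportion of them stays away from the
  multiples of \<open>2\<pi>\<close>.\<close>

lemma sum_one_minus_cos_block:
  assumes r: "1 \<le> r" and t1: "\<bar>t1\<bar> \<le> pi" and t2: "\<bar>t2\<bar> \<le> pi"
  shows "min (real r * t1\<^sup>2 + real r ^ 3 * t2\<^sup>2) (real r) / 1152 \<le> (\<Sum>k\<in>{- int r..int r}. 1 - cos (t1 + real_of_int k * t2))"
proof (cases "real r * \<bar>t2\<bar> \<le> 1/2")
  case True
  have "(\<Sum>k\<in>{- int r..int r}. (t1 + real_of_int k * t2)\<^sup>2 / 18) \<le> (\<Sum>k\<in>{- int r..int r}. 1 - cos (t1 + real_of_int k * t2))"
  proof (intro sum_mono one_minus_cos_ge)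
    fix k assume k: "k \<in> {- int r..int r}"
    have "\<bar>real_of_int k * t2\<bar> \<le> real r * \<bar>t2\<bar>" unfolding abs_mult using k by (intro mult_right_mono) auto
    then show "\<bar>t1 + real_of_int k * t2\<bar> \<le> 4" 
    proof -
      assume "\<bar>real_of_int k * t2\<bar> \<le> real r * \<bar>t2\<bar>"
      moreover have "pi < 7/2" using pi_approx by simp
      moreover have "\<bar>t1 + real_of_int k * t2\<bar> \<le> \<bar>t1\<bar> + \<bar>real_of_int k * t2\<bar>" by (rule abs_triangle_ineq)
      ultimately show ?thesis using True t1 by linarith
    qed
  qed
  moreover have "(\<Sum>k\<in>{- int r..int r}. (t1 + real_of_int k * t2)\<^sup>2 / 18) =
      ((2 * real r + 1) * t1\<^sup>2 + real r * (real r + 1) * (2 * real r + 1) / 3 * t2\<^sup>2) / 18"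
    unfolding sum_square_block[symmetric] sum_divide_distrib ..
  moreover have "real r * t1\<^sup>2 + real r ^ 3 * t2\<^sup>2 / 3 \<le> (2 * real r + 1) * t1\<^sup>2 + real r * (real r + 1) * (2 * real r + 1) / 3 * t2\<^sup>2"
  proof -
    have "real r ^ 3 \<le> real r * (real r + 1) * (2 * real r + 1)" by (simp add: power3_eq_cube algebra_simps)
    then have "real r ^ 3 * t2\<^sup>2 \<le> real r * (real r + 1) * (2 * real r + 1) * t2\<^sup>2" by (intro mult_right_mono) auto
    moreover have "real r * t1\<^sup>2 \<le> (2 * real r + 1) * t1\<^sup>2" by (intro mult_right_mono) auto
    ultimately show ?thesis by simp
  qed
  moreover have "0 \<le> real r * t1\<^sup>2" "0 \<le> real r ^ 3 * t2\<^sup>2" by auto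
  moreover have "min (A + B) R / 1152 \<le> T" if "S' \<le> T" "S' = S / 18" "A + B / 3 \<le> S" "0 \<le> A" "0 \<le> B" for A B R S S' T :: real
    using that by (simp add: min_def)
  ultimately show ?thesis by blast
next
  case False
  define f where "f j = 1 - cos (t1 + real_of_int j * t2)" for j :: int
  have f0: "0 \<le> f j" for j by (simp add: f_def)
  \<comment> \<open>Indices at distance \<open>K\<close> have angles that differ by \<open>K |t2|\<close> between \<open>1/4\<close> and \<open>\<pi>\<close>, so not both are close to a multiple of \<open>2\<pi>\<close>.\<close>
  obtain K :: nat where K: "1 \<le> K" "K \<le> r + 1" "1/4 \<le> real K * \<bar>t2\<bar>" "real K * \<bar>t2\<bar> \<le> pi"
  proof (cases "1/4 \<le> \<bar>t2\<bar>")
    case True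
    show ?thesis by (rule that[of 1]) (use True t2 r in auto)
  next
    case F: False
    have t0: "0 < \<bar>t2\<bar>" using False by (cases "t2 = 0") auto
    define K where "K = nat \<lceil>1 / (4 * \<bar>t2\<bar>)\<rceil>"
    have pos: "0 < 1 / (4 * \<bar>t2\<bar>)" using t0 by simp
    have K1: "1 / (4 * \<bar>t2\<bar>) \<le> real K" "real K < 1 / (4 * \<bar>t2\<bar>) + 1"
      using pos unfolding K_def by linarith+
    have m1: "1/4 \<le> real K * \<bar>t2\<bar>" using mult_right_mono[OF K1(1), of "\<bar>t2\<bar>"] t0 by simp
    have m2: "real K * \<bar>t2\<bar> < 1/4 + \<bar>t2\<bar>" using mult_strict_right_mono[OF K1(2) t0] t0 by (simp add: distrib_right)
    have "1 / (4 * \<bar>t2\<bar>) < real r / 2" using False t0 by (simp add: field_simps)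
    then have "real K < real r / 2 + 1" using K1 by linarith
    then have "K \<le> r + 1" by linarith
    moreover have "1 \<le> K" using K1(1) pos by linarith
    ultimately show ?thesis using that[of K] m1 m2 F pi_gt3 by linarith
  qed
  have pair: "1/576 \<le> f j + f (j + int K)" for j
  proof -
    define g where "g = real K * \<bar>t2\<bar> / 2"
    have g: "1/8 \<le> g" "g \<le> pi / 2" using K by (auto simp: g_def)
    have "cos (t1 + real_of_int j * t2) + cos (t1 + real_of_int (j + int K) * t2) =
       2 * cos (t1 + real_of_int j * t2 + real K * t2 / 2) * cos (real K * t2 / 2)"
      using cos_plus_cos[of "t1 + real_of_int j * t2" "t1 + real_of_int (j + int K) * t2"]
      by (simp add: field_simps)
    also have "cos (real K * t2 / 2) = cos g"
      by (cases "0 \<le> t2") (auto simp: g_def)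
    also have "2 * cos (t1 + real_of_int j * t2 + real K * t2 / 2) * cos g \<le> 2 * 1 * cos g"
      using g by (intro mult_right_mono mult_left_mono cos_ge_zero) auto
    finally have "cos (t1 + real_of_int j * t2) + cos (t1 + real_of_int (j + int K) * t2) \<le> 2 * cos g" by simp
    moreover have "cos g \<le> 1 - g\<^sup>2 / 18" using one_minus_cos_ge[of g] g pi_less_4 by auto
    moreover have "(1/8)\<^sup>2 / 18 \<le> g\<^sup>2 / 18" using g by (intro divide_right_mono power_mono) auto
    ultimately show ?thesis by (simp add: f_def power2_eq_square)
  qed
  have K': "int K \<le> int r + 1" using K by simp
  have "real r * (1/576) \<le> (\<Sum>j\<in>{- int r..int r - int K}. f j + f (j + int K))"
  proof -
    have "r \<le> card {- int r..int r - int K}" using K by auto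
    then have "real r * (1/576) \<le> real (card {- int r..int r - int K}) * (1/576)" by (intro mult_right_mono) auto
    also have "\<dots> \<le> (\<Sum>j\<in>{- int r..int r - int K}. f j + f (j + int K))"
      by (rule sum_bounded_below) (rule pair)
    finally show ?thesis .
  qed
  also have "\<dots> = (\<Sum>j\<in>{- int r..int r - int K}. f j) + (\<Sum>j\<in>{- int r + int K..int r}. f j)"
  proof -
    have "(\<Sum>j\<in>{- int r..int r - int K}. f (j + int K)) = (\<Sum>j\<in>{- int r + int K..int r}. f j)"
      by (rule sum.reindex_bij_witness[of _ "\<lambda>j. j - int K" "\<lambda>j. j + int K"]) auto
    then show ?thesis by (simp add: sum.distrib)
  qed
  also have "\<dots> \<le> (\<Sum>j\<in>{- int r..int r}. f j) + (\<Sum>j\<in>{- int r..int r}. f j)"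
    by (intro add_mono sum_mono2 f0) auto
  finally have "real r / 1152 \<le> (\<Sum>j\<in>{- int r..int r}. f j)" by simp
  moreover have "min (real r * t1\<^sup>2 + real r ^ 3 * t2\<^sup>2) (real r) / 1152 \<le> real r / 1152" by simp
  ultimately show ?thesis unfolding f_def by linarith
qed

text \<open>A sum written as the integral of a step function, so that dominated convergence applies to
  it.\<close>

lemma floor_step_integral:
  fixes F :: "nat \<Rightarrow> real"
  assumes n: "1 \<le> n"
  shows "(\<Sum>j<n. F j) / real n = (\<integral>x. indicator {0..<1} x * F (nat \<lfloor>real n * x\<rfloor>) \<partial>lborel)"
proof -
  have eq: "indicator {0..<1} x * F (nat \<lfloor>real n * x\<rfloor>) = (\<Sum>j<n. F j * indicator {real j / real n..<(real j + 1) / real n} x)" for x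
  proof (cases "x \<in> {0..<1}")
    case True
    define i where "i = nat \<lfloor>real n * x\<rfloor>"
    have i: "real i \<le> real n * x" "real n * x < real i + 1" using True n unfolding i_def by (auto simp: floor_less_iff)
    have "real n * x < real n" using True n by simp
    then have "i < n" using i by linarith
    have "(\<Sum>j<n. F j * indicator {real j / real n..<(real j + 1) / real n} x) = (\<Sum>j<n. if j = i then F j else 0)"
    proof (intro sum.cong refl)
      fix j
      have "x \<in> {real j / real n..<(real j + 1) / real n} \<longleftrightarrow> real j \<le> real n * x \<and> real n * x < real j + 1"
        using n by (simp add: field_simps)
      also have "\<dots> \<longleftrightarrow> j = i" using i by linarith
      finally show "F j * indicator {real j / real n..<(real j + 1) / real n} x = (if j = i then F j else 0)"
        by (simp add: indicator_def)
    qed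
    also have "\<dots> = F i" using \<open>i < n\<close> by simp
    finally show ?thesis using True by (simp add: i_def)
  next
    case False
    have "x \<notin> {real j / real n..<(real j + 1) / real n}" if "j < n" for j
    proof
      assume x: "x \<in> {real j / real n..<(real j + 1) / real n}"
      have "0 \<le> real j / real n" "(real j + 1) / real n \<le> 1" using that by auto
      with x have "0 \<le> x" "x < 1" by (meson atLeastLessThan_iff order_trans less_le_trans)+
      then show False using False by simp
    qed
    then show ?thesis using False by simp
  qed
  have "(\<integral>x. indicator {0..<1} x * F (nat \<lfloor>real n * x\<rfloor>) \<partial>lborel) = (\<Sum>j<n. F j * measure lborel {real j / real n..<(real j + 1) / real n})"
    unfolding eq by (subst Bochner_Integration.integral_sum) (auto intro!: integrable_real_indicator simp: divide_right_mono)
  also have "\<dots> = (\<Sum>j<n. F j / real n)"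
    by (intro sum.cong refl) (simp add: divide_right_mono diff_divide_distrib[symmetric])
  finally show ?thesis by (simp add: sum_divide_distrib)
qed

lemma riemann_floor_tendsto:
  fixes F :: "nat \<Rightarrow> nat \<Rightarrow> real" and f :: "real \<Rightarrow> real"
  assumes nn: "\<And>k. 1 \<le> nn k"
    and B: "\<And>k j. j < nn k \<Longrightarrow> \<bar>F k j\<bar> \<le> B"
    and lim: "\<And>x. 0 < x \<Longrightarrow> x < 1 \<Longrightarrow> (\<lambda>k. F k (nat \<lfloor>real (nn k) * x\<rfloor>)) \<longlonglongrightarrow> f x"
    and f: "continuous_on {0..1} f"
  shows "(\<lambda>k. (\<Sum>j<nn k. F k j) / real (nn k)) \<longlonglongrightarrow> integral {0..1} f"
proof -
  have fi: "set_integrable lborel {0..1} f" by (rule borel_integrable_atLeastAtMost'[OF f]) 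
  have "(\<lambda>k. \<integral>x. indicator {0..<1} x * F k (nat \<lfloor>real (nn k) * x\<rfloor>) \<partial>lborel) \<longlonglongrightarrow> (\<integral>x. indicator {0..1} x *\<^sub>R f x \<partial>lborel)"
  proof (rule integral_dominated_convergence[where w = "\<lambda>x. indicator {0..1} x * B"])
    show "(\<lambda>x. indicator {0..1} x *\<^sub>R f x) \<in> borel_measurable lborel"
      using fi unfolding set_integrable_def by auto
    show "(\<lambda>x. indicator {0..<1} x * F k (nat \<lfloor>real (nn k) * x\<rfloor>)) \<in> borel_measurable lborel" for k
      by measurable
    show "integrable lborel (\<lambda>x. indicator {0..1::real} x * B)" by simp
    have "AE x in lborel. x \<noteq> (0::real)" "AE x in lborel. x \<noteq> (1::real)"
      by (rule AE_lborel_singleton)+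
    then show "AE x in lborel. (\<lambda>k. indicator {0..<1} x * F k (nat \<lfloor>real (nn k) * x\<rfloor>)) \<longlonglongrightarrow> indicator {0..1} x *\<^sub>R f x"
    proof eventually_elim
      case (elim x)
      show ?case
      proof (cases "x \<in> {0..1}")
        case True
        then show ?thesis using elim lim[of x] by simp
      qed (auto simp: indicator_def)
    qed
    show "AE x in lborel. norm (indicator {0..<1} x * F k (nat \<lfloor>real (nn k) * x\<rfloor>)) \<le> indicator {0..1} x * B" for k
    proof (rule AE_I2)
      fix x :: real
      show "norm (indicator {0..<1} x * F k (nat \<lfloor>real (nn k) * x\<rfloor>)) \<le> indicator {0..1} x * B"
      proof (cases "x \<in> {0..<1}")
        case True
        have "real (nn k) * x < real (nn k)" using True nn[of k] by auto
        then have "nat \<lfloor>real (nn k) * x\<rfloor> < nn k" using True by (simp add: nat_less_iff floor_less_iff)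
        then show ?thesis using True B by simp
      next
        case False
        have "0 \<le> \<bar>F k 0\<bar>" by simp
        also have "\<dots> \<le> B" using B[of 0 k] nn[of k] by simp
        finally show ?thesis using False by (simp add: indicator_def)
      qed
    qed
  qed
  moreover have "(\<integral>x. indicator {0..1} x *\<^sub>R f x \<partial>lborel) = integral {0..1} f"
    using set_borel_integral_eq_integral(2)[OF fi] by (simp add: set_lebesgue_integral_def)
  ultimately show ?thesis
    using nn by (simp add: floor_step_integral)
qed

section \<open>Characteristic functions of the tilted steps\<close>

lemma Re_cosh_Complex: "Re (cosh (Complex x y)) = cosh x * cos y"
  by (simp add: cosh_def Re_exp field_simps)

lemma norm_cosh_le: "norm (cosh z) \<le> cosh (Re z)" for z :: complex
proof -
  have "norm (cosh z) = norm (exp z + exp (- z)) / 2" by (simp add: cosh_def norm_divide)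
  also have "\<dots> \<le> (norm (exp z) + norm (exp (- z))) / 2" by (intro divide_right_mono norm_triangle_ineq) auto
  also have "\<dots> = cosh (Re z)" by (simp add: cosh_def)
  finally show ?thesis .
qed

lemma norm_sinh_le: "norm (sinh z) \<le> cosh (Re z)" for z :: complex
proof -
  have "norm (sinh z) = norm (exp z - exp (- z)) / 2" by (simp add: sinh_def norm_divide)
  also have "\<dots> \<le> (norm (exp z) + norm (exp (- z))) / 2" by (intro divide_right_mono norm_triangle_ineq4) auto
  also have "\<dots> = cosh (Re z)" by (simp add: cosh_def)
  finally show ?thesis .
qed

lemma cosh_of_real: "cosh (complex_of_real x) = complex_of_real (cosh x)"
  unfolding cosh_def of_real_minus[symmetric] exp_of_real by (simp add: scaleR_conv_of_real)

lemma sinh_of_real: "sinh (complex_of_real x) = complex_of_real (sinh x)"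
  unfolding sinh_def of_real_minus[symmetric] exp_of_real by (simp add: scaleR_conv_of_real)

context ipdsaw
begin

text \<open>The moment generating function at a complex argument \<open>z\<close> is \<open>(C - 1)\<close>
  divided by this denominator, which has positive real part in the strip \<open>|Re z| <
  \<beta>/2\<close>.\<close>

abbreviation mgf_denom :: "complex \<Rightarrow> complex" where "mgf_denom z \<equiv> complex_of_real Cb - cosh z"

lemma Re_mgf_denom: "Cb - cosh (Re z) \<le> Re (mgf_denom z)"
proof -
  have "Re (cosh z) \<le> norm (cosh z)" by (rule complex_Re_le_cmod)
  then show ?thesis using norm_cosh_le[of z] by simp
qed

lemma mgf_denom_nz: "\<bar>Re z\<bar> < \<beta> / 2 \<Longrightarrow> mgf_denom z \<noteq> 0" "\<bar>Re z\<bar> < \<beta> / 2 \<Longrightarrow> 0 < Re (mgf_denom z)"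
proof -
  have *: "0 < Re (mgf_denom z)" if "\<bar>Re z\<bar> < \<beta> / 2"
    using Re_mgf_denom[of z] Cb_minus_cosh_pos[OF that] by linarith
  then show "\<bar>Re z\<bar> < \<beta> / 2 \<Longrightarrow> 0 < Re (mgf_denom z)" .
  show "\<bar>Re z\<bar> < \<beta> / 2 \<Longrightarrow> mgf_denom z \<noteq> 0" using * by fastforce
qed

lemma has_sum_complex_mgf:
  assumes "\<bar>Re z\<bar> < \<beta> / 2"
  shows "((\<lambda>k. exp (z * of_int k) * complex_of_real (pmf (step_law \<beta>) k)) has_sum (complex_of_real (Cb - 1) / mgf_denom z)) UNIV"
proof -
  define b where "b = \<beta> / 2"
  define E where "E = exp (complex_of_real (- b))"
  define t where "t = exp z"
  let ?f = "\<lambda>k::int. exp (z * of_int k - complex_of_real (b * \<bar>real_of_int k\<bar>))"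
  have geo: "((\<lambda>n. r ^ n) has_sum (1 / (1 - r))) (UNIV :: nat set)" if "norm r < 1" for r :: complex
    using that by (intro norm_summable_imp_has_sum geometric_sums)
      (auto intro: summable_geometric simp: norm_power)
  have n1: "norm (t * E) < 1" "norm (E / t) < 1"
    using assms by (auto simp: t_def E_def b_def norm_mult norm_divide simp flip: exp_add exp_diff)
  have 1: "(?f has_sum (1 / (1 - t * E))) (range int)"
  proof (subst has_sum_reindex)
    have "?f \<circ> int = (\<lambda>n. (t * E) ^ n)"
      by (auto simp: fun_eq_iff t_def E_def algebra_simps simp flip: exp_of_nat_mult exp_add)
    then show "((?f \<circ> int) has_sum (1 / (1 - t * E))) UNIV" using geo[OF n1(1)] by simp
  qed auto
  have 2: "(?f has_sum (E / t / (1 - E / t))) (range (\<lambda>n. - int n - 1))"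
  proof (subst has_sum_reindex)
    have "?f \<circ> (\<lambda>n. - int n - 1) = (\<lambda>n. (E / t) * (E / t) ^ n)"
    proof
      fix n
      have "(?f \<circ> (\<lambda>n. - int n - 1)) n = exp (- complex_of_real b - z + of_nat n * (- complex_of_real b - z))"
      proof -
        have "\<bar>real_of_int (- int n - 1)\<bar> = real n + 1" by simp
        then have "z * of_int (- int n - 1) - complex_of_real (b * \<bar>real_of_int (- int n - 1)\<bar>) =
          - complex_of_real b - z + of_nat n * (- complex_of_real b - z)"
          by (simp only: of_real_mult of_real_add of_real_of_nat_eq of_real_1) (simp add: algebra_simps)
        then show ?thesis by (simp only: o_def)
      qed
      also have "\<dots> = (E / t) * (E / t) ^ n"
        unfolding exp_add exp_of_nat_mult by (simp add: E_def t_def exp_diff)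
      finally show "(?f \<circ> (\<lambda>n. - int n - 1)) n = (E / t) * (E / t) ^ n" .
    qed
    then show "((?f \<circ> (\<lambda>n. - int n - 1)) has_sum (E / t / (1 - E / t))) UNIV"
      using has_sum_cmult_right[OF geo[OF n1(2)], of "E / t"] by simp
  qed (auto simp: inj_on_def)
  have 3: "range int \<inter> range (\<lambda>n. - int n - 1) = {}" by auto
  have 4: "range int \<union> range (\<lambda>n. - int n - 1) = UNIV"
  proof -
    have "k \<in> range int \<union> range (\<lambda>n. - int n - 1)" for k
    proof (cases "k \<ge> 0")
      case True
      then have "k = int (nat k)" by simp
      then show ?thesis by blast
    next
      case False
      then have "k = - int (nat (- k - 1)) - 1" by simp
      then show ?thesis by blast
    qed
    then show ?thesis by blast
  qed
  have s: "(?f has_sum (1 / (1 - t * E) + E / t / (1 - E / t))) UNIV"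
    using has_sum_Un_disjoint[OF 1 2 3] unfolding 4 .
  have c: "cc = (1 + exp (- b)) / (1 - exp (- b))" using c_const_eq[OF \<beta>_pos] by (simp add: b_def)
  have E_eq: "E = complex_of_real (exp (- b))" unfolding E_def by (simp only: exp_of_real)
  have e1: "exp (- b) \<noteq> 1" "exp (- b) \<noteq> -1" using \<beta>_pos by (auto simp: b_def) (smt (verit) exp_gt_zero)
  have ne: "E \<noteq> 0" "t \<noteq> 0" "1 - E \<noteq> 0" "1 + E \<noteq> 0"
  proof -
    show "1 - E \<noteq> 0" using e1 unfolding E_eq by (metis eq_iff_diff_eq_0 of_real_1 of_real_eq_iff)
    have "0 < Re (1 + E)" unfolding E_eq by (simp add: add_pos_pos)
    then show "1 + E \<noteq> 0" by (metis less_irrefl zero_complex.simps(1))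
  qed (auto simp: E_def t_def)
  have ne2: "1 - t * E \<noteq> 0" "t - E \<noteq> 0"
  proof -
    show "1 - t * E \<noteq> 0" using n1(1) by auto
    show "t - E \<noteq> 0" using n1(2) ne by auto
  qed
  have Cb: "complex_of_real Cb = (1 / E + E) / 2"
    unfolding Cb_def b_def[symmetric] cosh_def E_eq by (simp add: exp_minus field_simps)
  have ch: "cosh z = (t + 1 / t) / 2" unfolding cosh_def t_def scaleR_conv_of_real
    by (simp add: exp_minus field_simps)
  have cE: "complex_of_real cc = (1 + E) / (1 - E)" unfolding c E_eq by simp
  have B: "mgf_denom z = (1 - t * E) * (t - E) / (2 * E * t)"
    unfolding Cb ch using ne by (simp add: divide_simps) (simp add: algebra_simps)
  have D: "complex_of_real (Cb - 1) = (1 - E)\<^sup>2 / (2 * E)"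
    unfolding of_real_diff Cb using ne by (simp add: divide_simps power2_eq_square) (simp add: algebra_simps)
  have A: "1 / (1 - t * E) + E / t / (1 - E / t) = t * (1 - E) * (1 + E) / ((1 - t * E) * (t - E))"
  proof -
    have "E / t / (1 - E / t) = E / (t - E)" using ne ne2 by (simp add: field_simps)
    then show ?thesis using ne ne2 by (simp add: divide_simps) (simp add: algebra_simps)
  qed
  have eq: "(1 / (1 - t * E) + E / t / (1 - E / t)) / complex_of_real cc = complex_of_real (Cb - 1) / mgf_denom z"
    unfolding A B D cE using ne ne2 by (simp add: divide_simps power2_eq_square)
  have "?f k / complex_of_real cc = exp (z * of_int k) * complex_of_real (pmf (step_law \<beta>) k)" for k
  proof -
    have "exp (complex_of_real (b * \<bar>real_of_int k\<bar>)) * complex_of_real (exp (- b * \<bar>real_of_int k\<bar>)) = 1"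
      unfolding exp_of_real by (simp flip: of_real_mult exp_add)
    moreover have "exp (complex_of_real (b * \<bar>real_of_int k\<bar>)) \<noteq> 0" by simp
    ultimately have "1 / exp (complex_of_real (b * \<bar>real_of_int k\<bar>)) = complex_of_real (exp (- b * \<bar>real_of_int k\<bar>))"
      by (metis nonzero_mult_div_cancel_left)
    then show ?thesis
      unfolding pmf_step_law[OF \<beta>_pos] b_def[symmetric] exp_diff of_real_divide by (metis times_divide_eq_right mult.right_neutral)
  qed
  then show ?thesis using has_sum_divide_const[OF s, of "complex_of_real cc"] unfolding eq by simp
qed

definition cf :: "real \<Rightarrow> real \<Rightarrow> complex" where
  "cf \<tau> \<theta> = (\<integral>u. cis (\<theta> * real_of_int u) \<partial>measure_pmf (tilted_law \<beta> \<tau>))"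

lemma cf_eq:
  assumes "\<bar>\<tau>\<bar> < \<beta> / 2"
  shows "cf \<tau> \<theta> = complex_of_real (Cb - cosh \<tau>) / mgf_denom (Complex \<tau> \<theta>)"
proof -
  let ?s = "complex_of_real (Cb - cosh \<tau>) / mgf_denom (Complex \<tau> \<theta>)"
  have C1: "complex_of_real (Cb - 1) \<noteq> 0" using Cb_gt_1 by (metis less_irrefl of_real_eq_0_iff right_minus_eq)
  have L: "exp (lam \<tau>) = (Cb - 1) / (Cb - cosh \<tau>)"
    unfolding lam_def using Cb_gt_1 Cb_minus_cosh_pos[OF assms] by (simp add: exp_diff)
  have "((\<lambda>k. exp (Complex \<tau> \<theta> * of_int k) * complex_of_real (pmf (step_law \<beta>) k) / complex_of_real (exp (lam \<tau>)))
     has_sum (complex_of_real (Cb - 1) / mgf_denom (Complex \<tau> \<theta>) / complex_of_real (exp (lam \<tau>)))) UNIV"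
    using assms by (intro has_sum_divide_const has_sum_complex_mgf) simp
  moreover have "complex_of_real (Cb - 1) / mgf_denom (Complex \<tau> \<theta>) / complex_of_real (exp (lam \<tau>)) = ?s"
    unfolding L of_real_divide using C1 by (simp add: divide_simps)
  moreover have "exp (Complex \<tau> \<theta> * of_int k) * complex_of_real (pmf (step_law \<beta>) k) / complex_of_real (exp (lam \<tau>)) =
     cis (\<theta> * real_of_int k) * complex_of_real (pmf (tilted_law \<beta> \<tau>) k)" for k
  proof -
    have "exp (Complex \<tau> \<theta> * of_int k) = complex_of_real (exp (\<tau> * real_of_int k)) * cis (\<theta> * real_of_int k)"
      by (simp add: exp_eq_polar)
    then show ?thesis unfolding pmf_tilted[OF assms] exp_diff of_real_mult of_real_divide by simp
  qed
  ultimately have hs: "((\<lambda>k. cis (\<theta> * real_of_int k) * complex_of_real (pmf (tilted_law \<beta> \<tau>) k)) has_sum ?s) UNIV"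
    by simp
  have int: "integrable (measure_pmf (tilted_law \<beta> \<tau>)) (\<lambda>u. cis (\<theta> * real_of_int u))"
    by (rule measure_pmf.integrable_const_bound[of _ 1]) auto
  have "((\<lambda>k. Re (cis (\<theta> * real_of_int k)) * pmf (tilted_law \<beta> \<tau>) k) has_sum Re ?s) UNIV"
    using has_sum_Re[OF hs] by simp
  from expectation_has_sum(2)[OF this] have "Re (cf \<tau> \<theta>) = Re ?s"
    unfolding cf_def by (subst integral_Re[OF int, symmetric])
  moreover have "((\<lambda>k. Im (cis (\<theta> * real_of_int k)) * pmf (tilted_law \<beta> \<tau>) k) has_sum Im ?s) UNIV"
    using has_sum_Im[OF hs] by simp
  from expectation_has_sum(2)[OF this] have "Im (cf \<tau> \<theta>) = Im ?s"
    unfolding cf_def by (subst integral_Im[OF int, symmetric])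
  ultimately show ?thesis by (rule complex_eqI)
qed

text \<open>The real part of the denominator grows from \<open>C - cosh \<tau>\<close> by at least \<open>1 -
  cos \<theta>\<close> as the frequency is turned on. The constant does not depend on the tilt.\<close>

lemma norm_cf_le:
  assumes "\<bar>\<tau>\<bar> < \<beta> / 2"
  shows "norm (cf \<tau> \<theta>) \<le> exp (- ((1 - cos \<theta>) / (3 * Cb)))"
proof -
  define w x where "w = Cb - cosh \<tau>" and "x = 1 - cos \<theta>"
  have w: "0 < w" "w \<le> Cb" using Cb_minus_cosh_pos[OF assms] cosh_real_ge_1[of \<tau>] by (auto simp: w_def)
  have x: "0 \<le> x" "x \<le> 2" using cos_ge_minus_one[of \<theta>] by (auto simp: x_def)
  have "w + x \<le> w + cosh \<tau> * x" using x mult_right_mono[OF cosh_real_ge_1[of \<tau>], of x] by simp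
  also have "\<dots> = Re (mgf_denom (Complex \<tau> \<theta>))" by (simp add: Re_cosh_Complex w_def x_def algebra_simps)
  also have "\<dots> \<le> norm (mgf_denom (Complex \<tau> \<theta>))" by (rule complex_Re_le_cmod)
  finally have n: "w + x \<le> norm (mgf_denom (Complex \<tau> \<theta>))" .
  have "norm (cf \<tau> \<theta>) = w / norm (mgf_denom (Complex \<tau> \<theta>))"
    unfolding cf_eq[OF assms] w_def[symmetric] norm_divide using w by simp
  also have "\<dots> \<le> w / (w + x)" using n w x by (intro divide_left_mono mult_pos_pos) auto
  also have "\<dots> = 1 - x / (w + x)" using w x by (simp add: field_simps)
  finally have "norm (cf \<tau> \<theta>) \<le> 1 - x / (w + x)" .
  moreover have "x / (3 * Cb) \<le> x / (w + x)"
    using w x Cb_gt_1 by (intro divide_left_mono mult_pos_pos) auto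
  ultimately have "norm (cf \<tau> \<theta>) \<le> 1 + - (x / (3 * Cb))" by linarith
  also have "\<dots> \<le> exp (- (x / (3 * Cb)))" by (rule exp_ge_add_one_self)
  finally show ?thesis by (simp add: x_def)
qed

definition lnD :: "complex \<Rightarrow> complex" where "lnD z = - Ln (mgf_denom z)"

text \<open>The error in the second-order expansion of the logarithm of the characteristic function around
  \<open>\<theta> = 0\<close>.\<close>

definition cf_remainder :: "real \<Rightarrow> real \<Rightarrow> complex" where
  "cf_remainder \<tau> \<theta> = lnD (Complex \<tau> \<theta>) - lnD (complex_of_real \<tau>) - \<i> * complex_of_real (\<theta> * lam1 \<tau>) + complex_of_real (\<theta>\<^sup>2 * lam2 \<tau> / 2)"

lemma cf_exp:
  assumes "\<bar>\<tau>\<bar> < \<beta> / 2"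
  shows "cf \<tau> \<theta> = exp (\<i> * complex_of_real (\<theta> * lam1 \<tau>) - complex_of_real (\<theta>\<^sup>2 * lam2 \<tau> / 2) + cf_remainder \<tau> \<theta>)"
proof -
  have "exp (lnD (Complex \<tau> \<theta>) - lnD (complex_of_real \<tau>)) = mgf_denom (complex_of_real \<tau>) / mgf_denom (Complex \<tau> \<theta>)"
    unfolding lnD_def using mgf_denom_nz(1)[of "Complex \<tau> \<theta>"] mgf_denom_nz(1)[of "complex_of_real \<tau>"] assms
    by (simp add: exp_diff exp_minus field_simps)
  then show ?thesis unfolding cf_eq[OF assms] cf_remainder_def by (simp add: cosh_of_real)
qed

text \<open>Complex Taylor expansion of \<open>- Ln (C - cosh z)\<close> in the strip, where the third
  derivative is bounded.\<close>

lemma norm_cf_remainder_le: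
  assumes r: "0 \<le> r" "r < \<beta> / 2"
  obtains B where "0 \<le> B" "\<And>\<tau> \<theta>. \<bar>\<tau>\<bar> \<le> r \<Longrightarrow> norm (cf_remainder \<tau> \<theta>) \<le> B * \<bar>\<theta>\<bar> ^ 3"
proof -
  define S where "S = {z :: complex. \<bar>Re z\<bar> \<le> r}"
  define f :: "nat \<Rightarrow> complex \<Rightarrow> complex" where "f i z =
     (if i = 0 then lnD z else if i = 1 then sinh z / mgf_denom z
      else if i = 2 then (complex_of_real Cb * cosh z - 1) / (mgf_denom z)\<^sup>2
      else sinh z * (complex_of_real Cb * mgf_denom z + 2 * (complex_of_real Cb * cosh z - 1)) / (mgf_denom z) ^ 3)" for i z
  define ch where "ch = cosh r"
  define B where "B = ch * (Cb * (Cb + ch) + 2 * (Cb * ch + 1)) / (Cb - ch) ^ 3"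
  have w: "0 < Cb - ch" unfolding ch_def using Cb_minus_cosh_pos[of r] r by simp
  have ch: "1 \<le> ch" by (simp add: ch_def cosh_real_ge_1)
  have B0: "0 \<le> B" unfolding B_def using w ch Cb_gt_1 by simp
  have SD: "mgf_denom z \<noteq> 0" "0 < Re (mgf_denom z)" "Cb - ch \<le> norm (mgf_denom z)" "norm (mgf_denom z) \<le> Cb + ch"
    "norm (cosh z) \<le> ch" "norm (sinh z) \<le> ch" if "z \<in> S" for z
  proof -
    have z: "\<bar>Re z\<bar> \<le> r" using that by (simp add: S_def)
    then have zb: "\<bar>Re z\<bar> < \<beta> / 2" using r by simp
    show "mgf_denom z \<noteq> 0" "0 < Re (mgf_denom z)" using mgf_denom_nz[OF zb] by auto
    have cr: "cosh (Re z) \<le> ch" unfolding ch_def using cosh_real_nonneg_le_iff[of "\<bar>Re z\<bar>" r] z r by simp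
    show c: "norm (cosh z) \<le> ch" "norm (sinh z) \<le> ch" using norm_cosh_le[of z] norm_sinh_le[of z] cr by auto
    show "Cb - ch \<le> norm (mgf_denom z)" using Re_mgf_denom[of z] complex_Re_le_cmod[of "mgf_denom z"] cr by linarith
    show "norm (mgf_denom z) \<le> Cb + ch" using norm_triangle_ineq4[of "complex_of_real Cb" "cosh z"] c Cb_gt_1 by simp
  qed
  have conv: "convex S"
  proof -
    have "S = {z. Re z \<le> r} \<inter> {z. Re z \<ge> - r}" by (auto simp: S_def abs_le_iff)
    then show ?thesis by (auto intro!: convex_Int convex_halfspace_Re_le convex_halfspace_Re_ge)
  qed
  have T: "norm (f 0 z - (\<Sum>i\<le>2. f i w' * (z - w') ^ i / fact i)) \<le> B * norm (z - w') ^ Suc 2 / fact 2"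
    if zw: "z \<in> S" "w' \<in> S" for z w'
  proof (rule complex_Taylor[OF conv _ _ zw(2) zw(1)])
    fix i :: nat and x assume x: "x \<in> S" and i: "i \<le> 2"
    note d = SD[OF x]
    have nr: "mgf_denom x \<notin> \<real>\<^sub>\<le>\<^sub>0" using d(2) by (auto simp: complex_nonpos_Reals_iff)
    have dD: "(mgf_denom has_field_derivative - sinh x) (at x)" by (auto intro!: derivative_eq_intros)
    have hs: "cosh x * cosh x = 1 + sinh x * sinh x" using cosh_square_eq[of x] by (simp add: power2_eq_square)
    have "(f i has_field_derivative f (Suc i) x) (at x)"
    proof -
      consider "i = 0" | "i = 1" | "i = 2" using i by linarith
      then show ?thesis
      proof cases
        case 1
        have "((\<lambda>z. - Ln (mgf_denom z)) has_field_derivative sinh x / mgf_denom x) (at x)"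
          using d(1) nr by (auto intro!: derivative_eq_intros simp: field_simps)
        then show ?thesis using 1 by (simp add: f_def[abs_def] lnD_def[abs_def])
      next
        case 2
        have "((\<lambda>z. sinh z / mgf_denom z) has_field_derivative (cosh x * mgf_denom x - sinh x * (- sinh x)) / (mgf_denom x * mgf_denom x)) (at x)"
          using d(1) by (intro DERIV_divide dD) (auto intro!: derivative_eq_intros)
        moreover have "cosh x * mgf_denom x - sinh x * (- sinh x) = complex_of_real Cb * cosh x - 1"
          using hs by (simp add: algebra_simps)
        ultimately show ?thesis using 2 by (simp add: f_def[abs_def] power2_eq_square)
      next
        case 3
        have e: "((\<lambda>z. (mgf_denom z)\<^sup>2) has_field_derivative 2 * mgf_denom x * (- sinh x)) (at x)"
          by (auto intro!: derivative_eq_intros)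
        have "((\<lambda>z. (complex_of_real Cb * cosh z - 1) / (mgf_denom z)\<^sup>2) has_field_derivative
          (complex_of_real Cb * sinh x * (mgf_denom x)\<^sup>2 - (complex_of_real Cb * cosh x - 1) * (2 * mgf_denom x * (- sinh x))) / ((mgf_denom x)\<^sup>2 * (mgf_denom x)\<^sup>2)) (at x)"
          using d(1) by (intro DERIV_divide e) (auto intro!: derivative_eq_intros)
        moreover have "(complex_of_real Cb * sinh x * (mgf_denom x)\<^sup>2 - (complex_of_real Cb * cosh x - 1) * (2 * mgf_denom x * (- sinh x))) / ((mgf_denom x)\<^sup>2 * (mgf_denom x)\<^sup>2)
           = sinh x * (complex_of_real Cb * mgf_denom x + 2 * (complex_of_real Cb * cosh x - 1)) / (mgf_denom x) ^ 3"
        proof -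
          have "(c * s * D\<^sup>2 - q * (2 * D * (- s))) / (D\<^sup>2 * D\<^sup>2) = s * (c * D + 2 * q) / D ^ 3" if "D \<noteq> 0" for c s D q :: complex
            using that by (simp add: field_simps power2_eq_square power3_eq_cube)
          from this[OF d(1)] show ?thesis .
        qed
        ultimately show ?thesis using 3 by (simp add: f_def[abs_def])
      qed
    qed
    then show "(f i has_field_derivative f (Suc i) x) (at x within S)" by (rule has_field_derivative_at_within)
  next
    fix x assume x: "x \<in> S"
    note d = SD[OF x]
    have "norm (f (Suc 2) x) = norm (sinh x) * norm (complex_of_real Cb * mgf_denom x + 2 * (complex_of_real Cb * cosh x - 1)) / norm (mgf_denom x) ^ 3"
      by (simp add: f_def norm_mult norm_divide norm_power)
    also have "norm (complex_of_real Cb * mgf_denom x + 2 * (complex_of_real Cb * cosh x - 1)) \<le> Cb * (Cb + ch) + 2 * (Cb * ch + 1)"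
    proof -
      have "norm (complex_of_real Cb * mgf_denom x + 2 * (complex_of_real Cb * cosh x - 1)) \<le>
         norm (complex_of_real Cb * mgf_denom x) + norm (2 * (complex_of_real Cb * cosh x - 1))" by (rule norm_triangle_ineq)
      also have "norm (2 * (complex_of_real Cb * cosh x - 1)) \<le> 2 * (norm (complex_of_real Cb * cosh x) + 1)"
      proof -
        have "norm (2 * (complex_of_real Cb * cosh x - 1)) = 2 * norm (complex_of_real Cb * cosh x - 1)"
          by (simp only: norm_mult norm_numeral)
        then show ?thesis using norm_triangle_ineq4[of "complex_of_real Cb * cosh x" 1] by simp
      qed
      also have "norm (complex_of_real Cb * mgf_denom x) + 2 * (norm (complex_of_real Cb * cosh x) + 1) \<le> Cb * (Cb + ch) + 2 * (Cb * ch + 1)"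
        unfolding norm_mult using d Cb_gt_1 by (intro add_mono mult_mono) auto
      finally show ?thesis by simp
    qed
    then have "norm (sinh x) * norm (complex_of_real Cb * mgf_denom x + 2 * (complex_of_real Cb * cosh x - 1)) / norm (mgf_denom x) ^ 3 \<le> B"
      unfolding B_def using d w Cb_gt_1 ch by (intro frac_le mult_mono power_mono) auto
    finally show "norm (f (Suc 2) x) \<le> B" .
  qed
  show ?thesis
  proof (rule that[OF B0])
    fix \<tau> \<theta> assume \<tau>: "\<bar>\<tau>\<bar> \<le> r"
    have df: "Complex \<tau> \<theta> - complex_of_real \<tau> = \<i> * complex_of_real \<theta>" by (simp add: complex_eq_iff)
    have T1: "norm (f 0 (Complex \<tau> \<theta>) - (\<Sum>i\<le>2. f i (complex_of_real \<tau>) * (Complex \<tau> \<theta> - complex_of_real \<tau>) ^ i / fact i))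
      \<le> B * norm (Complex \<tau> \<theta> - complex_of_real \<tau>) ^ Suc 2 / fact 2"
      using \<tau> by (intro T) (auto simp: S_def)
    have T2: "(\<Sum>i\<le>2. f i (complex_of_real \<tau>) * (Complex \<tau> \<theta> - complex_of_real \<tau>) ^ i / fact i) =
       lnD (complex_of_real \<tau>) + \<i> * complex_of_real (\<theta> * lam1 \<tau>) - complex_of_real (\<theta>\<^sup>2 * lam2 \<tau> / 2)"
    proof -
      have f0: "f 0 (complex_of_real \<tau>) = lnD (complex_of_real \<tau>)" by (simp add: f_def)
      have f1: "f 1 (complex_of_real \<tau>) = complex_of_real (lam1 \<tau>)"
        by (simp add: f_def lam1_def cosh_of_real sinh_of_real)
      have f2: "f 2 (complex_of_real \<tau>) = complex_of_real (lam2 \<tau>)"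
        by (simp add: f_def lam2_def cosh_of_real)
      have "(\<Sum>i\<le>2. g i) = g 0 + g 1 + g (2::nat)" for g :: "nat \<Rightarrow> complex" by (simp add: eval_nat_numeral)
      then show ?thesis unfolding df by (simp only: f0 f1 f2) (simp add: power_mult_distrib algebra_simps)
    qed
    have T3: "norm (Complex \<tau> \<theta> - complex_of_real \<tau>) = \<bar>\<theta>\<bar>" unfolding df by (simp add: norm_mult)
    have T4: "f 0 (Complex \<tau> \<theta>) - (lnD (complex_of_real \<tau>) + \<i> * complex_of_real (\<theta> * lam1 \<tau>) - complex_of_real (\<theta>\<^sup>2 * lam2 \<tau> / 2)) = cf_remainder \<tau> \<theta>"
      by (simp add: cf_remainder_def f_def)
    have "fact 2 = (2::real)" "Suc 2 = 3" by (simp_all add: eval_nat_numeral)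
    then have "norm (cf_remainder \<tau> \<theta>) \<le> B * \<bar>\<theta>\<bar> ^ 3 / 2"
      using T1 unfolding T2 T3 T4 by simp
    also have "\<dots> \<le> B * \<bar>\<theta>\<bar> ^ 3" using B0 by simp
    finally show "norm (cf_remainder \<tau> \<theta>) \<le> B * \<bar>\<theta>\<bar> ^ 3" .
  qed
qed

end

section \<open>Local limit theorem for end point and area\<close>

lemma gaussian_integral:
  assumes "0 < (v::real)"
  shows "integrable lborel (\<lambda>x. exp (- v * x\<^sup>2 / 2))"
    and "(\<integral>x. exp (- v * x\<^sup>2 / 2) \<partial>lborel) = sqrt (2 * pi / v)"
proof -
  have e: "exp (- v * x\<^sup>2 / 2) = sqrt (2 * pi / v) * normal_density 0 (1 / sqrt v) x" for x
    using assms by (simp add: normal_density_def power_divide)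
  show "integrable lborel (\<lambda>x. exp (- v * x\<^sup>2 / 2))" unfolding e
    using assms by (intro integrable_mult_right integrable_normal_density) simp
  show "(\<integral>x. exp (- v * x\<^sup>2 / 2) \<partial>lborel) = sqrt (2 * pi / v)" unfolding e using assms by simp
qed

lemma integrable_inverse_square: "integrable lborel (\<lambda>x::real. inverse (1 + x\<^sup>2))"
  using integrable_inverse_1_plus_square by (simp add: set_integrable_def)

lemma abs_le_exp_gauss:
  fixes x v :: real
  assumes "0 < v"
  shows "\<bar>x\<bar> * exp (- v * x\<^sup>2 / 2) \<le> (1 + 4 / v) * exp (- (v / 2) * x\<^sup>2 / 2)"
proof -
  have "\<bar>x\<bar> \<le> 1 + x\<^sup>2"
  proof (cases "\<bar>x\<bar> \<le> 1")
    case False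
    then have "\<bar>x\<bar> * 1 \<le> \<bar>x\<bar> * \<bar>x\<bar>" by (intro mult_left_mono) auto
    then show ?thesis by (simp add: power2_eq_square abs_mult_self_eq)
  qed (simp add: add_increasing2)
  also have "\<dots> \<le> (1 + 4 / v) * (1 + v * x\<^sup>2 / 4)" using assms by (simp add: field_simps)
  also have "\<dots> \<le> (1 + 4 / v) * exp (v * x\<^sup>2 / 4)"
    using assms exp_ge_add_one_self[of "v * x\<^sup>2 / 4"] by (intro mult_left_mono) auto
  finally have "\<bar>x\<bar> * exp (- v * x\<^sup>2 / 2) \<le> (1 + 4 / v) * exp (v * x\<^sup>2 / 4) * exp (- v * x\<^sup>2 / 2)"
    by (intro mult_right_mono) auto
  also have "\<dots> = (1 + 4 / v) * exp (- (v / 2) * x\<^sup>2 / 2)"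
    by (simp add: mult.assoc flip: exp_add)
  finally show ?thesis .
qed

lemma floor_ratio_tendsto:
  assumes nn: "filterlim nn at_top sequentially" "\<And>k. 1 \<le> nn k" and t: "0 \<le> t"
  shows "(\<lambda>k. real (nat \<lfloor>real (nn k) * t\<rfloor>) / real (nn k)) \<longlonglongrightarrow> t"
proof (rule tendsto_sandwich[of "\<lambda>k. t - 1 / real (nn k)" _ _ "\<lambda>_. t"])
  have nr: "filterlim (\<lambda>k. real (nn k)) at_top sequentially"
    by (rule filterlim_compose[OF filterlim_real_sequentially nn(1)])
  have "(\<lambda>k. t - 1 / real (nn k)) \<longlonglongrightarrow> t - 0"
    by (intro tendsto_intros tendsto_divide_0[OF tendsto_const] filterlim_at_top_imp_at_infinity nr)
  then show "(\<lambda>k. t - 1 / real (nn k)) \<longlonglongrightarrow> t" by simp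
  have b: "real (nn k) * t - 1 \<le> real (nat \<lfloor>real (nn k) * t\<rfloor>) \<and> real (nat \<lfloor>real (nn k) * t\<rfloor>) \<le> real (nn k) * t" for k
  proof -
    have "0 \<le> real (nn k) * t" using t by simp
    then show ?thesis by (simp add: of_nat_nat)
  qed
  show "\<forall>\<^sub>F k in sequentially. t - 1 / real (nn k) \<le> real (nat \<lfloor>real (nn k) * t\<rfloor>) / real (nn k)"
  proof (rule always_eventually, rule allI)
    fix k
    have "t - 1 / real (nn k) = (real (nn k) * t - 1) / real (nn k)" using nn(2)[of k] by (simp add: field_simps)
    also have "\<dots> \<le> real (nat \<lfloor>real (nn k) * t\<rfloor>) / real (nn k)" using b[of k] by (intro divide_right_mono) auto
    finally show "t - 1 / real (nn k) \<le> real (nat \<lfloor>real (nn k) * t\<rfloor>) / real (nn k)" .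
  qed
  show "\<forall>\<^sub>F k in sequentially. real (nat \<lfloor>real (nn k) * t\<rfloor>) / real (nn k) \<le> t"
  proof (rule always_eventually, rule allI)
    fix k
    have "real (nat \<lfloor>real (nn k) * t\<rfloor>) / real (nn k) \<le> real (nn k) * t / real (nn k)" using b[of k] by (intro divide_right_mono) auto
    also have "\<dots> = t" using nn(2)[of k] by simp
    finally show "real (nat \<lfloor>real (nn k) * t\<rfloor>) / real (nn k) \<le> t" .
  qed
qed simp

text \<open>An integer version of the centred weight. For a bridge both give the same area, as the difference
  is a constant multiple of the end point; integrality is needed for Fourier inversion.\<close>

definition iweight :: "nat \<Rightarrow> nat \<Rightarrow> int" where "iweight n j = int (n div 2) - int j"

text \<open>Along a sequence of lengths \<open>nn\<close> and tilts \<open>hh\<close>, the limit theorem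
  concerns the steps in the middle block \<open>J = {mm..<nn - mm}\<close> only; the two ends are left free.
  \<open>SS\<close> and \<open>TT\<close> are the block's contributions to the end point and to the area, of
  standard deviation \<open>al = n\<^bsup>1/2\<^esup>\<close> and \<open>ga = n\<^bsup>3/2\<^esup>\<close> up to
  constants, and \<open>mu\<close> is the mean of the latter. \<open>Psi\<close> is their characteristic
  function after centring and rescaling, cut off to the box of Fourier inversion, and \<open>gauss\<close> its
  limit. Sequences instead of uniform estimates keep dominated convergence available; uniformity is recovered at
  the end by compactness. The bound \<open>8 mm \<le> nn\<close> leaves a block of a quarter of all steps on
  each side of the centre.\<close>

locale bulk_scaling = ipdsaw +
  fixes nn mm :: "nat \<Rightarrow> nat" and hh :: "nat \<Rightarrow> real" and h :: real
  assumes nn16: "\<And>k. 16 \<le> nn k" and nn_lim: "filterlim nn at_top sequentially"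
    and mm8: "\<And>k. 8 * mm k \<le> nn k" and mm_ratio: "(\<lambda>k. real (mm k) / real (nn k)) \<longlonglongrightarrow> 0"
    and hh: "\<And>k. 0 < hh k" "\<And>k. hh k < \<beta>" and hh_lim: "hh \<longlonglongrightarrow> h" and h: "0 < h" "h < \<beta>"
begin

lemma hb: "\<bar>h\<bar> < \<beta>" using h by simp

definition J where "J k = {mm k..<nn k - mm k}"
definition tau where "tau k j = hh k / real (nn k) * cweight (nn k) j"
definition Middle where "Middle k = Pi_pmf (J k) 0 (\<lambda>j. tilted_law \<beta> (tau k j))"
definition SS where "SS k u = (\<Sum>j\<in>J k. u j)" for u :: "nat \<Rightarrow> int"
definition TT where "TT k u = (\<Sum>j\<in>J k. iweight (nn k) j * u j)" for u :: "nat \<Rightarrow> int"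
definition mu where "mu k = (\<Sum>j\<in>J k. real_of_int (iweight (nn k) j) * lam1 (tau k j))"
definition al where "al k = sqrt (real (nn k))"
definition ga where "ga k = real (nn k) * sqrt (real (nn k))"
definition th where "th k p j = fst p / al k + real_of_int (iweight (nn k) j) * (snd p / ga k)"
definition Psi where "Psi k p = indicator (fbox (al k) (ga k)) p *\<^sub>R
   ((\<Prod>j\<in>J k. cf (tau k j) (th k p j)) * cis (- (snd p / ga k) * mu k))"
definition gauss :: "real \<times> real \<Rightarrow> real" where
  "gauss p = exp (- V0 h * (fst p)\<^sup>2 / 2) * exp (- G2 h * (snd p)\<^sup>2 / 2)"
definition gauss_mass where "gauss_mass = 2 * pi / sqrt (V0 h * G2 h)"

lemma nn_pos: "0 < real (nn k)" using nn16[of k] by simp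

lemma al_pos: "0 < al k" unfolding al_def using nn_pos by simp
lemma ga_pos: "0 < ga k" unfolding ga_def using nn_pos by simp
lemma al_ga: "al k * ga k = (real (nn k))\<^sup>2" using nn_pos[of k] by (simp add: al_def ga_def power2_eq_square)
lemma finite_J [simp]: "finite (J k)" by (simp add: J_def)
lemma J_less: "j \<in> J k \<Longrightarrow> j < nn k" by (auto simp: J_def)

lemma nn_real_lim: "filterlim (\<lambda>k. real (nn k)) at_top sequentially"
  by (rule filterlim_compose[OF filterlim_real_sequentially nn_lim])

lemma abs_iweight_le: "j < nn k \<Longrightarrow> \<bar>real_of_int (iweight (nn k) j)\<bar> \<le> real (nn k)"
  by (auto simp: iweight_def abs_le_iff)

lemma abs_tau_le: "j < nn k \<Longrightarrow> \<bar>tau k j\<bar> \<le> hh k / 2"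
  unfolding tau_def using hh(1)[of k] by (intro cweight_tilt_bound) auto

lemma tau_bound: "j < nn k \<Longrightarrow> \<bar>tau k j\<bar> < \<beta> / 2"
  using abs_tau_le[of j k] hh(2)[of k] by linarith

text \<open>The block is symmetric about the centre and the tilts are antisymmetric, so the end point has mean
  zero.\<close>

lemma sum_lam1_J: "(\<Sum>j\<in>J k. lam1 (tau k j)) = 0"
proof -
  have "(\<Sum>j\<in>J k. lam1 (tau k j)) = (\<Sum>j\<in>J k. lam1 (tau k (nn k - 1 - j)))"
    by (rule sum.reindex_bij_witness[of _ "\<lambda>j. nn k - 1 - j" "\<lambda>j. nn k - 1 - j"])
      (auto simp: J_def)
  also have "\<dots> = (\<Sum>j\<in>J k. - lam1 (tau k j))"
  proof (intro sum.cong refl)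
    fix j assume "j \<in> J k"
    then have "j < nn k" by (rule J_less)
    then have "cweight (nn k) (nn k - 1 - j) = - cweight (nn k) j"
      by (simp add: cweight_def of_nat_diff field_simps)
    then show "lam1 (tau k (nn k - 1 - j)) = - lam1 (tau k j)" by (simp add: tau_def)
  qed
  finally show ?thesis by (simp add: sum_negf)
qed

lemma charfun:
  "(\<integral>u. cis (fst p / al k * real_of_int (SS k u - v) + snd p / ga k * real_of_int (TT k u - w)) \<partial>measure_pmf (Middle k)) =
   (\<Prod>j\<in>J k. cf (tau k j) (th k p j)) * cis (- (fst p / al k * real_of_int v + snd p / ga k * real_of_int w))"
proof -
  let ?z = "cis (- (fst p / al k * real_of_int v + snd p / ga k * real_of_int w))"
  have cis_sum: "cis (\<Sum>j\<in>A. f j) = (\<Prod>j\<in>A. cis (f j))" if "finite A" for A :: "nat set" and f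
    using that by (induction A rule: finite_induct) (auto simp: cis_mult[symmetric])
  have 1: "cis (fst p / al k * real_of_int (SS k u - v) + snd p / ga k * real_of_int (TT k u - w)) =
     (\<Prod>j\<in>J k. cis (th k p j * real_of_int (u j))) * ?z" for u
  proof -
    have "(\<Sum>j\<in>J k. th k p j * real_of_int (u j)) = fst p / al k * real_of_int (SS k u) + snd p / ga k * real_of_int (TT k u)"
    proof -
      have "(\<Sum>j\<in>J k. th k p j * real_of_int (u j)) =
        (\<Sum>j\<in>J k. fst p / al k * real_of_int (u j) + snd p / ga k * (real_of_int (iweight (nn k) j) * real_of_int (u j)))"
        by (intro sum.cong refl) (simp add: th_def distrib_right)
      then show ?thesis by (simp add: SS_def TT_def sum_distrib_left sum.distrib)
    qed
    then have "fst p / al k * real_of_int (SS k u - v) + snd p / ga k * real_of_int (TT k u - w) =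
      (\<Sum>j\<in>J k. th k p j * real_of_int (u j)) + - (fst p / al k * real_of_int v + snd p / ga k * real_of_int w)"
      by (simp add: right_diff_distrib)
    then show ?thesis unfolding cis_sum[OF finite_J, symmetric] cis_mult by simp
  qed
  have 2: "(\<integral>u. (\<Prod>j\<in>J k. cis (th k p j * real_of_int (u j))) \<partial>measure_pmf (Middle k)) =
     (\<Prod>j\<in>J k. \<integral>u. cis (th k p j * real_of_int (u j)) \<partial>measure_pmf (Middle k))"
  proof (rule prob_space.indep_vars_lebesgue_integral[OF measure_pmf.prob_space_axioms finite_J])
    show "prob_space.indep_vars (Middle k) (\<lambda>_. borel) (\<lambda>j u. cis (th k p j * real_of_int (u j))) (J k)"
    proof -
      have "prob_space.indep_vars (Middle k) (\<lambda>_. count_space UNIV) (\<lambda>x f. f x) (J k)"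
        unfolding Middle_def by (rule indep_vars_Pi_pmf) simp
      from prob_space.indep_vars_compose2[OF measure_pmf.prob_space_axioms this,
          of "\<lambda>j x. cis (th k p j * real_of_int x)" "\<lambda>_. borel"]
      show ?thesis by simp
    qed
    show "integrable (measure_pmf (Middle k)) (\<lambda>u. cis (th k p j * real_of_int (u j)))" for j
      by (rule measure_pmf.integrable_const_bound[of _ 1]) auto
  qed
  also have "\<dots> = (\<Prod>j\<in>J k. cf (tau k j) (th k p j))"
  proof (intro prod.cong refl)
    fix j assume j: "j \<in> J k"
    have M: "map_pmf (\<lambda>f. f j) (Middle k) = tilted_law \<beta> (tau k j)"
      unfolding Middle_def by (subst Pi_pmf_component[OF finite_J]) (use j in simp)
    show "(\<integral>u. cis (th k p j * real_of_int (u j)) \<partial>measure_pmf (Middle k)) = cf (tau k j) (th k p j)"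
      unfolding cf_def M[symmetric] integral_map_pmf ..
  qed
  finally show ?thesis unfolding 1 by simp
qed

lemma fourier_Middle:
  "complex_of_real (4 * pi\<^sup>2 * (real (nn k))\<^sup>2 * measure (Middle k) {u. SS k u = v \<and> TT k u = w}) =
    (\<integral>p. Psi k p * cis (- (fst p * (real_of_int v / al k) + snd p * ((real_of_int w - mu k) / ga k))) \<partial>(lborel \<Otimes>\<^sub>M lborel))"
proof -
  have e: "4 * pi\<^sup>2 * (real (nn k))\<^sup>2 * measure (Middle k) {u. SS k u = v \<and> TT k u = w} =
     4 * pi\<^sup>2 * al k * ga k * measure (Middle k) {u. SS k u = v \<and> TT k u = w}"
    unfolding al_ga[symmetric] by simp
  show ?thesis
    unfolding e fourier_inversion_pair[OF al_pos ga_pos, symmetric] charfun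
  proof (intro Bochner_Integration.integral_cong refl)
    fix p :: "real \<times> real"
    have "- (snd p / ga k) * mu k + - (fst p * (real_of_int v / al k) + snd p * ((real_of_int w - mu k) / ga k)) =
      - (fst p / al k * real_of_int v + snd p / ga k * real_of_int w)"
      by (simp add: right_diff_distrib diff_divide_distrib)
    then show "indicator (fbox (al k) (ga k)) p *\<^sub>R ((\<Prod>j\<in>J k. cf (tau k j) (th k p j)) * cis (- (fst p / al k * real_of_int v + snd p / ga k * real_of_int w))) =
       Psi k p * cis (- (fst p * (real_of_int v / al k) + snd p * ((real_of_int w - mu k) / ga k)))"
      unfolding Psi_def by (simp only: scaleR_left_commute mult_scaleR_left mult.assoc cis_mult)
  qed
qed

text \<open>Each factor is bounded by the tilt-independent estimate, and the steps with weights
  \<open>-r..r\<close>, \<open>r = nn div 4\<close>, lie in the block and already give enough decay.\<close>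

lemma norm_Psi_box:
  assumes p: "p \<in> fbox (al k) (ga k)"
  shows "norm (Psi k p) \<le> exp (- (min (((fst p)\<^sup>2 + (snd p)\<^sup>2) / 512) (real (nn k) / 8) / (3456 * Cb)))"
proof -
  let ?n = "nn k"
  define t1 t2 where "t1 = fst p / al k" and "t2 = snd p / ga k"
  have "fst p \<in> {-(pi * al k)..pi * al k}" "snd p \<in> {-(pi * ga k)..pi * ga k}" using p by (auto simp: mem_Times_iff)
  then have t: "\<bar>t1\<bar> \<le> pi" "\<bar>t2\<bar> \<le> pi"
    using al_pos[of k] ga_pos[of k] by (auto simp: t1_def t2_def abs_le_iff field_simps)
  define r where "r = ?n div 4"
  have r: "1 \<le> r" "real ?n / 8 \<le> real r" using nn16[of k] unfolding r_def by linarith+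
  \<comment> \<open>The step whose integer weight is \<open>k'\<close>.\<close>
  define i where "i k' = nat (int (?n div 2) - k')" for k'
  have i: "i k' \<in> J k" "iweight ?n (i k') = k'" if "k' \<in> {- int r..int r}" for k'
  proof -
    have m: "8 * mm k \<le> ?n" "16 \<le> ?n" using mm8 nn16 by auto
    have "int (?n div 2) - k' \<ge> int (?n div 2) - int r" "int (?n div 2) - k' \<le> int (?n div 2) + int r" using that by auto
    moreover have "int (?n div 2) - int r \<ge> int (mm k)" "int (?n div 2) + int r < int ?n - int (mm k)"
      using m unfolding r_def by linarith+
    ultimately show "i k' \<in> J k" "iweight ?n (i k') = k'" unfolding i_def J_def iweight_def by auto
  qed
  have inj: "inj_on i {- int r..int r}" by (rule inj_on_inverseI[of _ "iweight ?n"]) (rule i(2))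
  have th: "th k p j = t1 + real_of_int (iweight ?n j) * t2" for j by (simp add: th_def t1_def t2_def)
  have "norm (Psi k p) = (\<Prod>j\<in>J k. norm (cf (tau k j) (th k p j)))"
    unfolding Psi_def using p by (simp add: norm_mult prod_norm)
  also have "\<dots> \<le> (\<Prod>j\<in>J k. exp (- ((1 - cos (th k p j)) / (3 * Cb))))"
    by (intro prod_mono conjI norm_cf_le tau_bound J_less) auto
  also have "\<dots> = exp (- ((\<Sum>j\<in>J k. 1 - cos (th k p j)) / (3 * Cb)))"
    by (simp add: exp_sum[symmetric] sum_negf sum_divide_distrib)
  also have "\<dots> \<le> exp (- (min (((fst p)\<^sup>2 + (snd p)\<^sup>2) / 512) (real ?n / 8) / (3456 * Cb)))"
  proof -
    have "min (real r * t1\<^sup>2 + real r ^ 3 * t2\<^sup>2) (real r) / 1152 \<le> (\<Sum>k'\<in>{- int r..int r}. 1 - cos (t1 + real_of_int k' * t2))"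
      by (rule sum_one_minus_cos_block[OF r(1) t])
    also have "\<dots> = (\<Sum>j\<in>i ` {- int r..int r}. 1 - cos (th k p j))"
      unfolding sum.reindex[OF inj] o_def th by (intro sum.cong refl) (simp add: i)
    also have "\<dots> \<le> (\<Sum>j\<in>J k. 1 - cos (th k p j))"
      using i by (intro sum_mono2) auto
    finally have 1: "min (real r * t1\<^sup>2 + real r ^ 3 * t2\<^sup>2) (real r) / 1152 \<le> (\<Sum>j\<in>J k. 1 - cos (th k p j))" .
    have "(fst p)\<^sup>2 / 8 \<le> real r * t1\<^sup>2"
    proof -
      have "(fst p)\<^sup>2 = real ?n * t1\<^sup>2" using nn_pos[of k] by (simp add: t1_def al_def power_divide)
      then have "(fst p)\<^sup>2 / 8 = (real ?n / 8) * t1\<^sup>2" by simp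
      also have "\<dots> \<le> real r * t1\<^sup>2" using r by (intro mult_right_mono) auto
      finally show ?thesis .
    qed
    moreover have "0 \<le> (fst p)\<^sup>2" by simp
    ultimately have 2: "(fst p)\<^sup>2 / 512 \<le> real r * t1\<^sup>2" by linarith
    have 3: "(snd p)\<^sup>2 / 512 \<le> real r ^ 3 * t2\<^sup>2"
    proof -
      have "(snd p)\<^sup>2 = real ?n ^ 3 * t2\<^sup>2" using nn_pos[of k]
        by (simp add: t2_def ga_def power_divide power_mult_distrib power2_eq_square power3_eq_cube)
      then have "(snd p)\<^sup>2 / 512 = (real ?n / 8) ^ 3 * t2\<^sup>2" by (simp add: power_divide)
      also have "\<dots> \<le> real r ^ 3 * t2\<^sup>2" using r by (intro mult_right_mono power_mono) auto
      finally show ?thesis .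
    qed
    have "((fst p)\<^sup>2 + (snd p)\<^sup>2) / 512 \<le> real r * t1\<^sup>2 + real r ^ 3 * t2\<^sup>2"
      using 2 3 by (simp add: add_divide_distrib)
    then have "min (((fst p)\<^sup>2 + (snd p)\<^sup>2) / 512) (real ?n / 8) / 1152 \<le> (\<Sum>j\<in>J k. 1 - cos (th k p j))"
      using 1 r(2) by (smt (verit) divide_right_mono min.mono)
    then have "min (((fst p)\<^sup>2 + (snd p)\<^sup>2) / 512) (real ?n / 8) / 1152 / (3 * Cb) \<le> (\<Sum>j\<in>J k. 1 - cos (th k p j)) / (3 * Cb)"
      using Cb_gt_1 by (intro divide_right_mono) auto
    then show ?thesis by simp
  qed
  finally show ?thesis .
qed

text \<open>An integrable majorant that does not depend on \<open>k\<close>. Where the quadratic term is the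
  smaller one, the bound is Gaussian; elsewhere it is exponentially small in \<open>nn\<close>, which beats the
  polynomial size of the box.\<close>

lemma Psi_dominated:
  obtains C where "0 \<le> C" "\<And>k p. norm (Psi k p) \<le> C * (inverse (1 + (fst p)\<^sup>2) * inverse (1 + (snd p)\<^sup>2))"
proof -
  define c where "c = 1 / (3456 * Cb)"
  have c: "0 < c" "c \<le> 1" using Cb_gt_1 by (auto simp: c_def)
  define c' where "c' = c / 512"
  have c': "0 < c'" "c' \<le> 1" using c by (auto simp: c'_def)
  have "(\<lambda>n. (1 + pi\<^sup>2 * real n) * (1 + pi\<^sup>2 * real n ^ 3) * exp (- (c * real n / 8))) \<longlonglongrightarrow> 0"
    using c(1) by real_asymp
  then have "Bseq (\<lambda>n. (1 + pi\<^sup>2 * real n) * (1 + pi\<^sup>2 * real n ^ 3) * exp (- (c * real n / 8)))"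
    by (intro convergent_imp_Bseq) (auto simp: convergent_def)
  then obtain C1 where C1: "0 < C1" "\<And>n. norm ((1 + pi\<^sup>2 * real n) * (1 + pi\<^sup>2 * real n ^ 3) * exp (- (c * real n / 8))) \<le> C1"
    by (rule BseqE) blast
  define C where "C = 1 / c'\<^sup>2 + C1"
  have gauss_le: "(1 + x\<^sup>2) * exp (- c' * x\<^sup>2) \<le> 1 / c'" for x :: real
  proof -
    have "c' * (1 + x\<^sup>2) \<le> 1 + c' * x\<^sup>2" using c' by (simp add: distrib_left)
    also have "\<dots> \<le> exp (c' * x\<^sup>2)" by (rule exp_ge_add_one_self)
    finally have "c' * (1 + x\<^sup>2) * exp (- c' * x\<^sup>2) \<le> exp (c' * x\<^sup>2) * exp (- c' * x\<^sup>2)" by (intro mult_right_mono) auto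
    then have "c' * ((1 + x\<^sup>2) * exp (- c' * x\<^sup>2)) \<le> 1" by (simp add: mult.assoc flip: exp_add)
    then show ?thesis using c' by (simp add: field_simps)
  qed
  show ?thesis
  proof (rule that[of C])
    show "0 \<le> C" using c' C1 by (simp add: C_def)
    fix k and p :: "real \<times> real"
    obtain x y where xy: "p = (x, y)" by (cases p)
    have pos: "0 < (1 + x\<^sup>2) * (1 + y\<^sup>2)" by (intro mult_pos_pos add_pos_nonneg) auto
    have "norm (Psi k p) * ((1 + x\<^sup>2) * (1 + y\<^sup>2)) \<le> C"
    proof (cases "p \<in> fbox (al k) (ga k)")
      case True
      have "norm (Psi k p) \<le> exp (- (c * min ((x\<^sup>2 + y\<^sup>2) / 512) (real (nn k) / 8)))"
        using norm_Psi_box[OF True] unfolding xy c_def by simp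
      also have "\<dots> \<le> exp (- c' * x\<^sup>2) * exp (- c' * y\<^sup>2) + exp (- (c * real (nn k) / 8))"
      proof (cases "(x\<^sup>2 + y\<^sup>2) / 512 \<le> real (nn k) / 8")
        case T: True
        have "exp (- (c * min ((x\<^sup>2 + y\<^sup>2) / 512) (real (nn k) / 8))) = exp (- c' * x\<^sup>2) * exp (- c' * y\<^sup>2)"
          unfolding min_absorb1[OF T] by (simp add: c'_def field_simps flip: exp_add)
        then show ?thesis by simp
      next
        case F: False
        then have m: "min ((x\<^sup>2 + y\<^sup>2) / 512) (real (nn k) / 8) = real (nn k) / 8" by simp
        show ?thesis unfolding m by simp
      qed
      finally have "norm (Psi k p) * ((1 + x\<^sup>2) * (1 + y\<^sup>2)) \<le> (exp (- c' * x\<^sup>2) * exp (- c' * y\<^sup>2) + exp (- (c * real (nn k) / 8))) * ((1 + x\<^sup>2) * (1 + y\<^sup>2))"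
        using pos by (intro mult_right_mono) auto
      also have "\<dots> = ((1 + x\<^sup>2) * exp (- c' * x\<^sup>2)) * ((1 + y\<^sup>2) * exp (- c' * y\<^sup>2)) + (1 + x\<^sup>2) * (1 + y\<^sup>2) * exp (- (c * real (nn k) / 8))"
        by (simp add: algebra_simps)
      also have "\<dots> \<le> (1 / c') * (1 / c') + C1"
      proof (intro add_mono mult_mono gauss_le)
        have "\<bar>x\<bar> \<le> pi * al k" "\<bar>y\<bar> \<le> pi * ga k" using True unfolding xy by (auto simp: abs_le_iff)
        then have "\<bar>x\<bar>\<^sup>2 \<le> (pi * al k)\<^sup>2" "\<bar>y\<bar>\<^sup>2 \<le> (pi * ga k)\<^sup>2" by (intro power_mono; simp)+
        then have "x\<^sup>2 \<le> pi\<^sup>2 * real (nn k)" "y\<^sup>2 \<le> pi\<^sup>2 * real (nn k) ^ 3"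
        proof -
          have "(pi * al k)\<^sup>2 = pi\<^sup>2 * real (nn k)" using nn_pos[of k] by (simp add: al_def power_mult_distrib)
          moreover have "(pi * ga k)\<^sup>2 = pi\<^sup>2 * real (nn k) ^ 3"
            using nn_pos[of k] by (simp add: ga_def power_mult_distrib) (simp add: power2_eq_square power3_eq_cube)
          moreover assume "\<bar>x\<bar>\<^sup>2 \<le> (pi * al k)\<^sup>2" "\<bar>y\<bar>\<^sup>2 \<le> (pi * ga k)\<^sup>2"
          ultimately show "x\<^sup>2 \<le> pi\<^sup>2 * real (nn k)" "y\<^sup>2 \<le> pi\<^sup>2 * real (nn k) ^ 3" by simp_all
        qed
        then have "(1 + x\<^sup>2) * (1 + y\<^sup>2) * exp (- (c * real (nn k) / 8)) \<le> (1 + pi\<^sup>2 * real (nn k)) * (1 + pi\<^sup>2 * real (nn k) ^ 3) * exp (- (c * real (nn k) / 8))"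
          by (intro mult_right_mono mult_mono) auto
        also have "\<dots> \<le> C1" using C1(2)[of "nn k"] by simp
        finally show "(1 + x\<^sup>2) * (1 + y\<^sup>2) * exp (- (c * real (nn k) / 8)) \<le> C1" .
      qed (use c' in auto)
      finally show ?thesis by (simp add: C_def power2_eq_square)
    next
      case False
      then show ?thesis using c' C1 by (simp add: Psi_def C_def)
    qed
    then have "norm (Psi k p) \<le> C / ((1 + x\<^sup>2) * (1 + y\<^sup>2))" using pos by (simp add: pos_le_divide_eq)
    then show "norm (Psi k p) \<le> C * (inverse (1 + (fst p)\<^sup>2) * inverse (1 + (snd p)\<^sup>2))"
      unfolding xy by (simp add: divide_inverse)
  qed
qed

text \<open>Macroscopic coordinates: step \<open>\<lfloor>n t\<rfloor>\<close> has relative weight \<open>1/2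
  - t\<close>, tilt close to \<open>h (1/2 - t)\<close>, and eventually lies in the block.\<close>

lemma profile_limits:
  assumes t: "0 < t" "t < 1"
  defines "j \<equiv> \<lambda>k. nat \<lfloor>real (nn k) * t\<rfloor>"
  shows "(\<lambda>k. real_of_int (iweight (nn k) (j k)) / real (nn k)) \<longlonglongrightarrow> 1/2 - t"
    and "(\<lambda>k. tau k (j k)) \<longlonglongrightarrow> h * (1/2 - t)"
    and "eventually (\<lambda>k. j k \<in> J k) sequentially"
proof -
  have jl: "(\<lambda>k. real (j k) / real (nn k)) \<longlonglongrightarrow> t"
    unfolding j_def using t by (intro floor_ratio_tendsto nn_lim order_trans[OF _ nn16]) auto
  have inv: "(\<lambda>k. 1 / real (nn k)) \<longlonglongrightarrow> 0"
    by (intro tendsto_divide_0[OF tendsto_const] filterlim_at_top_imp_at_infinity nn_real_lim)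
  have half: "(\<lambda>k. real (nn k div 2) / real (nn k)) \<longlonglongrightarrow> 1/2"
  proof -
    have e: "nat \<lfloor>real (nn k) * (1/2)\<rfloor> = nn k div 2" for k
      using floor_divide_of_nat_eq[of "nn k" 2, where 'a = real] by simp
    show ?thesis using floor_ratio_tendsto[OF nn_lim order_trans[OF _ nn16], of "1/2"] unfolding e by simp
  qed
  have "(\<lambda>k. real (nn k div 2) / real (nn k) - real (j k) / real (nn k)) \<longlonglongrightarrow> 1/2 - t"
    by (intro tendsto_diff half jl)
  then show "(\<lambda>k. real_of_int (iweight (nn k) (j k)) / real (nn k)) \<longlonglongrightarrow> 1/2 - t"
    by (simp add: iweight_def diff_divide_distrib)
  have "(\<lambda>k. hh k * (1/2 - 1 / real (nn k) / 2 - real (j k) / real (nn k))) \<longlonglongrightarrow> h * (1/2 - 0/2 - t)"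
    by (intro tendsto_intros hh_lim inv jl) auto
  moreover have "hh k * (1/2 - 1 / real (nn k) / 2 - real (j k) / real (nn k)) = tau k (j k)" for k
    using nn_pos[of k] by (simp add: tau_def cweight_def field_simps)
  ultimately show "(\<lambda>k. tau k (j k)) \<longlonglongrightarrow> h * (1/2 - t)" by simp
  define e where "e = min t (1 - t)"
  have e: "0 < e" using t by (simp add: e_def)
  have "eventually (\<lambda>k. real (mm k) / real (nn k) < e / 2) sequentially"
    using order_tendstoD(2)[OF mm_ratio, of "e/2"] e by simp
  moreover have "eventually (\<lambda>k. t - e / 2 < real (j k) / real (nn k)) sequentially"
    by (rule order_tendstoD(1)[OF jl]) (use e in simp)
  moreover have "eventually (\<lambda>k. real (j k) / real (nn k) < t + e / 2) sequentially"
    by (rule order_tendstoD(2)[OF jl]) (use e in simp)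
  ultimately show "eventually (\<lambda>k. j k \<in> J k) sequentially"
  proof eventually_elim
    case (elim k)
    have te: "e \<le> t" "e \<le> 1 - t" by (auto simp: e_def)
    have "real (mm k) / real (nn k) < real (j k) / real (nn k)" using elim te by linarith
    then have 1: "real (mm k) < real (j k)" using nn_pos[of k] by (simp add: divide_less_cancel)
    have "real (j k) / real (nn k) + real (mm k) / real (nn k) < 1" using elim te by linarith
    then have "real (j k) + real (mm k) < real (nn k)" using nn_pos[of k] by (simp add: field_simps)
    then show ?case using 1 unfolding J_def by auto
  qed
qed

text \<open>The Riemann sum converges to the quadratic form of the limiting covariance matrix, whose
  off-diagonal entry is the odd moment.\<close>

lemma variance_limit:
  "(\<lambda>k. \<Sum>j\<in>J k. (th k p j)\<^sup>2 * lam2 (tau k j)) \<longlonglongrightarrow> V0 h * (fst p)\<^sup>2 + G2 h * (snd p)\<^sup>2"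
proof -
  \<comment> \<open>The summand is extended by 0 from the block to all steps, which does not affect the limit of the Riemann sum.\<close>
  obtain x y where p: "p = (x, y)" by (cases p)
  define F where "F k j = indicator (J k) j * ((x + real_of_int (iweight (nn k) j) / real (nn k) * y)\<^sup>2 * lam2 (tau k j))" for k j
  define r where "r = (SOME r. 0 \<le> r \<and> r < \<beta> / 2 \<and> (\<forall>k. hh k / 2 \<le> r))"
  have "\<exists>r. 0 \<le> r \<and> r < \<beta> / 2 \<and> (\<forall>k. hh k / 2 \<le> r)"
  proof -
    have "eventually (\<lambda>k. hh k < (h + \<beta>) / 2) sequentially"
      using order_tendstoD(2)[OF hh_lim, of "(h + \<beta>) / 2"] h by simp
    then obtain N where N: "\<And>k. N \<le> k \<Longrightarrow> hh k < (h + \<beta>) / 2" by (auto simp: eventually_sequentially)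
    define M where "M = Max (insert ((h + \<beta>) / 2) (hh ` {..<N}))"
    have "M < \<beta>" unfolding M_def using hh h by (subst Max_less_iff) auto
    moreover have "hh k \<le> M" for k
    proof (cases "k < N")
      case True
      then show ?thesis unfolding M_def by (intro Max_ge) auto
    next
      case False
      then have "hh k \<le> (h + \<beta>) / 2" using N[of k] by simp
      also have "\<dots> \<le> M" unfolding M_def by (intro Max_ge) auto
      finally show ?thesis .
    qed
    moreover from this[of 0] have "0 \<le> M" using hh(1)[of 0] by linarith
    ultimately show ?thesis by (intro exI[of _ "M / 2"]) auto
  qed
  from someI_ex[OF this] have r: "0 \<le> r" "r < \<beta> / 2" "\<And>k. hh k / 2 \<le> r" unfolding r_def by auto
  have l2: "0 \<le> lam2 (tau k j)" "lam2 (tau k j) \<le> lam2 r" if "j < nn k" for k j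
    using lam2_pos[OF tau_bound[OF that]] lam2_mono[of "tau k j" r] abs_tau_le[OF that] r(2) r(3)[of k] by auto
  have l2r: "0 \<le> lam2 r" using lam2_pos[of r] r by simp
  have "(\<lambda>k. (\<Sum>j<nn k. F k j) / real (nn k)) \<longlonglongrightarrow> integral {0..1} (\<lambda>t. (x + (1/2 - t) * y)\<^sup>2 * lam2 (h * (1/2 - t)))"
  proof (rule riemann_floor_tendsto[where B = "(\<bar>x\<bar> + \<bar>y\<bar>)\<^sup>2 * lam2 r"])
    show "1 \<le> nn k" for k using nn16[of k] by simp
    fix k j assume j: "j < nn k"
    have "\<bar>x + real_of_int (iweight (nn k) j) / real (nn k) * y\<bar> \<le> \<bar>x\<bar> + \<bar>real_of_int (iweight (nn k) j)\<bar> / real (nn k) * \<bar>y\<bar>"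
      by (rule order_trans[OF abs_triangle_ineq]) (simp add: abs_mult)
    also have "\<dots> \<le> \<bar>x\<bar> + 1 * \<bar>y\<bar>"
      using abs_iweight_le[OF j] nn_pos[of k] by (intro add_mono mult_right_mono) auto
    finally have "\<bar>x + real_of_int (iweight (nn k) j) / real (nn k) * y\<bar>\<^sup>2 \<le> (\<bar>x\<bar> + \<bar>y\<bar>)\<^sup>2" by (intro power_mono) auto
    then have "(x + real_of_int (iweight (nn k) j) / real (nn k) * y)\<^sup>2 * lam2 (tau k j) \<le> (\<bar>x\<bar> + \<bar>y\<bar>)\<^sup>2 * lam2 r"
      using l2[OF j] by (intro mult_mono) auto
    then show "\<bar>F k j\<bar> \<le> (\<bar>x\<bar> + \<bar>y\<bar>)\<^sup>2 * lam2 r"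
      using l2[OF j] l2r by (auto simp: F_def indicator_def abs_mult)
  next
    fix t :: real assume t: "0 < t" "t < 1"
    let ?j = "\<lambda>k. nat \<lfloor>real (nn k) * t\<rfloor>"
    note L = profile_limits[OF t]
    have "\<bar>h * (1/2 - t)\<bar> < \<beta> / 2" using arg_bound[OF hb, of t] t by simp
    then have "isCont lam2 (h * (1/2 - t))"
      unfolding lam2_def[abs_def] using Cb_minus_cosh_pos by (intro continuous_intros) force
    then have "(\<lambda>k. lam2 (tau k (?j k))) \<longlonglongrightarrow> lam2 (h * (1/2 - t))" using L(2) by (rule isCont_tendsto_compose)
    then have "(\<lambda>k. (x + real_of_int (iweight (nn k) (?j k)) / real (nn k) * y)\<^sup>2 * lam2 (tau k (?j k))) \<longlonglongrightarrow> (x + (1/2 - t) * y)\<^sup>2 * lam2 (h * (1/2 - t))"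
      by (intro tendsto_intros L)
    then show "(\<lambda>k. F k (?j k)) \<longlonglongrightarrow> (x + (1/2 - t) * y)\<^sup>2 * lam2 (h * (1/2 - t))"
      by (rule Lim_transform_eventually) (use L(3) in \<open>auto elim!: eventually_mono simp: F_def\<close>)
  next
    show "continuous_on {0..1} (\<lambda>t. (x + (1/2 - t) * y)\<^sup>2 * lam2 (h * (1/2 - t)))"
      by (intro continuous_intros arg_bound[OF hb])
  qed
  moreover have "integral {0..1} (\<lambda>t. (x + (1/2 - t) * y)\<^sup>2 * lam2 (h * (1/2 - t))) = V0 h * x\<^sup>2 + G2 h * y\<^sup>2"
  proof -
    note ii = integrable_continuous_real continuous_intros arg_bound[OF hb]
    let ?l = "\<lambda>t. lam2 (h * (1/2 - t))"
    have i0: "(?l has_integral V0 h) {0..1}" unfolding V0_def by (intro integrable_integral ii)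
    have i1: "((\<lambda>t. (1/2 - t) * ?l t) has_integral 0) {0..1}"
    proof -
      have "(\<lambda>t. (1/2 - t) * ?l t) integrable_on {0..1}" by (intro ii)
      from integrable_integral[OF this] show ?thesis unfolding odd_moment_zero[OF hb] .
    qed
    have i2: "((\<lambda>t. (1/2 - t)\<^sup>2 * ?l t) has_integral G2 h) {0..1}" unfolding G2_def by (intro integrable_integral ii)
    have "((\<lambda>t. x\<^sup>2 * ?l t + 2 * x * y * ((1/2 - t) * ?l t) + y\<^sup>2 * ((1/2 - t)\<^sup>2 * ?l t)) has_integral (x\<^sup>2 * V0 h + 2 * x * y * 0 + y\<^sup>2 * G2 h)) {0..1}"
      by (intro has_integral_add has_integral_mult_right i0 i1 i2)
    moreover have "x\<^sup>2 * ?l t + 2 * x * y * ((1/2 - t) * ?l t) + y\<^sup>2 * ((1/2 - t)\<^sup>2 * ?l t) = (x + (1/2 - t) * y)\<^sup>2 * ?l t" for t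
      by (simp add: power2_eq_square algebra_simps)
    ultimately show ?thesis by (simp add: integral_unique mult.commute)
  qed
  moreover have "(\<Sum>j<nn k. F k j) / real (nn k) = (\<Sum>j\<in>J k. (th k p j)\<^sup>2 * lam2 (tau k j))" for k
  proof -
    have "(\<Sum>j<nn k. F k j) = (\<Sum>j\<in>J k. (x + real_of_int (iweight (nn k) j) / real (nn k) * y)\<^sup>2 * lam2 (tau k j))"
      by (rule sum.mono_neutral_cong_right) (auto simp: F_def indicator_def dest: J_less)
    moreover have "(x + real_of_int (iweight (nn k) j) / real (nn k) * y)\<^sup>2 / real (nn k) = (th k p j)\<^sup>2" for j
    proof -
      have "th k p j = (x + real_of_int (iweight (nn k) j) / real (nn k) * y) / sqrt (real (nn k))"
        using nn_pos[of k] by (simp add: th_def p al_def ga_def field_simps)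
      then show ?thesis using nn_pos[of k] by (simp add: power_divide)
    qed
    ultimately show ?thesis by (simp add: sum_divide_distrib flip: times_divide_eq_left)
  qed
  ultimately show ?thesis by (simp add: p)
qed

lemma Psi_tendsto: "(\<lambda>k. Psi k p) \<longlonglongrightarrow> complex_of_real (gauss p)"
proof -
  obtain x y where p: "p = (x, y)" by (cases p)
  define r where "r = (h + \<beta>) / 4"
  have r: "0 \<le> r" "r < \<beta> / 2" "h / 2 < r" using h by (auto simp: r_def)
  obtain B where B: "0 \<le> B" "\<And>\<tau> \<theta>. \<bar>\<tau>\<bar> \<le> r \<Longrightarrow> norm (cf_remainder \<tau> \<theta>) \<le> B * \<bar>\<theta>\<bar> ^ 3"
    using norm_cf_remainder_le[OF r(1,2)] by blast
  have ev_h: "eventually (\<lambda>k. hh k / 2 \<le> r) sequentially"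
    using order_tendstoD(2)[OF hh_lim, of "2 * r"] r by (auto elim!: eventually_mono)
  have "filterlim (\<lambda>k. pi * al k) at_top sequentially" "filterlim (\<lambda>k. pi * ga k) at_top sequentially"
  proof -
    have a: "filterlim al at_top sequentially" unfolding al_def[abs_def]
      by (rule filterlim_compose[OF sqrt_at_top nn_real_lim])
    show "filterlim (\<lambda>k. pi * al k) at_top sequentially"
      by (rule filterlim_tendsto_pos_mult_at_top[OF tendsto_const pi_gt_zero a])
    have "filterlim ga at_top sequentially" unfolding ga_def[abs_def]
      by (rule filterlim_at_top_mult_at_top[OF nn_real_lim a[unfolded al_def[abs_def]]])
    then show "filterlim (\<lambda>k. pi * ga k) at_top sequentially"
      by (rule filterlim_tendsto_pos_mult_at_top[OF tendsto_const pi_gt_zero])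
  qed
  then have "eventually (\<lambda>k. \<bar>x\<bar> \<le> pi * al k) sequentially" "eventually (\<lambda>k. \<bar>y\<bar> \<le> pi * ga k) sequentially"
    by (auto simp: filterlim_at_top)
  then have ev_box: "eventually (\<lambda>k. p \<in> fbox (al k) (ga k)) sequentially"
    by eventually_elim (auto simp: p abs_le_iff)
  define Q where "Q k = (\<Sum>j\<in>J k. (th k p j)\<^sup>2 * lam2 (tau k j))" for k
  define R where "R k = (\<Sum>j\<in>J k. cf_remainder (tau k j) (th k p j))" for k
  have Psi: "Psi k p = exp (- complex_of_real (Q k / 2) + R k)" if "p \<in> fbox (al k) (ga k)" for k
  proof -
    have "(\<Prod>j\<in>J k. cf (tau k j) (th k p j)) =
      exp (\<Sum>j\<in>J k. \<i> * complex_of_real (th k p j * lam1 (tau k j)) - complex_of_real ((th k p j)\<^sup>2 * lam2 (tau k j) / 2) + cf_remainder (tau k j) (th k p j))"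
      unfolding exp_sum[OF finite_J] by (intro prod.cong refl cf_exp tau_bound J_less)
    also have "(\<Sum>j\<in>J k. \<i> * complex_of_real (th k p j * lam1 (tau k j)) - complex_of_real ((th k p j)\<^sup>2 * lam2 (tau k j) / 2) + cf_remainder (tau k j) (th k p j)) =
      \<i> * complex_of_real (\<Sum>j\<in>J k. th k p j * lam1 (tau k j)) - complex_of_real (Q k / 2) + R k"
      by (simp add: sum.distrib sum_subtractf sum_distrib_left Q_def R_def sum_divide_distrib)
    also have "(\<Sum>j\<in>J k. th k p j * lam1 (tau k j)) = snd p / ga k * mu k"
    proof -
      have "(\<Sum>j\<in>J k. th k p j * lam1 (tau k j)) = fst p / al k * (\<Sum>j\<in>J k. lam1 (tau k j)) + snd p / ga k * mu k"
      proof -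
        have "(\<Sum>j\<in>J k. th k p j * lam1 (tau k j)) =
          (\<Sum>j\<in>J k. fst p / al k * lam1 (tau k j) + snd p / ga k * (real_of_int (iweight (nn k) j) * lam1 (tau k j)))"
          by (intro sum.cong refl) (simp add: th_def distrib_right)
        then show ?thesis by (simp add: mu_def sum_distrib_left sum.distrib)
      qed
      then show ?thesis by (simp add: sum_lam1_J)
    qed
    finally have "Psi k p = exp (\<i> * complex_of_real (snd p / ga k * mu k) - complex_of_real (Q k / 2) + R k) * exp (\<i> * complex_of_real (- (snd p / ga k) * mu k))"
      using that by (simp add: Psi_def cis_conv_exp)
    then show ?thesis unfolding exp_add[symmetric] by simp
  qed
  have Rlim: "R \<longlonglongrightarrow> 0"
  proof (rule Lim_null_comparison)
    show "eventually (\<lambda>k. norm (R k) \<le> B * (\<bar>x\<bar> + \<bar>y\<bar>) ^ 3 * (1 / sqrt (real (nn k)))) sequentially"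
      using ev_h
    proof eventually_elim
      case (elim k)
      have s: "0 < sqrt (real (nn k))" using nn_pos[of k] by simp
      have th: "\<bar>th k p j\<bar> \<le> (\<bar>x\<bar> + \<bar>y\<bar>) / sqrt (real (nn k))" if "j \<in> J k" for j
      proof -
        have "th k p j = (x + real_of_int (iweight (nn k) j) / real (nn k) * y) / sqrt (real (nn k))"
          using nn_pos[of k] by (simp add: th_def p al_def ga_def field_simps)
        moreover have "\<bar>x + real_of_int (iweight (nn k) j) / real (nn k) * y\<bar> \<le> \<bar>x\<bar> + 1 * \<bar>y\<bar>"
        proof -
          have "\<bar>x + real_of_int (iweight (nn k) j) / real (nn k) * y\<bar> \<le> \<bar>x\<bar> + \<bar>real_of_int (iweight (nn k) j)\<bar> / real (nn k) * \<bar>y\<bar>"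
            by (rule order_trans[OF abs_triangle_ineq]) (simp add: abs_mult)
          also have "\<dots> \<le> \<bar>x\<bar> + 1 * \<bar>y\<bar>"
            using abs_iweight_le[OF J_less[OF that]] nn_pos[of k] by (intro add_mono mult_right_mono) auto
          finally show ?thesis .
        qed
        ultimately show ?thesis using s by (simp add: divide_right_mono)
      qed
      have "norm (R k) \<le> (\<Sum>j\<in>J k. B * ((\<bar>x\<bar> + \<bar>y\<bar>) / sqrt (real (nn k))) ^ 3)"
        unfolding R_def
      proof (rule sum_norm_le)
        fix j assume j: "j \<in> J k"
        have "\<bar>tau k j\<bar> \<le> r" using abs_tau_le[OF J_less[OF j]] elim by linarith
        from B(2)[OF this] have "norm (cf_remainder (tau k j) (th k p j)) \<le> B * \<bar>th k p j\<bar> ^ 3" .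
        also have "\<dots> \<le> B * ((\<bar>x\<bar> + \<bar>y\<bar>) / sqrt (real (nn k))) ^ 3"
          using B(1) th[OF j] by (intro mult_left_mono power_mono) auto
        finally show "norm (cf_remainder (tau k j) (th k p j)) \<le> B * ((\<bar>x\<bar> + \<bar>y\<bar>) / sqrt (real (nn k))) ^ 3" .
      qed
      also have "\<dots> = real (card (J k)) * (B * ((\<bar>x\<bar> + \<bar>y\<bar>) / sqrt (real (nn k))) ^ 3)" by simp
      also have "\<dots> \<le> real (nn k) * (B * ((\<bar>x\<bar> + \<bar>y\<bar>) / sqrt (real (nn k))) ^ 3)"
        using B(1) s by (intro mult_right_mono mult_nonneg_nonneg zero_le_power) (auto simp: J_def)
      also have "\<dots> = B * (\<bar>x\<bar> + \<bar>y\<bar>) ^ 3 * (1 / sqrt (real (nn k)))"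
      proof -
        have "n * (B * (q / s) ^ 3) = B * q ^ 3 * (1 / s)" if "s * s = n" "0 < s" for n s q :: real
          using that by (auto simp: power_divide power3_eq_cube)
        from this[of "sqrt (real (nn k))" "real (nn k)"] s show ?thesis by simp
      qed
      finally show ?case .
    qed
    have "(\<lambda>k. B * (\<bar>x\<bar> + \<bar>y\<bar>) ^ 3 * (1 / sqrt (real (nn k)))) \<longlonglongrightarrow> B * (\<bar>x\<bar> + \<bar>y\<bar>) ^ 3 * 0"
      by (intro tendsto_intros tendsto_divide_0[OF tendsto_const] filterlim_at_top_imp_at_infinity
          filterlim_compose[OF sqrt_at_top nn_real_lim])
    then show "(\<lambda>k. B * (\<bar>x\<bar> + \<bar>y\<bar>) ^ 3 * (1 / sqrt (real (nn k)))) \<longlonglongrightarrow> 0" by simp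
  qed
  have "(\<lambda>k. exp (- complex_of_real (Q k / 2) + R k)) \<longlonglongrightarrow> exp (- complex_of_real ((V0 h * (fst p)\<^sup>2 + G2 h * (snd p)\<^sup>2) / 2) + 0)"
    unfolding Q_def by (intro tendsto_intros variance_limit Rlim) auto
  also have "exp (- complex_of_real ((V0 h * (fst p)\<^sup>2 + G2 h * (snd p)\<^sup>2) / 2) + 0) = complex_of_real (gauss p)"
  proof -
    have "gauss p = exp (- ((V0 h * (fst p)\<^sup>2 + G2 h * (snd p)\<^sup>2) / 2))"
      by (simp add: gauss_def add_divide_distrib flip: exp_add)
    then show ?thesis unfolding of_real_minus[symmetric] add_0_right exp_of_real by simp
  qed
  finally show ?thesis
    by (rule Lim_transform_eventually) (rule eventually_mono[OF ev_box], simp only: Psi)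
qed

lemma measurable_Psi [measurable]: "Psi k \<in> borel_measurable (lborel \<Otimes>\<^sub>M lborel)"
proof -
  have cf_meas: "cf \<tau> \<in> borel_measurable borel" if "\<bar>\<tau>\<bar> < \<beta> / 2" for \<tau>
  proof (rule borel_measurable_continuous_onI)
    have "continuous_on UNIV (\<lambda>\<theta>. complex_of_real (Cb - cosh \<tau>) / mgf_denom (complex_of_real \<tau> + \<i> * complex_of_real \<theta>))"
    proof -
      have nz: "mgf_denom (complex_of_real \<tau> + \<i> * complex_of_real \<theta>) \<noteq> 0" for \<theta>
        using that by (intro mgf_denom_nz(1)) simp
      show ?thesis by (intro continuous_intros ballI nz)
    qed
    then show "continuous_on UNIV (cf \<tau>)" using cf_eq[OF that] by (simp add: Complex_eq[symmetric] cong: continuous_on_cong)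
  qed
  have cis_meas [measurable]: "cis \<in> borel_measurable borel"
    by (intro borel_measurable_continuous_onI continuous_intros)
  have th_meas [measurable]: "(\<lambda>p. th k p j) \<in> borel_measurable (lborel \<Otimes>\<^sub>M lborel)" for j
    unfolding th_def by measurable
  have "(\<lambda>p. cf (tau k j) (th k p j)) \<in> borel_measurable (lborel \<Otimes>\<^sub>M lborel)" if "j \<in> J k" for j
    using measurable_compose[OF th_meas cf_meas[OF tau_bound[OF J_less[OF that]]]] .
  then have [measurable]: "(\<lambda>p. \<Prod>j\<in>J k. cf (tau k j) (th k p j)) \<in> borel_measurable (lborel \<Otimes>\<^sub>M lborel)"
    by (rule borel_measurable_prod)
  show ?thesis unfolding Psi_def by measurable
qed

lemma gauss_integrable: "integrable (lborel \<Otimes>\<^sub>M lborel) gauss"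
    and gauss_integral: "(\<integral>p. gauss p \<partial>(lborel \<Otimes>\<^sub>M lborel)) = gauss_mass"
    and gauss_moment1: "integrable (lborel \<Otimes>\<^sub>M lborel) (\<lambda>p. \<bar>fst p\<bar> * gauss p)"
    and gauss_moment2: "integrable (lborel \<Otimes>\<^sub>M lborel) (\<lambda>p. \<bar>snd p\<bar> * gauss p)"
proof -
  have v: "0 < V0 h" "0 < G2 h" using V0_pos[OF hb] G2_pos[OF hb] by auto
  have m: "integrable lborel (\<lambda>x. \<bar>x\<bar> * exp (- v * x\<^sup>2 / 2))" if "0 < v" for v :: real
  proof (rule Bochner_Integration.integrable_bound)
    show "integrable lborel (\<lambda>x. (1 + 4 / v) * exp (- (v / 2) * x\<^sup>2 / 2))"
      using that by (intro integrable_mult_right gaussian_integral) simp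
    show "AE x in lborel. norm (\<bar>x\<bar> * exp (- v * x\<^sup>2 / 2)) \<le> norm ((1 + 4 / v) * exp (- (v / 2) * x\<^sup>2 / 2))"
      using abs_le_exp_gauss[OF that] that by (auto simp: abs_mult)
  qed simp
  show "integrable (lborel \<Otimes>\<^sub>M lborel) gauss"
    using product_integral_lborel(1)[OF gaussian_integral(1)[OF v(1)] gaussian_integral(1)[OF v(2)]]
    by (simp add: gauss_def[abs_def])
  have "(\<integral>p. gauss p \<partial>(lborel \<Otimes>\<^sub>M lborel)) = sqrt (2 * pi / V0 h) * sqrt (2 * pi / G2 h)"
    using product_integral_lborel(2)[OF gaussian_integral(1)[OF v(1)] gaussian_integral(1)[OF v(2)]]
    by (simp only: gauss_def gaussian_integral(2)[OF v(1)] gaussian_integral(2)[OF v(2)])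
  also have "\<dots> = gauss_mass"
  proof -
    have "sqrt (2 * pi / V0 h) * sqrt (2 * pi / G2 h) = (sqrt (2 * pi) * sqrt (2 * pi)) / (sqrt (V0 h) * sqrt (G2 h))"
      unfolding real_sqrt_divide by (simp only: times_divide_times_eq)
    also have "sqrt (2 * pi) * sqrt (2 * pi) = 2 * pi" by (rule real_sqrt_mult_self[THEN trans]) simp
    finally show ?thesis unfolding gauss_mass_def real_sqrt_mult .
  qed
  finally show "(\<integral>p. gauss p \<partial>(lborel \<Otimes>\<^sub>M lborel)) = gauss_mass" .
  show "integrable (lborel \<Otimes>\<^sub>M lborel) (\<lambda>p. \<bar>fst p\<bar> * gauss p)"
    using product_integral_lborel(1)[OF m[OF v(1)] gaussian_integral(1)[OF v(2)]]
    by (simp add: gauss_def[abs_def] mult.assoc)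
  show "integrable (lborel \<Otimes>\<^sub>M lborel) (\<lambda>p. \<bar>snd p\<bar> * gauss p)"
    using product_integral_lborel(1)[OF gaussian_integral(1)[OF v(1)] m[OF v(2)]]
    by (simp add: gauss_def[abs_def] mult.left_commute)
qed

lemma Psi_integrable: "integrable (lborel \<Otimes>\<^sub>M lborel) (Psi k)"
  and Psi_L1: "(\<lambda>k. \<integral>p. norm (Psi k p - complex_of_real (gauss p)) \<partial>(lborel \<Otimes>\<^sub>M lborel)) \<longlonglongrightarrow> 0"
proof -
  obtain C where C: "0 \<le> C" "\<And>k p. norm (Psi k p) \<le> C * (inverse (1 + (fst p)\<^sup>2) * inverse (1 + (snd p)\<^sup>2))"
    using Psi_dominated by blast
  let ?w = "\<lambda>p :: real \<times> real. C * (inverse (1 + (fst p)\<^sup>2) * inverse (1 + (snd p)\<^sup>2))"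
  have w: "integrable (lborel \<Otimes>\<^sub>M lborel) ?w"
    by (intro integrable_mult_right product_integral_lborel(1) integrable_inverse_square)
  show "integrable (lborel \<Otimes>\<^sub>M lborel) (Psi k)" for k
    by (rule Bochner_Integration.integrable_bound[OF w]) (use C in \<open>auto intro!: AE_I2 order_trans[OF C(2)]\<close>)
  have [measurable]: "gauss \<in> borel_measurable (lborel \<Otimes>\<^sub>M lborel)" using gauss_integrable by auto
  have "(\<lambda>k. \<integral>p. norm (Psi k p - complex_of_real (gauss p)) \<partial>(lborel \<Otimes>\<^sub>M lborel)) \<longlonglongrightarrow> integral\<^sup>L (lborel \<Otimes>\<^sub>M lborel :: (real \<times> real) measure) (\<lambda>p. 0 :: real)"
  proof (rule integral_dominated_convergence[where w = "\<lambda>p. ?w p + gauss p"])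
    show "integrable (lborel \<Otimes>\<^sub>M lborel) (\<lambda>p. ?w p + gauss p)"
      by (intro Bochner_Integration.integrable_add w gauss_integrable)
    show "AE p in lborel \<Otimes>\<^sub>M lborel. (\<lambda>k. norm (Psi k p - complex_of_real (gauss p))) \<longlonglongrightarrow> 0"
    proof (rule AE_I2)
      fix p
      have "(\<lambda>k. norm (Psi k p - complex_of_real (gauss p))) \<longlonglongrightarrow> norm (complex_of_real (gauss p) - complex_of_real (gauss p))"
        by (intro tendsto_intros Psi_tendsto)
      then show "(\<lambda>k. norm (Psi k p - complex_of_real (gauss p))) \<longlonglongrightarrow> 0" by simp
    qed
    show "AE p in lborel \<Otimes>\<^sub>M lborel. norm (norm (Psi k p - complex_of_real (gauss p))) \<le> ?w p + gauss p" for k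
    proof (rule AE_I2)
      fix p
      have "norm (Psi k p - complex_of_real (gauss p)) \<le> norm (Psi k p) + norm (complex_of_real (gauss p))" by (rule norm_triangle_ineq4)
      moreover have "0 \<le> gauss p" by (simp add: gauss_def)
      then have "norm (complex_of_real (gauss p)) = gauss p" by simp
      ultimately show "norm (norm (Psi k p - complex_of_real (gauss p))) \<le> ?w p + gauss p" using C(2)[of k p] by simp
    qed
  qed auto
  then show "(\<lambda>k. \<integral>p. norm (Psi k p - complex_of_real (gauss p)) \<partial>(lborel \<Otimes>\<^sub>M lborel)) \<longlonglongrightarrow> 0" by simp
qed

end

context bulk_scaling begin

lemma norm_cis_minus_one: "norm (cis x - 1) \<le> \<bar>x\<bar>"
  using iexp_approx1[of x 0] by (simp add: cis_conv_exp)

text \<open>Fourier inversion with the \<open>L\<^sup>1\<close> convergence of the characteristic functions.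
  The upper bound holds for all \<open>(v, w)\<close>, as the modulus of the phase is 1. For the lower bound the
  phase is expanded, which costs the first absolute moments of the Gaussian and is only useful if
  \<open>v\<close> and \<open>w\<close> deviate from their means by much less than the respective standard
  deviations.\<close>

lemma local_limit:
  obtains \<epsilon> c where "\<epsilon> \<longlonglongrightarrow> 0" "0 \<le> c"
    "\<And>k v w. 4 * pi\<^sup>2 * (real (nn k))\<^sup>2 * measure (Middle k) {u. SS k u = v \<and> TT k u = w} \<le> gauss_mass + \<epsilon> k"
    "\<And>k v w. gauss_mass - \<epsilon> k - c * (\<bar>real_of_int v\<bar> / al k + \<bar>real_of_int w - mu k\<bar> / ga k) \<le>
       4 * pi\<^sup>2 * (real (nn k))\<^sup>2 * measure (Middle k) {u. SS k u = v \<and> TT k u = w}"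
proof -
  let ?N = "lborel \<Otimes>\<^sub>M lborel :: (real \<times> real) measure"
  define \<epsilon> where "\<epsilon> k = (\<integral>p. norm (Psi k p - complex_of_real (gauss p)) \<partial>?N)" for k
  define c1 c2 where "c1 = (\<integral>p. \<bar>fst p\<bar> * gauss p \<partial>?N)" and "c2 = (\<integral>p. \<bar>snd p\<bar> * gauss p \<partial>?N)"
  have c: "0 \<le> c1" "0 \<le> c2" unfolding c1_def c2_def by (auto intro!: integral_nonneg_AE simp: gauss_def)
  have gi: "integrable ?N (\<lambda>p. complex_of_real (gauss p))" using gauss_integrable by simp
  have di: "integrable ?N (\<lambda>p. norm (Psi k p - complex_of_real (gauss p)))" for k
    by (intro integrable_norm Bochner_Integration.integrable_diff Psi_integrable gi)
  have [measurable]: "cis \<in> borel_measurable borel"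
    by (intro borel_measurable_continuous_onI continuous_intros)
  show ?thesis
  proof (rule that[of \<epsilon> "max c1 c2"])
    show "\<epsilon> \<longlonglongrightarrow> 0" unfolding \<epsilon>_def by (rule Psi_L1)
    show "0 \<le> max c1 c2" using c by simp
    fix k v w
    let ?m = "4 * pi\<^sup>2 * (real (nn k))\<^sup>2 * measure (Middle k) {u. SS k u = v \<and> TT k u = w}"
    define a b where "a = real_of_int v / al k" and "b = (real_of_int w - mu k) / ga k"
    define z where "z p = cis (- (fst p * a + snd p * b))" for p
    have m0: "0 \<le> ?m" by (intro mult_nonneg_nonneg) auto
    have F: "complex_of_real ?m = (\<integral>p. Psi k p * z p \<partial>?N)" unfolding z_def a_def b_def by (rule fourier_Middle)
    have nz: "norm (z p) = 1" for p by (simp add: z_def)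
    have zi: "integrable ?N (\<lambda>p. Psi k p * z p)"
      by (rule Bochner_Integration.integrable_bound[OF Psi_integrable[of k]]) (auto simp: z_def norm_mult)
    have "?m = norm (complex_of_real ?m)" using m0 by (simp only: norm_of_real abs_of_nonneg)
    also have "\<dots> \<le> (\<integral>p. norm (Psi k p * z p) \<partial>?N)" unfolding F by (rule integral_norm_bound)
    also have "\<dots> \<le> (\<integral>p. gauss p + norm (Psi k p - complex_of_real (gauss p)) \<partial>?N)"
    proof (rule integral_mono)
      fix p
      have "norm (Psi k p) \<le> norm (complex_of_real (gauss p)) + norm (Psi k p - complex_of_real (gauss p))"
        using norm_triangle_sub[of "Psi k p" "complex_of_real (gauss p)"] .
      then show "norm (Psi k p * z p) \<le> gauss p + norm (Psi k p - complex_of_real (gauss p))"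
        by (simp add: norm_mult nz gauss_def)
    qed (intro integrable_norm zi Bochner_Integration.integrable_add gauss_integrable di)+
    also have "\<dots> = gauss_mass + \<epsilon> k"
      by (subst Bochner_Integration.integral_add[OF gauss_integrable di]) (simp add: gauss_integral \<epsilon>_def)
    finally show "?m \<le> gauss_mass + \<epsilon> k" .
    have i1: "integrable ?N (\<lambda>p. \<bar>a\<bar> * (\<bar>fst p\<bar> * gauss p) + \<bar>b\<bar> * (\<bar>snd p\<bar> * gauss p))"
      by (intro Bochner_Integration.integrable_add integrable_mult_right gauss_moment1 gauss_moment2)
    have "\<bar>?m - gauss_mass\<bar> = norm (complex_of_real ?m - complex_of_real gauss_mass)"
      by (simp only: of_real_diff[symmetric] norm_of_real)
    also have "complex_of_real ?m - complex_of_real gauss_mass = (\<integral>p. Psi k p * z p - complex_of_real (gauss p) \<partial>?N)"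
      unfolding F by (subst Bochner_Integration.integral_diff[OF zi gi]) (simp add: gauss_integral[symmetric])
    also have "norm \<dots> \<le> (\<integral>p. norm (Psi k p * z p - complex_of_real (gauss p)) \<partial>?N)" by (rule integral_norm_bound)
    also have "\<dots> \<le> (\<integral>p. norm (Psi k p - complex_of_real (gauss p)) + (\<bar>a\<bar> * (\<bar>fst p\<bar> * gauss p) + \<bar>b\<bar> * (\<bar>snd p\<bar> * gauss p)) \<partial>?N)"
    proof (rule integral_mono)
      fix p
      have g0: "0 \<le> gauss p" by (simp add: gauss_def)
      have "Psi k p * z p - complex_of_real (gauss p) = (Psi k p - complex_of_real (gauss p)) * z p + complex_of_real (gauss p) * (z p - 1)"
        by (simp add: algebra_simps)
      then have "norm (Psi k p * z p - complex_of_real (gauss p)) \<le> norm ((Psi k p - complex_of_real (gauss p)) * z p) + norm (complex_of_real (gauss p) * (z p - 1))"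
        by (metis norm_triangle_ineq)
      also have "\<dots> = norm (Psi k p - complex_of_real (gauss p)) + gauss p * norm (z p - 1)"
        using g0 by (simp add: norm_mult nz)
      also have "gauss p * norm (z p - 1) \<le> gauss p * (\<bar>fst p\<bar> * \<bar>a\<bar> + \<bar>snd p\<bar> * \<bar>b\<bar>)"
      proof (rule mult_left_mono[OF _ g0])
        have "norm (z p - 1) \<le> \<bar>- (fst p * a + snd p * b)\<bar>" unfolding z_def by (rule norm_cis_minus_one)
        also have "\<dots> \<le> \<bar>fst p\<bar> * \<bar>a\<bar> + \<bar>snd p\<bar> * \<bar>b\<bar>"
          unfolding abs_minus_cancel abs_mult[symmetric] by (rule abs_triangle_ineq)
        finally show "norm (z p - 1) \<le> \<bar>fst p\<bar> * \<bar>a\<bar> + \<bar>snd p\<bar> * \<bar>b\<bar>" .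
      qed
      finally show "norm (Psi k p * z p - complex_of_real (gauss p)) \<le> norm (Psi k p - complex_of_real (gauss p)) + (\<bar>a\<bar> * (\<bar>fst p\<bar> * gauss p) + \<bar>b\<bar> * (\<bar>snd p\<bar> * gauss p))"
        by (simp add: algebra_simps)
    qed (intro integrable_norm Bochner_Integration.integrable_diff Bochner_Integration.integrable_add zi gi di i1)+
    also have "\<dots> = \<epsilon> k + (\<bar>a\<bar> * c1 + \<bar>b\<bar> * c2)"
      unfolding c1_def c2_def \<epsilon>_def
      by (simp add: Bochner_Integration.integral_add[OF di i1] Bochner_Integration.integral_add gauss_moment1 gauss_moment2)
    also have "\<dots> \<le> \<epsilon> k + (\<bar>a\<bar> * max c1 c2 + \<bar>b\<bar> * max c1 c2)"
      by (intro add_left_mono add_mono mult_left_mono) auto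
    also have "\<bar>a\<bar> * max c1 c2 + \<bar>b\<bar> * max c1 c2 = max c1 c2 * (\<bar>real_of_int v\<bar> / al k + \<bar>real_of_int w - mu k\<bar> / ga k)"
      using al_pos[of k] ga_pos[of k] by (simp add: a_def b_def algebra_simps)
    finally have B: "\<bar>?m - gauss_mass\<bar> \<le> \<epsilon> k + max c1 c2 * (\<bar>real_of_int v\<bar> / al k + \<bar>real_of_int w - mu k\<bar> / ga k)" .
    have "g - e - z \<le> m" if "\<bar>m - g\<bar> \<le> e + z" for m g e z :: real using that by linarith
    from this[OF B] show "gauss_mass - \<epsilon> k - max c1 c2 * (\<bar>real_of_int v\<bar> / al k + \<bar>real_of_int w - mu k\<bar> / ga k) \<le> ?m" .
  qed
qed

end

section \<open>Positivity in the bulk\<close>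

lemma sum_V_eq: "(\<Sum>i\<le>n. V u i) = (\<Sum>j<n. (int n - int j) * u j)"
proof (induction n)
  case (Suc n)
  have "(\<Sum>j<Suc n. (int (Suc n) - int j) * u j) = (\<Sum>j<n. (int n - int j) * u j + u j) + u n"
    by (simp add: algebra_simps)
  also have "\<dots> = (\<Sum>j<n. (int n - int j) * u j) + V u (Suc n)"
    by (simp add: sum.distrib V_def)
  finally show ?case using Suc by simp
qed simp

definition neg_part :: "int \<Rightarrow> int" where "neg_part x = max 0 (- x)"

text \<open>The area which the first \<open>m\<close> and the last \<open>m\<close> positions spend below
  zero. Positions near the right end are expressed by the increments that follow, so that for a bridge the
  quantity depends on the increments at the ends only.\<close>

definition end_defect :: "nat \<Rightarrow> nat \<Rightarrow> (nat \<Rightarrow> int) \<Rightarrow> int" where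
  "end_defect n m u = (\<Sum>i<m. neg_part (V u i)) + (\<Sum>i\<in>{n - m<..n}. neg_part (- (\<Sum>j\<in>{i..<n}. u j)))"

definition positive_bridge :: "nat \<Rightarrow> nat \<Rightarrow> int \<Rightarrow> (nat \<Rightarrow> int) set" where
  "positive_bridge n m A = {u \<in> bridge n A. \<forall>i\<in>{m..n - m}. 0 < V u i}"

definition crossing :: "nat \<Rightarrow> (nat \<Rightarrow> int) set" where
  "crossing i = {u. V u i * V u (Suc i) \<le> 0}"

lemma V_tail: "i \<le> n \<Longrightarrow> V u n = V u i + (\<Sum>j\<in>{i..<n}. u j)"
  unfolding V_def by (metis atLeast0LessThan le0 sum.atLeastLessThan_concat)

lemma neg_part_nonneg [simp]: "0 \<le> neg_part x" by (simp add: neg_part_def)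

lemma neg_part_le: "neg_part x \<le> \<bar>x\<bar>" by (simp add: neg_part_def)

lemma abs_eq_neg_part: "\<bar>x\<bar> = x + 2 * neg_part x" by (simp add: neg_part_def)

lemma end_defect_nonneg: "0 \<le> end_defect n m u" unfolding end_defect_def by (intro add_nonneg_nonneg sum_nonneg) auto

text \<open>Absolute and signed area differ by twice the negative part, which by assumption sits at the ends;
  the signed area of a bridge is the weighted sum of its increments.\<close>

lemma area_decompose:
  assumes "V u n = 0" "2 * m \<le> n" "\<forall>i\<in>{m..n - m}. 0 < V u i"
  shows "area u n = (\<Sum>j<n. iweight n j * u j) + 2 * end_defect n m u"
proof -
  have "(\<Sum>i\<le>n. neg_part (V u i)) = (\<Sum>i<m. neg_part (V u i)) + (\<Sum>i\<in>{n - m<..n}. neg_part (V u i))"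
  proof -
    have "{..n} = ({..<m} \<union> {n - m<..n}) \<union> {m..n - m}" using assms(2) by auto
    moreover have "(\<Sum>i\<in>{m..n - m}. neg_part (V u i)) = 0"
      using assms(3) by (intro sum.neutral) (auto simp: neg_part_def)
    ultimately show ?thesis using assms(2)
      by (subst \<open>{..n} = _\<close>, subst sum.union_disjoint) (auto simp: sum.union_disjoint intro!: sum.union_disjoint)
  qed
  also have "(\<Sum>i\<in>{n - m<..n}. neg_part (V u i)) = (\<Sum>i\<in>{n - m<..n}. neg_part (- (\<Sum>j\<in>{i..<n}. u j)))"
  proof (intro sum.cong refl)
    fix i assume "i \<in> {n - m<..n}"
    then have "V u i = - (\<Sum>j\<in>{i..<n}. u j)" using V_tail[of i n u] assms(1) by auto
    then show "neg_part (V u i) = neg_part (- (\<Sum>j\<in>{i..<n}. u j))" by simp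
  qed
  finally have 1: "(\<Sum>i\<le>n. neg_part (V u i)) = end_defect n m u" unfolding end_defect_def .
  have "(\<Sum>j<n. (int n - int j) * u j) = (\<Sum>j<n. iweight n j * u j + (int n - int (n div 2)) * u j)"
    by (intro sum.cong refl) (simp add: iweight_def algebra_simps)
  also have "\<dots> = (\<Sum>j<n. iweight n j * u j) + (int n - int (n div 2)) * V u n"
    by (simp add: sum.distrib sum_distrib_left V_def)
  finally have 2: "(\<Sum>i\<le>n. V u i) = (\<Sum>j<n. iweight n j * u j)" unfolding sum_V_eq assms(1) by simp
  have "area u n = (\<Sum>i\<le>n. V u i) + 2 * (\<Sum>i\<le>n. neg_part (V u i))"
    unfolding area_def by (subst abs_eq_neg_part) (simp add: sum.distrib sum_distrib_left)
  then show ?thesis unfolding 1 2 .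
qed

lemma end_defect_le:
  assumes "2 * m \<le> n"
  shows "end_defect n m u \<le> int m * (\<Sum>j\<in>{..<n} - {m..<n - m}. \<bar>u j\<bar>)"
proof -
  let ?a = "\<Sum>j<m. \<bar>u j\<bar>" and ?b = "\<Sum>j\<in>{n - m..<n}. \<bar>u j\<bar>"
  have "(\<Sum>i<m. neg_part (V u i)) \<le> (\<Sum>i<m. ?a)"
  proof (rule sum_mono)
    fix i assume i: "i \<in> {..<m}"
    have "neg_part (V u i) \<le> \<bar>V u i\<bar>" by (rule neg_part_le)
    also have "\<dots> \<le> (\<Sum>j<i. \<bar>u j\<bar>)" unfolding V_def by (rule sum_abs)
    also have "\<dots> \<le> ?a" using i by (intro sum_mono2) auto
    finally show "neg_part (V u i) \<le> ?a" .
  qed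
  moreover have "(\<Sum>i\<in>{n - m<..n}. neg_part (- (\<Sum>j\<in>{i..<n}. u j))) \<le> (\<Sum>i\<in>{n - m<..n}. ?b)"
  proof (rule sum_mono)
    fix i assume i: "i \<in> {n - m<..n}"
    have "neg_part (- (\<Sum>j\<in>{i..<n}. u j)) \<le> \<bar>\<Sum>j\<in>{i..<n}. u j\<bar>" using neg_part_le[of "- (\<Sum>j\<in>{i..<n}. u j)"] by simp
    also have "\<dots> \<le> (\<Sum>j\<in>{i..<n}. \<bar>u j\<bar>)" by (rule sum_abs)
    also have "\<dots> \<le> ?b" using i by (intro sum_mono2) auto
    finally show "neg_part (- (\<Sum>j\<in>{i..<n}. u j)) \<le> ?b" .
  qed
  moreover have "?a + ?b = (\<Sum>j\<in>{..<n} - {m..<n - m}. \<bar>u j\<bar>)"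
  proof -
    have e: "{..<n} - {m..<n - m} = {..<m} \<union> {n - m..<n}" using assms by auto
    have "{..<m} \<inter> {n - m..<n} = {}" using assms by auto
    then show ?thesis unfolding e by (intro sum.union_disjoint[symmetric]) auto
  qed
  moreover have "(\<Sum>i<m. ?a) = int m * ?a" "(\<Sum>i\<in>{n - m<..n}. ?b) = int m * ?b" using assms by simp_all
  moreover have "X + Y \<le> int m * c" if "X \<le> X'" "Y \<le> Y'" "a + b = c" "X' = int m * a" "Y' = int m * b" for X Y X' Y' a b c :: int
    using that by (metis add_mono distrib_left)
  ultimately show ?thesis unfolding end_defect_def by blast
qed

lemma end_defect_cong:
  assumes "2 * m \<le> n" "\<And>j. j \<in> {..<n} - {m..<n - m} \<Longrightarrow> u j = w j"
  shows "end_defect n m u = end_defect n m w"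
proof -
  have "V u i = V w i" if "i < m" for i using that assms by (intro V_cong) auto
  moreover have "(\<Sum>j\<in>{i..<n}. u j) = (\<Sum>j\<in>{i..<n}. w j)" if "i \<in> {n - m<..n}" for i
    using that assms by (intro sum.cong) auto
  ultimately show ?thesis unfolding end_defect_def by simp
qed

context ipdsaw
begin

lemma sum_cweight_eq:
  assumes "V u n = 0"
  shows "(\<Sum>j<n. cweight n j * real_of_int (u j)) = real_of_int (\<Sum>j<n. iweight n j * u j)"
proof -
  have "(\<Sum>j<n. cweight n j * real_of_int (u j)) = (\<Sum>j<n. real_of_int (iweight n j * u j) + ((real n - 1) / 2 - real (n div 2)) * real_of_int (u j))"
    by (intro sum.cong refl) (simp add: cweight_def iweight_def algebra_simps)
  also have "\<dots> = real_of_int (\<Sum>j<n. iweight n j * u j) + ((real n - 1) / 2 - real (n div 2)) * real_of_int (V u n)"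
    by (simp add: sum.distrib sum_distrib_left V_def)
  finally show ?thesis using assms by simp
qed

text \<open>Since \<open>(z G(z))' = lam (z/2)\<close>, replacing one arch of total tilt \<open>h\<close> by
  two arches of tilts \<open>x\<close> and \<open>y\<close> loses at least \<open>lam (y/2)\<close> per unit of
  tilt removed from the larger one, and the smaller one returns at most half of that per unit. The surplus
  \<open>s\<close> in \<open>x + y = h + s\<close> is the additional step created by cutting a path.\<close>

lemma G0_superadditive_gap:
  assumes x: "2 * s \<le> x" "x \<le> y" and s: "0 < s" and xy: "x + y = h + s" and h: "h < \<beta>"
  shows "x * G0 x + y * G0 y \<le> h * G0 h - (x / 2 - s) * lam (h / 4)"
proof -
  have yh: "y \<le> h" "h / 2 \<le> y" "0 < y" "0 < x" "x \<le> h" using assms by auto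
  have D: "((\<lambda>z. z * G0 z) has_real_derivative lam (z / 2)) (at z)" if "0 \<le> z" "z \<le> h" for z
  proof -
    have "\<bar>z\<bar> < \<beta>" using that h by simp
    then show ?thesis using G0_G1_identity[of z]
      by (auto intro!: derivative_eq_intros G0_has_derivative simp: algebra_simps)
  qed
  have 1: "(h - y) * lam (y / 2) \<le> h * G0 h - y * G0 y"
  proof (cases "y = h")
    case False
    then have "y < h" using yh by simp
    then obtain z where z: "y < z" "z < h" "h * G0 h - y * G0 y = (h - y) * lam (z / 2)"
      using MVT2[of y h "\<lambda>z. z * G0 z" "\<lambda>z. lam (z / 2)"] D yh by auto
    have "lam (y / 2) \<le> lam (z / 2)" using z yh h by (intro lam_mono) auto
    then show ?thesis using z yh by (simp add: mult_left_mono)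
  qed simp
  have "G0 x \<le> lam (x / 2) / 2" using yh h by (intro G0_le_half) auto
  also have "\<dots> \<le> lam (y / 2) / 2" using assms yh by (intro divide_right_mono lam_mono) auto
  finally have 2: "x * G0 x \<le> x * (lam (y / 2) / 2)" using yh by (intro mult_left_mono) auto
  have hy: "h - y = x - s" using xy by simp
  have "(x / 2 - s) * lam (h / 4) \<le> (x / 2 - s) * lam (y / 2)"
    using x yh h by (intro mult_left_mono lam_mono) auto
  moreover have "(x / 2 - s) * lam (y / 2) = (x - s) * lam (y / 2) - x * (lam (y / 2) / 2)"
    by (simp add: algebra_simps)
  ultimately show ?thesis using 1 2 unfolding hy by linarith
qed

text \<open>Cut at the sign change and apply the Chernoff bound to both pieces with the same \<open>s =
  h/n\<close>. Each piece has at least \<open>m\<close> steps, so superadditivity yields a gain linear in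
  \<open>m\<close>; the polynomial prefactor comes from the sum over the length of the first piece.\<close>

lemma crossing_bound:
  fixes A :: nat
  assumes m: "1 \<le> m" "m \<le> i" "i < n - m" and h: "0 < h" "h < \<beta>"
  shows "measure (walk n) (bridge n (int A) \<inter> crossing i) \<le>
    4 * cc * (real A + real n) * (real n + 2)\<^sup>2 * exp (- h / real n * real A + real n * G0 h - (real m - 1) / 2 * lam (h / 4))"
proof -
  define N where "N = n - 1"
  have N: "n = Suc N" "1 \<le> i" "i < N" using m by (auto simp: N_def)
  define L where "L = A + N"
  define s where "s = h / real n"
  have s: "0 < s" using h N by (simp add: s_def)
  have cc: "0 < cc" by (rule c_const_pos[OF \<beta>_pos])
  define E where "E = exp (- s * real A + real n * G0 h - (real m - 1) / 2 * lam (h / 4))"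
  have sn: "s * real n = h" using N by (simp add: s_def)
  have piece: "measure (walk (Suc i)) (bridge (Suc i) (int L' - int i)) *
        measure (walk (Suc (N - i))) (bridge (Suc (N - i)) (int (L - L') - int (N - i))) \<le> 4 * (real n + 2)\<^sup>2 * E"
    if L': "L' \<le> L" for L'
  proof -
    let ?p = "Suc i" and ?q = "Suc (N - i)"
    have pq: "real ?p + real ?q = real n + 1" using N by (simp add: of_nat_diff)
    have p: "1 \<le> ?p" "1 \<le> ?q" "?p < n" "?q < n" using N by auto
    have bound: "measure (walk k) (bridge k a) \<le> 2 * (real n + 2) * exp (- s * real_of_int a + real k * G0 (s * real k))"
      if "1 \<le> k" "k < n" for k a
    proof -
      have "s * real k < s * real n" using that s by simp
      then have "measure (walk k) (bridge k a) \<le> 2 * (real k + 1) * exp (- (s * real k) / real k * real_of_int a + real k * G0 (s * real k))"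
        using that s h sn by (intro chernoff_bridge) auto
      also have "- (s * real k) / real k = - s" using that by simp
      also have "2 * (real k + 1) * exp (- s * real_of_int a + real k * G0 (s * real k)) \<le> 2 * (real n + 2) * exp (- s * real_of_int a + real k * G0 (s * real k))"
        using that by (intro mult_right_mono) auto
      finally show ?thesis .
    qed
    have "measure (walk ?p) (bridge ?p (int L' - int i)) * measure (walk ?q) (bridge ?q (int (L - L') - int (N - i)))
      \<le> (2 * (real n + 2) * exp (- s * real_of_int (int L' - int i) + real ?p * G0 (s * real ?p))) *
        (2 * (real n + 2) * exp (- s * real_of_int (int (L - L') - int (N - i)) + real ?q * G0 (s * real ?q)))"
      using p by (intro mult_mono bound) auto
    also have "\<dots> = 4 * (real n + 2)\<^sup>2 * exp (- s * real A + (real ?p * G0 (s * real ?p) + real ?q * G0 (s * real ?q)))"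
    proof -
      have "real_of_int (int L' - int i) + real_of_int (int (L - L') - int (N - i)) = real A"
        using L' N by (simp add: of_nat_diff L_def)
      then have "- s * real_of_int (int L' - int i) + - s * real_of_int (int (L - L') - int (N - i)) = - s * real A"
        by (metis distrib_left)
      then have "(- s * real_of_int (int L' - int i) + real ?p * G0 (s * real ?p)) + (- s * real_of_int (int (L - L') - int (N - i)) + real ?q * G0 (s * real ?q))
        = - s * real A + (real ?p * G0 (s * real ?p) + real ?q * G0 (s * real ?q))" by linarith
      then have "exp (- s * real_of_int (int L' - int i) + real ?p * G0 (s * real ?p)) * exp (- s * real_of_int (int (L - L') - int (N - i)) + real ?q * G0 (s * real ?q))
        = exp (- s * real A + (real ?p * G0 (s * real ?p) + real ?q * G0 (s * real ?q)))" by (metis exp_add)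
      moreover have "(2 * a * e1) * (2 * a * e2) = 4 * a\<^sup>2 * (e1 * e2)" for a e1 e2 :: real by (simp add: power2_eq_square)
      ultimately show ?thesis by (simp only:)
    qed
    also have "\<dots> \<le> 4 * (real n + 2)\<^sup>2 * E"
    proof (intro mult_left_mono)
      have gap: "x * G0 x + y * G0 y \<le> h * G0 h - s * ((real m - 1) / 2) * lam (h / 4)"
        if xy: "x = s * a" "y = s * b" "a \<le> b" "real m + 1 \<le> a" "a + b = real n + 1" for x y a b
      proof -
        have "s * 2 \<le> s * a" using xy m s by (intro mult_left_mono) auto
        moreover have "s * a \<le> s * b" using xy s by (intro mult_left_mono) auto
        moreover have "s * a + s * b = h + s" using sn xy by (simp add: distrib_left[symmetric]) (simp add: distrib_left)
        ultimately have "x * G0 x + y * G0 y \<le> h * G0 h - (x / 2 - s) * lam (h / 4)"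
          unfolding xy(1,2) using s h by (intro G0_superadditive_gap) auto
        moreover have "s * ((real m - 1) / 2) * lam (h / 4) \<le> (x / 2 - s) * lam (h / 4)"
        proof (rule mult_right_mono)
          have "s * ((real m - 1) / 2) \<le> s * (a / 2 - 1)" using xy s by (intro mult_left_mono) auto
          then show "s * ((real m - 1) / 2) \<le> x / 2 - s" by (simp add: xy right_diff_distrib)
          show "0 \<le> lam (h / 4)" using h by (intro lam_nonneg) auto
        qed
        ultimately show ?thesis by linarith
      qed
      have mm: "real m + 1 \<le> real ?p" "real m + 1 \<le> real ?q" using m N by (auto simp: of_nat_diff)
      have "(s * real ?p) * G0 (s * real ?p) + (s * real ?q) * G0 (s * real ?q) \<le> h * G0 h - s * ((real m - 1) / 2) * lam (h / 4)"
      proof (cases "real ?p \<le> real ?q")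
        case True
        show ?thesis by (rule gap[OF refl refl True mm(1) pq])
      next
        case False
        then show ?thesis using gap[OF refl refl _ mm(2), of "real ?p"] pq by simp
      qed
      then have "s * (real ?p * G0 (s * real ?p) + real ?q * G0 (s * real ?q)) \<le> s * (real n * G0 h - (real m - 1) / 2 * lam (h / 4))"
        unfolding sn[symmetric] by (simp add: algebra_simps)
      then have "real ?p * G0 (s * real ?p) + real ?q * G0 (s * real ?q) \<le> real n * G0 h - (real m - 1) / 2 * lam (h / 4)"
        using s by (simp only: mult_le_cancel_left_pos)
      then show "exp (- s * real A + (real ?p * G0 (s * real ?p) + real ?q * G0 (s * real ?q))) \<le> E"
        unfolding E_def exp_le_cancel_iff by linarith
    qed auto
    finally show ?thesis .
  qed
  have "measure (walk n) (bridge n (int A) \<inter> crossing i) \<le> cc * (\<Sum>L'\<le>L. 4 * (real n + 2)\<^sup>2 * E)"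
  proof -
    have A: "int A = int L - int N" by (simp add: L_def)
    have "measure (walk n) (bridge n (int A) \<inter> crossing i) \<le> cc * (\<Sum>L'\<le>L. measure (walk (Suc i)) (bridge (Suc i) (int L' - int i)) *
        measure (walk (Suc (N - i))) (bridge (Suc (N - i)) (int (L - L') - int (N - i))))"
      unfolding crossing_def N(1) A by (rule crossing_split[OF N(2,3)])
    also have "\<dots> \<le> cc * (\<Sum>L'\<le>L. 4 * (real n + 2)\<^sup>2 * E)"
      using cc by (intro mult_left_mono sum_mono piece) auto
    finally show ?thesis .
  qed
  also have "\<dots> = 4 * cc * (real A + real n) * (real n + 2)\<^sup>2 * E"
    using N by (simp add: L_def algebra_simps)
  moreover have "- h / real n = - s" by (simp add: s_def)
  ultimately show ?thesis unfolding E_def by (simp only:)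
qed

lemma pmf_step_minus: "pmf (step_law \<beta>) (- k) = pmf (step_law \<beta>) k"
  by (simp add: pmf_step_law[OF \<beta>_pos])

lemma walk_reflect: "map_pmf (\<lambda>u j. - u j) (walk n) = walk n"
proof -
  have "map_pmf uminus (step_law \<beta>) = step_law \<beta>"
  proof (rule pmf_eqI)
    fix k
    have "pmf (map_pmf uminus (step_law \<beta>)) (- (- k)) = pmf (step_law \<beta>) (- k)"
      by (rule pmf_map_inj') (auto simp: inj_on_def)
    then show "pmf (map_pmf uminus (step_law \<beta>)) k = pmf (step_law \<beta>) k" by (simp add: pmf_step_minus)
  qed
  then have "walk n = Pi_pmf {..<n} (- 0) (\<lambda>_. map_pmf uminus (step_law \<beta>))" by (simp add: walk_def)
  also have "\<dots> = map_pmf (\<lambda>u. uminus \<circ> u) (walk n)"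
    unfolding walk_def by (rule Pi_pmf_map) simp_all
  finally show ?thesis by (simp add: o_def)
qed

lemma V_minus: "V (\<lambda>j. - u j) i = - V u i" by (simp add: V_def sum_negf)

lemma area_minus: "area (\<lambda>j. - u j) n = area u n" by (simp add: area_def V_minus)

lemma positive_bridge_reflect:
  "measure (walk n) {u \<in> bridge n A. \<forall>i\<in>{m..n - m}. V u i < 0} = measure (walk n) (positive_bridge n m A)"
proof -
  have "measure (walk n) (positive_bridge n m A) = measure (map_pmf (\<lambda>u j. - u j) (walk n)) (positive_bridge n m A)"
    by (simp only: walk_reflect)
  also have "\<dots> = measure (walk n) ((\<lambda>u j. - u j) -` positive_bridge n m A)" by simp
  also have "(\<lambda>u j. - u j) -` positive_bridge n m A = {u \<in> bridge n A. \<forall>i\<in>{m..n - m}. V u i < 0}"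
    by (auto simp: positive_bridge_def bridge_def V_minus area_minus)
  finally show ?thesis by simp
qed

text \<open>Positive and negative bridges are exchanged by reflection and are disjoint.\<close>

lemma bridge_lower:
  assumes "2 * m \<le> n"
  shows "2 * measure (walk n) (positive_bridge n m A) \<le> measure (walk n) (bridge n A)"
proof -
  let ?N = "{u \<in> bridge n A. \<forall>i\<in>{m..n - m}. V u i < 0}"
  have "positive_bridge n m A \<inter> ?N = {}"
  proof -
    have "m \<in> {m..n - m}" using assms by auto
    then show ?thesis unfolding positive_bridge_def by fastforce
  qed
  then have "measure (walk n) (positive_bridge n m A \<union> ?N) = measure (walk n) (positive_bridge n m A) + measure (walk n) ?N"
    by (intro measure_pmf.finite_measure_Union) auto
  moreover have "measure (walk n) (positive_bridge n m A \<union> ?N) \<le> measure (walk n) (bridge n A)"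
    by (intro measure_pmf.finite_measure_mono) (auto simp: positive_bridge_def)
  ultimately show ?thesis unfolding positive_bridge_reflect by simp
qed

text \<open>A bridge that is neither positive nor negative throughout the bulk changes sign there.\<close>

lemma bridge_upper:
  assumes "2 * m < n"
  shows "measure (walk n) (bridge n A) \<le> 2 * measure (walk n) (positive_bridge n m A) + (\<Sum>i\<in>{m..<n - m}. measure (walk n) (bridge n A \<inter> crossing i))"
proof -
  let ?N = "{u \<in> bridge n A. \<forall>i\<in>{m..n - m}. V u i < 0}"
  let ?C = "\<Union>i\<in>{m..<n - m}. bridge n A \<inter> crossing i"
  have "bridge n A \<subseteq> positive_bridge n m A \<union> ?N \<union> ?C"
  proof
    fix u assume u: "u \<in> bridge n A"
    show "u \<in> positive_bridge n m A \<union> ?N \<union> ?C"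
    proof (cases "\<exists>i\<in>{m..<n - m}. u \<in> crossing i")
      case True
      then show ?thesis using u by auto
    next
      case False
      then have pos: "0 < V u i * V u (Suc i)" if "m \<le> i" "i < n - m" for i
        using that by (auto simp: crossing_def not_le)
      have same: "0 < V u m * V u i" if "m \<le> i" "i \<le> n - m" for i
        using that
      proof (induction i rule: dec_induct)
        case base
        then show ?case using pos[of m] assms by (auto simp: zero_less_mult_iff)
      next
        case (step i)
        then have "0 < V u m * V u i" "0 < V u i * V u (Suc i)" using pos[of i] by auto
        then show ?case by (auto simp: zero_less_mult_iff)
      qed
      show ?thesis
      proof (cases "0 < V u m")
        case True
        then have "u \<in> positive_bridge n m A" using u same by (auto simp: positive_bridge_def zero_less_mult_iff)
        then show ?thesis by simp
      next
        case False
        then have "u \<in> ?N" using u same by (force simp: zero_less_mult_iff)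
        then show ?thesis by simp
      qed
    qed
  qed
  then have "measure (walk n) (bridge n A) \<le> measure (walk n) (positive_bridge n m A \<union> ?N \<union> ?C)"
    by (intro measure_pmf.finite_measure_mono) auto
  also have "\<dots> \<le> measure (walk n) (positive_bridge n m A) + measure (walk n) ?N + measure (walk n) ?C"
    by (rule order_trans[OF measure_Un_le] add_right_mono measure_Un_le; simp)+
  also have "measure (walk n) ?C \<le> (\<Sum>i\<in>{m..<n - m}. measure (walk n) (bridge n A \<inter> crossing i))"
    by (rule measure_UNION_le) auto
  finally show ?thesis unfolding positive_bridge_reflect by simp
qed

end

section \<open>Change of measure\<close>

context ipdsaw
begin

text \<open>The tilted walk splits into the \<open>inner\<close> block, where the local limit theorem applies,
  and the \<open>2m\<close> \<open>outer\<close> steps. \<open>log_norm\<close> is the logarithm of the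
  normalisation of the tilt, and \<open>spread\<close> bounds what the outer steps can do to end point and
  area.\<close>

definition tilt :: "nat \<Rightarrow> real \<Rightarrow> nat \<Rightarrow> real" where "tilt n h j = h / real n * cweight n j"
definition inner :: "nat \<Rightarrow> nat \<Rightarrow> nat set" where "inner n m = {m..<n - m}"
definition outer :: "nat \<Rightarrow> nat \<Rightarrow> nat set" where "outer n m = {..<n} - {m..<n - m}"
definition Tilt where "Tilt n h = Pi_pmf {..<n} 0 (\<lambda>j. tilted_law \<beta> (tilt n h j))"
definition Inner where "Inner n m h = Pi_pmf (inner n m) 0 (\<lambda>j. tilted_law \<beta> (tilt n h j))"
definition Outer where "Outer n m h = Pi_pmf (outer n m) 0 (\<lambda>j. tilted_law \<beta> (tilt n h j))"
definition spread :: "nat \<Rightarrow> nat \<Rightarrow> (nat \<Rightarrow> int) \<Rightarrow> int" where "spread n m f = (\<Sum>j\<in>outer n m. \<bar>f j\<bar>)"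
definition log_norm where "log_norm n h = (\<Sum>j<n. lam (tilt n h j))"

lemma tilt_bound: "j < n \<Longrightarrow> 0 \<le> h \<Longrightarrow> h < \<beta> \<Longrightarrow> \<bar>tilt n h j\<bar> < \<beta> / 2"
  unfolding tilt_def using cweight_tilt_bound[of j n h] by linarith

lemma finite_outer [simp]: "finite (outer n m)" and finite_inner [simp]: "finite (inner n m)"
  by (auto simp: outer_def inner_def)

lemma outer_less: "j \<in> outer n m \<Longrightarrow> j < n" by (auto simp: outer_def)

lemma card_outer: "2 * m \<le> n \<Longrightarrow> card (outer n m) = 2 * m"
  unfolding outer_def by (subst card_Diff_subset) auto

text \<open>On finitely many steps the walk has the density \<open>exp (log_norm - \<Sum> tilt\<^sub>j
  u\<^sub>j)\<close> with respect to the tilted walk.\<close>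

lemma tilt_change:
  assumes h: "0 \<le> h" "h < \<beta>"
  shows "(\<integral>\<^sup>+u. f u \<partial>walk n) = (\<integral>\<^sup>+u. ennreal (exp (log_norm n h - (\<Sum>j<n. tilt n h j * real_of_int (u j)))) * f u \<partial>Tilt n h)"
proof -
  have "pmf (walk n) u = pmf (Tilt n h) u * exp (log_norm n h - (\<Sum>j<n. tilt n h j * real_of_int (u j)))" for u
  proof (cases "\<forall>j. j \<notin> {..<n} \<longrightarrow> u j = 0")
    case True
    have "pmf (Tilt n h) u = (\<Prod>j<n. exp (tilt n h j * real_of_int (u j) - lam (tilt n h j)) * pmf (step_law \<beta>) (u j))"
      unfolding Tilt_def using True
      by (subst pmf_Pi') (auto intro!: prod.cong pmf_tilted tilt_bound simp: h)
    also have "\<dots> = exp (\<Sum>j<n. tilt n h j * real_of_int (u j) - lam (tilt n h j)) * pmf (walk n) u"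
      unfolding walk_def using True by (subst pmf_Pi') (auto simp: prod.distrib exp_sum)
    also have "(\<Sum>j<n. tilt n h j * real_of_int (u j) - lam (tilt n h j)) = - (log_norm n h - (\<Sum>j<n. tilt n h j * real_of_int (u j)))"
      by (simp add: sum_subtractf log_norm_def)
    finally have "pmf (Tilt n h) u * exp (log_norm n h - (\<Sum>j<n. tilt n h j * real_of_int (u j))) =
       pmf (walk n) u * (exp (- (log_norm n h - (\<Sum>j<n. tilt n h j * real_of_int (u j)))) * exp (log_norm n h - (\<Sum>j<n. tilt n h j * real_of_int (u j))))"
      by (simp only: mult_ac)
    then show ?thesis unfolding exp_add[symmetric] by simp
  next
    case False
    then show ?thesis unfolding walk_def Tilt_def by (subst (1 2) pmf_Pi) auto
  qed
  then show ?thesis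
    unfolding nn_integral_measure_pmf by (simp add: ennreal_mult' mult.assoc)
qed

lemma nn_integral_Tilt_split:
  assumes "2 * m \<le> n"
  shows "(\<integral>\<^sup>+u. F u \<partial>Tilt n h) = (\<integral>\<^sup>+f. \<integral>\<^sup>+g. F (\<lambda>x. if x \<in> outer n m then f x else g x) \<partial>Inner n m h \<partial>Outer n m h)"
proof -
  have e: "{..<n} = outer n m \<union> inner n m" using assms by (auto simp: outer_def inner_def)
  have "Tilt n h = map_pmf (\<lambda>(f, g) x. if x \<in> outer n m then f x else g x) (pair_pmf (Outer n m h) (Inner n m h))"
    unfolding Tilt_def Outer_def Inner_def e
    by (rule Pi_pmf_union) (auto simp: outer_def inner_def)
  then show ?thesis by (simp add: nn_integral_pair_pmf' case_prod_unfold cong: if_cong)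
qed

lemma merge_sums:
  fixes f g :: "nat \<Rightarrow> int"
  assumes "2 * m \<le> n"
  defines "u \<equiv> \<lambda>x. if x \<in> outer n m then f x else g x"
  shows "V u n = (\<Sum>j\<in>outer n m. f j) + (\<Sum>j\<in>inner n m. g j)"
    and "(\<Sum>j<n. iweight n j * u j) = (\<Sum>j\<in>outer n m. iweight n j * f j) + (\<Sum>j\<in>inner n m. iweight n j * g j)"
    and "end_defect n m u = end_defect n m f"
proof -
  have e: "{..<n} = outer n m \<union> inner n m" "outer n m \<inter> inner n m = {}" using assms by (auto simp: outer_def inner_def)
  have s: "(\<Sum>j<n. c j * u j) = (\<Sum>j\<in>outer n m. c j * f j) + (\<Sum>j\<in>inner n m. c j * g j)" for c
  proof -
    have "(\<Sum>j<n. c j * u j) = (\<Sum>j\<in>outer n m. c j * u j) + (\<Sum>j\<in>inner n m. c j * u j)"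
      unfolding e(1) by (rule sum.union_disjoint) (use e in auto)
    also have "(\<Sum>j\<in>outer n m. c j * u j) = (\<Sum>j\<in>outer n m. c j * f j)" by (intro sum.cong) (auto simp: u_def)
    also have "(\<Sum>j\<in>inner n m. c j * u j) = (\<Sum>j\<in>inner n m. c j * g j)" using e(2) by (intro sum.cong) (auto simp: u_def)
    finally show ?thesis .
  qed
  show "V u n = (\<Sum>j\<in>outer n m. f j) + (\<Sum>j\<in>inner n m. g j)" using s[of "\<lambda>_. 1"] by (simp add: V_def)
  show "(\<Sum>j<n. iweight n j * u j) = (\<Sum>j\<in>outer n m. iweight n j * f j) + (\<Sum>j\<in>inner n m. iweight n j * g j)" by (rule s)
  show "end_defect n m u = end_defect n m f"
    using assms(1) by (intro end_defect_cong) (auto simp: u_def outer_def)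
qed

text \<open>On a positive bridge the density is \<open>exp (log_norm - (h/n) A)\<close> up to \<open>exp (2
  (h/n) end_defect)\<close>. Given the outer steps, the inner ones have to take prescribed values of sum and
  moment, which has probability at most \<open>M\<close>; averaging the correction over the outer steps gives
  \<open>E\<close>.\<close>

lemma positive_bridge_upper:
  assumes n: "2 * m \<le> n" "1 \<le> n" and h: "0 < h" "h < \<beta>"
    and M: "0 \<le> M" "\<And>v w. measure (Inner n m h) {g. (\<Sum>j\<in>inner n m. g j) = v \<and> (\<Sum>j\<in>inner n m. iweight n j * g j) = w} \<le> M"
    and E: "0 \<le> E" "(\<integral>\<^sup>+f. ennreal (exp (2 * (h / real n) * real_of_int (end_defect n m f))) \<partial>Outer n m h) \<le> ennreal E"
  shows "measure (walk n) (positive_bridge n m A) \<le> exp (log_norm n h - h / real n * real_of_int A) * (M * E)"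
proof -
  define s where "s = h / real n"
  define c1 where "c1 = exp (log_norm n h - s * real_of_int A)"
  define X where "X = {u. V u n = 0 \<and> (\<Sum>j<n. iweight n j * u j) = A - 2 * end_defect n m u}"
  have "ennreal (measure (walk n) (positive_bridge n m A)) = (\<integral>\<^sup>+u. indicator (positive_bridge n m A) u \<partial>walk n)"
    by (simp add: measure_pmf.emeasure_eq_measure)
  also have "\<dots> = (\<integral>\<^sup>+u. ennreal (exp (log_norm n h - (\<Sum>j<n. tilt n h j * real_of_int (u j)))) * indicator (positive_bridge n m A) u \<partial>Tilt n h)"
    using h by (intro tilt_change) auto
  also have "\<dots> \<le> (\<integral>\<^sup>+u. ennreal (c1 * exp (2 * s * real_of_int (end_defect n m u))) * indicator X u \<partial>Tilt n h)"
  proof (rule nn_integral_mono)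
    fix u
    show "ennreal (exp (log_norm n h - (\<Sum>j<n. tilt n h j * real_of_int (u j)))) * indicator (positive_bridge n m A) u \<le>
      ennreal (c1 * exp (2 * s * real_of_int (end_defect n m u))) * indicator X u"
    proof (cases "u \<in> positive_bridge n m A")
      case True
      then have V: "V u n = 0" "area u n = A" "\<forall>i\<in>{m..n - m}. 0 < V u i" by (auto simp: positive_bridge_def bridge_def)
      from area_decompose[OF V(1) n(1) V(3)] V(2) have iweight: "(\<Sum>j<n. iweight n j * u j) = A - 2 * end_defect n m u" by simp
      have "(\<Sum>j<n. tilt n h j * real_of_int (u j)) = s * (\<Sum>j<n. cweight n j * real_of_int (u j))"
        by (simp add: tilt_def s_def sum_distrib_left mult.assoc)
      also have "\<dots> = s * real_of_int (A - 2 * end_defect n m u)" unfolding sum_cweight_eq[OF V(1)] iweight ..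
      finally have "exp (log_norm n h - (\<Sum>j<n. tilt n h j * real_of_int (u j))) = c1 * exp (2 * s * real_of_int (end_defect n m u))"
        unfolding c1_def exp_add[symmetric] by (simp add: algebra_simps)
      moreover have "u \<in> X" using V iweight by (simp add: X_def)
      ultimately show ?thesis using True by (simp only: indicator_simps order_refl mult_1_right)
    qed simp
  qed
  also have "\<dots> = (\<integral>\<^sup>+f. \<integral>\<^sup>+g. ennreal (c1 * exp (2 * s * real_of_int (end_defect n m f))) *
      indicator {g. (\<Sum>j\<in>inner n m. g j) = - (\<Sum>j\<in>outer n m. f j) \<and>
         (\<Sum>j\<in>inner n m. iweight n j * g j) = A - 2 * end_defect n m f - (\<Sum>j\<in>outer n m. iweight n j * f j)} g \<partial>Inner n m h \<partial>Outer n m h)"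
    unfolding nn_integral_Tilt_split[OF n(1)] X_def
    by (intro nn_integral_cong arg_cong2[where f = "(*)"]) (auto simp: merge_sums[OF n(1)] indicator_def)
  also have "\<dots> \<le> (\<integral>\<^sup>+f. ennreal (c1 * M) * ennreal (exp (2 * s * real_of_int (end_defect n m f))) \<partial>Outer n m h)"
  proof (rule nn_integral_mono)
    fix f
    let ?S = "{g. (\<Sum>j\<in>inner n m. g j) = - (\<Sum>j\<in>outer n m. f j) \<and>
         (\<Sum>j\<in>inner n m. iweight n j * g j) = A - 2 * end_defect n m f - (\<Sum>j\<in>outer n m. iweight n j * f j)}"
    have "(\<integral>\<^sup>+g. ennreal (c1 * exp (2 * s * real_of_int (end_defect n m f))) * indicator ?S g \<partial>Inner n m h) =
      ennreal (c1 * exp (2 * s * real_of_int (end_defect n m f)) * measure (Inner n m h) ?S)"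
      by (subst nn_integral_cmult) (auto simp: measure_pmf.emeasure_eq_measure ennreal_mult' c1_def)
    also have "\<dots> \<le> ennreal (c1 * exp (2 * s * real_of_int (end_defect n m f)) * M)"
      using M by (intro ennreal_leI mult_left_mono) (auto simp: c1_def)
    also have "\<dots> = ennreal (c1 * M) * ennreal (exp (2 * s * real_of_int (end_defect n m f)))"
      using M by (simp add: c1_def mult_ac flip: ennreal_mult')
    finally show "(\<integral>\<^sup>+g. ennreal (c1 * exp (2 * s * real_of_int (end_defect n m f))) * indicator ?S g \<partial>Inner n m h)
       \<le> ennreal (c1 * M) * ennreal (exp (2 * s * real_of_int (end_defect n m f)))" .
  qed
  also have "\<dots> = ennreal (c1 * M) * (\<integral>\<^sup>+f. ennreal (exp (2 * s * real_of_int (end_defect n m f))) \<partial>Outer n m h)"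
    by (rule nn_integral_cmult) simp
  also have "\<dots> \<le> ennreal (c1 * M) * ennreal E" unfolding s_def by (intro mult_left_mono E) simp
  also have "\<dots> = ennreal (c1 * (M * E))" using M E by (simp add: c1_def mult.assoc flip: ennreal_mult')
  finally show ?thesis using M E unfolding c1_def s_def by (subst (asm) ennreal_le_iff) auto
qed

lemma exp_interpolate: "0 \<le> p \<Longrightarrow> p \<le> 1 \<Longrightarrow> exp (p * y) \<le> 1 + p * exp y" for p y :: real
proof -
  assume p: "0 \<le> p" "p \<le> 1"
  have "exp ((1 - p) *\<^sub>R 0 + p *\<^sub>R y) \<le> (1 - p) * exp 0 + p * exp y"
    using p by (intro convex_onD[OF exp_convex]) auto
  then show ?thesis using p by simp
qed

text \<open>Convexity interpolates between the trivial bound at \<open>\<delta> = 0\<close> and a fixed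
  exponential moment at \<open>\<delta> = \<eta>\<close>, so that the right-hand side tends to 1 linearly in
  \<open>\<delta>\<close>.\<close>

lemma tilted_abs_moment:
  assumes "\<bar>\<tau>\<bar> \<le> r" "0 < \<eta>" "r + \<eta> < \<beta> / 2" "0 \<le> \<delta>" "\<delta> \<le> \<eta>"
  shows "(\<integral>\<^sup>+u. ennreal (exp (\<delta> * \<bar>real_of_int u\<bar>)) \<partial>tilted_law \<beta> \<tau>) \<le> ennreal (exp (\<delta> / \<eta> * (2 * exp (lam (r + \<eta>)))))"
proof -
  have t: "\<bar>\<tau>\<bar> < \<beta> / 2" "\<bar>\<tau> + \<eta>\<bar> < \<beta> / 2" "\<bar>\<tau> + - \<eta>\<bar> < \<beta> / 2" using assms(1-3) by linarith+
  note m = tilted_mgf[OF t(1,2)] tilted_mgf[OF t(1,3)]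
  have le: "exp (lam (\<tau> + e) - lam \<tau>) \<le> exp (lam (r + \<eta>))" if "\<bar>e\<bar> = \<eta>" for e
  proof -
    have "lam (\<tau> + e) \<le> lam (r + \<eta>)" using assms that by (intro lam_mono) auto
    moreover have "0 \<le> lam \<tau>" using t by (intro lam_nonneg)
    ultimately show ?thesis by simp
  qed
  have "(\<integral>\<^sup>+u. ennreal (exp (\<delta> * \<bar>real_of_int u\<bar>)) \<partial>tilted_law \<beta> \<tau>) \<le>
     (\<integral>\<^sup>+u. ennreal (1 + \<delta> / \<eta> * (exp (\<eta> * real_of_int u) + exp (- \<eta> * real_of_int u))) \<partial>tilted_law \<beta> \<tau>)"
  proof (intro nn_integral_mono ennreal_leI)
    fix u :: int
    have "exp (\<delta> * \<bar>real_of_int u\<bar>) = exp (\<delta> / \<eta> * (\<eta> * \<bar>real_of_int u\<bar>))" using assms by simp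
    also have "\<dots> \<le> 1 + \<delta> / \<eta> * exp (\<eta> * \<bar>real_of_int u\<bar>)" using assms by (intro exp_interpolate) auto
    also have "\<dots> \<le> 1 + \<delta> / \<eta> * (exp (\<eta> * real_of_int u) + exp (- \<eta> * real_of_int u))"
      using assms by (intro add_left_mono mult_left_mono) (auto simp: abs_if)
    finally show "exp (\<delta> * \<bar>real_of_int u\<bar>) \<le> 1 + \<delta> / \<eta> * (exp (\<eta> * real_of_int u) + exp (- \<eta> * real_of_int u))" .
  qed
  also have "\<dots> = ennreal (measure_pmf.expectation (tilted_law \<beta> \<tau>) (\<lambda>u. 1 + \<delta> / \<eta> * (exp (\<eta> * real_of_int u) + exp (- \<eta> * real_of_int u))))"
    using m(1,3) assms by (intro nn_integral_eq_integral) auto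
  also have "measure_pmf.expectation (tilted_law \<beta> \<tau>) (\<lambda>u. 1 + \<delta> / \<eta> * (exp (\<eta> * real_of_int u) + exp (- \<eta> * real_of_int u))) =
     1 + \<delta> / \<eta> * (exp (lam (\<tau> + \<eta>) - lam \<tau>) + exp (lam (\<tau> + - \<eta>) - lam \<tau>))"
    using m(1,3) by (simp add: m(2) m(4)[simplified])
  also have "ennreal \<dots> \<le> ennreal (1 + \<delta> / \<eta> * (2 * exp (lam (r + \<eta>))))"
    using assms add_mono[OF le[of \<eta>] le[of "- \<eta>"]]
    by (intro ennreal_leI add_left_mono mult_left_mono) (simp_all del: exp_le_cancel_iff)
  also have "\<dots> \<le> ennreal (exp (\<delta> / \<eta> * (2 * exp (lam (r + \<eta>)))))"
    by (intro ennreal_leI exp_ge_add_one_self)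
  finally show ?thesis .
qed

lemma outer_exp_moment:
  assumes n: "2 * m \<le> n" and h: "0 \<le> h" "h < \<beta>" and r: "h / 2 \<le> r" "0 < \<eta>" "r + \<eta> < \<beta> / 2" "0 \<le> \<delta>" "\<delta> \<le> \<eta>"
  shows "(\<integral>\<^sup>+f. ennreal (exp (\<delta> * real_of_int (spread n m f))) \<partial>Outer n m h) \<le> ennreal (exp (2 * real m * (\<delta> / \<eta> * (2 * exp (lam (r + \<eta>))))))"
proof -
  have "(\<integral>\<^sup>+f. ennreal (exp (\<delta> * real_of_int (spread n m f))) \<partial>Outer n m h) =
     (\<integral>\<^sup>+f. (\<Prod>j\<in>outer n m. ennreal (exp (\<delta> * \<bar>real_of_int (f j)\<bar>))) \<partial>Outer n m h)"
    by (intro nn_integral_cong) (simp add: spread_def sum_distrib_left exp_sum prod_ennreal)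
  also have "\<dots> = (\<Prod>j\<in>outer n m. \<integral>\<^sup>+x. ennreal (exp (\<delta> * \<bar>real_of_int x\<bar>)) \<partial>tilted_law \<beta> (tilt n h j))"
    unfolding Outer_def by (rule nn_integral_prod_Pi_pmf[where f = "\<lambda>_ x. ennreal (exp (\<delta> * \<bar>real_of_int x\<bar>))"]) simp
  also have "\<dots> \<le> (\<Prod>j\<in>outer n m. ennreal (exp (\<delta> / \<eta> * (2 * exp (lam (r + \<eta>))))))"
  proof (intro prod_mono_ennreal tilted_abs_moment r)
    fix j assume "j \<in> outer n m"
    then show "\<bar>tilt n h j\<bar> \<le> r" unfolding tilt_def using cweight_tilt_bound[OF outer_less h(1)] r(1) by (meson order_trans)
  qed
  also have "\<dots> = ennreal (exp (2 * real m * (\<delta> / \<eta> * (2 * exp (lam (r + \<eta>))))))"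
    by (simp add: card_outer[OF n] ennreal_power flip: exp_of_nat_mult)
  finally show ?thesis .
qed

lemma end_defect_le_spread: "2 * m \<le> n \<Longrightarrow> end_defect n m f \<le> int m * spread n m f"
  using end_defect_le[of m n f] by (simp add: spread_def outer_def)

lemma spread_tail:
  assumes n: "2 * m \<le> n" and h: "0 \<le> h" "h < \<beta>" and r: "h / 2 \<le> r" "0 < \<eta>" "r + \<eta> < \<beta> / 2"
  shows "measure (Outer n m h) {f. \<rho> < spread n m f} \<le> exp (2 * real m * (2 * exp (lam (r + \<eta>))) - \<eta> * real_of_int \<rho>)"
proof -
  have "ennreal (measure (Outer n m h) {f. \<rho> < spread n m f}) = (\<integral>\<^sup>+f. indicator {f. \<rho> < spread n m f} f \<partial>Outer n m h)"
    by (simp add: measure_pmf.emeasure_eq_measure)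
  also have "\<dots> \<le> (\<integral>\<^sup>+f. ennreal (exp (- \<eta> * real_of_int \<rho>)) * ennreal (exp (\<eta> * real_of_int (spread n m f))) \<partial>Outer n m h)"
  proof (rule nn_integral_mono)
    fix f
    have "1 \<le> exp (- \<eta> * real_of_int \<rho>) * exp (\<eta> * real_of_int (spread n m f))" if "\<rho> < spread n m f"
      using that r by (simp flip: exp_add)
    then show "indicator {f. \<rho> < spread n m f} f \<le> ennreal (exp (- \<eta> * real_of_int \<rho>)) * ennreal (exp (\<eta> * real_of_int (spread n m f)))"
      by (auto simp: indicator_def simp flip: ennreal_mult')
  qed
  also have "\<dots> = ennreal (exp (- \<eta> * real_of_int \<rho>)) * (\<integral>\<^sup>+f. ennreal (exp (\<eta> * real_of_int (spread n m f))) \<partial>Outer n m h)"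
    by (rule nn_integral_cmult) simp
  also have "\<dots> \<le> ennreal (exp (- \<eta> * real_of_int \<rho>)) * ennreal (exp (2 * real m * (\<eta> / \<eta> * (2 * exp (lam (r + \<eta>))))))"
    using r by (intro mult_left_mono outer_exp_moment n h) auto
  also have "\<dots> = ennreal (exp (2 * real m * (2 * exp (lam (r + \<eta>))) - \<eta> * real_of_int \<rho>))"
    using r by (simp add: mult_ac flip: ennreal_mult' exp_add)
  finally show ?thesis by (subst (asm) ennreal_le_iff) auto
qed

lemma tilt_markov:
  assumes h: "0 \<le> h" "h < \<beta>" and K: "K \<subseteq> {..<n}" "\<And>j. j \<in> K \<Longrightarrow> \<bar>tilt n h j - l\<bar> < \<beta> / 2"
  shows "measure (Tilt n h) {u. l * real_of_int (\<Sum>j\<in>K. u j) \<le> 0} \<le> exp (\<Sum>j\<in>K. lam (tilt n h j - l) - lam (tilt n h j))"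
proof -
  have fin: "finite K" using K(1) finite_subset by blast
  have "ennreal (measure (Tilt n h) {u. l * real_of_int (\<Sum>j\<in>K. u j) \<le> 0}) = (\<integral>\<^sup>+u. indicator {u. l * real_of_int (\<Sum>j\<in>K. u j) \<le> 0} u \<partial>Tilt n h)"
    by (simp add: measure_pmf.emeasure_eq_measure)
  also have "\<dots> \<le> (\<integral>\<^sup>+u. (\<Prod>j<n. ennreal (if j \<in> K then exp (- l * real_of_int (u j)) else 1)) \<partial>Tilt n h)"
  proof (rule nn_integral_mono)
    fix u
    have "(\<Prod>j<n. ennreal (if j \<in> K then exp (- l * real_of_int (u j)) else 1)) = ennreal (\<Prod>j<n. (if j \<in> K then exp (- l * real_of_int (u j)) else 1))"
      by (rule prod_ennreal) auto
    also have "(\<Prod>j<n. (if j \<in> K then exp (- l * real_of_int (u j)) else 1)) = (\<Prod>j\<in>K. exp (- l * real_of_int (u j)))"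
      using K(1) by (intro prod.mono_neutral_cong_right) auto
    also have "\<dots> = exp (- (l * real_of_int (\<Sum>j\<in>K. u j)))"
      using fin by (simp add: exp_sum[symmetric] sum_distrib_left sum_negf)
    finally show "indicator {u. l * real_of_int (\<Sum>j\<in>K. u j) \<le> 0} u \<le> (\<Prod>j<n. ennreal (if j \<in> K then exp (- l * real_of_int (u j)) else 1))"
      by (simp add: indicator_def)
  qed
  also have "\<dots> = (\<Prod>j<n. \<integral>\<^sup>+x. ennreal (if j \<in> K then exp (- l * real_of_int x) else 1) \<partial>tilted_law \<beta> (tilt n h j))"
    unfolding Tilt_def by (rule nn_integral_prod_Pi_pmf[where f = "\<lambda>j x. ennreal (if j \<in> K then exp (- l * real_of_int x) else 1)"]) simp
  also have "\<dots> = (\<Prod>j<n. if j \<in> K then ennreal (exp (lam (tilt n h j - l) - lam (tilt n h j))) else 1)"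
  proof (intro prod.cong refl)
    fix j assume j: "j \<in> {..<n}"
    show "(\<integral>\<^sup>+x. ennreal (if j \<in> K then exp (- l * real_of_int x) else 1) \<partial>tilted_law \<beta> (tilt n h j)) =
      (if j \<in> K then ennreal (exp (lam (tilt n h j - l) - lam (tilt n h j))) else 1)"
    proof (cases "j \<in> K")
      case True
      have b: "\<bar>tilt n h j\<bar> < \<beta> / 2" "\<bar>tilt n h j + - l\<bar> < \<beta> / 2" using tilt_bound[of j n h] K(2)[OF True] j h by auto
      show ?thesis
        using True by (simp add: nn_integral_eq_integral[OF tilted_mgf(1)[OF b], simplified] tilted_mgf(2)[OF b, simplified])
    qed (simp add: measure_pmf.emeasure_space_1)
  qed
  also have "\<dots> = (\<Prod>j\<in>K. ennreal (exp (lam (tilt n h j - l) - lam (tilt n h j))))"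
    using K(1) by (intro prod.mono_neutral_cong_right) auto
  also have "\<dots> = ennreal (exp (\<Sum>j\<in>K. lam (tilt n h j - l) - lam (tilt n h j)))"
    using fin by (simp add: prod_ennreal exp_sum)
  finally show ?thesis by (subst (asm) ennreal_le_iff) auto
qed

text \<open>The tilts of the first \<open>i \<le> n/2\<close> steps are lowered by their mean
  \<open>l\<close>. The lowered tilts are those of a bridge of \<open>i\<close> steps with \<open>s i\<close> in
  place of \<open>h\<close>, so their \<open>lam\<close> sum up to at most \<open>i lam (h/4) / 2\<close>,
  whereas by convexity the original ones sum up to at least \<open>i lam l\<close> with \<open>l \<ge>
  h/4\<close>.\<close>

lemma prefix_gain:
  assumes h: "0 < h" "h < \<beta>" and i: "1 \<le> i" "2 * i \<le> n"
  defines "l \<equiv> h / real n * ((real n - real i) / 2)"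
  shows "(\<Sum>j<i. lam (tilt n h j - l) - lam (tilt n h j)) \<le> - (real i / 2) * lam (h / 4)"
    and "j < i \<Longrightarrow> \<bar>tilt n h j - l\<bar> < \<beta> / 2" and "0 < l"
proof -
  define s where "s = h / real n"
  have s: "0 < s" "s * real n = h" using h i by (auto simp: s_def)
  have lq: "h / 4 \<le> l" "l < h / 2"
  proof -
    have "s * (real n / 4) \<le> s * ((real n - real i) / 2)" using s i by (intro mult_left_mono) auto
    then show "h / 4 \<le> l" using s by (simp add: l_def s_def)
    have "s * ((real n - real i) / 2) < s * (real n / 2)" using s i by (intro mult_strict_left_mono) auto
    then have "s * ((real n - real i) / 2) < h / 2" unfolding times_divide_eq_right s(2) .
    then show "l < h / 2" by (simp add: l_def s_def)
  qed
  then show "0 < l" using h by simp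
  have sh: "tilt n h j - l = s * real i / real i * cweight i j" for j
    using i by (simp add: tilt_def l_def s_def cweight_def algebra_simps diff_divide_distrib add_divide_distrib)
  have si: "0 \<le> s * real i" "s * real i \<le> h / 2"
  proof -
    show "0 \<le> s * real i" using s by simp
    have "s * real i \<le> s * (real n / 2)" using s i by (intro mult_left_mono) auto
    then show "s * real i \<le> h / 2" using s by simp
  qed
  show "\<bar>tilt n h j - l\<bar> < \<beta> / 2" if "j < i"
    unfolding sh using cweight_tilt_bound[OF that si(1)] si h by linarith
  have "(\<Sum>j<i. lam (tilt n h j - l)) \<le> real i * G0 (s * real i)"
    unfolding sh using si h i by (intro sum_lam_le) auto
  also have "\<dots> \<le> real i * (lam (s * real i / 2) / 2)" using si h by (intro mult_left_mono G0_le_half) auto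
  also have "\<dots> \<le> real i * (lam (h / 4) / 2)" using si h by (intro mult_left_mono divide_right_mono lam_mono) auto
  finally have 1: "(\<Sum>j<i. lam (tilt n h j - l)) \<le> real i / 2 * lam (h / 4)" by simp
  have "(\<Sum>j<i. lam l + lam1 l * (tilt n h j - l)) \<le> (\<Sum>j<i. lam (tilt n h j))"
  proof (rule sum_mono)
    fix j assume j: "j \<in> {..<i}"
    show "lam l + lam1 l * (tilt n h j - l) \<le> lam (tilt n h j)"
      using j i lq h by (intro lam_tangent tilt_bound) auto
  qed
  moreover have "(\<Sum>j<i. tilt n h j - l) = 0"
  proof -
    have "(\<Sum>j<i. cweight i j) = 0"
    proof -
      have "(\<Sum>j<i. cweight i j) = (\<Sum>j<i. cweight i (i - 1 - j))"
        by (rule sum.reindex_bij_witness[of _ "\<lambda>j. i - 1 - j" "\<lambda>j. i - 1 - j"]) auto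
      also have "\<dots> = (\<Sum>j<i. - cweight i j)" by (intro sum.cong refl) (auto simp: cweight_def of_nat_diff field_simps)
      finally show ?thesis by (simp add: sum_negf)
    qed
    then show ?thesis unfolding sh by (simp flip: sum_distrib_left)
  qed
  ultimately have "real i * lam l \<le> (\<Sum>j<i. lam (tilt n h j))"
    by (simp add: sum.distrib flip: sum_distrib_left)
  moreover have "real i * lam (h / 4) \<le> real i * lam l" using lq h by (intro mult_left_mono lam_mono) auto
  ultimately show "(\<Sum>j<i. lam (tilt n h j - l) - lam (tilt n h j)) \<le> - (real i / 2) * lam (h / 4)"
    using 1 by (simp add: sum_subtractf)
qed

lemma tilt_reverse: "j < n \<Longrightarrow> tilt n h (n - 1 - j) = - tilt n h j"
proof -
  assume "j < n"
  then have "cweight n (n - 1 - j) = - cweight n j" by (simp add: cweight_def of_nat_diff field_simps)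
  then show ?thesis by (simp add: tilt_def)
qed

text \<open>Exponential Markov inequality for the first \<open>i\<close> steps; past the middle the same
  estimate is applied to the walk read backwards from its end point 0.\<close>

lemma tilt_return_prob:
  assumes h: "0 < h" "h < \<beta>" and i: "1 \<le> m" "m \<le> i" "i \<le> n - m"
  shows "measure (Tilt n h) {u. V u n = 0 \<and> V u i \<le> 0} \<le> exp (- (real m / 2) * lam (h / 4))"
proof -
  have l4: "0 \<le> lam (h / 4)" using h by (intro lam_nonneg) auto
  have mono: "exp (- (real i' / 2) * lam (h / 4)) \<le> exp (- (real m / 2) * lam (h / 4))" if "m \<le> i'" for i'
    using that l4 by (auto intro!: mult_right_mono)
  show ?thesis
  proof (cases "2 * i \<le> n")
    case True
    define l where "l = h / real n * ((real n - real i) / 2)"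
    have i1: "1 \<le> i" using i by simp
    note g = prefix_gain[OF h i1 True, folded l_def]
    have "measure (Tilt n h) {u. V u n = 0 \<and> V u i \<le> 0} \<le> measure (Tilt n h) {u. l * real_of_int (\<Sum>j\<in>{..<i}. u j) \<le> 0}"
      using g(3) by (intro measure_pmf.finite_measure_mono) (auto simp: V_def mult_le_0_iff simp del: of_int_sum)
    also have "\<dots> \<le> exp (\<Sum>j\<in>{..<i}. lam (tilt n h j - l) - lam (tilt n h j))"
      using h True g(2) by (intro tilt_markov) auto
    also have "\<dots> \<le> exp (- (real i / 2) * lam (h / 4))" using g(1) by simp
    also note mono[OF i(2)]
    finally show ?thesis .
  next
    case False
    define i' where "i' = n - i"
    have i': "1 \<le> i'" "2 * i' \<le> n" "m \<le> i'" using False i by (auto simp: i'_def)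
    define l where "l = h / real n * ((real n - real i') / 2)"
    note g = prefix_gain[OF h i'(1,2), folded l_def]
    have t: "tilt n h j - (- l) = - (tilt n h (n - 1 - j) - l)" "lam (tilt n h j) = lam (tilt n h (n - 1 - j))" if "j < n" for j
      using tilt_reverse[OF that, of h] by simp_all
    have "measure (Tilt n h) {u. V u n = 0 \<and> V u i \<le> 0} \<le> measure (Tilt n h) {u. - l * real_of_int (\<Sum>j\<in>{i..<n}. u j) \<le> 0}"
    proof (intro measure_pmf.finite_measure_mono subsetI)
      fix u assume "u \<in> {u. V u n = 0 \<and> V u i \<le> 0}"
      then have "0 \<le> (\<Sum>j\<in>{i..<n}. u j)" using V_tail[of i n u] i by auto
      then show "u \<in> {u. - l * real_of_int (\<Sum>j\<in>{i..<n}. u j) \<le> 0}" using g(3) by (simp del: of_int_sum)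
    qed simp
    also have "\<dots> \<le> exp (\<Sum>j\<in>{i..<n}. lam (tilt n h j - (- l)) - lam (tilt n h j))"
    proof (rule tilt_markov)
      fix j assume "j \<in> {i..<n}"
      then have j: "j < n" "n - 1 - j < i'" by (auto simp: i'_def)
      show "\<bar>tilt n h j - (- l)\<bar> < \<beta> / 2" unfolding t(1)[OF j(1)] abs_minus_cancel by (rule g(2)[OF j(2)])
    qed (use h in auto)
    also have "(\<Sum>j\<in>{i..<n}. lam (tilt n h j - (- l)) - lam (tilt n h j)) = (\<Sum>j<i'. lam (tilt n h j - l) - lam (tilt n h j))"
    proof (rule sum.reindex_bij_witness[of _ "\<lambda>j. n - 1 - j" "\<lambda>j. n - 1 - j"])
      fix j assume "j \<in> {i..<n}"
      then have j: "j < n" by simp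
      show "lam (tilt n h (n - 1 - j) - l) - lam (tilt n h (n - 1 - j)) = lam (tilt n h j - (- l)) - lam (tilt n h j)"
        unfolding t(1)[OF j] t(2)[OF j] lam_minus ..
    qed (auto simp: i'_def)
    also have "exp \<dots> \<le> exp (- (real i' / 2) * lam (h / 4))" using g(1) by simp
    also note mono[OF i'(3)]
    finally show ?thesis .
  qed
qed

text \<open>As for the upper bound, now with \<open>end_defect \<ge> 0\<close> simply dropped. The outer steps
  are restricted to small spread, for which the inner probability is at least \<open>M\<close>, and the tilted
  paths that are not positive in the bulk are subtracted.\<close>

lemma positive_bridge_lower:
  assumes m: "1 \<le> m" "2 * m \<le> n" and h: "0 < h" "h < \<beta>"
    and M: "0 \<le> M" "\<And>v w. \<bar>v\<bar> \<le> \<rho> \<Longrightarrow> \<bar>w - A\<bar> \<le> (2 * int m + int n) * \<rho> \<Longrightarrow>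
      M \<le> measure (Inner n m h) {g. (\<Sum>j\<in>inner n m. g j) = v \<and> (\<Sum>j\<in>inner n m. iweight n j * g j) = w}"
  shows "exp (log_norm n h - h / real n * real_of_int A) *
     (M * measure (Outer n m h) {f. spread n m f \<le> \<rho>} - (real n + 1) * exp (- (real m / 2) * lam (h / 4)))
     \<le> measure (walk n) (positive_bridge n m A)"
proof -
  define s where "s = h / real n"
  have s: "0 < s" using h m by (simp add: s_def)
  define c1 where "c1 = exp (log_norm n h - s * real_of_int A)"
  define X where "X = {u. V u n = 0 \<and> (\<Sum>j<n. iweight n j * u j) = A - 2 * end_defect n m u}"
  define Y where "Y = {u. \<forall>i\<in>{m..n - m}. 0 < V u i}"
  have "ennreal (c1 * measure (Tilt n h) (X \<inter> Y)) = (\<integral>\<^sup>+u. ennreal c1 * indicator (X \<inter> Y) u \<partial>Tilt n h)"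
    by (subst nn_integral_cmult) (auto simp: measure_pmf.emeasure_eq_measure ennreal_mult' c1_def)
  also have "\<dots> \<le> (\<integral>\<^sup>+u. ennreal (exp (log_norm n h - (\<Sum>j<n. tilt n h j * real_of_int (u j)))) * indicator (positive_bridge n m A) u \<partial>Tilt n h)"
  proof (rule nn_integral_mono)
    fix u
    show "ennreal c1 * indicator (X \<inter> Y) u \<le> ennreal (exp (log_norm n h - (\<Sum>j<n. tilt n h j * real_of_int (u j)))) * indicator (positive_bridge n m A) u"
    proof (cases "u \<in> X \<inter> Y")
      case True
      then have V: "V u n = 0" "(\<Sum>j<n. iweight n j * u j) = A - 2 * end_defect n m u" "\<forall>i\<in>{m..n - m}. 0 < V u i"
        by (auto simp: X_def Y_def)
      have "area u n = A" using area_decompose[OF V(1) m(2) V(3)] V(2) by simp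
      then have g: "u \<in> positive_bridge n m A" using V by (simp add: positive_bridge_def bridge_def)
      have "(\<Sum>j<n. tilt n h j * real_of_int (u j)) = s * (\<Sum>j<n. cweight n j * real_of_int (u j))"
        by (simp add: tilt_def s_def sum_distrib_left mult.assoc)
      also have "\<dots> = s * real_of_int (A - 2 * end_defect n m u)" unfolding sum_cweight_eq[OF V(1)] V(2) ..
      also have "\<dots> \<le> s * real_of_int A" using s end_defect_nonneg[of n m u] by (intro mult_left_mono) auto
      finally have "c1 \<le> exp (log_norm n h - (\<Sum>j<n. tilt n h j * real_of_int (u j)))" unfolding c1_def by simp
      then show ?thesis using True g by (simp add: ennreal_leI del: Int_iff)
    qed simp
  qed
  also have "\<dots> = (\<integral>\<^sup>+u. indicator (positive_bridge n m A) u \<partial>walk n)" using h by (intro tilt_change[symmetric]) auto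
  also have "\<dots> = ennreal (measure (walk n) (positive_bridge n m A))" by (simp add: measure_pmf.emeasure_eq_measure)
  finally have 1: "c1 * measure (Tilt n h) (X \<inter> Y) \<le> measure (walk n) (positive_bridge n m A)"
    by (subst (asm) ennreal_le_iff) auto
  have 2: "measure (Tilt n h) X \<le> measure (Tilt n h) (X \<inter> Y) + (real n + 1) * exp (- (real m / 2) * lam (h / 4))"
  proof -
    let ?B = "\<Union>i\<in>{m..n - m}. {u. V u n = 0 \<and> V u i \<le> 0}"
    have "X \<subseteq> (X \<inter> Y) \<union> ?B" by (force simp: X_def Y_def not_less)
    then have "measure (Tilt n h) X \<le> measure (Tilt n h) ((X \<inter> Y) \<union> ?B)" by (intro measure_pmf.finite_measure_mono) auto
    also have "\<dots> \<le> measure (Tilt n h) (X \<inter> Y) + measure (Tilt n h) ?B" by (rule measure_Un_le) auto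
    also have "measure (Tilt n h) ?B \<le> (\<Sum>i\<in>{m..n - m}. measure (Tilt n h) {u. V u n = 0 \<and> V u i \<le> 0})"
      by (rule measure_UNION_le) auto
    also have "\<dots> \<le> (\<Sum>i\<in>{m..n - m}. exp (- (real m / 2) * lam (h / 4)))"
      using m by (intro sum_mono tilt_return_prob[OF h]) auto
    also have "\<dots> \<le> (real n + 1) * exp (- (real m / 2) * lam (h / 4))" by (simp add: mult_right_mono)
    finally show ?thesis by simp
  qed
  have 3: "M * measure (Outer n m h) {f. spread n m f \<le> \<rho>} \<le> measure (Tilt n h) X"
  proof -
    let ?S = "\<lambda>f. {g. (\<Sum>j\<in>inner n m. g j) = - (\<Sum>j\<in>outer n m. f j) \<and>
         (\<Sum>j\<in>inner n m. iweight n j * g j) = A - 2 * end_defect n m f - (\<Sum>j\<in>outer n m. iweight n j * f j)}"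
    have "ennreal (M * measure (Outer n m h) {f. spread n m f \<le> \<rho>}) = (\<integral>\<^sup>+f. ennreal M * indicator {f. spread n m f \<le> \<rho>} f \<partial>Outer n m h)"
      using M by (subst nn_integral_cmult) (auto simp: measure_pmf.emeasure_eq_measure ennreal_mult')
    also have "\<dots> \<le> (\<integral>\<^sup>+f. emeasure (Inner n m h) (?S f) \<partial>Outer n m h)"
    proof (rule nn_integral_mono)
      fix f
      show "ennreal M * indicator {f. spread n m f \<le> \<rho>} f \<le> emeasure (Inner n m h) (?S f)"
      proof (cases "spread n m f \<le> \<rho>")
        case True
        have sp0: "0 \<le> spread n m f" unfolding spread_def by (intro sum_nonneg) auto
        have a: "\<bar>- (\<Sum>j\<in>outer n m. f j)\<bar> \<le> \<rho>"
          using order_trans[OF sum_abs[of f "outer n m"] True[unfolded spread_def]] by simp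
        have "\<bar>\<Sum>j\<in>outer n m. iweight n j * f j\<bar> \<le> (\<Sum>j\<in>outer n m. \<bar>iweight n j * f j\<bar>)" by (rule sum_abs)
        also have "\<dots> \<le> (\<Sum>j\<in>outer n m. int n * \<bar>f j\<bar>)"
        proof (rule sum_mono)
          fix j assume "j \<in> outer n m"
          then have "\<bar>iweight n j\<bar> \<le> int n" using outer_less[of j n m] by (auto simp: iweight_def abs_le_iff)
          then show "\<bar>iweight n j * f j\<bar> \<le> int n * \<bar>f j\<bar>" unfolding abs_mult by (rule mult_right_mono) simp
        qed
        also have "\<dots> = int n * spread n m f" by (simp add: spread_def sum_distrib_left)
        also have "\<dots> \<le> int n * \<rho>" using True by (intro mult_left_mono) auto
        finally have k: "\<bar>\<Sum>j\<in>outer n m. iweight n j * f j\<bar> \<le> int n * \<rho>" .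
        have "end_defect n m f \<le> int m * spread n m f" by (rule end_defect_le_spread[OF m(2)])
        also have "\<dots> \<le> int m * \<rho>" using True by (intro mult_left_mono) auto
        finally have e: "end_defect n m f \<le> int m * \<rho>" .
        have b: "\<bar>(A - 2 * end_defect n m f - (\<Sum>j\<in>outer n m. iweight n j * f j)) - A\<bar> \<le> (2 * int m + int n) * \<rho>"
          using k e end_defect_nonneg[of n m f] unfolding distrib_right by linarith
        from M(2)[OF a b] show ?thesis using True by (simp add: measure_pmf.emeasure_eq_measure ennreal_leI)
      qed simp
    qed
    also have "\<dots> = (\<integral>\<^sup>+f. \<integral>\<^sup>+g. indicator (?S f) g \<partial>Inner n m h \<partial>Outer n m h)" by simp
    also have "\<dots> = (\<integral>\<^sup>+u. indicator X u \<partial>Tilt n h)"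
      unfolding nn_integral_Tilt_split[OF m(2)] X_def
      by (intro nn_integral_cong) (auto simp: merge_sums[OF m(2)] indicator_def)
    also have "\<dots> = ennreal (measure (Tilt n h) X)" by (simp add: measure_pmf.emeasure_eq_measure)
    finally show ?thesis by (subst (asm) ennreal_le_iff) auto
  qed
  have "c1 * (M * measure (Outer n m h) {f. spread n m f \<le> \<rho>} - (real n + 1) * exp (- (real m / 2) * lam (h / 4))) \<le> c1 * measure (Tilt n h) (X \<inter> Y)"
    using 2 3 by (intro mult_left_mono) (auto simp: c1_def)
  then show ?thesis using 1 unfolding c1_def s_def by linarith
qed

end

section \<open>Sharp asymptotics of the bridge probability\<close>

text \<open>The ends have length \<open>mm \<approx> nn\<^bsup>1/8\<^esup>\<close>: long enough for \<open>exp
  (- c mm)\<close> to beat every power of \<open>nn\<close>, and so short that \<open>mm\<^sup>2 =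
  o(nn\<^bsup>1/2\<^esup>)\<close>, the scale on which the local limit theorem resolves the end point. The area
  may miss its mean by \<open>O(nn)\<close>, less than its standard deviation of order
  \<open>nn\<^bsup>3/2\<^esup>\<close>.\<close>

locale bulk_bridge = bulk_scaling +
  fixes A :: "nat \<Rightarrow> nat" and C :: real
  assumes mm_le: "\<And>k. mm k ^ 8 \<le> nn k" and mm_gt: "\<And>k. nn k < (mm k + 1) ^ 8"
    and area_close: "\<And>k. \<bar>real (A k) - (real (nn k))\<^sup>2 * G1 (hh k)\<bar> \<le> C * real (nn k)"
begin

lemma mm_lim: "filterlim mm at_top sequentially"
  unfolding filterlim_at_top
proof
  fix Z :: nat
  have "eventually (\<lambda>k. (Z + 1) ^ 8 \<le> nn k) sequentially"
    using nn_lim unfolding filterlim_at_top by blast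
  then show "eventually (\<lambda>k. Z \<le> mm k) sequentially"
  proof eventually_elim
    case (elim k)
    then have "(Z + 1) ^ 8 < (mm k + 1) ^ 8" using mm_gt[of k] by linarith
    then have "Z + 1 < mm k + 1" by (rule power_less_imp_less_base) simp
    then show ?case by simp
  qed
qed

lemma mm_real_lim: "filterlim (\<lambda>k. real (mm k)) at_top sequentially"
  by (rule filterlim_compose[OF filterlim_real_sequentially mm_lim])

lemma mm_square_ratio: "(\<lambda>k. (real (mm k))\<^sup>2 / sqrt (real (nn k))) \<longlonglongrightarrow> 0"
proof (rule tendsto_sandwich[where f = "\<lambda>_. 0"])
  show "(\<lambda>k. real (nn k) powr (- 1 / 4)) \<longlonglongrightarrow> 0"
    by (rule filterlim_compose[OF _ nn_real_lim]) real_asymp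
  show "eventually (\<lambda>k. (real (mm k))\<^sup>2 / sqrt (real (nn k)) \<le> real (nn k) powr (- 1 / 4)) sequentially"
  proof (rule always_eventually, rule allI)
    fix k
    have n: "0 < real (nn k)" by (rule nn_pos)
    have "((real (mm k))\<^sup>2) ^ 4 \<le> (real (nn k) powr (1 / 4)) ^ 4"
    proof -
      have "real (mm k ^ 8) \<le> real (nn k)" using mm_le[of k] by (simp only: of_nat_le_iff)
      then have "((real (mm k))\<^sup>2) ^ 4 \<le> real (nn k)" by (simp flip: power_mult)
      also have "\<dots> = (real (nn k) powr (1 / 4)) ^ 4" using n by (simp add: powr_power)
      finally show ?thesis .
    qed
    then have "(real (mm k))\<^sup>2 \<le> real (nn k) powr (1 / 4)" using power_mono_iff[of "(real (mm k))\<^sup>2" "real (nn k) powr (1 / 4)" 4] by simp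
    then have "(real (mm k))\<^sup>2 / sqrt (real (nn k)) \<le> real (nn k) powr (1 / 4) / sqrt (real (nn k))"
      using n by (intro divide_right_mono) auto
    also have "\<dots> = real (nn k) powr (- 1 / 4)"
      using n by (simp add: powr_half_sqrt[symmetric] flip: powr_diff)
    finally show "(real (mm k))\<^sup>2 / sqrt (real (nn k)) \<le> real (nn k) powr (- 1 / 4)" .
  qed
qed auto

lemma polynomial_times_exp_mm: assumes c: "0 < c" shows "(\<lambda>k. real (nn k) ^ p * exp (- c * real (mm k))) \<longlonglongrightarrow> 0"
proof (rule tendsto_sandwich[where f = "\<lambda>_. 0"])
  have "((\<lambda>x::real. (x + 1) ^ (8 * p) * exp (- c * x)) \<longlongrightarrow> 0) at_top" using c by real_asymp
  from filterlim_compose[OF this mm_real_lim]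
  show "(\<lambda>k. (real (mm k) + 1) ^ (8 * p) * exp (- c * real (mm k))) \<longlonglongrightarrow> 0" .
  have "real (nn k) ^ p \<le> (real (mm k) + 1) ^ (8 * p)" for k
  proof -
    have "real (nn k) \<le> real ((mm k + 1) ^ 8)" using mm_gt[of k] by (simp only: of_nat_le_iff)
    then have "real (nn k) ^ p \<le> ((real (mm k) + 1) ^ 8) ^ p" by (intro power_mono) (auto simp: add.commute)
    then show ?thesis by (simp add: power_mult)
  qed
  then show "eventually (\<lambda>k. real (nn k) ^ p * exp (- c * real (mm k)) \<le> (real (mm k) + 1) ^ (8 * p) * exp (- c * real (mm k))) sequentially"
    by (intro always_eventually allI mult_right_mono) auto
qed simp_all

text \<open>A bound for the tilts which is eventually valid and leaves room \<open>eta\<close> for an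
  exponential moment.\<close>

definition h_top where "h_top = (h + \<beta>) / 2"
definition r_top where "r_top = h_top / 2"
definition eta where "eta = (\<beta> - h_top) / 4"

lemma h_top: "h < h_top" "h_top < \<beta>" "0 < h_top" "0 < eta" "r_top + eta < \<beta> / 2" "\<bar>h_top / 2\<bar> < \<beta> / 2" "\<bar>h_top\<bar> < \<beta>" "0 \<le> r_top"
  using h by (auto simp: h_top_def r_top_def eta_def field_simps)

lemma eventually_h_top: "eventually (\<lambda>k. h / 2 \<le> hh k \<and> hh k \<le> h_top) sequentially"
proof -
  have "eventually (\<lambda>k. h / 2 < hh k) sequentially" "eventually (\<lambda>k. hh k < h_top) sequentially"
    using order_tendstoD(1)[OF hh_lim, of "h / 2"] order_tendstoD(2)[OF hh_lim, of h_top] h h_top by simp_all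
  then show ?thesis by eventually_elim auto
qed

lemma eventually_mm: "eventually (\<lambda>k. 1 \<le> mm k) sequentially"
  using mm_lim unfolding filterlim_at_top by blast

lemma recip_nn: "(\<lambda>k. 1 / real (nn k)) \<longlonglongrightarrow> 0"
  by (rule filterlim_compose[OF _ nn_real_lim]) real_asymp

lemma log_norm_lim: "(\<lambda>k. exp (log_norm (nn k) (hh k) - real (nn k) * G0 (hh k))) \<longlonglongrightarrow> 1"
proof -
  have "(\<lambda>k. log_norm (nn k) (hh k) - real (nn k) * G0 (hh k)) \<longlonglongrightarrow> 0"
  proof (rule tendsto_sandwich)
    show "(\<lambda>k. - (lam2 (h_top / 2) * \<beta>\<^sup>2) * (1 / real (nn k))) \<longlonglongrightarrow> 0"
      by (rule tendsto_mult_right_zero[OF recip_nn])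
    have n: "1 \<le> nn k" for k using nn16[of k] by simp
    show "eventually (\<lambda>k. log_norm (nn k) (hh k) - real (nn k) * G0 (hh k) \<le> 0) sequentially"
    proof (rule always_eventually, rule allI)
      fix k show "log_norm (nn k) (hh k) - real (nn k) * G0 (hh k) \<le> 0"
        using sum_lam_le[OF n[of k], of "hh k"] hh[of k] unfolding log_norm_def tilt_def by simp
    qed
    show "eventually (\<lambda>k. - (lam2 (h_top / 2) * \<beta>\<^sup>2) * (1 / real (nn k)) \<le> log_norm (nn k) (hh k) - real (nn k) * G0 (hh k)) sequentially"
      using eventually_h_top
    proof eventually_elim
      case (elim k)
      have "lam2 (hh k / 2) * (hh k)\<^sup>2 \<le> lam2 (h_top / 2) * \<beta>\<^sup>2"
      proof (rule mult_mono)
        show "lam2 (hh k / 2) \<le> lam2 (h_top / 2)" using elim hh[of k] h_top by (intro lam2_mono) auto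
        show "(hh k)\<^sup>2 \<le> \<beta>\<^sup>2" using hh[of k] by (intro power_mono) auto
        show "0 \<le> lam2 (h_top / 2)" using lam2_pos[OF h_top(6)] by simp
      qed simp
      then have "lam2 (hh k / 2) * (hh k)\<^sup>2 / real (nn k) \<le> lam2 (h_top / 2) * \<beta>\<^sup>2 / real (nn k)" by (rule divide_right_mono) simp
      then show ?case using sum_lam_ge[OF n[of k], of "hh k"] hh[of k] unfolding log_norm_def tilt_def by simp
    qed
  qed simp
  from tendsto_exp[OF this] show ?thesis by simp
qed

lemma Inner_eq: "Inner (nn k) (mm k) (hh k) = Middle k"
  unfolding Inner_def Middle_def inner_def J_def tilt_def tau_def ..

lemma Inner_event: "{g. (\<Sum>j\<in>inner (nn k) (mm k). g j) = v \<and> (\<Sum>j\<in>inner (nn k) (mm k). iweight (nn k) j * g j) = w} = {u. SS k u = v \<and> TT k u = w}"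
  unfolding SS_def TT_def inner_def J_def ..

definition scale where "scale k = (real (nn k))\<^sup>2 * exp (hh k / real (nn k) * real (A k) - real (nn k) * G0 (hh k))"

lemma area_quadratic: "\<exists>K\<ge>0. eventually (\<lambda>k. real (A k) \<le> K * (real (nn k))\<^sup>2) sequentially"
proof (intro exI conjI)
  show "0 \<le> \<bar>C\<bar> + G1 h_top"
    using G1_less[of 0 h_top] h_top h by simp
  show "eventually (\<lambda>k. real (A k) \<le> (\<bar>C\<bar> + G1 h_top) * (real (nn k))\<^sup>2) sequentially"
    using eventually_h_top
  proof eventually_elim
    case (elim k)
    have "G1 (hh k) \<le> G1 h_top" using G1_less[of "hh k" h_top] elim hh[of k] h_top by (cases "hh k = h_top") auto
    then have 1: "(real (nn k))\<^sup>2 * G1 (hh k) \<le> (real (nn k))\<^sup>2 * G1 h_top" by (intro mult_left_mono) auto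
    have "C * real (nn k) \<le> \<bar>C\<bar> * (real (nn k))\<^sup>2"
      using nn16[of k] by (intro mult_mono) (auto simp: power2_eq_square)
    then show ?case using area_close[of k] 1 by (simp add: algebra_simps abs_le_iff)
  qed
qed

lemma crossings_vanish:
  "(\<lambda>k. scale k * (\<Sum>i\<in>{mm k..<nn k - mm k}. measure (walk (nn k)) (bridge (nn k) (int (A k)) \<inter> crossing i))) \<longlonglongrightarrow> 0"
proof -
  obtain K where K: "0 \<le> K" "eventually (\<lambda>k. real (A k) \<le> K * (real (nn k))\<^sup>2) sequentially" using area_quadratic by blast
  define c where "c = lam (h / 8) / 2"
  have c: "0 < c" using lam_less[of 0 "h / 8"] h by (simp add: c_def)
  define D where "D = 16 * cc * (K + 1) * exp c"
  have cc: "0 < cc" by (rule c_const_pos[OF \<beta>_pos])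
  show ?thesis
  proof (rule tendsto_sandwich[where f = "\<lambda>_. 0"])
    show "(\<lambda>k. D * (real (nn k) ^ 7 * exp (- c * real (mm k)))) \<longlonglongrightarrow> 0"
      by (rule tendsto_mult_right_zero[OF polynomial_times_exp_mm[OF c]])
    show "eventually (\<lambda>k. scale k * (\<Sum>i\<in>{mm k..<nn k - mm k}. measure (walk (nn k)) (bridge (nn k) (int (A k)) \<inter> crossing i))
      \<le> D * (real (nn k) ^ 7 * exp (- c * real (mm k)))) sequentially"
      using K(2) eventually_h_top eventually_mm
    proof eventually_elim
      case (elim k)
      define n m e where "n = nn k" and "m = mm k" and "e = exp (- hh k / real n * real (A k) + real n * G0 (hh k))"
      have n: "16 \<le> real n" using nn16[of k] by (simp add: n_def)
      have 0: "measure (walk n) (bridge n (int (A k)) \<inter> crossing i) \<le> 16 * cc * (K + 1) * real n ^ 4 * (e * (exp c * exp (- c * real m)))"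
        if i: "i \<in> {m..<n - m}" for i
      proof -
        have "measure (walk n) (bridge n (int (A k)) \<inter> crossing i) \<le>
          4 * cc * (real (A k) + real n) * (real n + 2)\<^sup>2 * exp (- hh k / real n * real (A k) + real n * G0 (hh k) - (real m - 1) / 2 * lam (hh k / 4))"
          using i elim hh[of k] unfolding m_def by (intro crossing_bound) auto
        also have "\<dots> \<le> 4 * cc * ((K + 1) * (real n)\<^sup>2) * (4 * (real n)\<^sup>2) * (e * (exp c * exp (- c * real m)))"
        proof (intro mult_mono)
          have "real n \<le> (real n)\<^sup>2" using n by (simp add: power2_eq_square)
          then show "real (A k) + real n \<le> (K + 1) * (real n)\<^sup>2" using elim(1)[folded n_def] unfolding distrib_right by linarith
          have "(real n + 2)\<^sup>2 \<le> (2 * real n)\<^sup>2" using n by (intro power_mono) auto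
          then show "(real n + 2)\<^sup>2 \<le> 4 * (real n)\<^sup>2" by (simp add: power_mult_distrib)
          have "2 * c \<le> lam (hh k / 4)" unfolding c_def using elim hh[of k] h by simp (intro lam_mono, auto)
          then have "(real m - 1) / 2 * (2 * c) \<le> (real m - 1) / 2 * lam (hh k / 4)"
            using elim by (intro mult_left_mono) (auto simp: m_def)
          then have "- hh k / real n * real (A k) + real n * G0 (hh k) - (real m - 1) / 2 * lam (hh k / 4) \<le>
             (- hh k / real n * real (A k) + real n * G0 (hh k)) + (c + - c * real m)" by (simp add: field_simps)
          then show "exp (- hh k / real n * real (A k) + real n * G0 (hh k) - (real m - 1) / 2 * lam (hh k / 4)) \<le> e * (exp c * exp (- c * real m))"
            unfolding e_def exp_add[symmetric] exp_le_cancel_iff .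
        qed (use cc K in auto)
        also have "\<dots> = 16 * cc * (K + 1) * real n ^ 4 * (e * (exp c * exp (- c * real m)))" by (simp add: eval_nat_numeral)
        finally show ?thesis .
      qed
      have "(\<Sum>i\<in>{m..<n - m}. measure (walk n) (bridge n (int (A k)) \<inter> crossing i)) \<le>
         real (card {m..<n - m}) * (16 * cc * (K + 1) * real n ^ 4 * (e * (exp c * exp (- c * real m))))"
        by (rule sum_bounded_above) (rule 0)
      also have "\<dots> \<le> real n * (16 * cc * (K + 1) * real n ^ 4 * (e * (exp c * exp (- c * real m))))"
        using cc K by (intro mult_right_mono) (auto simp: e_def)
      finally have "scale k * (\<Sum>i\<in>{m..<n - m}. measure (walk n) (bridge n (int (A k)) \<inter> crossing i)) \<le>
         scale k * (real n * (16 * cc * (K + 1) * real n ^ 4 * (e * (exp c * exp (- c * real m)))))"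
        by (intro mult_left_mono) (auto simp: scale_def)
      moreover have "scale k = (real n)\<^sup>2 * inverse e"
        unfolding scale_def e_def exp_minus[symmetric] n_def by simp
      moreover have "(real n)\<^sup>2 * inverse e * (real n * (16 * cc * (K + 1) * real n ^ 4 * (e * (exp c * exp (- c * real m))))) =
         D * (real n ^ 7 * exp (- c * real m))"
        unfolding D_def by (simp add: e_def eval_nat_numeral field_simps)
      ultimately show ?case unfolding n_def m_def by (simp only:)
    qed
    show "eventually (\<lambda>k. 0 \<le> scale k * (\<Sum>i\<in>{mm k..<nn k - mm k}. measure (walk (nn k)) (bridge (nn k) (int (A k)) \<inter> crossing i))) sequentially"
      by (intro always_eventually allI mult_nonneg_nonneg sum_nonneg) (auto simp: scale_def)
  qed simp
qed

lemma positive_bridge_upper_limit: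
  "\<exists>U. U \<longlonglongrightarrow> gauss_mass / (4 * pi\<^sup>2) \<and> eventually (\<lambda>k. scale k * measure (walk (nn k)) (positive_bridge (nn k) (mm k) (int (A k))) \<le> U k) sequentially"
proof -
  obtain \<epsilon> c where lim: "\<epsilon> \<longlonglongrightarrow> 0" and "0 \<le> c"
    and up: "\<And>k v w. 4 * pi\<^sup>2 * (real (nn k))\<^sup>2 * measure (Middle k) {u. SS k u = v \<and> TT k u = w} \<le> gauss_mass + \<epsilon> k"
    and "\<And>k v w. gauss_mass - \<epsilon> k - c * (\<bar>real_of_int v\<bar> / al k + \<bar>real_of_int w - mu k\<bar> / ga k) \<le>
       4 * pi\<^sup>2 * (real (nn k))\<^sup>2 * measure (Middle k) {u. SS k u = v \<and> TT k u = w}"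
    by (rule local_limit) blast
  define E where "E k = exp (2 * real (mm k) * ((2 * (hh k / real (nn k)) * real (mm k)) / eta * (2 * exp (lam (r_top + eta)))))" for k
  define M where "M k = (gauss_mass + \<epsilon> k) / (4 * pi\<^sup>2 * (real (nn k))\<^sup>2)" for k
  define U where "U k = exp (log_norm (nn k) (hh k) - real (nn k) * G0 (hh k)) * ((gauss_mass + \<epsilon> k) / (4 * pi\<^sup>2) * E k)" for k
  have mm2: "(\<lambda>k. (real (mm k))\<^sup>2 / real (nn k)) \<longlonglongrightarrow> 0"
  proof (rule tendsto_sandwich[OF _ _ tendsto_const mm_square_ratio])
    have "(real (mm k))\<^sup>2 / real (nn k) \<le> (real (mm k))\<^sup>2 / sqrt (real (nn k))" for k
      using nn16[of k] by (intro divide_left_mono real_le_lsqrt) (auto simp: power2_eq_square)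
    then show "eventually (\<lambda>k. (real (mm k))\<^sup>2 / real (nn k) \<le> (real (mm k))\<^sup>2 / sqrt (real (nn k))) sequentially" by simp
  qed simp
  have E_lim: "E \<longlonglongrightarrow> 1"
  proof -
    have "(\<lambda>k. (8 * exp (lam (r_top + eta)) / eta) * hh k * ((real (mm k))\<^sup>2 / real (nn k))) \<longlonglongrightarrow> (8 * exp (lam (r_top + eta)) / eta) * h * 0"
      by (intro tendsto_mult tendsto_const hh_lim mm2)
    then have "(\<lambda>k. 2 * real (mm k) * ((2 * (hh k / real (nn k)) * real (mm k)) / eta * (2 * exp (lam (r_top + eta))))) \<longlonglongrightarrow> 0"
      by (simp add: power2_eq_square mult_ac)
    from tendsto_exp[OF this] show ?thesis unfolding E_def by simp
  qed
  have delta_lim: "(\<lambda>k. 2 * (hh k / real (nn k)) * real (mm k)) \<longlonglongrightarrow> 0"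
  proof -
    have "(\<lambda>k. 2 * hh k * (real (mm k) / real (nn k))) \<longlonglongrightarrow> 2 * h * 0"
      by (intro tendsto_mult tendsto_const hh_lim mm_ratio)
    then show ?thesis by (simp add: mult_ac)
  qed
  have "U \<longlonglongrightarrow> 1 * ((gauss_mass + 0) / (4 * pi\<^sup>2) * 1)"
    unfolding U_def by (intro tendsto_mult log_norm_lim tendsto_divide tendsto_add tendsto_const lim E_lim) simp
  moreover have "eventually (\<lambda>k. scale k * measure (walk (nn k)) (positive_bridge (nn k) (mm k) (int (A k))) \<le> U k) sequentially"
    using eventually_h_top order_tendstoD(2)[OF delta_lim h_top(4)]
  proof eventually_elim
    case (elim k)
    define n m where "n = nn k" and "m = mm k"
    have n: "2 * m \<le> n" "1 \<le> n" "0 < real n" using mm8[of k] nn16[of k] by (auto simp: n_def m_def)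
    have "0 \<le> gauss_mass + \<epsilon> k" by (rule order_trans[OF _ up]) simp
    then have M0: "0 \<le> M k" unfolding M_def by (intro divide_nonneg_nonneg) auto
    have "measure (walk n) (positive_bridge n m (int (A k))) \<le> exp (log_norm n (hh k) - hh k / real n * real_of_int (int (A k))) * (M k * E k)"
    proof (rule positive_bridge_upper[OF n(1,2) hh(1,2) M0])
      fix v w
      show "measure (Inner n m (hh k)) {g. (\<Sum>j\<in>inner n m. g j) = v \<and> (\<Sum>j\<in>inner n m. iweight n j * g j) = w} \<le> M k"
        unfolding n_def m_def Inner_eq Inner_event M_def using up[of k v w] nn_pos[of k]
        by (subst le_divide_eq) (auto simp: mult_ac)
      show "0 \<le> E k" by (simp add: E_def)
      have "(\<integral>\<^sup>+f. ennreal (exp (2 * (hh k / real n) * real_of_int (end_defect n m f))) \<partial>Outer n m (hh k)) \<le>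
         (\<integral>\<^sup>+f. ennreal (exp ((2 * (hh k / real n) * real m) * real_of_int (spread n m f))) \<partial>Outer n m (hh k))"
      proof (intro nn_integral_mono ennreal_leI)
        fix f
        have "real_of_int (end_defect n m f) \<le> real_of_int (int m * spread n m f)"
          using end_defect_le_spread[OF n(1), of f] by (simp only: of_int_le_iff)
        then have "2 * (hh k / real n) * real_of_int (end_defect n m f) \<le> 2 * (hh k / real n) * (real m * real_of_int (spread n m f))"
          using hh(1)[of k] by (intro mult_left_mono) auto
        then show "exp (2 * (hh k / real n) * real_of_int (end_defect n m f)) \<le> exp ((2 * (hh k / real n) * real m) * real_of_int (spread n m f))"
          by (simp add: mult.assoc)
      qed
      also have "\<dots> \<le> ennreal (E k)"
        unfolding E_def n_def[symmetric] m_def[symmetric]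
        using elim hh[of k] h_top by (intro outer_exp_moment[OF n(1)]) (auto simp: r_top_def n_def m_def)
      finally show "(\<integral>\<^sup>+f. ennreal (exp (2 * (hh k / real n) * real_of_int (end_defect n m f))) \<partial>Outer n m (hh k)) \<le> ennreal (E k)" .
    qed
    then have "scale k * measure (walk n) (positive_bridge n m (int (A k))) \<le> scale k * (exp (log_norm n (hh k) - hh k / real n * real (A k)) * (M k * E k))"
      by (intro mult_left_mono) (auto simp: scale_def)
    also have "\<dots> = (exp (hh k / real n * real (A k) - real n * G0 (hh k)) * exp (log_norm n (hh k) - hh k / real n * real (A k))) * (((real n)\<^sup>2 * M k) * E k)"
      by (simp add: scale_def n_def)
    also have "\<dots> = U k"
    proof -
      have "(real n)\<^sup>2 * M k = (gauss_mass + \<epsilon> k) / (4 * pi\<^sup>2)" unfolding M_def n_def[symmetric] using n(3) by simp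
      then show ?thesis unfolding exp_add[symmetric] U_def n_def[symmetric] by simp
    qed
    finally show ?case unfolding n_def m_def .
  qed
  ultimately show ?thesis by (auto intro!: exI[of _ U])
qed

text \<open>Removing the outer steps changes the mean area by \<open>O(mm nn)\<close> only.\<close>

lemma mean_close: "\<exists>K. eventually (\<lambda>k. \<bar>real (A k) - mu k\<bar> \<le> K * (real (mm k) + 1) * real (nn k)) sequentially"
proof
  define L1 where "L1 = lam1 (h_top / 2)"
  define K where "K = \<bar>C\<bar> + 2 * L1 + \<beta> * lam2 (h_top / 2)"
  show "eventually (\<lambda>k. \<bar>real (A k) - mu k\<bar> \<le> K * (real (mm k) + 1) * real (nn k)) sequentially"
    using eventually_h_top
  proof eventually_elim
    case (elim k)
    define n m where "n = nn k" and "m = mm k"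
    have n: "2 * m \<le> n" "1 \<le> n" "0 < real n" using mm8[of k] nn16[of k] by (auto simp: n_def m_def)
    have hk: "0 < hh k" "hh k < \<beta>" using hh by auto
    have l1: "lam1 (hh k / 2) \<le> L1" "0 \<le> L1"
    proof -
      show a: "lam1 (hh k / 2) \<le> L1" unfolding L1_def using elim hk h_top by (intro lam1_mono) auto
      show "0 \<le> L1" unfolding L1_def using lam1_less[of 0 "h_top/2"] h_top h by simp
    qed
    have l2: "lam2 (hh k / 2) \<le> lam2 (h_top / 2)" "0 \<le> lam2 (h_top / 2)"
      using elim hk h_top lam2_mono[of "hh k / 2" "h_top / 2"] lam2_pos[OF h_top(6)] by auto
    let ?t = "\<lambda>j. hh k / real n * cweight n j"
    have "mu k = (\<Sum>j\<in>inner n m. cweight n j * lam1 (?t j)) + (real (n div 2) - (real n - 1) / 2) * (\<Sum>j\<in>J k. lam1 (tau k j))"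
      unfolding mu_def sum_distrib_left sum.distrib[symmetric] n_def m_def inner_def J_def[symmetric] tau_def
      by (intro sum.cong refl) (simp add: iweight_def cweight_def algebra_simps)
    then have mu1: "mu k = (\<Sum>j\<in>inner n m. cweight n j * lam1 (?t j))" unfolding sum_lam1_J by simp
    have "(\<Sum>j<n. cweight n j * lam1 (?t j)) = (\<Sum>j\<in>outer n m. cweight n j * lam1 (?t j)) + mu k"
    proof -
      have e: "{..<n} = outer n m \<union> inner n m" "outer n m \<inter> inner n m = {}" using n by (auto simp: outer_def inner_def)
      show ?thesis unfolding mu1 e(1) by (rule sum.union_disjoint) (use e(2) in auto)
    qed
    moreover have "\<bar>\<Sum>j\<in>outer n m. cweight n j * lam1 (?t j)\<bar> \<le> real m * L1 * real n"
    proof -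
      have "\<bar>\<Sum>j\<in>outer n m. cweight n j * lam1 (?t j)\<bar> \<le> (\<Sum>j\<in>outer n m. \<bar>cweight n j * lam1 (?t j)\<bar>)" by (rule sum_abs)
      also have "\<dots> \<le> (\<Sum>j\<in>outer n m. real n / 2 * L1)"
      proof (rule sum_mono)
        fix j assume "j \<in> outer n m"
        then have j: "j < n" by (rule outer_less)
        have "\<bar>lam1 (?t j)\<bar> \<le> lam1 (hh k / 2)" using cweight_tilt_bound[OF j, of "hh k"] hk by (intro abs_lam1_le) auto
        then show "\<bar>cweight n j * lam1 (?t j)\<bar> \<le> real n / 2 * L1"
          unfolding abs_mult using cweight_bound[OF j] l1 by (intro mult_mono) auto
      qed
      also have "\<dots> = real m * L1 * real n" by (simp add: card_outer[OF n(1)])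
      finally show ?thesis .
    qed
    moreover have "\<bar>(\<Sum>j<n. cweight n j * lam1 (?t j)) - (real n)\<^sup>2 * G1 (hh k)\<bar> \<le> real n * (L1 + \<beta> * lam2 (h_top / 2))"
    proof -
      have "hh k * lam2 (hh k / 2) \<le> \<beta> * lam2 (h_top / 2)" using hk l2 lam2_pos[of "hh k / 2"] by (intro mult_mono) auto
      then have "real n * (lam1 (hh k / 2) + hh k * lam2 (hh k / 2)) \<le> real n * (L1 + \<beta> * lam2 (h_top / 2))"
        using l1 by (intro mult_left_mono) auto
      then show ?thesis using mean_riemann[OF n(2), of "hh k"] hk by linarith
    qed
    moreover have "\<bar>real (A k) - (real n)\<^sup>2 * G1 (hh k)\<bar> \<le> \<bar>C\<bar> * real n"
      using area_close[of k] n abs_ge_self[of C] by (simp add: n_def) (meson abs_ge_self mult_right_mono of_nat_0_le_iff order_trans)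
    ultimately have "\<bar>real (A k) - mu k\<bar> \<le> \<bar>C\<bar> * real n + real n * (L1 + \<beta> * lam2 (h_top / 2)) + real m * L1 * real n" by linarith
    also have "\<dots> \<le> K * (real m + 1) * real n"
    proof -
      have "0 \<le> \<beta> * lam2 (h_top / 2)" using l2 \<beta>_pos by simp
      then have "\<bar>C\<bar> + (L1 + \<beta> * lam2 (h_top / 2)) + real m * L1 \<le> K * (real m + 1)"
        unfolding K_def using l1 mult_nonneg_nonneg[of "\<bar>C\<bar> + L1 + \<beta> * lam2 (h_top / 2)" "real m"] by (simp add: algebra_simps)
      then have "(\<bar>C\<bar> + (L1 + \<beta> * lam2 (h_top / 2)) + real m * L1) * real n \<le> K * (real m + 1) * real n" by (rule mult_right_mono) simp
      then show ?thesis by (simp add: algebra_simps)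
    qed
    finally show ?case unfolding n_def m_def .
  qed
qed

lemma positive_bridge_lower_limit:
  "\<exists>U. U \<longlonglongrightarrow> gauss_mass / (4 * pi\<^sup>2) \<and> eventually (\<lambda>k. U k \<le> scale k * measure (walk (nn k)) (positive_bridge (nn k) (mm k) (int (A k)))) sequentially"
proof -
  obtain \<epsilon> c where lim: "\<epsilon> \<longlonglongrightarrow> 0" and c: "0 \<le> c"
    and lo: "\<And>k v w. gauss_mass - \<epsilon> k - c * (\<bar>real_of_int v\<bar> / al k + \<bar>real_of_int w - mu k\<bar> / ga k) \<le>
       4 * pi\<^sup>2 * (real (nn k))\<^sup>2 * measure (Middle k) {u. SS k u = v \<and> TT k u = w}"
    by (rule local_limit) blast
  obtain K0 where K0: "eventually (\<lambda>k. \<bar>real (A k) - mu k\<bar> \<le> K0 * (real (mm k) + 1) * real (nn k)) sequentially"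
    using mean_close by blast
  define K where "K = \<bar>K0\<bar>"
  define q where "q k = (real (mm k))\<^sup>2 / sqrt (real (nn k))" for k
  have q: "q \<longlonglongrightarrow> 0" unfolding q_def by (rule mm_square_ratio)
  \<comment> \<open>Choosing the spread of the outer steps at most \<open>mm\<^sup>2\<close> makes both phase errors \<open>O(mm\<^sup>2/\<surd>nn)\<close>.\<close>
  define W where "W k = gauss_mass - \<epsilon> k - c * (q k + (3 + 2 * K) * q k)" for k
  define M where "M k = max 0 (W k) / (4 * pi\<^sup>2 * (real (nn k))\<^sup>2)" for k
  define S where "S k = 1 - exp (2 * real (mm k) * (2 * exp (lam (r_top + eta))) - eta * (real (mm k))\<^sup>2)" for k
  define b where "b = lam (h / 8) / 2"
  have b: "0 < b" using lam_less[of 0 "h / 8"] h by (simp add: b_def)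
  define U where "U k = exp (log_norm (nn k) (hh k) - real (nn k) * G0 (hh k)) *
     (max 0 (W k) / (4 * pi\<^sup>2) * S k - 2 * (real (nn k) ^ 3 * exp (- b * real (mm k))))" for k
  have gm: "0 \<le> gauss_mass" using V0_pos[OF hb] G2_pos[OF hb] by (simp add: gauss_mass_def)
  have "S \<longlonglongrightarrow> 1 - 0"
  proof -
    have "((\<lambda>x::real. exp (2 * x * (2 * D) - eta * x\<^sup>2)) \<longlongrightarrow> 0) at_top" if "0 < D" for D using h_top(4) that by real_asymp
    from filterlim_compose[OF this[OF exp_gt_zero] mm_real_lim] show ?thesis unfolding S_def by (intro tendsto_diff tendsto_const)
  qed
  then have S: "S \<longlonglongrightarrow> 1" by simp
  have "W \<longlonglongrightarrow> gauss_mass - 0 - c * (0 + (3 + 2 * K) * 0)"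
    unfolding W_def by (intro tendsto_diff tendsto_mult tendsto_add tendsto_const lim q)
  then have W: "W \<longlonglongrightarrow> gauss_mass" by simp
  have "U \<longlonglongrightarrow> 1 * (max 0 gauss_mass / (4 * pi\<^sup>2) * 1 - 2 * 0)"
    unfolding U_def by (intro tendsto_mult tendsto_diff log_norm_lim tendsto_divide tendsto_max tendsto_const W S polynomial_times_exp_mm[OF b]) simp
  moreover have "eventually (\<lambda>k. U k \<le> scale k * measure (walk (nn k)) (positive_bridge (nn k) (mm k) (int (A k)))) sequentially"
    using eventually_h_top eventually_mm K0
  proof eventually_elim
    case (elim k)
    define n m where "n = nn k" and "m = mm k"
    have n: "2 * m \<le> n" "1 \<le> n" "0 < real n" "1 \<le> m" using mm8[of k] nn16[of k] elim by (auto simp: n_def m_def)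
    have al: "al k = sqrt (real n)" "ga k = real n * sqrt (real n)" by (auto simp: al_def ga_def n_def)
    have m2: "real m \<le> (real m)\<^sup>2" using n by (simp add: power2_eq_square)
    have m3: "real m + 1 \<le> 2 * (real m)\<^sup>2" using m2 n by linarith
    have M0: "0 \<le> M k" unfolding M_def by (intro divide_nonneg_nonneg) auto
    have "exp (log_norm n (hh k) - hh k / real n * real_of_int (int (A k))) *
     (M k * measure (Outer n m (hh k)) {f. spread n m f \<le> int m ^ 2} - (real n + 1) * exp (- (real m / 2) * lam (hh k / 4)))
     \<le> measure (walk n) (positive_bridge n m (int (A k)))"
    proof (rule positive_bridge_lower[OF n(4) n(1) hh(1,2) M0])
      fix v w :: int assume v: "\<bar>v\<bar> \<le> int m ^ 2" and w: "\<bar>w - int (A k)\<bar> \<le> (2 * int m + int n) * int m ^ 2"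
      have v': "\<bar>real_of_int v\<bar> \<le> (real m)\<^sup>2"
      proof -
        have "real_of_int \<bar>v\<bar> \<le> real_of_int (int m ^ 2)" using v by (simp only: of_int_le_iff)
        then show ?thesis by simp
      qed
      have w': "\<bar>real_of_int w - mu k\<bar> \<le> (3 + 2 * K) * (real m)\<^sup>2 * real n"
      proof -
        have "real_of_int \<bar>w - int (A k)\<bar> \<le> real_of_int ((2 * int m + int n) * int m ^ 2)" using w by (simp only: of_int_le_iff)
        then have 1: "\<bar>real_of_int w - real (A k)\<bar> \<le> (2 * real m + real n) * (real m)\<^sup>2" by simp
        have "(2 * real m + real n) * (real m)\<^sup>2 \<le> (3 * real n) * (real m)\<^sup>2" using n by (intro mult_right_mono) auto
        moreover have "K0 * (real m + 1) * real n \<le> K * (2 * (real m)\<^sup>2) * real n"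
          using n by (intro mult_right_mono mult_mono m3) (auto simp: K_def)
        ultimately have "\<bar>real_of_int w - mu k\<bar> \<le> (3 * real n) * (real m)\<^sup>2 + K * (2 * (real m)\<^sup>2) * real n"
          using 1 elim unfolding n_def[symmetric] m_def[symmetric] by linarith
        then show ?thesis by (simp add: algebra_simps)
      qed
      have "\<bar>real_of_int v\<bar> / al k \<le> q k" unfolding q_def al n_def[symmetric] m_def[symmetric] using v' by (intro divide_right_mono) auto
      moreover have "\<bar>real_of_int w - mu k\<bar> / ga k \<le> (3 + 2 * K) * q k"
      proof -
        have "\<bar>real_of_int w - mu k\<bar> / ga k \<le> ((3 + 2 * K) * (real m)\<^sup>2 * real n) / ga k" using w' ga_pos[of k] by (intro divide_right_mono) auto
        also have "\<dots> = (3 + 2 * K) * q k" unfolding al q_def n_def[symmetric] m_def[symmetric] using n by simp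
        finally show ?thesis .
      qed
      ultimately have "c * (\<bar>real_of_int v\<bar> / al k + \<bar>real_of_int w - mu k\<bar> / ga k) \<le> c * (q k + (3 + 2 * K) * q k)"
        using c by (intro mult_left_mono) auto
      then have "W k \<le> 4 * pi\<^sup>2 * (real n)\<^sup>2 * measure (Middle k) {u. SS k u = v \<and> TT k u = w}"
        using lo[of k v w] unfolding W_def n_def[symmetric] by linarith
      then have "max 0 (W k) \<le> 4 * pi\<^sup>2 * (real n)\<^sup>2 * measure (Middle k) {u. SS k u = v \<and> TT k u = w}" by simp
      then show "M k \<le> measure (Inner n m (hh k)) {g. (\<Sum>j\<in>inner n m. g j) = v \<and> (\<Sum>j\<in>inner n m. iweight n j * g j) = w}"
        unfolding n_def m_def Inner_eq Inner_event M_def using nn_pos[of k]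
        by (subst divide_le_eq) (auto simp: mult_ac)
    qed
    then have 1: "scale k * (exp (log_norm n (hh k) - hh k / real n * real (A k)) *
     (M k * measure (Outer n m (hh k)) {f. spread n m f \<le> int m ^ 2} - (real n + 1) * exp (- (real m / 2) * lam (hh k / 4))))
     \<le> scale k * measure (walk n) (positive_bridge n m (int (A k)))"
      by (intro mult_left_mono) (auto simp: scale_def)
    have S1: "S k \<le> measure (Outer n m (hh k)) {f. spread n m f \<le> int m ^ 2}"
    proof -
      have "measure (Outer n m (hh k)) {f. int m ^ 2 < spread n m f} \<le> exp (2 * real m * (2 * exp (lam (r_top + eta))) - eta * real_of_int (int m ^ 2))"
        using elim hh[of k] h_top by (intro spread_tail[OF n(1)]) (auto simp: r_top_def)
      moreover have "measure (Outer n m (hh k)) {f. int m ^ 2 < spread n m f} = 1 - measure (Outer n m (hh k)) {f. spread n m f \<le> int m ^ 2}"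
      proof -
        have "{f. int m ^ 2 < spread n m f} = UNIV - {f. spread n m f \<le> int m ^ 2}" by auto
        then show ?thesis using prob_space.prob_compl[OF measure_pmf.prob_space_axioms, of "{f. spread n m f \<le> int m ^ 2}" "Outer n m (hh k)"] by simp
      qed
      ultimately show ?thesis unfolding S_def m_def by simp
    qed
    have e1: "exp (- (real m / 2) * lam (hh k / 4)) \<le> exp (- b * real m)"
    proof -
      have "2 * b \<le> lam (hh k / 4)" unfolding b_def using elim hh[of k] h by simp (intro lam_mono, auto)
      then have "real m / 2 * (2 * b) \<le> real m / 2 * lam (hh k / 4)" by (intro mult_left_mono) auto
      then show ?thesis by (simp add: mult.commute)
    qed
    have "(real n)\<^sup>2 * ((real n + 1) * exp (- (real m / 2) * lam (hh k / 4))) \<le> (real n)\<^sup>2 * ((2 * real n) * exp (- b * real m))"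
      using e1 n by (intro mult_left_mono mult_mono) auto
    then have e2: "(real n)\<^sup>2 * ((real n + 1) * exp (- (real m / 2) * lam (hh k / 4))) \<le> 2 * (real n ^ 3 * exp (- b * real m))"
      by (simp add: eval_nat_numeral mult_ac)
    have e3: "max 0 (W k) / (4 * pi\<^sup>2) * S k \<le> max 0 (W k) / (4 * pi\<^sup>2) * measure (Outer n m (hh k)) {f. spread n m f \<le> int m ^ 2}"
      using S1 by (intro mult_left_mono) auto
    have e4: "(real n)\<^sup>2 * M k = max 0 (W k) / (4 * pi\<^sup>2)" unfolding M_def n_def[symmetric] using n by simp
    have "U k \<le> exp (log_norm n (hh k) - real n * G0 (hh k)) *
      ((real n)\<^sup>2 * M k * measure (Outer n m (hh k)) {f. spread n m f \<le> int m ^ 2} - (real n)\<^sup>2 * ((real n + 1) * exp (- (real m / 2) * lam (hh k / 4))))"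
      unfolding U_def e4 n_def[symmetric] m_def[symmetric] using e2 e3 by (intro mult_left_mono) auto
    also have "exp (log_norm n (hh k) - real n * G0 (hh k)) =
       exp (hh k / real n * real (A k) - real n * G0 (hh k)) * exp (log_norm n (hh k) - hh k / real n * real (A k))"
      unfolding exp_add[symmetric] by simp
    also have "\<dots> * ((real n)\<^sup>2 * M k * measure (Outer n m (hh k)) {f. spread n m f \<le> int m ^ 2} - (real n)\<^sup>2 * ((real n + 1) * exp (- (real m / 2) * lam (hh k / 4)))) =
       scale k * (exp (log_norm n (hh k) - hh k / real n * real (A k)) *
     (M k * measure (Outer n m (hh k)) {f. spread n m f \<le> int m ^ 2} - (real n + 1) * exp (- (real m / 2) * lam (hh k / 4))))"
      unfolding scale_def n_def[symmetric] by (simp only: right_diff_distrib mult_ac)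
    also note 1
    finally show ?case unfolding n_def m_def .
  qed
  ultimately show ?thesis using gm by (auto intro!: exI[of _ U] simp: max_def)
qed

text \<open>Both bounds for positive bridges meet at \<open>gauss_mass / (4\<pi>\<^sup>2)\<close>; the two
  signs double it, and sign changes in the bulk do not count.\<close>

theorem bridge_limit: "(\<lambda>k. scale k * measure (walk (nn k)) (bridge (nn k) (int (A k)))) \<longlonglongrightarrow> 1 / (pi * sqrt (V0 h * G2 h))"
proof -
  obtain U where U: "U \<longlonglongrightarrow> gauss_mass / (4 * pi\<^sup>2)"
    "eventually (\<lambda>k. scale k * measure (walk (nn k)) (positive_bridge (nn k) (mm k) (int (A k))) \<le> U k) sequentially"
    using positive_bridge_upper_limit by blast
  obtain T where T: "T \<longlonglongrightarrow> gauss_mass / (4 * pi\<^sup>2)"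
    "eventually (\<lambda>k. T k \<le> scale k * measure (walk (nn k)) (positive_bridge (nn k) (mm k) (int (A k)))) sequentially"
    using positive_bridge_lower_limit by blast
  let ?c = "\<lambda>k. scale k * (\<Sum>i\<in>{mm k..<nn k - mm k}. measure (walk (nn k)) (bridge (nn k) (int (A k)) \<inter> crossing i))"
  have s0: "0 \<le> scale k" for k by (simp add: scale_def)
  have gm: "1 / (pi * sqrt (V0 h * G2 h)) = 2 * (gauss_mass / (4 * pi\<^sup>2))"
    by (simp add: gauss_mass_def power2_eq_square)
  show ?thesis unfolding gm
  proof (rule tendsto_sandwich)
    show "(\<lambda>k. 2 * T k) \<longlonglongrightarrow> 2 * (gauss_mass / (4 * pi\<^sup>2))" by (intro tendsto_mult tendsto_const T)
    have "(\<lambda>k. 2 * U k + ?c k) \<longlonglongrightarrow> 2 * (gauss_mass / (4 * pi\<^sup>2)) + 0" by (intro tendsto_add tendsto_mult tendsto_const U crossings_vanish)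
    then show "(\<lambda>k. 2 * U k + ?c k) \<longlonglongrightarrow> 2 * (gauss_mass / (4 * pi\<^sup>2))" by simp
    show "eventually (\<lambda>k. 2 * T k \<le> scale k * measure (walk (nn k)) (bridge (nn k) (int (A k)))) sequentially"
      using T(2)
    proof eventually_elim
      case (elim k)
      have "2 * mm k \<le> nn k" using mm8[of k] by simp
      from mult_left_mono[OF bridge_lower[OF this, of "int (A k)"] s0[of k]] elim show ?case by simp
    qed
    show "eventually (\<lambda>k. scale k * measure (walk (nn k)) (bridge (nn k) (int (A k))) \<le> 2 * U k + ?c k) sequentially"
      using U(2)
    proof eventually_elim
      case (elim k)
      have "2 * mm k < nn k" using mm8[of k] nn16[of k] by simp
      from mult_left_mono[OF bridge_upper[OF this, of "int (A k)"] s0[of k]] elim show ?case by (simp add: distrib_left)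
    qed
  qed
qed

end

context ipdsaw
begin

definition bridge_ratio :: "nat \<Rightarrow> real \<Rightarrow> nat \<Rightarrow> real" where
  "bridge_ratio n h A = (real n)\<^sup>2 * exp (h / real n * real A - real n * G0 h) * measure (walk n) (bridge n (int A))"

lemma ex_eighth_root: "\<exists>m::nat. m ^ 8 \<le> n \<and> n < (m + 1) ^ 8"
proof -
  define m where "m = (LEAST m. n < (m + 1) ^ 8)"
  have "n + 1 \<le> (n + 1) ^ 8" by (rule self_le_power) auto
  then have ex: "n < (n + 1) ^ 8" by simp
  have 1: "n < (m + 1) ^ 8" unfolding m_def using ex by (rule LeastI)
  have "m ^ 8 \<le> n"
  proof (cases m)
    case (Suc k)
    then have "\<not> n < (k + 1) ^ 8" unfolding m_def by (intro not_less_Least) (auto simp: m_def)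
    then show ?thesis using Suc by simp
  qed simp
  then show ?thesis using 1 by blast
qed

text \<open>The limit along sequences that satisfy the assumptions from some index on, with a suitable length
  of the ends supplied.\<close>

lemma bridge_ratio_tendsto:
  fixes N A :: "nat \<Rightarrow> nat" and H :: "nat \<Rightarrow> real"
  assumes N: "filterlim N at_top sequentially" and H: "H \<longlonglongrightarrow> h" and h: "0 < h" "h < \<beta>"
    and A: "eventually (\<lambda>k. \<bar>real (A k) - (real (N k))\<^sup>2 * G1 (H k)\<bar> \<le> C * real (N k)) sequentially"
  shows "(\<lambda>k. bridge_ratio (N k) (H k) (A k)) \<longlonglongrightarrow> 1 / (pi * sqrt (V0 h * G2 h))"
proof -
  have "eventually (\<lambda>k. 16 \<le> N k) sequentially" using N unfolding filterlim_at_top by blast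
  moreover have "eventually (\<lambda>k. 0 < H k) sequentially" "eventually (\<lambda>k. H k < \<beta>) sequentially"
    using order_tendstoD[OF H] h by blast+
  ultimately have "eventually (\<lambda>k. 16 \<le> N k \<and> 0 < H k \<and> H k < \<beta> \<and> \<bar>real (A k) - (real (N k))\<^sup>2 * G1 (H k)\<bar> \<le> C * real (N k)) sequentially"
    using A by eventually_elim auto
  then obtain k0 where k0: "\<And>k. k0 \<le> k \<Longrightarrow> 16 \<le> N k \<and> 0 < H k \<and> H k < \<beta> \<and> \<bar>real (A k) - (real (N k))\<^sup>2 * G1 (H k)\<bar> \<le> C * real (N k)"
    unfolding eventually_sequentially by blast
  define N' H' A' where "N' k = N (k + k0)" and "H' k = H (k + k0)" and "A' k = A (k + k0)" for k
  obtain m where m: "\<And>n::nat. m n ^ 8 \<le> n" "\<And>n::nat. n < (m n + 1) ^ 8" using ex_eighth_root by metis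
  have N'_lim: "filterlim N' at_top sequentially" unfolding N'_def
    by (rule filterlim_compose[OF N]) (rule filterlim_add_const_nat_at_top)
  have N16: "16 \<le> N' k" for k using k0[of "k + k0"] by (simp add: N'_def)
  interpret bulk_bridge \<beta> N' "\<lambda>k. m (N' k)" H' h A' C
  proof unfold_locales
    show "16 \<le> N' k" for k by (rule N16)
    show "filterlim N' at_top sequentially" by (rule N'_lim)
    show "8 * m (N' k) \<le> N' k" for k
    proof (cases "m (N' k) \<le> 2")
      case True
      then show ?thesis using N16[of k] by simp
    next
      case False
      then have "3 ^ 7 * m (N' k) \<le> m (N' k) ^ 7 * m (N' k)" by (intro mult_right_mono power_mono) auto
      also have "\<dots> = m (N' k) ^ 8" by (simp add: eval_nat_numeral)
      also note m(1)
      finally show ?thesis by simp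
    qed
    show "(\<lambda>k. real (m (N' k)) / real (N' k)) \<longlonglongrightarrow> 0"
    proof (rule tendsto_sandwich[where f = "\<lambda>_. 0"])
      have "((\<lambda>x::real. sqrt x / x) \<longlongrightarrow> 0) at_top" by real_asymp
      from filterlim_compose[OF this filterlim_compose[OF filterlim_real_sequentially N'_lim]]
      show "(\<lambda>k. sqrt (real (N' k)) / real (N' k)) \<longlonglongrightarrow> 0" .
      have "real (m (N' k)) \<le> sqrt (real (N' k))" for k
      proof (rule real_le_rsqrt)
        have "m (N' k) ^ 2 \<le> m (N' k) ^ 8" by (cases "m (N' k) = 0") (auto intro!: power_increasing)
        then have "m (N' k) ^ 2 \<le> N' k" using m(1)[of "N' k"] by linarith
        then show "(real (m (N' k)))\<^sup>2 \<le> real (N' k)" by (simp only: of_nat_power[symmetric] of_nat_le_iff)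
      qed
      then show "eventually (\<lambda>k. real (m (N' k)) / real (N' k) \<le> sqrt (real (N' k)) / real (N' k)) sequentially"
        by (intro always_eventually allI divide_right_mono) auto
    qed auto
    show "0 < H' k" "H' k < \<beta>" for k using k0[of "k + k0"] by (auto simp: H'_def)
    show "H' \<longlonglongrightarrow> h" unfolding H'_def using H by (rule LIMSEQ_ignore_initial_segment)
    show "0 < h" "h < \<beta>" by (rule h)+
    show "m (N' k) ^ 8 \<le> N' k" "N' k < (m (N' k) + 1) ^ 8" for k by (rule m)+
    show "\<bar>real (A' k) - (real (N' k))\<^sup>2 * G1 (H' k)\<bar> \<le> C * real (N' k)" for k
      using k0[of "k + k0"] by (simp add: H'_def A'_def N'_def)
  qed
  have "(\<lambda>k. bridge_ratio (N (k + k0)) (H (k + k0)) (A (k + k0))) \<longlonglongrightarrow> 1 / (pi * sqrt (V0 h * G2 h))"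
    using bridge_limit unfolding scale_def bridge_ratio_def N'_def H'_def A'_def .
  then show ?thesis by (rule LIMSEQ_offset)
qed

text \<open>Uniformity by contradiction: an unbounded sequence has a subsequence along which the tilts
  converge inside \<open>(0, \<beta>)\<close>, and there the ratio has a finite limit.\<close>

lemma bridge_ratio_bounded:
  assumes h: "0 < h0" "h1 < \<beta>"
  shows "\<exists>K n0. \<forall>n\<ge>n0. \<forall>h\<in>{h0..h1}. \<forall>A. \<bar>real A - (real n)\<^sup>2 * G1 h\<bar> \<le> C * real n \<longrightarrow> bridge_ratio n h A \<le> K"
proof (rule ccontr)
  assume "\<not> ?thesis"
  then have "\<exists>n h A. k \<le> n \<and> h \<in> {h0..h1} \<and> \<bar>real A - (real n)\<^sup>2 * G1 h\<bar> \<le> C * real n \<and> real k < bridge_ratio n h A" for k :: nat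
    unfolding not_ex not_all not_imp Ball_def not_le by blast
  then obtain N H A where NHA: "\<And>k::nat. k \<le> N k" "\<And>k. H k \<in> {h0..h1}"
      "\<And>k. \<bar>real (A k) - (real (N k))\<^sup>2 * G1 (H k)\<bar> \<le> C * real (N k)" "\<And>k. real k < bridge_ratio (N k) (H k) (A k)"
    by metis
  have "seq_compact {h0..h1}" by (simp add: compact_imp_seq_compact)
  then obtain h r where r: "h \<in> {h0..h1}" "strict_mono (r :: nat \<Rightarrow> nat)" "(H \<circ> r) \<longlonglongrightarrow> h"
    using NHA(2) unfolding seq_compact_def by metis
  have "(\<lambda>k. bridge_ratio (N (r k)) (H (r k)) (A (r k))) \<longlonglongrightarrow> 1 / (pi * sqrt (V0 h * G2 h))"
  proof (rule bridge_ratio_tendsto[where C = C])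
    show "filterlim (\<lambda>k. N (r k)) at_top sequentially"
    proof (rule filterlim_at_top_mono[OF filterlim_ident always_eventually, rule_format])
      show "k \<le> N (r k)" for k using seq_suble[OF r(2), of k] NHA(1)[of "r k"] by linarith
    qed
    show "(\<lambda>k. H (r k)) \<longlonglongrightarrow> h" using r(3) by (simp add: o_def)
  qed (use r(1) h NHA(3) in auto)
  moreover have "filterlim (\<lambda>k. bridge_ratio (N (r k)) (H (r k)) (A (r k))) at_top sequentially"
  proof (rule filterlim_at_top_mono[OF filterlim_real_sequentially always_eventually, rule_format])
    fix k
    have "real k \<le> real (r k)" using seq_suble[OF r(2), of k] by simp
    then show "real k \<le> bridge_ratio (N (r k)) (H (r k)) (A (r k))" using NHA(4)[of "r k"] by linarith
  qed
  ultimately show False using not_tendsto_and_filterlim_at_infinity[OF trivial_limit_sequentially] filterlim_at_top_imp_at_infinity by blast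
qed

end

text \<open>A second-order Taylor expansion with Peano remainder, packaged as a continuous function vanishing
  at \<open>a\<close>. It serves both as a limit and as a quadratic upper bound near \<open>a\<close>.\<close>

lemma second_order_expansion:
  fixes f f1 :: "real \<Rightarrow> real"
  assumes S: "open S" "a \<in> S" and f: "\<And>x. x \<in> S \<Longrightarrow> (f has_real_derivative f1 x) (at x)"
    and f1: "f1 a = 0" "(f1 has_real_derivative D) (at a)"
  shows "\<exists>r. r a = 0 \<and> isCont r a \<and> (\<forall>x. f x = f a + (D / 2 + r x) * (x - a)\<^sup>2)"
proof -
  define r where "r x = (f x - f a) / (x - a)\<^sup>2 - (if x = a then 0 else D / 2)" for x
  have r0: "r a = 0" by (simp add: r_def)
  have fr: "f x = f a + (D / 2 + r x) * (x - a)\<^sup>2" for x by (cases "x = a") (auto simp: r_def)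
  have "(r \<longlongrightarrow> 0) (at a)"
  proof (rule tendstoI)
    fix e :: real assume e: "0 < e"
    have "((\<lambda>x. (f1 x - f1 a) / (x - a)) \<longlongrightarrow> D) (at a)" using f1(2) by (simp add: has_field_derivative_iff)
    then have "eventually (\<lambda>x. dist ((f1 x - f1 a) / (x - a)) D < e / 2) (at a)" using e by (intro tendstoD) auto
    then obtain d1 where d1: "0 < d1" "\<And>x. x \<noteq> a \<Longrightarrow> dist x a < d1 \<Longrightarrow> dist (f1 x / (x - a)) D < e / 2"
      using f1(1) unfolding eventually_at by auto
    obtain d2 where d2: "0 < d2" "ball a d2 \<subseteq> S" using S openE by blast
    define d where "d = min d1 d2"
    have d: "0 < d" using d1 d2 by (simp add: d_def)
    show "eventually (\<lambda>x. dist (r x) 0 < e) (at a)"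
      unfolding eventually_at
    proof (intro exI conjI ballI impI)
      fix x assume x: "x \<noteq> a \<and> dist x a < d"
      let ?g = "\<lambda>x. f x - f a - D / 2 * (x - a)\<^sup>2"
      have seg: "z \<in> S" "\<bar>f1 z - D * (z - a)\<bar> \<le> e / 2 * \<bar>x - a\<bar>" if z: "z \<in> closed_segment a x" for z
      proof -
        have za: "\<bar>z - a\<bar> \<le> \<bar>x - a\<bar>" using z segment_bound1[of z a x] by simp
        then have zd: "dist z a < d" using x by (simp add: dist_real_def)
        then show "z \<in> S" using d2 by (auto simp: d_def dist_commute)
        show "\<bar>f1 z - D * (z - a)\<bar> \<le> e / 2 * \<bar>x - a\<bar>"
        proof (cases "z = a")
          case False
          have "dist (f1 z / (z - a)) D < e / 2" using d1(2)[OF False] zd by (simp add: d_def)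
          then have "\<bar>f1 z / (z - a) - D\<bar> * \<bar>z - a\<bar> \<le> e / 2 * \<bar>x - a\<bar>" using za e by (intro mult_mono) (auto simp: dist_real_def)
          moreover have "\<bar>f1 z / (z - a) - D\<bar> * \<bar>z - a\<bar> = \<bar>f1 z - D * (z - a)\<bar>"
            using False by (simp add: abs_mult[symmetric] left_diff_distrib)
          ultimately show ?thesis by simp
        qed (use f1 e in simp)
      qed
      have "norm (?g x - ?g a) \<le> e / 2 * \<bar>x - a\<bar> * norm (x - a)"
      proof (rule field_differentiable_bound[of "closed_segment a x" ?g "\<lambda>z. f1 z - D * (z - a)"])
        fix z assume z: "z \<in> closed_segment a x"
        show "(?g has_field_derivative f1 z - D * (z - a)) (at z within closed_segment a x)"
          by (rule has_field_derivative_at_within) (auto intro!: derivative_eq_intros f seg[OF z])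
        show "norm (f1 z - D * (z - a)) \<le> e / 2 * \<bar>x - a\<bar>" using seg(2)[OF z] by simp
      qed auto
      then have "\<bar>?g x\<bar> \<le> e / 2 * (x - a)\<^sup>2" by (simp add: power2_eq_square)
      also have "\<dots> < e * (x - a)\<^sup>2" using x e by (intro mult_strict_right_mono) auto
      finally have "\<bar>?g x\<bar> / (x - a)\<^sup>2 < e" using x by (simp add: divide_less_eq)
      moreover have "r x = ?g x / (x - a)\<^sup>2" using x by (simp add: r_def diff_divide_distrib)
      ultimately show "dist (r x) 0 < e" using x by (simp add: dist_real_def abs_divide)
    qed (rule d)
  qed
  then have "isCont r a" by (simp add: isCont_def r0)
  then show ?thesis using r0 fr by blast
qed

lemma floor_sum_integral:
  fixes F :: "nat \<Rightarrow> real" and s t :: real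
  assumes S: "finite S" "0 \<notin> S" and s: "0 < s"
  shows "(\<Sum>j\<in>S. F j) = s * (\<integral>y. (if nat \<lfloor>t + s * y\<rfloor> \<in> S then F (nat \<lfloor>t + s * y\<rfloor>) else 0) \<partial>lborel)"
proof -
  let ?I = "\<lambda>j. {(real j - t) / s..<(real j + 1 - t) / s}"
  have eq: "(if nat \<lfloor>t + s * y\<rfloor> \<in> S then F (nat \<lfloor>t + s * y\<rfloor>) else 0) = (\<Sum>j\<in>S. F j * indicator (?I j) y)" for y
  proof -
    have ind: "indicator (?I j) y = (if j = nat \<lfloor>t + s * y\<rfloor> then 1 else (0::real))" if "j \<in> S" for j
    proof -
      have j: "0 < j" using that S by (cases j) auto
      have "y \<in> ?I j \<longleftrightarrow> real j \<le> t + s * y \<and> t + s * y < real j + 1"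
        using s by (simp add: pos_divide_le_eq pos_less_divide_eq algebra_simps)
      also have "\<dots> \<longleftrightarrow> \<lfloor>t + s * y\<rfloor> = int j" by (simp add: floor_eq_iff)
      also have "\<dots> \<longleftrightarrow> j = nat \<lfloor>t + s * y\<rfloor>" using j by auto
      finally show ?thesis by (simp add: indicator_def)
    qed
    have "(\<Sum>j\<in>S. F j * indicator (?I j) y) = (\<Sum>j\<in>S. if j = nat \<lfloor>t + s * y\<rfloor> then F j else 0)"
      by (intro sum.cong refl) (simp add: ind)
    then show ?thesis using S by simp
  qed
  have "(\<integral>y. (\<Sum>j\<in>S. F j * indicator (?I j) y) \<partial>lborel) = (\<Sum>j\<in>S. \<integral>y. F j * indicator (?I j) y \<partial>lborel)"
    using s by (intro Bochner_Integration.integral_sum integrable_mult_right integrable_real_indicator)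
      (auto simp: emeasure_lborel_Ico divide_right_mono)
  also have "\<dots> = (\<Sum>j\<in>S. F j / s)"
  proof (intro sum.cong refl)
    fix j assume "j \<in> S"
    have le: "(real j - t) / s \<le> (real j + 1 - t) / s" using s by (simp add: divide_right_mono)
    have "(real j + 1 - t) / s - (real j - t) / s = 1 / s" by (simp add: diff_divide_distrib add_divide_distrib)
    then show "(\<integral>y. F j * indicator (?I j) y \<partial>lborel) = F j / s" using le by simp
  qed
  finally show ?thesis unfolding eq using s by (simp add: sum_divide_distrib[symmetric])
qed

section \<open>Summation over the number of stretches\<close>

context collapsed
begin

text \<open>The maximiser of \<open>G_tilde\<close>, the second derivative there, and \<open>weight L
  n\<close>, which is the contribution of the bridges with \<open>n\<close> steps up to the common factor
  \<open>exp (\<beta> L + \<beta>)\<close>.\<close>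

definition a where "a = a_opt \<beta>"
definition D where "D = Gt2 a"
definition weight :: "nat \<Rightarrow> nat \<Rightarrow> real" where
  "weight L n = exp (real n * lnw) * measure (walk n) (bridge n (int L + 1 - int n))"

lemma a: "0 < a" "Gt1 a = 0" unfolding a_def by (rule a_opt)+
lemma D: "D < 0" unfolding D_def by (rule Gt2_neg[OF a(1)])

lemma partition_fun_eq: "partition_fun \<beta> L = exp (\<beta> * real L) * exp \<beta> * (\<Sum>n\<in>{2..Suc L}. weight L n)"
proof -
  have cc: "0 < cc" by (rule c_const_pos[OF \<beta>_pos])
  have "partition_fun \<beta> L = (\<Sum>N=1..L. partition_part \<beta> N L)" by (simp add: partition_fun_def partition_part_def)
  also have "\<dots> = (\<Sum>N=1..L. exp (\<beta> * real L) * exp \<beta> * weight L (Suc N))"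
  proof (intro sum.cong refl)
    fix N assume N: "N \<in> {1..L}"
    have "exp (real (Suc N) * lnw) = (cc / exp \<beta>) ^ Suc N" using cc by (subst exp_of_nat_mult) simp
    also have "\<dots> = cc ^ Suc N / exp (real (Suc N) * \<beta>)" by (simp only: power_divide exp_of_nat_mult)
    finally have "exp (\<beta> * real L) * exp \<beta> * exp (real (Suc N) * lnw) = (exp (\<beta> * real L) * exp \<beta> / exp (real (Suc N) * \<beta>)) * cc ^ Suc N"
      by simp
    also have "exp (\<beta> * real L) * exp \<beta> / exp (real (Suc N) * \<beta>) = exp (\<beta> * (real L - real N))"
      unfolding exp_add[symmetric] exp_diff[symmetric] by (simp add: algebra_simps)
    finally show "partition_part \<beta> N L = exp (\<beta> * real L) * exp \<beta> * weight L (Suc N)"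
      using N by (subst partition_part_eq) (auto simp: weight_def mult.assoc)
  qed
  also have "\<dots> = (\<Sum>n\<in>{2..Suc L}. exp (\<beta> * real L) * exp \<beta> * weight L n)"
    by (rule sum.reindex_bij_witness[of _ "\<lambda>n. n - 1" Suc]) auto
  finally show ?thesis by (simp only: sum_distrib_left)
qed

context
  fixes L n :: nat and x
  assumes L: "1 \<le> L" and n: "1 \<le> n" "n \<le> Suc L" and x: "x = real n / sqrt (real L)"
begin

lemma x_pos: "0 < x" using L n unfolding x by simp

lemma sqrt_L_G_tilde: "sqrt (real L) * G_tilde \<beta> x = real n * lnw - hx x / real n * real L + real n * G0 (hx x)"
proof -
  have s: "0 < sqrt (real L)" "sqrt (real L) * sqrt (real L) = real L" using L by auto
  have n': "sqrt (real L) * x = real n" using s unfolding x by simp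
  have "sqrt (real L) * (hx x / x) = hx x / real n * real L"
    using s n unfolding x by (simp add: field_simps)
  moreover have "sqrt (real L) * (x * lnw - hx x / x + x * G0 (hx x)) =
      (sqrt (real L) * x) * lnw - sqrt (real L) * (hx x / x) + (sqrt (real L) * x) * G0 (hx x)"
    by (simp add: algebra_simps)
  ultimately show ?thesis unfolding G_tilde_eq[OF x_pos] by (simp only: n')
qed

lemma area_near_mean: "\<bar>real (Suc L - n) - (real n)\<^sup>2 * G1 (hx x)\<bar> \<le> 1 * real n"
proof -
  have "(real n)\<^sup>2 * G1 (hx x) = real L" unfolding hx(3)[OF x_pos] unfolding x using n L by (simp add: power_divide)
  then show ?thesis using n by (simp add: of_nat_diff abs_le_iff)
qed

lemma area_term: "int L + 1 - int n = int (Suc L - n)" using n by simp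

text \<open>With \<open>x = n/\<surd>L\<close> and the tilt \<open>hx x\<close>, the exponents \<open>n ln
  (c/e\<^bsup>\<beta>\<^esup>)\<close>, \<open>- h A/n\<close> and \<open>n G(h)\<close> combine to
  \<open>\<surd>L G~(x)\<close>. The factor \<open>exp (h - h/n)\<close> remains because the area is \<open>L +
  1 - n\<close> and not \<open>L\<close>.\<close>

lemma weight_eq: "weight L n = exp (sqrt (real L) * G_tilde \<beta> x) * exp (hx x - hx x / real n) * bridge_ratio n (hx x) (Suc L - n) / (real n)\<^sup>2"
proof -
  have n0: "0 < real n" using n by simp
  have b: "bridge_ratio n (hx x) (Suc L - n) / (real n)\<^sup>2 =
     exp (hx x / real n * real (Suc L - n) - real n * G0 (hx x)) * measure (walk n) (bridge n (int L + 1 - int n))"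
    unfolding bridge_ratio_def area_term using n0 by simp
  have ex: "exp (sqrt (real L) * G_tilde \<beta> x) * exp (hx x - hx x / real n) * exp (hx x / real n * real (Suc L - n) - real n * G0 (hx x)) = exp (real n * lnw)"
    unfolding exp_add[symmetric] sqrt_L_G_tilde using n n0 by (simp add: of_nat_diff field_simps)
  show ?thesis unfolding weight_def ex[symmetric] times_divide_eq_right[symmetric] b by (simp only: mult.assoc)
qed

text \<open>The Chernoff bound is available for all tilts in \<open>(0, \<beta>)\<close>, so this holds for
  every \<open>n\<close>, even where the sharp asymptotics is not uniform.\<close>

lemma weight_le: "weight L n \<le> 2 * (real L + 2) * exp \<beta> * exp (sqrt (real L) * G_tilde \<beta> x)"
proof -
  have n0: "0 < real n" using n by simp
  have h: "0 < hx x" "hx x < \<beta>" using hx[OF x_pos] by auto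
  have "weight L n \<le> exp (real n * lnw) * (2 * (real n + 1) * exp (- hx x / real n * real_of_int (int L + 1 - int n) + real n * G0 (hx x)))"
    unfolding weight_def using n h by (intro mult_left_mono chernoff_bridge) auto
  also have "\<dots> = 2 * (real n + 1) * (exp (hx x - hx x / real n) * exp (sqrt (real L) * G_tilde \<beta> x))"
  proof -
    have "exp (real n * lnw) * exp (- hx x / real n * real_of_int (int L + 1 - int n) + real n * G0 (hx x)) = exp (hx x - hx x / real n) * exp (sqrt (real L) * G_tilde \<beta> x)"
      unfolding exp_add[symmetric] sqrt_L_G_tilde using n0 by (simp add: field_simps)
    then show ?thesis by (simp only: mult.left_commute[of "exp (real n * lnw)"])
  qed
  also have "\<dots> \<le> 2 * (real L + 2) * (exp \<beta> * exp (sqrt (real L) * G_tilde \<beta> x))"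
  proof (intro mult_mono)
    have "0 \<le> hx x / real n" using h n0 by simp
    then show "exp (hx x - hx x / real n) \<le> exp \<beta>" unfolding exp_le_cancel_iff using h by linarith
  qed (use n in auto)
  finally show ?thesis by (simp add: mult.assoc)
qed

end

lemma G_tilde_gap:
  assumes d: "0 < \<delta>" "\<delta> < a"
  shows "\<exists>\<eta>>0. \<forall>x>0. \<delta> \<le> \<bar>x - a\<bar> \<longrightarrow> G_tilde \<beta> x \<le> G_tilde \<beta> a - \<eta>"
proof -
  let ?e = "min (G_tilde \<beta> a - G_tilde \<beta> (a - \<delta>)) (G_tilde \<beta> a - G_tilde \<beta> (a + \<delta>))"
  show ?thesis
  proof (intro exI[of _ ?e] conjI allI impI)
  show "0 < ?e" using G_tilde_strict_max[OF a, of "a - \<delta>"] G_tilde_strict_max[OF a, of "a + \<delta>"] d by simp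
  fix x :: real assume x: "0 < x" "\<delta> \<le> \<bar>x - a\<bar>"
  show "G_tilde \<beta> x \<le> G_tilde \<beta> a - ?e"
  proof (cases "x < a")
    case True
    have "G_tilde \<beta> x \<le> G_tilde \<beta> (a - \<delta>)"
    proof (rule DERIV_nonneg_imp_nondecreasing[of x "a - \<delta>" "G_tilde \<beta>"])
      fix z assume z: "x \<le> z" "z \<le> a - \<delta>"
      have "(G_tilde \<beta> has_real_derivative Gt1 z) (at z)" using x z by (intro G_tilde_has_derivative) auto
      moreover have "0 \<le> Gt1 z" using Gt1_less[of z a] a x z d by auto
      ultimately show "\<exists>y. (G_tilde \<beta> has_real_derivative y) (at z) \<and> 0 \<le> y" by blast
    qed (use x True in auto)
    then show ?thesis by simp
  next
    case False
    have "G_tilde \<beta> x \<le> G_tilde \<beta> (a + \<delta>)"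
    proof (rule DERIV_nonpos_imp_nonincreasing[of "a + \<delta>" x "G_tilde \<beta>"])
      fix z assume z: "a + \<delta> \<le> z" "z \<le> x"
      have "(G_tilde \<beta> has_real_derivative Gt1 z) (at z)" using a d z by (intro G_tilde_has_derivative) auto
      moreover have "Gt1 z \<le> 0" using Gt1_less[of a z] a z d by auto
      ultimately show "\<exists>y. (G_tilde \<beta> has_real_derivative y) (at z) \<and> y \<le> 0" by blast
    qed (use x False in auto)
    then show ?thesis by simp
  qed
  qed
qed

definition normalized where "normalized L n = real L powr (3 / 4) * exp (- sqrt (real L) * G_tilde \<beta> a) * weight L n"

lemma normalized_nonneg: "0 \<le> normalized L n" by (simp add: normalized_def weight_def)

definition window where "window \<delta> L = {n\<in>{2..Suc L}. \<bar>real n / sqrt (real L) - a\<bar> < \<delta>}"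

lemma tail_vanishes:
  assumes d: "0 < \<delta>" "\<delta> < a"
  shows "(\<lambda>L. \<Sum>n\<in>{2..Suc L} - window \<delta> L. normalized L n) \<longlonglongrightarrow> 0"
proof -
  obtain \<eta> where \<eta>: "0 < \<eta>" "\<And>x. 0 < x \<Longrightarrow> \<delta> \<le> \<bar>x - a\<bar> \<Longrightarrow> G_tilde \<beta> x \<le> G_tilde \<beta> a - \<eta>"
    using G_tilde_gap[OF d] by blast
  show ?thesis
  proof (rule tendsto_sandwich[where f = "\<lambda>_. 0"])
    have "((\<lambda>x::real. x * (x powr (3 / 4) * (2 * (x + 2) * exp \<beta>) * exp (- \<eta> * sqrt x))) \<longlongrightarrow> 0) at_top" using \<eta>(1) by real_asymp
    from filterlim_compose[OF this filterlim_real_sequentially]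
    show "(\<lambda>L. real L * (real L powr (3 / 4) * (2 * (real L + 2) * exp \<beta>) * exp (- \<eta> * sqrt (real L)))) \<longlonglongrightarrow> 0" .
    show "eventually (\<lambda>L. (\<Sum>n\<in>{2..Suc L} - window \<delta> L. normalized L n) \<le>
       real L * (real L powr (3 / 4) * (2 * (real L + 2) * exp \<beta>) * exp (- \<eta> * sqrt (real L)))) sequentially"
      using eventually_ge_at_top[of 1]
    proof eventually_elim
      case (elim L)
      let ?b = "real L powr (3 / 4) * (2 * (real L + 2) * exp \<beta>) * exp (- \<eta> * sqrt (real L))"
      have "(\<Sum>n\<in>{2..Suc L} - window \<delta> L. normalized L n) \<le> real (card ({2..Suc L} - window \<delta> L)) * ?b"
      proof (rule sum_bounded_above)
        fix n assume n: "n \<in> {2..Suc L} - window \<delta> L"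
        define x where "x = real n / sqrt (real L)"
        have n': "1 \<le> n" "n \<le> Suc L" using n by auto
        have "G_tilde \<beta> x \<le> G_tilde \<beta> a - \<eta>"
          using n elim by (intro \<eta>) (auto simp: window_def x_def)
        then have "sqrt (real L) * G_tilde \<beta> x \<le> sqrt (real L) * (G_tilde \<beta> a - \<eta>)" by (intro mult_left_mono) auto
        then have e: "exp (- sqrt (real L) * G_tilde \<beta> a) * exp (sqrt (real L) * G_tilde \<beta> x) \<le> exp (- \<eta> * sqrt (real L))"
          unfolding exp_add[symmetric] exp_le_cancel_iff by (simp add: algebra_simps)
        have "normalized L n \<le> real L powr (3 / 4) * exp (- sqrt (real L) * G_tilde \<beta> a) * (2 * (real L + 2) * exp \<beta> * exp (sqrt (real L) * G_tilde \<beta> x))"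
          unfolding normalized_def by (intro mult_left_mono weight_le[OF elim n' x_def]) auto
        also have "\<dots> = real L powr (3 / 4) * (2 * (real L + 2) * exp \<beta>) * (exp (- sqrt (real L) * G_tilde \<beta> a) * exp (sqrt (real L) * G_tilde \<beta> x))"
          by (simp only: mult_ac)
        also have "\<dots> \<le> ?b" using e by (intro mult_left_mono) auto
        finally show "normalized L n \<le> ?b" .
      qed
      also have "\<dots> \<le> real L * ?b"
      proof (intro mult_right_mono)
        have "card ({2..Suc L} - window \<delta> L) \<le> card {2..Suc L}" by (intro card_mono) auto
        then show "real (card ({2..Suc L} - window \<delta> L)) \<le> real L" by simp
      qed auto
      finally show ?case .
    qed
  qed (auto intro!: always_eventually sum_nonneg normalized_nonneg)
qed

lemma normalized_eq:
  assumes L: "1 \<le> L" and n: "1 \<le> n" "n \<le> Suc L"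
  defines "x \<equiv> real n / sqrt (real L)"
  shows "real L powr (1 / 4) * normalized L n =
    exp (sqrt (real L) * (G_tilde \<beta> x - G_tilde \<beta> a)) * exp (hx x - hx x / real n) * bridge_ratio n (hx x) (Suc L - n) / x\<^sup>2"
proof -
  have p: "real L powr (1 / 4) * real L powr (3 / 4) = real L" using L by (simp flip: powr_add)
  have e: "exp (- sqrt (real L) * G_tilde \<beta> a) * exp (sqrt (real L) * G_tilde \<beta> x) = exp (sqrt (real L) * (G_tilde \<beta> x - G_tilde \<beta> a))"
    unfolding exp_add[symmetric] by (simp add: algebra_simps)
  have xx: "real L / (real n)\<^sup>2 = 1 / x\<^sup>2" unfolding x_def using L n by (simp add: power_divide)
  have "real L powr (1 / 4) * normalized L n =
     (real L powr (1 / 4) * real L powr (3 / 4)) / (real n)\<^sup>2 * (exp (- sqrt (real L) * G_tilde \<beta> a) * exp (sqrt (real L) * G_tilde \<beta> x)) *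
       exp (hx x - hx x / real n) * bridge_ratio n (hx x) (Suc L - n)"
    unfolding normalized_def weight_eq[OF L n x_def[THEN meta_eq_to_obj_eq]] by simp
  then show ?thesis unfolding p e xx by simp
qed

text \<open>Write \<open>n = \<lfloor>a \<surd>L + y L\<^bsup>1/4\<^esup>\<rfloor>\<close> and apply dominated
  convergence in \<open>y\<close>: \<open>\<surd>L (G~(x) - G~(a))\<close> tends to \<open>D
  y\<^sup>2/2\<close>, and within the window it is at most \<open>- |D|/4\<close> times the square of the
  rescaled distance.\<close>

lemma window_limit:
  "\<exists>\<delta>. 0 < \<delta> \<and> \<delta> < a \<and> (\<lambda>L. \<Sum>n\<in>window \<delta> L. normalized L n) \<longlonglongrightarrow>
     exp (hx a) / (pi * sqrt (V0 (hx a) * G2 (hx a)) * a\<^sup>2) * sqrt (2 * pi / \<bar>D\<bar>)"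
proof -
  obtain r where r: "r a = 0" "isCont r a" "\<And>x. G_tilde \<beta> x = G_tilde \<beta> a + (D / 2 + r x) * (x - a)\<^sup>2"
    using second_order_expansion[of "{0<..}" a "G_tilde \<beta>" Gt1 D] a G_tilde_has_derivative Gt1_has_derivative[OF a(1)]
    unfolding D_def by (auto simp del: not_less)
  have "eventually (\<lambda>x. dist (r x) 0 < \<bar>D\<bar> / 4) (nhds a)"
  proof (rule tendstoD)
    have "(r \<longlongrightarrow> r a) (nhds a)" using r(2) unfolding isCont_def tendsto_at_iff_tendsto_nhds .
    then show "(r \<longlongrightarrow> 0) (nhds a)" unfolding r(1) .
  qed (use D in simp)
  then obtain d1 where d1: "0 < d1" "\<And>x. dist x a < d1 \<Longrightarrow> dist (r x) 0 < \<bar>D\<bar> / 4"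
    unfolding eventually_nhds_metric by blast
  \<comment> \<open>Small enough for the remainder to take away at most half of the quadratic term.\<close>
  define \<delta> where "\<delta> = min d1 (a / 2)"
  have \<delta>: "0 < \<delta>" "\<delta> \<le> d1" "\<delta> \<le> a / 2" "\<delta> < a" using d1 a by (auto simp: \<delta>_def)
  define h0 h1 where "h0 = hx (a + \<delta>)" and "h1 = hx (a - \<delta>)"
  have h01: "0 < h0" "h1 < \<beta>" using hx(1)[of "a + \<delta>"] hx(2)[of "a - \<delta>"] \<delta> a by (auto simp: h0_def h1_def)
  obtain K n0 where K: "\<And>n h A. n0 \<le> n \<Longrightarrow> h \<in> {h0..h1} \<Longrightarrow> \<bar>real A - (real n)\<^sup>2 * G1 h\<bar> \<le> 1 * real n \<Longrightarrow> bridge_ratio n h A \<le> K"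
    using bridge_ratio_bounded[OF h01, of 1] by metis
  define pos where "pos L y = nat \<lfloor>a * sqrt (real L) + real L powr (1 / 4) * y\<rfloor>" for L :: nat and y
  define f where "f L y = (if pos L y \<in> window \<delta> L then real L powr (1 / 4) * normalized L (pos L y) else 0)" for L y
  define c where "c = \<bar>D\<bar> / 4"
  have c: "0 < c" using D by (simp add: c_def)
  define g where "g y = exp (hx a) / (pi * sqrt (V0 (hx a) * G2 (hx a)) * a\<^sup>2) * exp (- \<bar>D\<bar> * y\<^sup>2 / 2)" for y
  define W where "W y = exp \<beta> * \<bar>K\<bar> / (a / 2)\<^sup>2 * exp c * exp (- c * y\<^sup>2 / 2)" for y
  have sum_eq: "(\<Sum>n\<in>window \<delta> L. normalized L n) = (\<integral>y. f L y \<partial>lborel)" if "1 \<le> L" for L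
  proof -
    have L4: "0 < real L powr (1 / 4)" using that by simp
    have "(\<Sum>n\<in>window \<delta> L. normalized L n) = real L powr (1 / 4) * (\<integral>y. (if pos L y \<in> window \<delta> L then normalized L (pos L y) else 0) \<partial>lborel)"
      unfolding pos_def by (rule floor_sum_integral[OF _ _ L4]) (auto simp: window_def)
    also have "\<dots> = (\<integral>y. real L powr (1 / 4) * (if pos L y \<in> window \<delta> L then normalized L (pos L y) else 0) \<partial>lborel)"
      by (rule Bochner_Integration.integral_mult_right_zero[symmetric])
    also have "\<dots> = (\<integral>y. f L y \<partial>lborel)" by (intro Bochner_Integration.integral_cong) (auto simp: f_def)
    finally show ?thesis .
  qed
  have sq4: "real L powr (1 / 4) * real L powr (1 / 4) = sqrt (real L)" for L
    by (simp add: powr_half_sqrt flip: powr_add)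
  \<comment> \<open>The rescaled distance from the maximiser after rounding.\<close>
  define e where "e L y = (real (pos L y) - a * sqrt (real L)) / real L powr (1 / 4)" for L y
  have x_eq: "real (pos L y) / sqrt (real L) - a = e L y / real L powr (1 / 4)" if "1 \<le> L" for L y
  proof -
    have "real (pos L y) / sqrt (real L) - a = (real (pos L y) - a * sqrt (real L)) / sqrt (real L)" using that by (simp add: diff_divide_distrib)
    then show ?thesis unfolding e_def sq4[symmetric] by simp
  qed
  have expo: "sqrt (real L) * (G_tilde \<beta> x - G_tilde \<beta> a) = (D / 2 + r x) * (e L y)\<^sup>2"
    if "1 \<le> L" "x = real (pos L y) / sqrt (real L)" for L x y
  proof -
    have "x - a = e L y / real L powr (1 / 4)" unfolding that(2) by (rule x_eq[OF that(1)])
    then have "sqrt (real L) * (x - a)\<^sup>2 = (e L y)\<^sup>2"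
      unfolding sq4[symmetric] using that(1) by (simp add: power2_eq_square)
    moreover have "sqrt (real L) * (G_tilde \<beta> x - G_tilde \<beta> a) = (D / 2 + r x) * (sqrt (real L) * (x - a)\<^sup>2)"
      by (subst r(3)) simp
    ultimately show ?thesis by simp
  qed
  have bound: "norm (f L y) \<le> W y" if L: "1 \<le> L" "real n0 \<le> a / 2 * sqrt (real L)" for L y
  proof (cases "pos L y \<in> window \<delta> L")
    case False
    then show ?thesis by (simp add: f_def W_def)
  next
    case True
    define n x where "n = pos L y" and "x = real n / sqrt (real L)"
    have n: "1 \<le> n" "n \<le> Suc L" "\<bar>x - a\<bar> < \<delta>" using True by (auto simp: n_def x_def window_def)
    have x2: "a / 2 < x" "0 < x" using n(3) \<delta>(1,3) a by (auto simp: abs_less_iff)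
    have h: "hx x \<in> {h0..h1}"
      using n(3) \<delta> a hx_less[of x "a + \<delta>"] hx_less[of "a - \<delta>" x] x2 by (auto simp: h0_def h1_def abs_less_iff)
    have sL: "0 < sqrt (real L)" using L by simp
    have "real n = x * sqrt (real L)" using sL by (simp add: x_def)
    moreover have "a / 2 * sqrt (real L) \<le> x * sqrt (real L)" using x2 sL by (intro mult_right_mono) auto
    ultimately have "n0 \<le> n" using L by linarith
    then have br: "bridge_ratio n (hx x) (Suc L - n) \<le> K" using h area_near_mean[OF L(1) n(1,2) x_def] by (intro K) auto
    have br0: "0 \<le> bridge_ratio n (hx x) (Suc L - n)" by (simp add: bridge_ratio_def)
    have he: "exp (hx x - hx x / real n) \<le> exp \<beta>"
    proof -
      have "0 \<le> hx x / real n" "hx x < \<beta>" using hx[OF x2(2)] by auto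
      then show ?thesis unfolding exp_le_cancel_iff by linarith
    qed
    have ee: "exp (sqrt (real L) * (G_tilde \<beta> x - G_tilde \<beta> a)) \<le> exp c * exp (- c * y\<^sup>2 / 2)"
    proof -
      have "\<bar>r x\<bar> < \<bar>D\<bar> / 4" using d1(2)[of x] n(3) \<delta>(2) by (simp add: dist_real_def)
      then have "D / 2 + r x \<le> - c" using D by (simp add: c_def)
      then have 1: "(D / 2 + r x) * (e L y)\<^sup>2 \<le> - c * (e L y)\<^sup>2" by (intro mult_right_mono) auto
      have "y\<^sup>2 \<le> 2 * (e L y)\<^sup>2 + 2"
      proof -
        define t where "t = a * sqrt (real L) + real L powr (1 / 4) * y"
        have "0 < n" using n by simp
        then have fl: "real n \<le> t" "t < real n + 1" unfolding n_def pos_def t_def[symmetric] by linarith+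
        \<comment> \<open>Rounding to an integer moves \<open>y\<close> by \<open>\<theta>\<close>, less than 1 because \<open>L\<^bsup>1/4\<^esup> \<ge> 1\<close>.\<close>
        define \<theta> where "\<theta> = y - e L y"
        have L4: "1 \<le> real L powr (1 / 4)" using L by (simp add: ge_one_powr_ge_zero)
        have th: "\<theta> * real L powr (1 / 4) = t - real n"
        proof -
          have "e L y * real L powr (1 / 4) = real n - a * sqrt (real L)" using L by (simp add: e_def n_def)
          then show ?thesis by (simp add: \<theta>_def left_diff_distrib t_def)
        qed
        have "0 \<le> \<theta>" using th fl L4 by (metis diff_ge_0_iff_ge less_le_trans zero_le_mult_iff zero_less_one not_less)
        moreover have "\<theta> \<le> 1"
        proof (rule ccontr)
          assume "\<not> \<theta> \<le> 1"
          then have "1 * 1 \<le> \<theta> * real L powr (1 / 4)" using L4 by (intro mult_mono) auto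
          then show False using th fl by simp
        qed
        ultimately have "\<theta>\<^sup>2 \<le> 1" by (simp add: power_le_one)
        moreover have "y\<^sup>2 \<le> 2 * (e L y)\<^sup>2 + 2 * \<theta>\<^sup>2"
          using zero_le_power2[of "e L y - \<theta>"] by (simp add: \<theta>_def power2_eq_square algebra_simps)
        ultimately show ?thesis by linarith
      qed
      then have "c * y\<^sup>2 \<le> c * (2 * (e L y)\<^sup>2 + 2)" using c by (intro mult_left_mono) auto
      then have "- c * (e L y)\<^sup>2 \<le> c + - c * y\<^sup>2 / 2" by (simp add: algebra_simps)
      then show ?thesis unfolding exp_add[symmetric] expo[OF L(1) x_def[unfolded n_def]] exp_le_cancel_iff using 1 by linarith
    qed
    have "f L y = exp (sqrt (real L) * (G_tilde \<beta> x - G_tilde \<beta> a)) * exp (hx x - hx x / real n) * bridge_ratio n (hx x) (Suc L - n) / x\<^sup>2"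
      using True normalized_eq[OF L(1) n(1,2)] by (simp add: f_def n_def x_def)
    also have "\<dots> \<le> (exp c * exp (- c * y\<^sup>2 / 2)) * exp \<beta> * \<bar>K\<bar> / (a / 2)\<^sup>2"
      using br br0 he ee x2 a by (intro frac_le mult_mono) (auto intro!: power_mono)
    also have "\<dots> = W y" by (simp add: W_def)
    finally have "f L y \<le> W y" .
    moreover have "0 \<le> f L y" by (simp add: f_def normalized_nonneg)
    ultimately show ?thesis by simp
  qed
  have ptw: "(\<lambda>L. f L y) \<longlonglongrightarrow> g y" for y
  proof -
    have L4lim: "filterlim (\<lambda>L. real L powr (1 / 4)) at_top sequentially"
      by (rule filterlim_compose[OF _ filterlim_real_sequentially]) real_asymp
    have poslim: "filterlim (\<lambda>L. a * sqrt (real L) + real L powr (1 / 4) * y) at_top sequentially"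
      by (rule filterlim_compose[OF _ filterlim_real_sequentially]) (use a in real_asymp)
    have "eventually (\<lambda>L. 0 \<le> a * sqrt (real L) + real L powr (1 / 4) * y \<and> 1 \<le> L) sequentially"
      by (rule eventually_conj[OF poslim[unfolded filterlim_at_top, rule_format, of 0] eventually_ge_at_top[of 1]])
    then have near: "eventually (\<lambda>L. y - 1 / real L powr (1 / 4) \<le> e L y \<and> e L y \<le> y) sequentially"
    proof eventually_elim
      case (elim L)
      have L4: "0 < real L powr (1 / 4)" using elim by simp
      define t where "t = a * sqrt (real L) + real L powr (1 / 4) * y"
      have fl: "t - 1 \<le> real (pos L y)" "real (pos L y) \<le> t" using elim unfolding pos_def t_def[symmetric] by linarith+
      have "(t - 1 - a * sqrt (real L)) / real L powr (1 / 4) \<le> e L y" "e L y \<le> (t - a * sqrt (real L)) / real L powr (1 / 4)"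
        unfolding e_def using fl L4 by (auto intro!: divide_right_mono)
      then show ?case using L4 unfolding t_def by (simp add: diff_divide_distrib)
    qed
    have elim': "(\<lambda>L. e L y) \<longlonglongrightarrow> y"
    proof (rule tendsto_sandwich)
      show "(\<lambda>L. y - 1 / real L powr (1 / 4)) \<longlonglongrightarrow> y"
        by (rule filterlim_compose[OF _ filterlim_real_sequentially, of "\<lambda>x. y - 1 / x powr (1 / 4)"]) real_asymp
      show "eventually (\<lambda>L. y - 1 / real L powr (1 / 4) \<le> e L y) sequentially" "eventually (\<lambda>L. e L y \<le> y) sequentially"
        using near by (auto elim: eventually_mono)
    qed simp
    define X where "X L = real (pos L y) / sqrt (real L)" for L
    have Xlim: "X \<longlonglongrightarrow> a"
    proof -
      have "(\<lambda>L. e L y / real L powr (1 / 4)) \<longlonglongrightarrow> 0"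
        by (rule tendsto_divide_0[OF elim' filterlim_at_top_imp_at_infinity[OF L4lim]])
      then have "(\<lambda>L. a + e L y / real L powr (1 / 4)) \<longlonglongrightarrow> a + 0" by (intro tendsto_intros)
      moreover have "eventually (\<lambda>L. a + e L y / real L powr (1 / 4) = X L) sequentially"
        using eventually_ge_at_top[of 1] by eventually_elim (simp add: X_def x_eq[symmetric])
      ultimately show ?thesis by (simp add: tendsto_cong)
    qed
    have nlim: "filterlim (\<lambda>L. pos L y) at_top sequentially"
      unfolding filterlim_at_top
    proof
      fix Z :: nat
      have "eventually (\<lambda>L. real Z \<le> a * sqrt (real L) + real L powr (1 / 4) * y) sequentially"
        using poslim unfolding filterlim_at_top by blast
      then show "eventually (\<lambda>L. Z \<le> pos L y) sequentially"
        by eventually_elim (simp add: pos_def le_nat_floor)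
    qed
    have win: "eventually (\<lambda>L. 1 \<le> L \<and> pos L y \<in> window \<delta> L) sequentially"
    proof -
      have "eventually (\<lambda>L. dist (X L) a < \<delta>) sequentially" using Xlim \<delta>(1) by (rule tendstoD)
      moreover have "eventually (\<lambda>L. 2 \<le> pos L y) sequentially" using nlim unfolding filterlim_at_top by blast
      moreover have "eventually (\<lambda>L. a * sqrt (real L) + real L powr (1 / 4) * y \<le> real L) sequentially"
        by (rule eventually_compose_filterlim[OF _ filterlim_real_sequentially, of "\<lambda>x. a * sqrt x + x powr (1 / 4) * y \<le> x"]) real_asymp
      ultimately show ?thesis using eventually_ge_at_top[of 1]
      proof eventually_elim
        case (elim L)
        have "pos L y \<le> L" unfolding pos_def using elim(3) by linarith
        then show ?case using elim by (simp add: window_def X_def dist_real_def)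
      qed
    qed
    have hlim: "(\<lambda>L. hx (X L)) \<longlonglongrightarrow> hx a"
      by (rule isCont_tendsto_compose[OF DERIV_isCont[OF hx_has_derivative[OF a(1)]] Xlim])
    have ha: "0 < hx a" "hx a < \<beta>" using hx[OF a(1)] by auto
    have blim: "(\<lambda>L. bridge_ratio (pos L y) (hx (X L)) (Suc L - pos L y)) \<longlonglongrightarrow> 1 / (pi * sqrt (V0 (hx a) * G2 (hx a)))"
    proof (rule bridge_ratio_tendsto[OF nlim hlim ha])
      show "eventually (\<lambda>L. \<bar>real (Suc L - pos L y) - (real (pos L y))\<^sup>2 * G1 (hx (X L))\<bar> \<le> 1 * real (pos L y)) sequentially"
        using win
      proof eventually_elim
        case (elim L)
        then have n: "1 \<le> L" "1 \<le> pos L y" "pos L y \<le> Suc L" by (auto simp: window_def)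
        show ?case by (rule area_near_mean[OF n X_def])
      qed
    qed
    have rlim: "(\<lambda>L. r (X L)) \<longlonglongrightarrow> r a" by (rule isCont_tendsto_compose[OF r(2) Xlim])
    have ninv: "(\<lambda>L. hx (X L) / real (pos L y)) \<longlonglongrightarrow> 0"
      by (rule tendsto_divide_0[OF hlim filterlim_at_top_imp_at_infinity[OF filterlim_compose[OF filterlim_real_sequentially nlim]]])
    have "(\<lambda>L. exp ((D / 2 + r (X L)) * (e L y)\<^sup>2) * exp (hx (X L) - hx (X L) / real (pos L y)) * bridge_ratio (pos L y) (hx (X L)) (Suc L - pos L y) / (X L)\<^sup>2)
      \<longlonglongrightarrow> exp ((D / 2 + r a) * y\<^sup>2) * exp (hx a - 0) * (1 / (pi * sqrt (V0 (hx a) * G2 (hx a)))) / a\<^sup>2"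
      using a by (intro tendsto_mult tendsto_divide tendsto_exp tendsto_diff tendsto_add tendsto_power tendsto_const rlim elim' hlim ninv blim Xlim) auto
    moreover have "exp ((D / 2 + r a) * y\<^sup>2) * exp (hx a - 0) * (1 / (pi * sqrt (V0 (hx a) * G2 (hx a)))) / a\<^sup>2 = g y"
      using D r(1) by (simp add: g_def)
    moreover have "eventually (\<lambda>L. exp ((D / 2 + r (X L)) * (e L y)\<^sup>2) * exp (hx (X L) - hx (X L) / real (pos L y)) * bridge_ratio (pos L y) (hx (X L)) (Suc L - pos L y) / (X L)\<^sup>2 = f L y) sequentially"
      using win
    proof eventually_elim
      case (elim L)
      then have n: "1 \<le> L" "1 \<le> pos L y" "pos L y \<le> Suc L" by (auto simp: window_def)
      show ?case unfolding f_def using elim normalized_eq[OF n] expo[OF n(1) X_def] by (simp add: X_def)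
    qed
    ultimately show ?thesis by (simp add: tendsto_cong)
  qed
  have gi: "integrable lborel g" "(\<integral>y. g y \<partial>lborel) = exp (hx a) / (pi * sqrt (V0 (hx a) * G2 (hx a)) * a\<^sup>2) * sqrt (2 * pi / \<bar>D\<bar>)"
    using gaussian_integral[of "\<bar>D\<bar>"] D unfolding g_def by auto
  have Wi: "integrable lborel W" using gaussian_integral(1)[OF c] unfolding W_def by auto
  have "eventually (\<lambda>L. 1 \<le> L \<and> real n0 \<le> a / 2 * sqrt (real L)) sequentially"
  proof -
    have "filterlim (\<lambda>L. a / 2 * sqrt (real L)) at_top sequentially"
      by (rule filterlim_compose[OF _ filterlim_real_sequentially]) (use a in real_asymp)
    from eventually_conj[OF eventually_ge_at_top[of 1] this[unfolded filterlim_at_top, rule_format, of "real n0"]]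
    show ?thesis .
  qed
  then obtain L0 where L0: "\<And>L. L0 \<le> L \<Longrightarrow> 1 \<le> L \<and> real n0 \<le> a / 2 * sqrt (real L)"
    unfolding eventually_sequentially by blast
  have "(\<lambda>k. \<integral>y. f (k + L0) y \<partial>lborel) \<longlonglongrightarrow> (\<integral>y. g y \<partial>lborel)"
  proof (rule integral_dominated_convergence[where w = W])
    show "g \<in> borel_measurable lborel" using gi(1) by auto
    show "(\<lambda>y. f (k + L0) y) \<in> borel_measurable lborel" for k
      unfolding f_def pos_def by measurable
    show "AE y in lborel. (\<lambda>k. f (k + L0) y) \<longlonglongrightarrow> g y"
      using LIMSEQ_ignore_initial_segment[OF ptw] by simp
    show "AE y in lborel. norm (f (k + L0) y) \<le> W y" for k
      using bound[of "k + L0"] L0[of "k + L0"] by simp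
  qed (rule Wi)
  then have "(\<lambda>k. \<Sum>n\<in>window \<delta> (k + L0). normalized (k + L0) n) \<longlonglongrightarrow> (\<integral>y. g y \<partial>lborel)"
    using sum_eq L0 by simp
  then have "(\<lambda>L. \<Sum>n\<in>window \<delta> L. normalized L n) \<longlonglongrightarrow> (\<integral>y. g y \<partial>lborel)" by (rule LIMSEQ_offset)
  then show ?thesis using \<delta> gi(2) by auto
qed

lemma K_const_pos: "0 < K_const \<beta>"
proof -
  have h: "\<bar>hx a\<bar> < \<beta>" using hx[OF a(1)] by simp
  show ?thesis unfolding K_const_eq a_def[symmetric] D_def[symmetric]
    using V0_pos[OF h] G2_pos[OF h] a D by (intro divide_pos_pos mult_pos_pos) auto
qed

theorem partition_fun_asymp:
  "(\<lambda>L. partition_fun \<beta> L) \<sim>[at_top]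
    (\<lambda>L. K_const \<beta> / real L powr (3 / 4) * exp (\<beta> * real L + G_tilde \<beta> (a_opt \<beta>) * sqrt (real L)))"
proof (rule asymp_equivI')
  let ?I = "exp (hx a) / (pi * sqrt (V0 (hx a) * G2 (hx a)) * a\<^sup>2) * sqrt (2 * pi / \<bar>D\<bar>)"
  obtain \<delta> where \<delta>: "0 < \<delta>" "\<delta> < a" and lim: "(\<lambda>L. \<Sum>n\<in>window \<delta> L. normalized L n) \<longlonglongrightarrow> ?I"
    using window_limit by blast
  have "(\<lambda>L. (\<Sum>n\<in>window \<delta> L. normalized L n) + (\<Sum>n\<in>{2..Suc L} - window \<delta> L. normalized L n)) \<longlonglongrightarrow> ?I + 0"
    by (intro tendsto_add lim tail_vanishes[OF \<delta>])
  moreover have "(\<Sum>n\<in>window \<delta> L. normalized L n) + (\<Sum>n\<in>{2..Suc L} - window \<delta> L. normalized L n) = (\<Sum>n\<in>{2..Suc L}. normalized L n)" for L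
    by (rule sum.subset_diff[symmetric, of "window \<delta> L", unfolded add.commute[of "sum _ (_ - _)"]]) (auto simp: window_def)
  ultimately have "(\<lambda>L. \<Sum>n\<in>{2..Suc L}. normalized L n) \<longlonglongrightarrow> ?I" by simp
  then have lim': "(\<lambda>L. exp \<beta> / K_const \<beta> * (\<Sum>n\<in>{2..Suc L}. normalized L n)) \<longlonglongrightarrow> exp \<beta> / K_const \<beta> * ?I"
    by (intro tendsto_mult tendsto_const)
  have one: "exp \<beta> / K_const \<beta> * ?I = 1"
  proof -
    have K: "K_const \<beta> = exp \<beta> * ?I"
      unfolding K_const_eq a_def[symmetric] D_def[symmetric] by (simp add: real_sqrt_divide mult_ac)
    have "exp \<beta> / K_const \<beta> * ?I = (exp \<beta> * ?I) / K_const \<beta>" by (rule times_divide_eq_left)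
    also have "\<dots> = K_const \<beta> / K_const \<beta>" unfolding K[symmetric] ..
    also have "\<dots> = 1" using K_const_pos by simp
    finally show ?thesis .
  qed
  have ev: "eventually (\<lambda>L. exp \<beta> / K_const \<beta> * (\<Sum>n\<in>{2..Suc L}. normalized L n) =
      partition_fun \<beta> L / (K_const \<beta> / real L powr (3 / 4) * exp (\<beta> * real L + G_tilde \<beta> (a_opt \<beta>) * sqrt (real L)))) sequentially"
    using eventually_ge_at_top[of 1]
  proof eventually_elim
    case (elim L)
    have s: "(\<Sum>n\<in>{2..Suc L}. normalized L n) = real L powr (3 / 4) * exp (- sqrt (real L) * G_tilde \<beta> a) * (\<Sum>n\<in>{2..Suc L}. weight L n)"
      by (simp only: normalized_def sum_distrib_left)
    show ?case unfolding s partition_fun_eq a_def[symmetric] exp_add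
      using K_const_pos elim by (simp add: exp_minus field_simps)
  qed
  show "(\<lambda>L. partition_fun \<beta> L / (K_const \<beta> / real L powr (3 / 4) * exp (\<beta> * real L + G_tilde \<beta> (a_opt \<beta>) * sqrt (real L)))) \<longlonglongrightarrow> 1"
    by (rule Lim_transform_eventually[OF lim'[unfolded one] ev])
qed

end

lemma beta_c_pos: "0 < beta_c"
  using theI'[OF beta_c_unique] unfolding beta_c_def by blast

theorem theorem2p1:
  fixes \<beta> :: real
  assumes "\<beta> > beta_c"
  shows "(\<lambda>L. partition_fun \<beta> L) \<sim>[at_top]
    (\<lambda>L. K_const \<beta> / real L powr (3 / 4) *
      exp (\<beta> * real L + G_tilde \<beta> (a_opt \<beta>) * sqrt (real L)))"
proof -
  interpret collapsed \<beta> by unfold_locales (use assms beta_c_pos in auto)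
  show ?thesis by (rule partition_fun_asymp)
qed

end
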